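(* For every nondiscrete locally compact field $\mathbf{K}$ and every nonprincipal ultrafilter $\omega$ on the set of positive integers, the group $\pi_1\big(\mathrm{Cone}_\omega(A_4(\mathbf{K})/Z(\mathbf{K}))\big)$ is an abelian group with continuum cardinality.
   Context: For a commutative ring $R$, $A_4(R)$ denotes the group of upper triangular $4\times 4$ matrices over $R$ with diagonal $(1,t_{22},t_{33},1)$, where $t_{22},t_{33}\in R^\times$, and with arbitrary entries $x_{ij}\in R$ for $i<j$. $Z(R)$ denotes the central subgroup of unipotent matrices whose only possibly nonzero off-diagonal entry is the $(1,4)$-entry. The compactly generated locally compact group $A_4(\mathbf{K})/Z(\mathbf{K})$ is endowed with the word metric associated to a compact generating subset. Asymptotic cone: for a metric space $(X,d)$ with base-point $x_0$ and a nonprincipal ultrafilter $\omega$ on the set $\mathbf{N}$ of positive integers, let $\mathrm{Precone}(X)$ be the set of sequences $(x_n)$ in $X$ with $\limsup_n d(x_n,x_0)/n<\infty$, with pseudo-distance $d_\omega(x,y)=\lim_\omega \frac1n d(x_n,y_n)$. Then $\mathrm{Cone}_\omega(X)$ is the metric space obtained by identifying points at pseudo-distance $0$. *)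

theory Defs
  imports "HOL-Analysis.Analysis" "HOL-Algebra.Coset" "HOL-Algebra.Generated_Groups"
    "HOL-Library.Equipollence"
begin

class topological_field = field + topological_ab_group_add + topological_semigroup_mult + t2_space +
  assumes tendsto_inverse_nhds: "a \<noteq> 0 \<Longrightarrow> (inverse \<longlongrightarrow> inverse a) (nhds a)"

instance real_normed_field \<subseteq> topological_field
proof
  fix a :: 'a
  assume "a \<noteq> 0"
  then show "(inverse \<longlongrightarrow> inverse a) (nhds a)"
    using tendsto_inverse[OF filterlim_ident, of a] by simp
qed

text \<open>The entries are listed one by one because the numeral \<open>4 :: 4\<close> is \<open>0\<close>, so the order
  on the index type is not the usual order on the indices \<open>1, 2, 3, 4\<close>.\<close>

definition abels4_carrier :: "('r::comm_ring_1 ^ 4 ^ 4) set" where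
  "abels4_carrier = {A.
     A $ 2 $ 1 = 0 \<and> A $ 3 $ 1 = 0 \<and> A $ 4 $ 1 = 0 \<and> A $ 3 $ 2 = 0 \<and> A $ 4 $ 2 = 0 \<and> A $ 4 $ 3 = 0 \<and>
     A $ 1 $ 1 = 1 \<and> A $ 2 $ 2 dvd 1 \<and> A $ 3 $ 3 dvd 1 \<and> A $ 4 $ 4 = 1}"

definition abels4 :: "('r::comm_ring_1 ^ 4 ^ 4) monoid" where
  "abels4 = \<lparr>carrier = abels4_carrier, mult = (**), one = mat 1\<rparr>"

definition abels4_Z :: "('r::comm_ring_1 ^ 4 ^ 4) set" where
  "abels4_Z = {A. \<forall>i j. (i, j) \<noteq> (1, 4) \<longrightarrow> A $ i $ j = mat 1 $ i $ j}"

definition quotient_group_topology ::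
    "'a topology \<Rightarrow> ('a, 'm) monoid_scheme \<Rightarrow> 'a set \<Rightarrow> 'a set topology" where
  "quotient_group_topology X G H =
     topology (\<lambda>U. U \<subseteq> carrier (G Mod H) \<and> openin X {x \<in> topspace X. H #>\<^bsub>G\<^esub> x \<in> U})"

definition abels4_mod_Z :: "('r::comm_ring_1 ^ 4 ^ 4) set monoid" where
  "abels4_mod_Z = abels4 Mod abels4_Z"

definition abels4_mod_Z_topology :: "('k::topological_field ^ 4 ^ 4) set topology" where
  "abels4_mod_Z_topology = quotient_group_topology (top_of_set (carrier abels4)) abels4 abels4_Z"

definition word_length :: "('a, 'm) monoid_scheme \<Rightarrow> 'a set \<Rightarrow> 'a \<Rightarrow> nat" where
  "word_length G S g =
     (LEAST n. \<exists>ws. length ws = n \<and> set ws \<subseteq> S \<union> m_inv G ` S \<and> foldr (mult G) ws (one G) = g)"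

text \<open>The left-invariant word metric. The value outside the carrier, here and in the distance
  on the cone below, is only there to fit the locale \<^locale>\<open>Metric_space\<close>, which wants symmetry and
  nonnegativity on the whole type.\<close>

definition word_metric :: "('a, 'm) monoid_scheme \<Rightarrow> 'a set \<Rightarrow> 'a \<Rightarrow> 'a \<Rightarrow> real" where
  "word_metric G S g h =
     (if g \<in> carrier G \<and> h \<in> carrier G then real (word_length G S (inv\<^bsub>G\<^esub> g \<otimes>\<^bsub>G\<^esub> h)) else 0)"

text \<open>An ultrafilter on a set \<open>A\<close> is a filter on the ambient type that is concentrated on \<open>A\<close>.\<close>

definition nonprincipal_ultrafilter_on :: "'a set \<Rightarrow> 'a filter \<Rightarrow> bool" where
  "nonprincipal_ultrafilter_on A \<omega> \<longleftrightarrow>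
     \<omega> \<noteq> bot \<and> \<omega> \<le> principal A \<and>
     (\<forall>P. eventually P \<omega> \<or> eventually (\<lambda>x. \<not> P x) \<omega>) \<and>
     (\<forall>a\<in>A. \<omega> \<noteq> principal {a})"

text \<open>Sequences indexed by the positive integers are extensional functions on \<open>{1..}\<close>.\<close>

definition precone :: "'a set \<Rightarrow> ('a \<Rightarrow> 'a \<Rightarrow> real) \<Rightarrow> 'a \<Rightarrow> (nat \<Rightarrow> 'a) set" where
  "precone X d x0 = {x \<in> {1..} \<rightarrow>\<^sub>E X. limsup (\<lambda>n. ereal (d (x n) x0 / real n)) < \<infinity>}"

definition precone_dist :: "nat filter \<Rightarrow> ('a \<Rightarrow> 'a \<Rightarrow> real) \<Rightarrow> (nat \<Rightarrow> 'a) \<Rightarrow> (nat \<Rightarrow> 'a) \<Rightarrow> real" where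
  "precone_dist \<omega> d x y = Lim \<omega> (\<lambda>n. d (x n) (y n) / real n)"

definition precone_rel ::
    "nat filter \<Rightarrow> 'a set \<Rightarrow> ('a \<Rightarrow> 'a \<Rightarrow> real) \<Rightarrow> 'a \<Rightarrow> ((nat \<Rightarrow> 'a) \<times> (nat \<Rightarrow> 'a)) set" where
  "precone_rel \<omega> X d x0 =
     {(x, y). x \<in> precone X d x0 \<and> y \<in> precone X d x0 \<and> precone_dist \<omega> d x y = 0}"

definition asymptotic_cone ::
    "nat filter \<Rightarrow> 'a set \<Rightarrow> ('a \<Rightarrow> 'a \<Rightarrow> real) \<Rightarrow> 'a \<Rightarrow> (nat \<Rightarrow> 'a) set set" where
  "asymptotic_cone \<omega> X d x0 = precone X d x0 // precone_rel \<omega> X d x0"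

definition cone_dist ::
    "nat filter \<Rightarrow> 'a set \<Rightarrow> ('a \<Rightarrow> 'a \<Rightarrow> real) \<Rightarrow> 'a \<Rightarrow> (nat \<Rightarrow> 'a) set \<Rightarrow> (nat \<Rightarrow> 'a) set \<Rightarrow> real" where
  "cone_dist \<omega> X d x0 a b =
     (if a \<in> asymptotic_cone \<omega> X d x0 \<and> b \<in> asymptotic_cone \<omega> X d x0
      then precone_dist \<omega> d (SOME x. x \<in> a) (SOME y. y \<in> b) else 0)"

definition cone_topology ::
    "nat filter \<Rightarrow> 'a set \<Rightarrow> ('a \<Rightarrow> 'a \<Rightarrow> real) \<Rightarrow> 'a \<Rightarrow> (nat \<Rightarrow> 'a) set topology" where
  "cone_topology \<omega> X d x0 =
     Metric_space.mtopology (asymptotic_cone \<omega> X d x0) (cone_dist \<omega> X d x0)"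

definition based_loops :: "'a topology \<Rightarrow> 'a \<Rightarrow> (real \<Rightarrow> 'a) set" where
  "based_loops T p = {f. pathin T f \<and> f 0 = p \<and> f 1 = p}"

definition loop_homotopy :: "'a topology \<Rightarrow> 'a \<Rightarrow> ((real \<Rightarrow> 'a) \<times> (real \<Rightarrow> 'a)) set" where
  "loop_homotopy T p =
     {(f, g). f \<in> based_loops T p \<and> g \<in> based_loops T p \<and>
              homotopic_with (\<lambda>h. h 0 = p \<and> h 1 = p) (top_of_set {0..1}) T f g}"

text \<open>The library operation \<^const>\<open>joinpaths\<close> is confined to topological type classes.\<close>

definition concat_paths :: "(real \<Rightarrow> 'a) \<Rightarrow> (real \<Rightarrow> 'a) \<Rightarrow> real \<Rightarrow> 'a" where
  "concat_paths f g = (\<lambda>t. if t \<le> 1/2 then f (2 * t) else g (2 * t - 1))"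

definition fundamental_group :: "'a topology \<Rightarrow> 'a \<Rightarrow> (real \<Rightarrow> 'a) set monoid" where
  "fundamental_group T p =
     \<lparr>carrier = based_loops T p // loop_homotopy T p,
      mult = (\<lambda>a b. \<Union>f\<in>a. \<Union>g\<in>b. loop_homotopy T p `` {concat_paths f g}),
      one = loop_homotopy T p `` {\<lambda>_. p}\<rparr>"

end

theory Submission
  imports Defs "HOL-Library.Function_Algebras"
begin

text \<open>Write \<open>R\<close> for the ring of sequences in the field, and say that a sequence has size at most
\<open>r\<close> if its terms are \<open>\<omega>\<close>-eventually at most \<open>exp ((r + \<epsilon>)
n)\<close>, for every \<open>\<epsilon> > 0\<close>. Up to Lipschitz constants, a word metric on the
quotient group is the logarithm of the largest of the entries other than the corner and of the inverses of
the diagonal entries, so a point of the cone is given by a unitriangular matrix \<open>u\<close> over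
\<open>R\<close> with entries of finite size and by the two growth rates \<open>a = (a\<^sub>2,
a\<^sub>3)\<close> of the diagonal entries. Keeping the corner entry of \<open>u\<close> gives a model of
the cone of the full matrix group, on which the corner entries act by translation; the cone in question is
the quotient by this action. The theorem holds because the model is simply connected and the quotient map
behaves like a covering. The fundamental group is then the group of corner entries of finite size modulo
those of size at most \<open>0\<close>.

The model is a union of planes (flats), one for each \<open>u\<close>, and the flats of \<open>u\<close> and
\<open>u + v\<close> meet over the points \<open>a\<close> at which conjugation by \<open>a\<close> brings
all entries of \<open>v\<close> down to size at most \<open>0\<close>. Inside a cell of a given radius this
makes the group of displacements an amalgam: the root subgroups other than the corner, with only the
relations that hold inside the stabiliser of some point, already generate the unitriangular group with its
corner. This is the argument of Abels (\<open>amalgam_hom\<close>): the commutators of the roots 13, 34 and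
of the roots 12, 24 are forced to agree, to be central and to depend additively on the product of their
arguments. Each relation is realised by a homotopy that moves along flats (\<open>letter_hom_ex\<close>), so
two paths that follow flats and have the same ends are homotopic, with control on the size of the homotopy
(\<open>flat_paths_homotopic\<close>). The control permits an infinite concatenation over dyadic
subdivisions, and every path is homotopic to a fixed flat arc between its ends
(\<open>path_homotopic_flat_arc\<close>).

Elements of size at most \<open>r\<close> form a group. Hence errors do not add up along a chain, and lifts
of a path that are defined up to a small error can be corrected to a true lift, by an intersection of nested
balls (\<open>path_lift\<close>). For the same reason homotopic loops have lifts with the same end up to
size \<open>0\<close> (\<open>lift_end_invariant\<close>). The lift of a loop ends in a corner translate of
its beginning, and this translation identifies the fundamental group with the quotient of the additive group
of corner entries (\<open>fundamental_group_cone\<close>), which is abelian. Sequences with growth rates in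
the unit interval represent continuum many elements of it, and the field has at most the cardinality of the
continuum (\<open>quotient_eqpoll_reals\<close>).\<close>

section \<open>Unitriangular matrices and the amalgam of their tame subgroups\<close>

text \<open>Upper unitriangular \<open>4 \<times> 4\<close> matrices, given by their entries above the diagonal. The matrix product is
written as addition because \<^class>\<open>group_add\<close> is the library's class of noncommutative groups.\<close>

datatype 'r uni = Uni (e12: 'r) (e23: 'r) (e34: 'r) (e13: 'r) (e24: 'r) (e14: 'r)

instantiation uni :: (comm_ring_1) group_add
begin

definition "0 = Uni 0 0 0 0 0 0"
definition "u + v = Uni (e12 u + e12 v) (e23 u + e23 v) (e34 u + e34 v)
  (e13 u + e13 v + e12 u * e23 v) (e24 u + e24 v + e23 u * e34 v)
  (e14 u + e14 v + e12 u * e24 v + e13 u * e34 v)"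
definition "- u = Uni (- e12 u) (- e23 u) (- e34 u)
  (e12 u * e23 u - e13 u) (e23 u * e34 u - e24 u)
  (e12 u * e24 u + e13 u * e34 u - e14 u - e12 u * e23 u * e34 u)"
definition "u - v = u + - (v :: 'a uni)"

instance
  by standard (auto simp: plus_uni_def zero_uni_def uminus_uni_def minus_uni_def algebra_simps
      intro: uni.expand)

end

lemma uni_zero_sel [simp]:
  "e12 0 = 0" "e23 0 = 0" "e34 0 = 0" "e13 0 = 0" "e24 0 = 0" "e14 0 = 0"
  by (simp_all add: zero_uni_def)

lemma uni_plus_sel [simp]:
  "e12 (u + v) = e12 u + e12 v" "e23 (u + v) = e23 u + e23 v" "e34 (u + v) = e34 u + e34 v"
  "e13 (u + v) = e13 u + e13 v + e12 u * e23 v" "e24 (u + v) = e24 u + e24 v + e23 u * e34 v"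
  "e14 (u + v) = e14 u + e14 v + e12 u * e24 v + e13 u * e34 v"
  by (simp_all add: plus_uni_def)

lemma uni_minus_sel [simp]:
  "e12 (- u) = - e12 u" "e23 (- u) = - e23 u" "e34 (- u) = - e34 u"
  "e13 (- u) = e12 u * e23 u - e13 u" "e24 (- u) = e23 u * e34 u - e24 u"
  "e14 (- u) = e12 u * e24 u + e13 u * e34 u - e14 u - e12 u * e23 u * e34 u"
  by (simp_all add: uminus_uni_def)

lemma uni_diff_sel [simp]:
  "e12 (u - v) = e12 u - e12 v" "e23 (u - v) = e23 u - e23 v" "e34 (u - v) = e34 u - e34 v"
  "e13 (u - v) = e13 u - e13 v - (e12 u - e12 v) * e23 v"
  "e24 (u - v) = e24 u - e24 v - (e23 u - e23 v) * e34 v"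
  "e14 (u - v) = e14 u - e14 v - (e12 u - e12 v) * (e24 v - e23 v * e34 v) - (e13 u - e13 v) * e34 v"
  by (simp_all add: minus_uni_def algebra_simps del: add_uminus_conv_diff diff_conv_add_uminus)

abbreviation "el12 s \<equiv> Uni s 0 0 0 0 0"
abbreviation "el23 s \<equiv> Uni 0 s 0 0 0 0"
abbreviation "el34 s \<equiv> Uni 0 0 s 0 0 0"
abbreviation "el13 s \<equiv> Uni 0 0 0 s 0 0"
abbreviation "el24 s \<equiv> Uni 0 0 0 0 s 0"
abbreviation "el14 s \<equiv> Uni 0 0 0 0 0 s"

text \<open>The order of the factors is the one of the normal form used for the amalgam below; there the
roots 24 and 14 carry the correction terms.\<close>

lemma uni_decomp:
  "u = el13 (e13 u) + el23 (e23 u) + el24 (e24 u - e23 u * e34 u) + el14 (e14 u - e13 u * e34 u)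
     + el12 (e12 u) + el34 (e34 u)"
  by (rule uni.expand) (simp add: algebra_simps)

lemma el14_central: "el14 s + u = u + el14 s"
  by (rule uni.expand) (simp add: algebra_simps)

definition add_closed :: "'r::ab_group_add set \<Rightarrow> bool" where
  "add_closed S \<longleftrightarrow> 0 \<in> S \<and> (\<forall>x\<in>S. \<forall>y\<in>S. x + y \<in> S) \<and> (\<forall>x\<in>S. - x \<in> S)"

lemma add_closedD:
  assumes "add_closed S"
  shows "0 \<in> S" "x \<in> S \<Longrightarrow> y \<in> S \<Longrightarrow> x + y \<in> S" "x \<in> S \<Longrightarrow> - x \<in> S"
    "x \<in> S \<Longrightarrow> y \<in> S \<Longrightarrow> x - y \<in> S"
  using assms unfolding add_closed_def by (auto simp: diff_conv_add_uminus simp del: add_uminus_conv_diff)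

definition uni_in :: "'r set \<Rightarrow> 'r set \<Rightarrow> 'r set \<Rightarrow> 'r set \<Rightarrow> 'r set \<Rightarrow> 'r set \<Rightarrow> 'r uni set" where
  "uni_in S12 S23 S34 S13 S24 S14 = {u. e12 u \<in> S12 \<and> e23 u \<in> S23 \<and> e34 u \<in> S34 \<and>
     e13 u \<in> S13 \<and> e24 u \<in> S24 \<and> e14 u \<in> S14}"

text \<open>Subgroups of the root groups other than the corner are mapped to a group \<open>H\<close>, and every commutator relation between
them is assumed that does not involve the corner. Nothing is assumed about the pairs 13, 34 and 12, 24, whose
commutators are corner elements. The units allow a factor to be moved from one argument of a
product to the other without leaving the prescribed sets.\<close>

locale tame_amalgam = group H for H (structure) +
  fixes S12 S23 S34 S13 S24 S14 :: "'r::comm_ring_1 set"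
    and x12 x23 x34 x13 x24 :: "'r \<Rightarrow> 'a" and r r' t t' :: 'r
  assumes add_closed: "add_closed S12" "add_closed S23" "add_closed S34" "add_closed S13"
      "add_closed S24" "add_closed S14"
    and mult_closed: "\<And>a b. a \<in> S12 \<Longrightarrow> b \<in> S23 \<Longrightarrow> a * b \<in> S13"
      "\<And>a b. a \<in> S23 \<Longrightarrow> b \<in> S34 \<Longrightarrow> a * b \<in> S24"
      "\<And>a b. a \<in> S12 \<Longrightarrow> b \<in> S24 \<Longrightarrow> a * b \<in> S14"
      "\<And>a b. a \<in> S13 \<Longrightarrow> b \<in> S34 \<Longrightarrow> a * b \<in> S14"
    and units: "r \<in> S23" "r * r' = 1" "t \<in> S34" "t * t' = 1"
      "\<And>a. a \<in> S13 \<Longrightarrow> a * r' \<in> S12" "\<And>a. a \<in> S14 \<Longrightarrow> a * t' \<in> S13"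
      "\<And>a. a \<in> S24 \<Longrightarrow> a * t' \<in> S23"
    and carr [simp]: "\<And>a. a \<in> S12 \<Longrightarrow> x12 a \<in> carrier H" "\<And>a. a \<in> S23 \<Longrightarrow> x23 a \<in> carrier H"
      "\<And>a. a \<in> S34 \<Longrightarrow> x34 a \<in> carrier H" "\<And>a. a \<in> S13 \<Longrightarrow> x13 a \<in> carrier H"
      "\<And>a. a \<in> S24 \<Longrightarrow> x24 a \<in> carrier H"
    and additive: "\<And>a b. a \<in> S12 \<Longrightarrow> b \<in> S12 \<Longrightarrow> x12 a \<otimes> x12 b = x12 (a + b)"
      "\<And>a b. a \<in> S23 \<Longrightarrow> b \<in> S23 \<Longrightarrow> x23 a \<otimes> x23 b = x23 (a + b)"
      "\<And>a b. a \<in> S34 \<Longrightarrow> b \<in> S34 \<Longrightarrow> x34 a \<otimes> x34 b = x34 (a + b)"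
      "\<And>a b. a \<in> S13 \<Longrightarrow> b \<in> S13 \<Longrightarrow> x13 a \<otimes> x13 b = x13 (a + b)"
      "\<And>a b. a \<in> S24 \<Longrightarrow> b \<in> S24 \<Longrightarrow> x24 a \<otimes> x24 b = x24 (a + b)"
    and commute: "\<And>a b. a \<in> S12 \<Longrightarrow> b \<in> S34 \<Longrightarrow> x34 b \<otimes> x12 a = x12 a \<otimes> x34 b"
      "\<And>a b. a \<in> S12 \<Longrightarrow> b \<in> S13 \<Longrightarrow> x12 a \<otimes> x13 b = x13 b \<otimes> x12 a"
      "\<And>a b. a \<in> S23 \<Longrightarrow> b \<in> S13 \<Longrightarrow> x23 a \<otimes> x13 b = x13 b \<otimes> x23 a"
      "\<And>a b. a \<in> S23 \<Longrightarrow> b \<in> S24 \<Longrightarrow> x24 b \<otimes> x23 a = x23 a \<otimes> x24 b"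
      "\<And>a b. a \<in> S34 \<Longrightarrow> b \<in> S24 \<Longrightarrow> x34 a \<otimes> x24 b = x24 b \<otimes> x34 a"
      "\<And>a b. a \<in> S13 \<Longrightarrow> b \<in> S24 \<Longrightarrow> x24 b \<otimes> x13 a = x13 a \<otimes> x24 b"
    and steinberg: "\<And>a b. a \<in> S12 \<Longrightarrow> b \<in> S23 \<Longrightarrow> x12 a \<otimes> x23 b = x13 (a * b) \<otimes> x23 b \<otimes> x12 a"
      "\<And>a b. a \<in> S23 \<Longrightarrow> b \<in> S34 \<Longrightarrow> x23 a \<otimes> x34 b = x24 (a * b) \<otimes> x34 b \<otimes> x23 a"
begin

lemmas closed = add_closed[THEN add_closedD(1)] add_closed[THEN add_closedD(2)]
  add_closed[THEN add_closedD(3)] add_closed[THEN add_closedD(4)] mult_closed units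

lemma swap_left:
  assumes "x \<otimes> y = z" "x \<in> carrier H" "y \<in> carrier H" "w \<in> carrier H"
  shows "x \<otimes> (y \<otimes> w) = z \<otimes> w"
  using assms by (metis m_assoc)

definition cm where "cm a b \<longleftrightarrow> a \<otimes> b = b \<otimes> a"

lemma cm_mult: "\<lbrakk>cm g a; cm g b; g \<in> carrier H; a \<in> carrier H; b \<in> carrier H\<rbrakk> \<Longrightarrow> cm g (a \<otimes> b)"
  unfolding cm_def by (metis m_assoc)
lemma cm_inv: "\<lbrakk>cm g a; g \<in> carrier H; a \<in> carrier H\<rbrakk> \<Longrightarrow> cm g (inv a)"
  unfolding cm_def by (metis inv_closed inv_solve_left inv_solve_right m_assoc m_closed)

text \<open>The two families of commutators that have to become the corner elements, and the value \<open>c s\<close> that \<open>el14 s\<close> will take.\<close>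

definition K where "K \<sigma> \<tau> = x13 \<sigma> \<otimes> x34 \<tau> \<otimes> inv x13 \<sigma> \<otimes> inv x34 \<tau>"
definition K' where "K' \<alpha> \<rho> = x12 \<alpha> \<otimes> x24 \<rho> \<otimes> inv x12 \<alpha> \<otimes> inv x24 \<rho>"
definition c where "c s = K (s * t') t"

lemma K_carr [simp]: "\<sigma> \<in> S13 \<Longrightarrow> \<tau> \<in> S34 \<Longrightarrow> K \<sigma> \<tau> \<in> carrier H"
  by (simp add: K_def)
lemma K'_carr [simp]: "\<sigma> \<in> S12 \<Longrightarrow> \<tau> \<in> S24 \<Longrightarrow> K' \<sigma> \<tau> \<in> carrier H"
  by (simp add: K'_def)

lemma K_swap: "\<sigma> \<in> S13 \<Longrightarrow> \<tau> \<in> S34 \<Longrightarrow> x13 \<sigma> \<otimes> x34 \<tau> = K \<sigma> \<tau> \<otimes> x34 \<tau> \<otimes> x13 \<sigma>"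
  by (simp add: K_def m_assoc)
lemma K'_swap: "\<sigma> \<in> S12 \<Longrightarrow> \<tau> \<in> S24 \<Longrightarrow> x12 \<sigma> \<otimes> x24 \<tau> = K' \<sigma> \<tau> \<otimes> x24 \<tau> \<otimes> x12 \<sigma>"
  by (simp add: K'_def m_assoc)

lemma K_cm1:
  assumes "\<sigma> \<in> S13" "\<tau> \<in> S34"
  shows "a \<in> S12 \<Longrightarrow> cm (x12 a) (K \<sigma> \<tau>)" "b \<in> S24 \<Longrightarrow> cm (x24 b) (K \<sigma> \<tau>)"
  unfolding K_def using assms
  by (intro cm_mult cm_inv; simp add: cm_def commute)+

lemma K'_cm1:
  assumes "\<sigma> \<in> S12" "\<tau> \<in> S24"
  shows "a \<in> S13 \<Longrightarrow> cm (x13 a) (K' \<sigma> \<tau>)" "b \<in> S34 \<Longrightarrow> cm (x34 b) (K' \<sigma> \<tau>)"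
  unfolding K'_def using assms
  by (intro cm_mult cm_inv; simp add: cm_def commute)+

text \<open>The commutator \<open>K \<sigma> \<tau>\<close> arises by moving \<open>x34 \<tau>\<close> past \<open>x13 \<sigma>\<close>. Moving \<open>x23 q\<close> through both sides produces the same
factor \<open>x24 (q * \<tau>)\<close>, which commutes with everything involved.\<close>

lemma K_cm23:
  assumes "\<sigma> \<in> S13" "\<tau> \<in> S34" "q \<in> S23"
  shows "cm (x23 q) (K \<sigma> \<tau>)"
proof -
  let ?Y = "x23 q" and ?X = "x13 \<sigma>" and ?T = "x34 \<tau>" and ?Z = "x24 (q * \<tau>)" and ?K = "K \<sigma> \<tau>"
  have Zc: "q * \<tau> \<in> S24" using assms closed by simp
  have C: "?Y \<in> carrier H" "?X \<in> carrier H" "?T \<in> carrier H" "?Z \<in> carrier H" "?K \<in> carrier H"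
    using assms Zc by auto
  have yx: "?Y \<otimes> ?X = ?X \<otimes> ?Y" and zx: "?Z \<otimes> ?X = ?X \<otimes> ?Z" and yt: "?Y \<otimes> ?T = ?Z \<otimes> ?T \<otimes> ?Y"
    and zk: "?Z \<otimes> ?K = ?K \<otimes> ?Z" and xt: "?X \<otimes> ?T = ?K \<otimes> ?T \<otimes> ?X"
    using commute(3)[OF assms(3,1)] commute(6)[OF assms(1) Zc] steinberg(2)[OF assms(3,2)]
      K_swap[OF assms(1,2)] K_cm1(2)[OF assms(1,2) Zc] by (simp_all add: cm_def)
  have "(?Y \<otimes> ?K) \<otimes> (?T \<otimes> ?X) = ?Y \<otimes> (?X \<otimes> ?T)" using C xt by (simp add: m_assoc)
  also have "\<dots> = ?X \<otimes> (?Y \<otimes> ?T)" using C yx by (metis m_assoc)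
  also have "\<dots> = ?X \<otimes> ?Z \<otimes> ?T \<otimes> ?Y" using C yt by (simp add: m_assoc)
  also have "\<dots> = ?Z \<otimes> (?X \<otimes> ?T) \<otimes> ?Y" using C swap_left[OF zx] by (simp add: m_assoc)
  also have "\<dots> = ?Z \<otimes> ?K \<otimes> ?T \<otimes> (?X \<otimes> ?Y)" using C xt by (simp add: m_assoc)
  also have "\<dots> = ?K \<otimes> (?Z \<otimes> ?T \<otimes> ?Y) \<otimes> ?X" using C swap_left[OF zk] yx by (simp add: m_assoc)
  also have "\<dots> = ?K \<otimes> (?Y \<otimes> ?T) \<otimes> ?X" using yt by simp
  also have "\<dots> = (?K \<otimes> ?Y) \<otimes> (?T \<otimes> ?X)" using C by (simp add: m_assoc)
  finally show ?thesis using C unfolding cm_def by (meson m_closed right_cancel)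
qed

text \<open>Both sides measure the reordering of \<open>x12 \<alpha> \<otimes> x23 q \<otimes> x34 \<tau>\<close>: one may first combine 12 with 23 to a factor 13, or 23 with 34
to a factor 24.\<close>

lemma K'_eq_K:
  assumes "\<alpha> \<in> S12" "q \<in> S23" "\<tau> \<in> S34"
  shows "K' \<alpha> (q * \<tau>) = K (\<alpha> * q) \<tau>"
proof -
  let ?A = "x12 \<alpha>" and ?Y = "x23 q" and ?X = "x13 (\<alpha> * q)" and ?T = "x34 \<tau>"
    and ?Z = "x24 (q * \<tau>)" and ?K = "K (\<alpha> * q) \<tau>"
  have Zc: "q * \<tau> \<in> S24" "\<alpha> * q \<in> S13" using assms closed by auto
  have C: "?A \<in> carrier H" "?Y \<in> carrier H" "?X \<in> carrier H" "?T \<in> carrier H" "?Z \<in> carrier H"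
    "?K \<in> carrier H"
    using assms Zc by auto
  have ay: "?A \<otimes> ?Y = ?X \<otimes> ?Y \<otimes> ?A" and yt: "?Y \<otimes> ?T = ?Z \<otimes> ?T \<otimes> ?Y" and at: "?A \<otimes> ?T = ?T \<otimes> ?A"
    and xt: "?X \<otimes> ?T = ?K \<otimes> ?T \<otimes> ?X" and xz: "?X \<otimes> ?Z = ?Z \<otimes> ?X"
    and zk: "?Z \<otimes> ?K = ?K \<otimes> ?Z" and az: "?A \<otimes> ?Z = K' \<alpha> (q * \<tau>) \<otimes> ?Z \<otimes> ?A"
    using steinberg(1)[OF assms(1,2)] steinberg(2)[OF assms(2,3)] commute(1)[OF assms(1,3)]
      K_swap[OF Zc(2) assms(3)] commute(6)[OF Zc(2,1)] K'_swap[OF assms(1) Zc(1)]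
      K_cm1(2)[OF Zc(2) assms(3) Zc(1)] by (simp_all add: cm_def)
  have "(?A \<otimes> ?Z) \<otimes> (?T \<otimes> ?Y) = ?A \<otimes> ?Y \<otimes> ?T" using C yt by (simp add: m_assoc)
  also have "\<dots> = ?X \<otimes> ?Y \<otimes> (?A \<otimes> ?T)" using C ay by (simp add: m_assoc)
  also have "\<dots> = ?X \<otimes> (?Y \<otimes> ?T) \<otimes> ?A" using C at by (simp add: m_assoc)
  also have "\<dots> = (?X \<otimes> ?Z) \<otimes> ?T \<otimes> ?Y \<otimes> ?A" using C yt by (simp add: m_assoc)
  also have "\<dots> = ?Z \<otimes> (?X \<otimes> ?T) \<otimes> ?Y \<otimes> ?A" using C xz by (simp add: m_assoc)
  also have "\<dots> = ?Z \<otimes> ?K \<otimes> ?T \<otimes> (?X \<otimes> ?Y \<otimes> ?A)" using C xt by (simp add: m_assoc)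
  also have "\<dots> = ?Z \<otimes> ?K \<otimes> ?T \<otimes> (?A \<otimes> ?Y)" using ay by simp
  also have "\<dots> = ?K \<otimes> ?Z \<otimes> (?A \<otimes> ?T) \<otimes> ?Y" using C zk at by (simp add: m_assoc)
  also have "\<dots> = (?K \<otimes> ?Z \<otimes> ?A) \<otimes> (?T \<otimes> ?Y)" using C by (simp add: m_assoc)
  finally have "?A \<otimes> ?Z = ?K \<otimes> ?Z \<otimes> ?A" using C by (meson m_closed right_cancel)
  then show ?thesis using az C assms Zc by (metis K'_carr m_assoc m_closed right_cancel)
qed

text \<open>The units let one apply the previous identity twice and so shift the whole product into
the first argument.\<close>

lemma K_eq_c: assumes "\<sigma> \<in> S13" "\<tau> \<in> S34" shows "K \<sigma> \<tau> = c (\<sigma> * \<tau>)"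
proof -
  have m: "\<sigma> * r' \<in> S12" "r * \<tau> \<in> S24" "r * \<tau> * t' \<in> S23" using assms closed by auto
  have e: "\<sigma> * r' * r = \<sigma>" "r * \<tau> * t' * t = r * \<tau>"
    using units(2,4) by (metis mult.assoc mult.commute mult.right_neutral)+
  have "K \<sigma> \<tau> = K' (\<sigma> * r') (r * \<tau>)" using K'_eq_K[OF m(1) units(1) assms(2)] e by simp
  also have "\<dots> = K (\<sigma> * r' * (r * \<tau> * t')) t" using K'_eq_K[OF m(1) m(3) units(3)] e by simp
  also have "\<sigma> * r' * (r * \<tau> * t') = \<sigma> * \<tau> * t'" by (metis e(1) mult.assoc)
  finally show ?thesis by (simp add: c_def)
qed

lemma K'_eq_c: assumes "\<alpha> \<in> S12" "\<rho> \<in> S24" shows "K' \<alpha> \<rho> = c (\<alpha> * \<rho>)"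
proof -
  have "\<rho> * t' \<in> S23" "\<rho> * t' * t = \<rho>"
    using assms units by (auto, metis mult.assoc mult.commute mult.right_neutral)
  then show ?thesis using K'_eq_K[OF assms(1) _ units(3), of "\<rho> * t'"] by (simp add: c_def ac_simps)
qed

lemma c_carr [simp]: "s \<in> S14 \<Longrightarrow> c s \<in> carrier H"
  by (simp add: c_def closed)

text \<open>The element \<open>c s\<close> is a commutator of both kinds, and each kind visibly commutes with the roots
that the other one misses.\<close>

lemma c_cm:
  assumes s: "s \<in> S14"
  shows "a \<in> S12 \<Longrightarrow> c s \<otimes> x12 a = x12 a \<otimes> c s" "a \<in> S23 \<Longrightarrow> c s \<otimes> x23 a = x23 a \<otimes> c s"
    "a \<in> S34 \<Longrightarrow> c s \<otimes> x34 a = x34 a \<otimes> c s" "a \<in> S13 \<Longrightarrow> c s \<otimes> x13 a = x13 a \<otimes> c s"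
    "a \<in> S24 \<Longrightarrow> c s \<otimes> x24 a = x24 a \<otimes> c s"
proof -
  have m: "s * t' \<in> S13" "s * t' * r' \<in> S12" "r * t \<in> S24" using s closed by auto
  have e: "s * t' * r' * r = s * t'" using units(2) by (metis mult.assoc mult.commute mult.right_neutral)
  have c': "c s = K' (s * t' * r') (r * t)"
    using K'_eq_K[OF m(2) units(1) units(3)] e by (simp add: c_def)
  show "a \<in> S12 \<Longrightarrow> c s \<otimes> x12 a = x12 a \<otimes> c s" "a \<in> S23 \<Longrightarrow> c s \<otimes> x23 a = x23 a \<otimes> c s"
    "a \<in> S24 \<Longrightarrow> c s \<otimes> x24 a = x24 a \<otimes> c s"
    using K_cm1[OF m(1) units(3)] K_cm23[OF m(1) units(3)] unfolding c_def cm_def by auto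
  show "a \<in> S34 \<Longrightarrow> c s \<otimes> x34 a = x34 a \<otimes> c s" "a \<in> S13 \<Longrightarrow> c s \<otimes> x13 a = x13 a \<otimes> c s"
    using K'_cm1[OF m(2,3)] unfolding c' cm_def by auto
qed

lemma c_add: assumes "s \<in> S14" "s' \<in> S14" shows "c (s + s') = c s \<otimes> c s'"
proof -
  let ?X = "x13 (s' * t')" and ?X' = "x13 (s * t')" and ?T = "x34 t"
  have m: "s' * t' \<in> S13" "s * t' \<in> S13" "s + s' \<in> S14" using assms closed by auto
  have C: "?X \<in> carrier H" "?X' \<in> carrier H" "?T \<in> carrier H" "c s \<in> carrier H" "c s' \<in> carrier H"
    "c (s + s') \<in> carrier H"
    using m assms units by auto
  have XX: "x13 ((s + s') * t') = ?X \<otimes> ?X'" using additive(4)[OF m(1,2)]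
    by (simp add: algebra_simps)
  have sw: "?X \<otimes> ?T = c s' \<otimes> ?T \<otimes> ?X" "?X' \<otimes> ?T = c s \<otimes> ?T \<otimes> ?X'"
    using K_swap[OF m(1) units(3)] K_swap[OF m(2) units(3)] by (auto simp: c_def)
  have "c (s + s') \<otimes> (?T \<otimes> (?X \<otimes> ?X')) = ?X \<otimes> ?X' \<otimes> ?T"
    using K_swap[of "(s + s') * t'" t] m(3) units XX C by (simp add: c_def m_assoc)
  also have "\<dots> = ?X \<otimes> (c s \<otimes> ?T \<otimes> ?X')" using C sw by (simp add: m_assoc)
  also have "\<dots> = c s \<otimes> (?X \<otimes> ?T) \<otimes> ?X'"
    using C c_cm(4)[OF assms(1) m(1)] by (metis m_assoc m_closed)
  also have "\<dots> = (c s \<otimes> c s') \<otimes> (?T \<otimes> (?X \<otimes> ?X'))" using C sw by (simp add: m_assoc)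
  finally show "c (s + s') = c s \<otimes> c s'" using C by (meson m_closed right_cancel)
qed

text \<open>The image of \<open>u\<close> read off its normal form.\<close>

definition \<psi> where
  "\<psi> u = x13 (e13 u) \<otimes> (x23 (e23 u) \<otimes> (x24 (e24 u - e23 u * e34 u) \<otimes> (c (e14 u - e13 u * e34 u) \<otimes>
     (x12 (e12 u) \<otimes> x34 (e34 u)))))"

abbreviation "W \<equiv> uni_in S12 S23 S34 S13 S24 S14"

lemma swap34_13: "b \<in> S34 \<Longrightarrow> p \<in> S13 \<Longrightarrow> x34 b \<otimes> x13 p = x13 p \<otimes> (c (- (p * b)) \<otimes> x34 b)"
proof -
  assume b: "b \<in> S34" and p: "p \<in> S13"
  have m: "p * b \<in> S14" "- (p * b) \<in> S14" "0 \<in> S14" using b p closed by auto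
  have "c 0 = \<one>" using c_add[OF m(3,3)] m(3) by (metis add_0 c_carr l_cancel_one')
  then have inv: "c (- (p * b)) \<otimes> c (p * b) = \<one>" using c_add[OF m(2,1)] by simp
  have "x13 p \<otimes> (c (- (p * b)) \<otimes> x34 b) = c (- (p * b)) \<otimes> (x13 p \<otimes> x34 b)"
    using c_cm(4)[OF m(2) p] b p m by (metis carr(3,4) c_carr m_assoc)
  also have "\<dots> = (c (- (p * b)) \<otimes> c (p * b)) \<otimes> (x34 b \<otimes> x13 p)"
    using K_swap[OF p b] K_eq_c[OF p b] b p m by (simp add: m_assoc)
  finally show ?thesis using inv b p by simp
qed

lemma x24_0: "x24 0 = \<one>"
  using additive(5)[of 0 0] closed(5) by (metis add_0 carr(5) l_cancel_one)

lemma swap34_23: "b \<in> S34 \<Longrightarrow> q \<in> S23 \<Longrightarrow> x34 b \<otimes> x23 q = x23 q \<otimes> (x24 (- (q * b)) \<otimes> x34 b)"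
proof -
  assume b: "b \<in> S34" and q: "q \<in> S23"
  have m: "q * b \<in> S24" "- (q * b) \<in> S24" using b q closed by auto
  have inv: "x24 (- (q * b)) \<otimes> x24 (q * b) = \<one>" using additive(5)[OF m(2,1)] x24_0 by simp
  have "x23 q \<otimes> (x24 (- (q * b)) \<otimes> x34 b) = x24 (- (q * b)) \<otimes> (x23 q \<otimes> x34 b)"
    using commute(4)[OF q m(2)] b q m by (metis carr(2,3,5) m_assoc)
  also have "\<dots> = (x24 (- (q * b)) \<otimes> x24 (q * b)) \<otimes> (x34 b \<otimes> x23 q)"
    using steinberg(2)[OF q b] b q m by (simp add: m_assoc)
  finally show ?thesis using inv b q by simp
qed

lemma swap12_24: "a \<in> S12 \<Longrightarrow> p \<in> S24 \<Longrightarrow> x12 a \<otimes> x24 p = x24 p \<otimes> (c (a * p) \<otimes> x12 a)"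
  using K'_swap[of a p] K'_eq_c[of a p] c_cm(5)[of "a * p" p] by (simp add: m_assoc closed)

lemma swap12_23: "a \<in> S12 \<Longrightarrow> p \<in> S23 \<Longrightarrow> x12 a \<otimes> x23 p = x13 (a * p) \<otimes> (x23 p \<otimes> x12 a)"
  using steinberg(1)[of a p] by (simp add: m_assoc closed)

lemmas swaps = commute(1-6) c_cm(2,4,5) c_cm(1,3)[symmetric] swap34_13 swap34_23 swap12_24 swap12_23

lemma \<psi>_mult:
  assumes u: "u \<in> W" and v: "v \<in> W"
  shows "\<psi> u \<otimes> \<psi> v = \<psi> (u + v)"
proof -
  obtain a q b p z s where U: "u = Uni a q b p z s" by (cases u)
  obtain a' q' b' p' z' s' where V: "v = Uni a' q' b' p' z' s'" by (cases v)
  have m: "a \<in> S12" "q \<in> S23" "b \<in> S34" "p \<in> S13" "z \<in> S24" "s \<in> S14"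
     "a' \<in> S12" "q' \<in> S23" "b' \<in> S34" "p' \<in> S13" "z' \<in> S24" "s' \<in> S14"
    using u v unfolding U V by (auto simp: uni_in_def)
  note [simp] = m closed m_assoc
  note sl = swaps[THEN swap_left] additive[THEN swap_left] c_add[symmetric, THEN swap_left]
  \<comment> \<open>The exchange rules sort the letters of the product into the order of the normal form.\<close>
  show ?thesis unfolding \<psi>_def U V
    apply (simp add: swaps sl additive c_add[symmetric])
    apply (simp add: algebra_simps)
    done
qed

lemma x_0: "x12 0 = \<one>" "x23 0 = \<one>" "x34 0 = \<one>" "x13 0 = \<one>" "x24 0 = \<one>" "c 0 = \<one>"
  using additive(1)[of 0 0] additive(2)[of 0 0] additive(3)[of 0 0] additive(4)[of 0 0]
    additive(5)[of 0 0] c_add[of 0 0] add_closed[THEN add_closedD(1)]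
  by simp_all

text \<open>The existence of this homomorphism says that the unitriangular group, corner included, is the
amalgam of its tame subgroups.\<close>

theorem amalgam_hom:
  obtains \<psi> where "\<And>u. u \<in> W \<Longrightarrow> \<psi> u \<in> carrier H"
    "\<And>u v. u \<in> W \<Longrightarrow> v \<in> W \<Longrightarrow> \<psi> (u + v) = \<psi> u \<otimes> \<psi> v"
    "\<And>s. s \<in> S12 \<Longrightarrow> \<psi> (el12 s) = x12 s" "\<And>s. s \<in> S23 \<Longrightarrow> \<psi> (el23 s) = x23 s"
    "\<And>s. s \<in> S34 \<Longrightarrow> \<psi> (el34 s) = x34 s" "\<And>s. s \<in> S13 \<Longrightarrow> \<psi> (el13 s) = x13 s"
    "\<And>s. s \<in> S24 \<Longrightarrow> \<psi> (el24 s) = x24 s"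
proof
  show "\<psi> u \<in> carrier H" if "u \<in> W" for u
    using that closed unfolding uni_in_def by (auto simp: \<psi>_def)
qed (use \<psi>_mult in \<open>auto simp: \<psi>_def x_0\<close>)

end

section \<open>A pseudometric model of the cone\<close>

lemma homotopic_paths_right_unit:
  assumes "path p" "path_image p \<subseteq> S" "pathfinish p = x"
  shows "homotopic_paths S (p +++ (\<lambda>_. x)) p"
proof -
  have c: "continuous_on {0..1} (\<lambda>t::real. if t \<le> 1/2 then 2 * t else 1)"
    unfolding split_01 by (rule continuous_on_cases continuous_intros | force)+
  show ?thesis
    by (rule homotopic_paths_sym, rule homotopic_paths_reparametrize[OF assms(1,2) c])
      (use assms(3) in \<open>auto simp: joinpaths_def pathfinish_def\<close>)
qed

lemma homotopic_paths_left_unit: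
  assumes "path p" "path_image p \<subseteq> S" "pathstart p = x"
  shows "homotopic_paths S ((\<lambda>_. x) +++ p) p"
proof -
  have c: "continuous_on {0..1} (\<lambda>t::real. if t \<le> 1/2 then 0 else 2 * t - 1)"
    unfolding split_01 by (rule continuous_on_cases continuous_intros | force)+
  show ?thesis
    by (rule homotopic_paths_sym, rule homotopic_paths_reparametrize[OF assms(1,2) c])
      (use assms(3) in \<open>auto simp: joinpaths_def pathstart_def\<close>)
qed

lemma homotopic_paths_right_inverse:
  assumes "path p" "path_image p \<subseteq> S" "pathstart p = x"
  shows "homotopic_paths S (p +++ reversepath p) (\<lambda>_. x)"
proof -
  have p: "continuous_on {0..1} p" using assms by (auto simp: path_def)
  let ?h = "\<lambda>y. p (fst y * (1 - \<bar>2 * snd y - 1\<bar>))"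
  have in01: "s * (1 - \<bar>2 * t - 1\<bar>) \<in> {0..1}" if "s \<in> {0..1}" "t \<in> {0..1}" for s t :: real
    using that mult_mono[of s 1 "1 - \<bar>2 * t - 1\<bar>" 1] by (auto simp: abs_if)
  have c: "continuous_on ({0..1} \<times> {0..1}) ?h"
    by (rule continuous_on_compose2[OF p]) (use in01 in \<open>auto intro!: continuous_intros\<close>)
  have "homotopic_paths S (\<lambda>_. x) (p +++ reversepath p)"
    unfolding homotopic_paths
  proof (intro exI[of _ ?h] conjI ballI)
    show "?h \<in> {0..1} \<times> {0..1} \<rightarrow> S"
      using in01 assms(2) by (force simp: path_image_def)
    show "?h (1, t) = (p +++ reversepath p) t" if "t \<in> {0..1}" for t
      using that by (auto simp: joinpaths_def reversepath_def abs_if algebra_simps)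
  qed (use c assms(3) in \<open>auto simp: pathstart_def pathfinish_def o_def\<close>)
  then show ?thesis by (rule homotopic_paths_sym)
qed

lemma homotopic_paths_left_inverse:
  assumes "path p" "path_image p \<subseteq> S" "pathfinish p = x"
  shows "homotopic_paths S (reversepath p +++ p) (\<lambda>_. x)"
  using homotopic_paths_right_inverse[of "reversepath p" S] assms by simp

text \<open>The point \<open>(u, a)\<close> stands for the matrix \<open>u\<close> times a diagonal matrix with diagonal entries of logarithmic size
\<open>0, fst a, snd a, 0\<close>; these four numbers are the heights of the point.\<close>

type_synonym 'r point = "'r uni \<times> real \<times> real"

text \<open>\<open>B r\<close> is the set of elements of logarithmic size at most \<open>r\<close>. The size of a sum is at most the larger of the sizes, as
for a nonarchimedean absolute value, because growth rates are not affected by constant factors. The size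
of a product can be smaller than the sum of the sizes, and an element of size \<open>-\<infinity>\<close> need not be \<open>0\<close>.\<close>

locale valued_ring =
  fixes B :: "real \<Rightarrow> 'r::comm_ring_1 set"
  assumes B_0: "0 \<in> B r"
    and B_add: "x \<in> B r \<Longrightarrow> y \<in> B r \<Longrightarrow> x + y \<in> B r"
    and B_uminus: "x \<in> B r \<Longrightarrow> - x \<in> B r"
    and B_mult: "x \<in> B r \<Longrightarrow> y \<in> B s \<Longrightarrow> x * y \<in> B (r + s)"
    and B_mono: "x \<in> B r \<Longrightarrow> r \<le> s \<Longrightarrow> x \<in> B s"
    and B_closed: "(\<And>s. r < s \<Longrightarrow> x \<in> B s) \<Longrightarrow> x \<in> B r"
    and B_unit: "\<exists>t\<in>B r. \<exists>t'\<in>B (- r). t * t' = 1"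
begin

lemma B_diff: "x \<in> B r \<Longrightarrow> y \<in> B r \<Longrightarrow> x - y \<in> B r"
  using B_add[of x r "- y"] B_uminus by simp

lemma add_closed_B: "add_closed (B r)"
  by (simp add: add_closed_def B_0 B_add B_uminus)

lemma B_mult': "x \<in> B r \<Longrightarrow> y \<in> B s \<Longrightarrow> r + s \<le> q \<Longrightarrow> x * y \<in> B q"
  using B_mult B_mono by blast

definition Fin :: "'r set" where "Fin = (\<Union>r. B r)"

lemma Fin_I: "x \<in> B r \<Longrightarrow> x \<in> Fin" by (auto simp: Fin_def)
lemma Fin_0: "0 \<in> Fin" using B_0 Fin_I by blast
lemma Fin_add: "x \<in> Fin \<Longrightarrow> y \<in> Fin \<Longrightarrow> x + y \<in> Fin"
  unfolding Fin_def by clarify (meson B_add B_mono UNIV_I UN_I linorder_linear)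
lemma Fin_uminus: "x \<in> Fin \<Longrightarrow> - x \<in> Fin"
  unfolding Fin_def using B_uminus by auto
lemma Fin_mult: "x \<in> Fin \<Longrightarrow> y \<in> Fin \<Longrightarrow> x * y \<in> Fin"
  unfolding Fin_def using B_mult by blast
lemma Fin_diff: "x \<in> Fin \<Longrightarrow> y \<in> Fin \<Longrightarrow> x - y \<in> Fin"
  using Fin_add[of x "- y"] Fin_uminus by simp

definition UFin :: "'r uni set" where "UFin = uni_in Fin Fin Fin Fin Fin Fin"

lemma UFin_add: "u \<in> UFin \<Longrightarrow> v \<in> UFin \<Longrightarrow> u + v \<in> UFin"
  unfolding UFin_def uni_in_def by (auto intro!: Fin_add Fin_mult)
lemma UFin_uminus: "u \<in> UFin \<Longrightarrow> - u \<in> UFin"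
  unfolding UFin_def uni_in_def by (auto intro!: Fin_add Fin_diff Fin_uminus Fin_mult)

text \<open>The matrices whose \<open>(i, j)\<close> entry has size at most \<open>a\<^sub>i - a\<^sub>j + (j - i) \<rho>\<close>, where \<open>a\<^sub>1 = a\<^sub>4 = 0\<close>. The factor \<open>j - i\<close> makes
this a group. For \<open>\<rho> = 0\<close> it consists of the matrices that move \<open>(0, a)\<close> to a point at distance \<open>0\<close>.\<close>

definition grp :: "real \<times> real \<Rightarrow> real \<Rightarrow> 'r uni set" where
  "grp a \<rho> = uni_in (B (- fst a + \<rho>)) (B (fst a - snd a + \<rho>)) (B (snd a + \<rho>))
     (B (- snd a + 2 * \<rho>)) (B (fst a + 2 * \<rho>)) (B (3 * \<rho>))"

lemma grp_0: "0 \<in> grp a \<rho>" by (simp add: grp_def uni_in_def B_0)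
lemma grp_add: "u \<in> grp a \<rho> \<Longrightarrow> v \<in> grp a \<rho> \<Longrightarrow> u + v \<in> grp a \<rho>"
  unfolding grp_def uni_in_def by (auto intro!: B_add elim!: B_mult')
lemma grp_uminus: "u \<in> grp a \<rho> \<Longrightarrow> - u \<in> grp a \<rho>"
  unfolding grp_def uni_in_def
  by (auto intro!: B_diff B_add B_uminus elim: B_mult' intro: B_mult'[OF B_mult'[OF _ _ order_refl]])

definition near :: "real \<times> real \<Rightarrow> real \<times> real \<Rightarrow> real \<Rightarrow> bool" where
  "near a b d \<longleftrightarrow> \<bar>fst a - fst b\<bar> \<le> d \<and> \<bar>snd a - snd b\<bar> \<le> d"

lemma near_sym: "near a b d \<longleftrightarrow> near b a d" by (auto simp: near_def)
lemma near_nonneg: "near a b d \<Longrightarrow> 0 \<le> d" by (auto simp: near_def)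

lemma grp_near: "u \<in> grp b \<rho> \<Longrightarrow> near a b d \<Longrightarrow> u \<in> grp a (\<rho> + 2 * d)"
  unfolding grp_def uni_in_def near_def
  by (auto elim!: B_mono)

text \<open>The matrix \<open>u\<close>, multiplied on the left by the inverse of the diagonal matrix of \<open>a\<close> and on the right by the
diagonal matrix of \<open>b\<close>, has entries of size at most \<open>d\<close>.\<close>

definition bnd :: "real \<times> real \<Rightarrow> real \<times> real \<Rightarrow> real \<Rightarrow> 'r uni \<Rightarrow> bool" where
  "bnd a b d u \<longleftrightarrow> e12 u \<in> B (d - fst b) \<and> e23 u \<in> B (fst a - snd b + d) \<and> e34 u \<in> B (snd a + d) \<and>
     e13 u \<in> B (d - snd b) \<and> e24 u \<in> B (fst a + d) \<and> e14 u \<in> B d"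

lemma bnd_add:
  assumes "bnd a b d u" "bnd b c d' v" "near a b d" "near b c d'"
  shows "bnd a c (d + d') (u + v)"
  using assms unfolding bnd_def near_def
  by (auto intro!: B_add elim!: B_mult' elim: B_mono)

text \<open>The points \<open>x\<close> and \<open>y\<close> are at distance at most \<open>d\<close>. The matrices and their inverses are both bounded, which makes
the relation symmetric; it is left invariant and satisfies the triangle inequality.\<close>

definition clos :: "real \<Rightarrow> 'r point \<Rightarrow> 'r point \<Rightarrow> bool" where
  "clos d x y \<longleftrightarrow> near (snd x) (snd y) d \<and> bnd (snd x) (snd y) d (- fst x + fst y) \<and>
     bnd (snd y) (snd x) d (- fst y + fst x)"

definition act :: "'r uni \<Rightarrow> 'r point \<Rightarrow> 'r point" where
  "act w x = (w + fst x, snd x)"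

lemma act_act: "act w (act w' x) = act (w + w') x" by (simp add: act_def add.assoc)
lemma act_0 [simp]: "act 0 x = x" by (simp add: act_def)

lemma clos_nonneg: "clos d x y \<Longrightarrow> 0 \<le> d" by (auto simp: clos_def near_nonneg)
lemma clos_sym: "clos d x y \<longleftrightarrow> clos d y x" unfolding clos_def using near_sym by blast
lemma minus_add_cancel_left: "- (w + x) + (w + y) = - x + (y :: 'b::group_add)"
  by (simp only: minus_add add.assoc minus_add_cancel)

lemma clos_act: "clos d (act w x) (act w y) \<longleftrightarrow> clos d x y"
  unfolding clos_def act_def by (simp only: fst_conv snd_conv minus_add_cancel_left)

lemma clos_trans: "clos d x y \<Longrightarrow> clos d' y z \<Longrightarrow> clos (d + d') x z"
proof -
  assume xy: "clos d x y" and yz: "clos d' y z"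
  have 1: "- fst x + fst z = (- fst x + fst y) + (- fst y + fst z)"
    "- fst z + fst x = (- fst z + fst y) + (- fst y + fst x)" by (simp_all add: add.assoc)
  have "near (snd x) (snd z) (d + d')" using xy yz by (auto simp: clos_def near_def)
  moreover have "bnd (snd x) (snd z) (d + d') (- fst x + fst z)"
    unfolding 1 using xy yz bnd_add unfolding clos_def by blast
  moreover have "bnd (snd z) (snd x) (d' + d) (- fst z + fst x)"
    unfolding 1 using xy yz bnd_add near_sym unfolding clos_def by blast
  ultimately show ?thesis by (simp add: clos_def add.commute)
qed

lemma clos_mono: "clos d x y \<Longrightarrow> d \<le> d' \<Longrightarrow> clos d' x y"
  unfolding clos_def near_def bnd_def by (auto elim!: B_mono)

lemma clos_flat: "near a b d \<Longrightarrow> clos d (u, a) (u, b)"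
  unfolding clos_def using near_sym by (auto simp: bnd_def B_0)

lemma clos_refl: "0 \<le> d \<Longrightarrow> clos d x x"
  using clos_flat[of "snd x" "snd x" d "fst x"] by (simp add: near_def)

lemma clos_closed:
  assumes "\<And>d'. d < d' \<Longrightarrow> clos d' x y"
  shows "clos d x y"
proof -
  have n: "near (snd x) (snd y) d"
    using assms unfolding clos_def near_def by (meson dense_ge order_less_imp_le le_less_linear less_le_not_le field_le_epsilon dense not_le)
  have 1: "z \<in> B (q + d)" if "\<And>d'. d < d' \<Longrightarrow> z \<in> B (q + d')" for z q
  proof (rule B_closed)
    fix s assume "q + d < s"
    then show "z \<in> B s" using that[of "s - q"] by simp
  qed
  have 2: "z \<in> B (d - q)" if "\<And>d'. d < d' \<Longrightarrow> z \<in> B (d' - q)" for z q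
    using 1[of z "- q"] that by simp
  have 3: "z \<in> B d" if "\<And>d'. d < d' \<Longrightarrow> z \<in> B d'" for z using 1[of z 0] that by simp
  have "bnd (snd x) (snd y) d (- fst x + fst y)"
    using assms unfolding clos_def bnd_def by (intro conjI 1 2 3) blast+
  moreover have "bnd (snd y) (snd x) d (- fst y + fst x)"
    using assms unfolding clos_def bnd_def by (intro conjI 1 2 3) blast+
  ultimately show ?thesis using n by (simp add: clos_def)
qed

lemma clos_imp_grp: "clos d (u, a) (v, b) \<Longrightarrow> - u + v \<in> grp a (2 * d)"
  unfolding clos_def bnd_def grp_def uni_in_def near_def
  by (auto elim!: B_mono)

lemma grp_imp_clos:
  assumes "- u + v \<in> grp a \<rho>" "0 \<le> \<rho>"
  shows "clos (3 * \<rho>) (u, a) (v, a)"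
proof -
  have "- v + u = - (- u + v)" by (simp add: minus_add)
  then have "- v + u \<in> grp a \<rho>" using grp_uminus assms(1) by metis
  then show ?thesis using assms unfolding clos_def near_def bnd_def grp_def uni_in_def
    by (auto elim!: B_mono)
qed

lemma clos_0_iff: "clos 0 (u, a) (v, a) \<longleftrightarrow> - u + v \<in> grp a 0"
  using clos_imp_grp[of 0 u a v a] grp_imp_clos[of u v a 0] by auto

text \<open>The action of the corner entries.\<close>

definition zact :: "'r \<Rightarrow> 'r point \<Rightarrow> 'r point" where "zact z = act (el14 z)"

lemma el14_add: "el14 z + el14 w = el14 (z + w)" by (rule uni.expand) simp
lemma zact_zact: "zact z (zact w x) = zact (z + w) x" by (simp add: zact_def act_act el14_add)
lemma el14_0: "el14 0 = 0" by (simp add: zero_uni_def)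
lemma zact_0 [simp]: "zact 0 x = x" by (simp add: zact_def el14_0)
lemma clos_zact: "clos d (zact z x) (zact z y) \<longleftrightarrow> clos d x y" by (simp add: zact_def clos_act)

lemma clos_zact_iff: "0 \<le> d \<Longrightarrow> clos d x (zact z x) \<longleftrightarrow> z \<in> B d"
proof -
  have 1: "- fst x + (el14 z + fst x) = el14 z"
    by (simp add: el14_central[of z] add.assoc[symmetric])
  have 2: "- (el14 z + fst x) + fst x = el14 (- z)"
    by (rule uni.expand) (simp add: algebra_simps)
  have "z \<in> B d \<Longrightarrow> - z \<in> B d" by (rule B_uminus)
  then show "0 \<le> d \<Longrightarrow> ?thesis"
    unfolding clos_def zact_def act_def fst_conv snd_conv 1 2
    by (auto simp: near_def bnd_def B_0)
qed

text \<open>Points can be at infinite distance, hence the truncation at \<open>1\<close>.\<close>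

definition pd :: "'r point \<Rightarrow> 'r point \<Rightarrow> real" where
  "pd x y = Inf (insert 1 {d. clos d x y})"

lemma pd_bdd: "bdd_below (insert 1 {d. clos d x y})"
  by (rule bdd_belowI[of _ 0]) (auto simp: clos_nonneg)

lemma pd_nonneg: "0 \<le> pd x y"
  unfolding pd_def by (rule cInf_greatest) (auto simp: clos_nonneg)

lemma pd_le: "clos d x y \<Longrightarrow> pd x y \<le> d"
  unfolding pd_def by (rule cInf_lower[OF _ pd_bdd]) auto

lemma pd_le_1: "pd x y \<le> 1"
  unfolding pd_def by (rule cInf_lower[OF _ pd_bdd]) auto

lemma pd_less: "pd x y < d \<Longrightarrow> d \<le> 1 \<Longrightarrow> clos d x y"
  unfolding pd_def using cInf_lessD[of "insert 1 {d. clos d x y}" d] clos_mono by fastforce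

lemma pd_sym: "pd x y = pd y x" by (simp add: pd_def clos_sym)

lemma pd_act: "pd (act w x) (act w y) = pd x y" by (simp add: pd_def clos_act)

lemma pd_triangle: "pd x z \<le> pd x y + pd y z"
proof (rule field_le_epsilon)
  fix e :: real assume e: "0 < e"
  show "pd x z \<le> pd x y + pd y z + e"
  proof (cases "pd x y + pd y z + e \<le> 1")
    case True
    then have "clos (pd x y + e / 2) x y" "clos (pd y z + e / 2) y z"
      using e pd_nonneg[of x y] pd_nonneg[of y z] by (auto intro!: pd_less)
    from pd_le[OF clos_trans[OF this]] show ?thesis by simp
  qed (use pd_le_1[of x z] in linarith)
qed

lemma pd_0_iff: "pd x y = 0 \<longleftrightarrow> clos 0 x y"
proof
  assume "pd x y = 0"
  then have 1: "clos d' x y" if "0 < d'" for d'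
    using pd_less[of x y "min d' 1"] that by (auto intro: clos_mono)
  then show "clos 0 x y" by (rule clos_closed)
next
  assume "clos 0 x y"
  from pd_le[OF this] pd_nonneg[of x y] show "pd x y = 0" by simp
qed

text \<open>The homotopy theory of the library is about topological type classes, and \<^const>\<open>pd\<close> is only a pseudometric on
the type of points. The embedding of the points in a function space by their distances identifies points at
distance \<open>0\<close> and puts the metric quotient inside a topological type.\<close>

definition \<kappa> :: "'r point \<Rightarrow> 'r point \<Rightarrow> real" where "\<kappa> x = pd x"

lemma \<kappa>_eq_iff: "\<kappa> x = \<kappa> y \<longleftrightarrow> clos 0 x y"
proof
  assume "\<kappa> x = \<kappa> y"
  then have "pd x y = pd y y" by (metis \<kappa>_def)
  then show "clos 0 x y" by (metis pd_0_iff clos_refl order_refl)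
next
  assume "clos 0 x y"
  then have "pd x y = 0" "pd y x = 0" using pd_0_iff clos_sym by blast+
  then show "\<kappa> x = \<kappa> y"
    unfolding \<kappa>_def by (intro ext antisym) (metis add_0 pd_triangle)+
qed

lemma pd_lipschitz: "\<bar>pd x y - pd x' y\<bar> \<le> pd x x'"
  using pd_triangle[of x y x'] pd_triangle[of x' y x] pd_sym[of x x'] by linarith

lemma continuous_on_\<kappa>:
  assumes "\<And>s e. s \<in> S \<Longrightarrow> 0 < e \<Longrightarrow> eventually (\<lambda>s'. clos e (f s) (f s')) (at s within S)"
  shows "continuous_on S (\<lambda>s. \<kappa> (f s))"
proof (rule continuous_on_coordinatewise_then_product)
  fix y
  show "continuous_on S (\<lambda>s. \<kappa> (f s) y)"
    unfolding continuous_on_def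
  proof (intro ballI tendstoI)
    fix s and e :: real assume s: "s \<in> S" and e: "0 < e"
    show "\<forall>\<^sub>F s' in at s within S. dist (\<kappa> (f s') y) (\<kappa> (f s) y) < e"
      using assms[OF s half_gt_zero[OF e]]
    proof eventually_elim
      case (elim s')
      have "\<bar>pd (f s) y - pd (f s') y\<bar> \<le> e / 2" using pd_lipschitz pd_le[OF elim] order_trans by blast
      then show ?case using e by (simp add: \<kappa>_def dist_real_def abs_minus_commute)
    qed
  qed
qed

lemma continuous_on_\<kappa>D:
  assumes "continuous_on S (\<lambda>s. \<kappa> (f s))" "s \<in> S" "0 < e"
  shows "eventually (\<lambda>s'. clos e (f s) (f s')) (at s within S)"
proof -
  have "continuous_on S (\<lambda>s'. \<kappa> (f s') (f s))"
    using continuous_on_product_then_coordinatewise[OF assms(1)] .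
  then have "((\<lambda>s'. \<kappa> (f s') (f s)) \<longlongrightarrow> \<kappa> (f s) (f s)) (at s within S)"
    using assms(2) by (auto simp: continuous_on_def)
  moreover have "\<kappa> (f s) (f s) = 0" unfolding \<kappa>_def by (simp add: pd_0_iff clos_refl)
  ultimately have "\<forall>\<^sub>F s' in at s within S. dist (\<kappa> (f s') (f s)) 0 < min e 1"
    using assms(3) tendstoD[of _ _ _ "min e 1"] by fastforce
  then show ?thesis
  proof eventually_elim
    case (elim s')
    then have "pd (f s) (f s') < min e 1" by (simp add: \<kappa>_def pd_sym abs_less_iff)
    then show ?case using pd_less clos_mono by (metis min.cobounded1 min.cobounded2)
  qed
qed

text \<open>Left translation, transported along \<open>\<kappa>\<close> to all functions.\<close>

definition tr :: "'r uni \<Rightarrow> ('r point \<Rightarrow> real) \<Rightarrow> 'r point \<Rightarrow> real" where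
  "tr w f = (\<lambda>y. f (act (- w) y))"

lemma tr_\<kappa>: "tr w (\<kappa> x) = \<kappa> (act w x)"
proof
  fix y show "tr w (\<kappa> x) y = \<kappa> (act w x) y"
    using pd_act[of w x "act (- w) y"] by (simp add: tr_def \<kappa>_def act_act)
qed

lemma tr_tr: "tr w (tr w' f) = tr (w + w') f"
  by (simp add: tr_def act_act minus_add)

lemma tr_0 [simp]: "tr 0 f = f" by (simp add: tr_def)

lemma continuous_on_tr: "continuous_on S (tr w)"
  unfolding tr_def
  by (intro continuous_on_coordinatewise_then_product)
     (metis continuous_on_id continuous_on_product_then_coordinatewise)

lemma continuous_on_flat: "continuous_on S (\<lambda>b. \<kappa> (u, b))"
proof (rule continuous_on_\<kappa>)
  fix a :: "real \<times> real" and e :: real assume "0 < e"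
  have "\<forall>\<^sub>F b in at a within S. dist b a < e" using \<open>0 < e\<close> eventually_at_ball by (auto simp: eventually_at)
  then show "\<forall>\<^sub>F b in at a within S. clos e (u, a) (u, b)"
  proof eventually_elim
    case (elim b)
    have "\<bar>fst a - fst b\<bar> \<le> dist b a" "\<bar>snd a - snd b\<bar> \<le> dist b a"
      using dist_fst_le[of b a] dist_snd_le[of b a] by (auto simp: dist_real_def)
    then show ?case using elim by (intro clos_flat) (auto simp: near_def)
  qed
qed

text \<open>A straight segment in the flat of \<open>u\<close>.\<close>

definition seg :: "'r uni \<Rightarrow> real \<times> real \<Rightarrow> real \<times> real \<Rightarrow> real \<Rightarrow> 'r point \<Rightarrow> real" where
  "seg u a b = (\<lambda>c. \<kappa> (u, c)) \<circ> linepath a b"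

lemma path_seg [simp]: "path (seg u a b)"
  unfolding seg_def by (intro path_continuous_image continuous_on_flat) auto
lemma pathstart_seg [simp]: "pathstart (seg u a b) = \<kappa> (u, a)"
  by (simp add: seg_def pathstart_def linepath_def)
lemma pathfinish_seg [simp]: "pathfinish (seg u a b) = \<kappa> (u, b)"
  by (simp add: seg_def pathfinish_def linepath_def)
lemma path_image_seg: "path_image (seg u a b) = (\<lambda>c. \<kappa> (u, c)) ` closed_segment a b"
  by (simp add: seg_def path_image_compose)
lemma reversepath_seg: "reversepath (seg u a b) = seg u b a"
  by (simp add: seg_def reversepath_def o_def linepath_def fun_eq_iff algebra_simps)
lemma tr_seg: "tr w \<circ> seg u a b = seg (w + u) a b"
  by (simp add: seg_def o_def tr_\<kappa> act_def)
lemma seg_const: "seg u a a = (\<lambda>_. \<kappa> (u, a))"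
  by (simp add: seg_def o_def linepath_refl)

lemma seg_join:
  assumes "convex C" "a \<in> C" "b \<in> C" "c \<in> C" "\<And>x. x \<in> C \<Longrightarrow> \<kappa> (u, x) \<in> X"
  shows "homotopic_paths X (seg u a b +++ seg u b c) (seg u a c)"
proof -
  have sub: "path_image (linepath a b +++ linepath b c) \<subseteq> C"
    using assms by (simp add: path_image_join closed_segment_subset)
  have sub': "closed_segment a c \<subseteq> C" using assms by (simp add: closed_segment_subset)
  have "homotopic_paths C (linepath a b +++ linepath b c) (linepath a c)"
  proof (rule homotopic_paths_linear)
    fix t :: real assume "t \<in> {0..1}"
    then have "(linepath a b +++ linepath b c) t \<in> C" "linepath a c t \<in> C"
      using sub sub' linepath_in_path by (metis imageI path_image_def subsetD)+
    then show "closed_segment ((linepath a b +++ linepath b c) t) (linepath a c t) \<subseteq> C"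
      using assms(1) by (rule closed_segment_subset)
  qed auto
  then have "homotopic_paths X ((\<lambda>c. \<kappa> (u, c)) \<circ> (linepath a b +++ linepath b c))
      ((\<lambda>c. \<kappa> (u, c)) \<circ> linepath a c)"
    by (rule homotopic_paths_continuous_image) (use assms in \<open>auto intro: continuous_on_flat\<close>)
  then show ?thesis by (simp add: seg_def path_compose_join)
qed

lemma convex_near: "convex {b. near a b d}"
proof -
  have "{b. near a b d} = {fst a - d..fst a + d} \<times> {snd a - d..snd a + d}"
    by (auto simp: near_def)
  then show ?thesis by (simp add: convex_Times)
qed

end

section \<open>The path group of a cell\<close>

lemma homotopic_paths_cancel_middle:
  assumes "path p" "path q" "path s" "path_image p \<subseteq> S" "path_image q \<subseteq> S" "path_image s \<subseteq> S"
    "pathfinish p = pathstart q" "pathstart s = pathstart q"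
  shows "homotopic_paths S ((p +++ q) +++ (reversepath q +++ s)) (p +++ s)"
proof -
  have "homotopic_paths S ((p +++ q) +++ (reversepath q +++ s)) (p +++ (q +++ (reversepath q +++ s)))"
    using assms by (intro homotopic_paths_sym[OF homotopic_paths_assoc])
      (auto simp: subset_path_image_join)
  also have "homotopic_paths S (p +++ (q +++ (reversepath q +++ s))) (p +++ ((q +++ reversepath q) +++ s))"
    using assms by (intro homotopic_paths_join homotopic_paths_assoc)
      (auto simp: subset_path_image_join)
  also have "homotopic_paths S (p +++ ((q +++ reversepath q) +++ s)) (p +++ ((\<lambda>_. pathstart q) +++ s))"
    using assms by (intro homotopic_paths_join homotopic_paths_right_inverse) auto
  also have "homotopic_paths S (p +++ ((\<lambda>_. pathstart q) +++ s)) (p +++ s)"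
    using assms by (intro homotopic_paths_join homotopic_paths_left_unit)
      (auto simp: pathstart_def joinpaths_def)
  finally show ?thesis .
qed

lemma homotopic_paths_cancel_right:
  assumes "path p" "path q" "path r" "path_image p \<subseteq> S" "path_image q \<subseteq> S" "path_image r \<subseteq> S"
    "pathfinish p = pathstart q" "pathfinish q = pathstart r"
  shows "homotopic_paths S ((p +++ (q +++ r)) +++ reversepath r) (p +++ q)"
proof -
  have "homotopic_paths S ((p +++ (q +++ r)) +++ reversepath r) (((p +++ q) +++ r) +++ reversepath r)"
    using assms by (intro homotopic_paths_join homotopic_paths_assoc) (auto simp: subset_path_image_join)
  also have "homotopic_paths S (((p +++ q) +++ r) +++ reversepath r) ((p +++ q) +++ (r +++ reversepath r))"
    using assms by (intro homotopic_paths_sym[OF homotopic_paths_assoc])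
      (auto simp: subset_path_image_join)
  also have "homotopic_paths S ((p +++ q) +++ (r +++ reversepath r)) ((p +++ q) +++ (\<lambda>_. pathstart r))"
    using assms by (intro homotopic_paths_join homotopic_paths_right_inverse)
      (auto simp: subset_path_image_join)
  also have "homotopic_paths S ((p +++ q) +++ (\<lambda>_. pathstart r)) (p +++ q)"
    using assms by (intro homotopic_paths_right_unit) (auto simp: subset_path_image_join)
  finally show ?thesis .
qed

context valued_ring
begin

text \<open>The parts, near \<open>x\<close>, of the flats that come near \<open>x\<close>. The factor \<open>2\<close> leaves room for the points
of the plane that are used below to realise the relations between the root subgroups.\<close>

definition cell :: "'r point \<Rightarrow> real \<Rightarrow> ('r point \<Rightarrow> real) set" where
  "cell x \<rho> = {\<kappa> (fst x + w, b) |w b. w \<in> grp (snd x) \<rho> \<and> near (snd x) b (2 * \<rho>)}"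

lemma cellI: "w \<in> grp (snd x) \<rho> \<Longrightarrow> near (snd x) b (2 * \<rho>) \<Longrightarrow> \<kappa> (fst x + w, b) \<in> cell x \<rho>"
  unfolding cell_def by blast

lemma cell0I: "w \<in> grp a \<rho> \<Longrightarrow> near a b (2 * \<rho>) \<Longrightarrow> \<kappa> (w, b) \<in> cell (0, a) \<rho>"
  using cellI[of w "(0,a)" \<rho> b] by simp

lemma path_image_seg_cell:
  assumes "w \<in> grp (snd x) \<rho>" "near (snd x) b (2 * \<rho>)" "near (snd x) b' (2 * \<rho>)"
  shows "path_image (seg (fst x + w) b b') \<subseteq> cell x \<rho>"
proof -
  have "closed_segment b b' \<subseteq> {b. near (snd x) b (2 * \<rho>)}"
    using assms by (intro closed_segment_subset convex_near) auto
  then show ?thesis unfolding path_image_seg using cellI[OF assms(1)] by blast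
qed

lemma path_image_seg_cell0:
  assumes "w \<in> grp a \<rho>" "near a b (2 * \<rho>)" "near a b' (2 * \<rho>)"
  shows "path_image (seg w b b') \<subseteq> cell (0, a) \<rho>"
  using path_image_seg_cell[of w "(0,a)"] assms by simp

lemma seg_join_cell:
  assumes "w \<in> grp (snd x) \<rho>" "near (snd x) b (2 * \<rho>)" "near (snd x) b' (2 * \<rho>)" "near (snd x) b'' (2 * \<rho>)"
  shows "homotopic_paths (cell x \<rho>) (seg (fst x + w) b b' +++ seg (fst x + w) b' b'') (seg (fst x + w) b b'')"
  by (rule seg_join[OF convex_near[of "snd x" "2 * \<rho>"]]) (use assms cellI in auto)

lemma seg_join_cell0:
  assumes "w \<in> grp a \<rho>" "near a b (2 * \<rho>)" "near a b' (2 * \<rho>)" "near a b'' (2 * \<rho>)"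
  shows "homotopic_paths (cell (0,a) \<rho>) (seg w b b' +++ seg w b' b'') (seg w b b'')"
  using seg_join_cell[of w "(0,a)"] assms by simp

lemma \<kappa>_switch: "v \<in> grp b 0 \<Longrightarrow> \<kappa> (u + v, b) = \<kappa> (u, b)"
  by (simp add: \<kappa>_eq_iff clos_0_iff[of u b] clos_sym[of _ "(u + v, b)"] add.assoc[symmetric])

lemma \<kappa>_switch0: "v \<in> grp b 0 \<Longrightarrow> \<kappa> (v, b) = \<kappa> (0, b)"
  using \<kappa>_switch[of v b 0] by simp

text \<open>Two flats intersect in a convex set, because the conditions on the heights are linear.\<close>

lemma grp_segment:
  assumes "v \<in> grp b 0" "v \<in> grp b' 0" "c \<in> closed_segment b b'"
  shows "v \<in> grp c 0"
proof -
  obtain s where s: "0 \<le> s" "s \<le> 1" "c = (1 - s) *\<^sub>R b + s *\<^sub>R b'"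
    using assms(3) by (auto simp: in_segment)
  have c: "fst c = (1 - s) * fst b + s * fst b'" "snd c = (1 - s) * snd b + s * snd b'"
    using s by auto
  have conv: "min x y \<le> (1 - s) * x + s * y" for x y
    using convex_bound_le[of "- x" "- min x y" "- y" "1 - s" s] s by auto
  have B: "z \<in> B ((1 - s) * x + s * y)" if "z \<in> B x" "z \<in> B y" for z x y
    using conv[of x y] that B_mono by (metis min_def)
  have e: "- ((1 - s) * x + s * y) = (1 - s) * (- x) + s * (- y)"
    "((1 - s) * x + s * y) - ((1 - s) * x' + s * y') = (1 - s) * (x - x') + s * (y - y')"
    for x y x' y' :: real
    by (simp_all add: algebra_simps)
  have Bm: "z \<in> B (- ((1 - s) * x) - s * y)" if "z \<in> B (- x)" "z \<in> B (- y)" for z x y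
    using B[OF that] by (simp add: algebra_simps)
  show ?thesis using assms(1,2) unfolding grp_def uni_in_def c e by (auto intro!: B Bm)
qed

end

text \<open>Paths in a cell that lead from its centre to a translate of the centre by an element of \<open>W\<close> form a group
\<open>H\<close> up to homotopy: translate the second path to the end of the first one. It is an extension of \<open>W\<close> by the
fundamental group of the cell. A splitting over \<open>W\<close> will give a preferred homotopy class for every
end.\<close>

locale cell_group = valued_ring B for B :: "real \<Rightarrow> 'r::comm_ring_1 set" +
  fixes a :: "real \<times> real" and \<rho> :: real
  assumes rho: "0 \<le> \<rho>"
begin

abbreviation "X \<equiv> cell (0, a) \<rho>"
abbreviation "W \<equiv> grp a \<rho>"

definition PG :: "'r uni \<Rightarrow> (real \<Rightarrow> 'r point \<Rightarrow> real) set" where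
  "PG w = {g. path g \<and> path_image g \<subseteq> X \<and> pathstart g = \<kappa> (0, a) \<and> pathfinish g = \<kappa> (w, a)}"

definition cls :: "(real \<Rightarrow> 'r point \<Rightarrow> real) \<Rightarrow> (real \<Rightarrow> 'r point \<Rightarrow> real) set" where
  "cls g = {g'. homotopic_paths X g g'}"

definition H where
  "H = \<lparr>carrier = {(w, cls g) |w g. w \<in> W \<and> g \<in> PG w},
        mult = (\<lambda>(w, C) (w', C'). (w + w', cls ((SOME g. g \<in> C) +++ (tr w \<circ> (SOME g. g \<in> C'))))),
        one = (0, cls (\<lambda>_. \<kappa> (0, a)))\<rparr>"

lemma near_a: "near a a (2 * \<rho>)" using rho by (simp add: near_def)

lemma cls_eq_iff: "path g \<Longrightarrow> path_image g \<subseteq> X \<Longrightarrow> cls g = cls g' \<longleftrightarrow> homotopic_paths X g g'"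
  unfolding cls_def using homotopic_paths_sym homotopic_paths_trans homotopic_paths_refl by blast

lemma cls_eqI: "homotopic_paths X g g' \<Longrightarrow> cls g = cls g'"
  unfolding cls_def using homotopic_paths_sym homotopic_paths_trans by blast

lemma some_cls: "path g \<Longrightarrow> path_image g \<subseteq> X \<Longrightarrow> homotopic_paths X g (SOME g'. g' \<in> cls g)"
  using someI[of "homotopic_paths X g" g] by (simp add: cls_def)

lemma tr_X: "w \<in> W \<Longrightarrow> tr w ` X \<subseteq> X"
proof clarify
  fix f assume w: "w \<in> W" and "f \<in> X"
  then obtain v b where f: "f = \<kappa> (v, b)" and v: "v \<in> W" and b: "near a b (2 * \<rho>)"
    unfolding cell_def by auto
  show "tr w f \<in> X" using cell0I[OF grp_add[OF w v] b] by (simp add: f tr_\<kappa> act_def)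
qed

lemma tr_homotopic: "w \<in> W \<Longrightarrow> homotopic_paths X g g' \<Longrightarrow> homotopic_paths X (tr w \<circ> g) (tr w \<circ> g')"
  by (rule homotopic_paths_continuous_image) (use tr_X continuous_on_tr in auto)

lemma PG_D: "g \<in> PG w \<Longrightarrow> path g" "g \<in> PG w \<Longrightarrow> path_image g \<subseteq> X"
  "g \<in> PG w \<Longrightarrow> pathstart g = \<kappa> (0, a)" "g \<in> PG w \<Longrightarrow> pathfinish g = \<kappa> (w, a)"
  by (auto simp: PG_def)

lemma tr_PG: 
  assumes "w \<in> W" "g \<in> PG w'"
  shows "path (tr w \<circ> g)" "path_image (tr w \<circ> g) \<subseteq> X"
    "pathstart (tr w \<circ> g) = \<kappa> (w, a)" "pathfinish (tr w \<circ> g) = \<kappa> (w + w', a)"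
proof -
  show "path (tr w \<circ> g)" using PG_D[OF assms(2)] by (intro path_continuous_image continuous_on_tr)
  show "path_image (tr w \<circ> g) \<subseteq> X" 
    using PG_D[OF assms(2)] tr_X[OF assms(1)] by (auto simp: path_image_compose)
  show "pathstart (tr w \<circ> g) = \<kappa> (w, a)" "pathfinish (tr w \<circ> g) = \<kappa> (w + w', a)"
    using PG_D[OF assms(2)] by (simp_all add: pathstart_compose pathfinish_compose tr_\<kappa> act_def)
qed

lemma join_PG:
  assumes "w \<in> W" "g \<in> PG w" "g' \<in> PG w'"
  shows "g +++ (tr w \<circ> g') \<in> PG (w + w')"
proof -
  note 1 = tr_PG[OF assms(1,3)] and 2 = PG_D[OF assms(2)]
  have "path (g +++ (tr w \<circ> g'))" using 1(1,3) 2(1,4) by (intro path_join_imp) simp_all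
  moreover have "path_image (g +++ (tr w \<circ> g')) \<subseteq> X" using 1(2) 2(2) by (rule subset_path_image_join[rotated])
  ultimately show ?thesis
    unfolding PG_def using 1(4) 2(3) by (simp only: mem_Collect_eq pathstart_join pathfinish_join)
qed

lemma mult_cls:
  assumes "w \<in> W" "g \<in> PG w" "g' \<in> PG w'"
  shows "(w, cls g) \<otimes>\<^bsub>H\<^esub> (w', cls g') = (w + w', cls (g +++ (tr w \<circ> g')))"
proof -
  let ?s = "SOME k. k \<in> cls g" and ?s' = "SOME k. k \<in> cls g'"
  have "homotopic_paths X (g +++ (tr w \<circ> g')) (?s +++ (tr w \<circ> ?s'))"
    by (intro homotopic_paths_join some_cls tr_homotopic assms PG_D[OF assms(2)] PG_D[OF assms(3)])
      (simp only: tr_PG[OF assms(1,3)] PG_D[OF assms(2)])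
  from cls_eqI[OF this] show ?thesis by (simp add: H_def)
qed

lemma const_PG: "(\<lambda>_. \<kappa> (0, a)) \<in> PG 0"
  using cell0I[OF grp_0 near_a] by (auto simp: PG_def path_def path_image_def pathstart_def pathfinish_def)

lemma one_H: "\<one>\<^bsub>H\<^esub> = (0, cls (\<lambda>_. \<kappa> (0, a)))" by (simp add: H_def)

lemma H_elim:
  assumes "x \<in> carrier H"
  obtains w g where "x = (w, cls g)" "w \<in> W" "g \<in> PG w"
  using assms by (auto simp: H_def)

lemma H_I: "w \<in> W \<Longrightarrow> g \<in> PG w \<Longrightarrow> (w, cls g) \<in> carrier H"
  by (auto simp: H_def)

sublocale group H
proof (rule groupI)
  fix x y assume "x \<in> carrier H" "y \<in> carrier H"
  then show "x \<otimes>\<^bsub>H\<^esub> y \<in> carrier H"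
    by (elim H_elim) (simp add: mult_cls H_I grp_add join_PG)
next
  show "\<one>\<^bsub>H\<^esub> \<in> carrier H" unfolding one_H by (intro H_I grp_0 const_PG)
next
  fix x y z assume xyz: "x \<in> carrier H" "y \<in> carrier H" "z \<in> carrier H"
  obtain w g where x: "x = (w, cls g)" "w \<in> W" "g \<in> PG w" using H_elim[OF xyz(1)] .
  obtain w' g' where y: "y = (w', cls g')" "w' \<in> W" "g' \<in> PG w'" using H_elim[OF xyz(2)] .
  obtain w'' g'' where z: "z = (w'', cls g'')" "w'' \<in> W" "g'' \<in> PG w''" using H_elim[OF xyz(3)] .
  have eq: "tr w \<circ> (g' +++ (tr w' \<circ> g'')) = (tr w \<circ> g') +++ (tr (w + w') \<circ> g'')"
    by (simp add: joinpaths_def fun_eq_iff tr_tr)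
  have "homotopic_paths X (g +++ ((tr w \<circ> g') +++ (tr (w + w') \<circ> g''))) 
    ((g +++ (tr w \<circ> g')) +++ (tr (w + w') \<circ> g''))"
    by (intro homotopic_paths_assoc)
      (simp_all only: tr_PG[OF x(2) y(3)] tr_PG[OF grp_add[OF x(2) y(2)] z(3)] PG_D[OF x(3)])
  then show "x \<otimes>\<^bsub>H\<^esub> y \<otimes>\<^bsub>H\<^esub> z = x \<otimes>\<^bsub>H\<^esub> (y \<otimes>\<^bsub>H\<^esub> z)"
    using x y z by (simp add: mult_cls grp_add join_PG eq add.assoc[symmetric] cls_eqI)
next
  fix x assume "x \<in> carrier H"
  then obtain w g where x: "x = (w, cls g)" "w \<in> W" "g \<in> PG w" using H_elim by blast
  have t0: "tr 0 \<circ> g = g" by (simp add: o_def)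
  have "homotopic_paths X ((\<lambda>_. \<kappa> (0, a)) +++ g) g"
    using PG_D[OF x(3)] by (intro homotopic_paths_left_unit)
  then show "\<one>\<^bsub>H\<^esub> \<otimes>\<^bsub>H\<^esub> x = x"
    using x by (simp add: one_H mult_cls grp_0 const_PG t0 cls_eqI)
  let ?g = "tr (- w) \<circ> reversepath g"
  have w: "- w \<in> W" using x grp_uminus by auto
  have "path (tr (- w) \<circ> g)" "path_image (tr (- w) \<circ> g) \<subseteq> X" using tr_PG[OF w x(3)] by auto
  moreover have r: "reversepath (tr (- w) \<circ> g) = ?g" by (simp add: reversepath_def o_def)
  ultimately have p: "?g \<in> PG (- w)"
    using tr_PG[OF w x(3)] unfolding PG_def r[symmetric] by simp
  have "tr (- w) \<circ> (reversepath g +++ g) = ?g +++ (tr (- w) \<circ> g)"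
    by (simp add: path_compose_join)
  moreover have "homotopic_paths X (reversepath g +++ g) (\<lambda>_. \<kappa> (w, a))"
    using PG_D[OF x(3)] by (intro homotopic_paths_left_inverse)
  ultimately have "homotopic_paths X (?g +++ (tr (- w) \<circ> g)) (tr (- w) \<circ> (\<lambda>_. \<kappa> (w, a)))"
    using tr_homotopic[OF w] by metis
  then have "homotopic_paths X (?g +++ (tr (- w) \<circ> g)) (\<lambda>_. \<kappa> (0, a))"
    by (simp add: o_def tr_\<kappa> act_def)
  then have "(- w, cls ?g) \<otimes>\<^bsub>H\<^esub> x = \<one>\<^bsub>H\<^esub>"
    using x w p by (simp add: mult_cls one_H cls_eqI)
  then show "\<exists>y\<in>carrier H. y \<otimes>\<^bsub>H\<^esub> x = \<one>\<^bsub>H\<^esub>" using H_I[OF w p] by blast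
qed

text \<open>If \<open>v\<close> fixes the point \<open>b\<close> of the plane, the flats of \<open>0\<close> and \<open>v\<close> meet over \<open>b\<close>. The path goes to \<open>b\<close> in the first flat and returns in
the second one.\<close>

definition \<phi> :: "real \<times> real \<Rightarrow> 'r uni \<Rightarrow> 'r uni \<times> (real \<Rightarrow> 'r point \<Rightarrow> real) set" where
  "\<phi> b v = (v, cls (seg 0 a b +++ seg v b a))"

definition stab :: "real \<times> real \<Rightarrow> 'r uni set" where "stab b = {v \<in> W. v \<in> grp b 0}"

lemma \<phi>_PG:
  assumes "near a b (2 * \<rho>)" "v \<in> stab b"
  shows "seg 0 a b +++ seg v b a \<in> PG v"
  using assms near_a \<kappa>_switch0[of v b]
  by (simp add: PG_def stab_def grp_0 subset_path_image_join path_image_seg_cell0)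

lemma \<phi>_carrier: "near a b (2 * \<rho>) \<Longrightarrow> v \<in> stab b \<Longrightarrow> \<phi> b v \<in> carrier H"
  unfolding \<phi>_def by (rule H_I[OF _ \<phi>_PG]) (auto simp: stab_def)

lemma \<phi>_hom:
  assumes b: "near a b (2 * \<rho>)" and v: "v \<in> stab b" and v': "v' \<in> stab b"
  shows "\<phi> b v \<otimes>\<^bsub>H\<^esub> \<phi> b v' = \<phi> b (v + v')"
proof -
  have vv: "v \<in> W" "v' \<in> W" "v + v' \<in> W" "v \<in> grp b 0" "v + v' \<in> grp b 0"
    using v v' grp_add by (auto simp: stab_def)
  have "homotopic_paths X ((seg 0 a b +++ seg v b a) +++ (reversepath (seg v b a) +++ seg (v + v') b a))
     (seg 0 a b +++ seg (v + v') b a)"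
    using vv b near_a grp_0 \<kappa>_switch0[OF vv(4)] \<kappa>_switch0[OF vv(5)]
    by (intro homotopic_paths_cancel_middle) (simp_all add: path_image_seg_cell0)
  then show ?thesis
    using mult_cls[OF vv(1) \<phi>_PG[OF b v] \<phi>_PG[OF b v']] unfolding \<phi>_def
    by (simp add: path_compose_join tr_seg reversepath_seg cls_eqI)
qed

text \<open>Over the segment from \<open>b\<close> to \<open>b'\<close> the two flats coincide, so the detour is contractible.\<close>

lemma \<phi>_indep:
  assumes b: "near a b (2 * \<rho>)" "near a b' (2 * \<rho>)" and v: "v \<in> stab b" "v \<in> stab b'"
  shows "\<phi> b v = \<phi> b' v"
proof -
  have vv: "v \<in> W" "v \<in> grp b 0" "v \<in> grp b' 0" using v by (auto simp: stab_def)
  note im = path_image_seg_cell0 grp_0 near_a b vv(1)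
  have eq: "\<kappa> (0, c) = \<kappa> (v, c)" if "c \<in> closed_segment b' b" for c
    using \<kappa>_switch0[OF grp_segment[OF vv(3,2) that]] by simp
  have sg: "homotopic_paths X (seg 0 b' b) (seg v b' b)"
  proof (intro homotopic_paths_eq)
    show "seg 0 b' b t = seg v b' b t" if "t \<in> {0..1}" for t
      using eq[OF linepath_in_path[OF that]] by (simp add: seg_def)
  qed (simp_all add: im)
  have "homotopic_paths X (seg 0 a b +++ seg v b a)
     ((seg 0 a b' +++ seg v b' b) +++ (reversepath (seg v b' b) +++ seg v b' a))"
  proof (rule homotopic_paths_join)
    have "homotopic_paths X (seg 0 a b) (seg 0 a b' +++ seg 0 b' b)"
      by (rule homotopic_paths_sym[OF seg_join_cell0]) (simp_all add: im)
    also have "homotopic_paths X (seg 0 a b' +++ seg 0 b' b) (seg 0 a b' +++ seg v b' b)"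
      by (intro homotopic_paths_join sg) (simp_all add: im)
    finally show "homotopic_paths X (seg 0 a b) (seg 0 a b' +++ seg v b' b)" .
    show "homotopic_paths X (seg v b a) (reversepath (seg v b' b) +++ seg v b' a)"
      unfolding reversepath_seg by (rule homotopic_paths_sym[OF seg_join_cell0]) (simp_all add: im)
  qed (use \<kappa>_switch0[OF vv(2)] in simp)
  also have "homotopic_paths X ((seg 0 a b' +++ seg v b' b) +++ (reversepath (seg v b' b) +++ seg v b' a))
     (seg 0 a b' +++ seg v b' a)"
    using \<kappa>_switch0[OF vv(3)] by (intro homotopic_paths_cancel_middle) (simp_all add: im)
  finally show ?thesis by (simp add: \<phi>_def cls_eqI)
qed

lemma letters_grp:
  assumes "u \<in> grp b \<sigma>"
  shows "el12 (e12 u) \<in> grp b \<sigma>" "el23 (e23 u) \<in> grp b \<sigma>" "el34 (e34 u) \<in> grp b \<sigma>"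
    "el13 (e13 u) \<in> grp b \<sigma>" "el24 (e24 u - e23 u * e34 u) \<in> grp b \<sigma>"
    "el14 (e14 u - e13 u * e34 u) \<in> grp b \<sigma>"
  using assms unfolding grp_def uni_in_def
  by (auto simp: B_0 intro!: B_diff elim: B_mult')

lemma letter_iff [simp]:
  "el12 s \<in> grp b \<sigma> \<longleftrightarrow> s \<in> B (- fst b + \<sigma>)" "el23 s \<in> grp b \<sigma> \<longleftrightarrow> s \<in> B (fst b - snd b + \<sigma>)"
  "el34 s \<in> grp b \<sigma> \<longleftrightarrow> s \<in> B (snd b + \<sigma>)" "el13 s \<in> grp b \<sigma> \<longleftrightarrow> s \<in> B (- snd b + 2 * \<sigma>)"
  "el24 s \<in> grp b \<sigma> \<longleftrightarrow> s \<in> B (fst b + 2 * \<sigma>)" "el14 s \<in> grp b \<sigma> \<longleftrightarrow> s \<in> B (3 * \<sigma>)"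
  by (auto simp: grp_def uni_in_def B_0)

text \<open>Four points at which the stabilisers contain several full root subgroups of \<open>W\<close>: the roots 12, 23, 13 at \<open>\<beta>1\<close>,
the roots 23, 34, 24 at \<open>\<beta>2\<close>, the roots 12, 34 at \<open>\<beta>3\<close> and the roots 23, 13, 24 at \<open>\<beta>4\<close>. Every pair of roots
for which the amalgam needs a relation occurs at one of them.\<close>

definition \<beta>1 where "\<beta>1 = (fst a - \<rho>, snd a - 2 * \<rho>)"
definition \<beta>2 where "\<beta>2 = (fst a + 2 * \<rho>, snd a + \<rho>)"
definition \<beta>3 where "\<beta>3 = (fst a - \<rho>, snd a + \<rho>)"
definition \<beta>4 where "\<beta>4 = (fst a + 2 * \<rho>, snd a - 2 * \<rho>)"
lemmas \<beta>_defs = \<beta>1_def \<beta>2_def \<beta>3_def \<beta>4_def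

lemma near_\<beta>: "near a \<beta>1 (2 * \<rho>)" "near a \<beta>2 (2 * \<rho>)" "near a \<beta>3 (2 * \<rho>)" "near a \<beta>4 (2 * \<rho>)"
  using rho by (simp_all add: near_def \<beta>_defs)

abbreviation "T12 \<equiv> B (- fst a + \<rho>)"
abbreviation "T23 \<equiv> B (fst a - snd a + \<rho>)"
abbreviation "T34 \<equiv> B (snd a + \<rho>)"
abbreviation "T13 \<equiv> B (- snd a + 2 * \<rho>)"
abbreviation "T24 \<equiv> B (fst a + 2 * \<rho>)"
abbreviation "T14 \<equiv> B (3 * \<rho>)"

lemma stab_letters:
  "s \<in> T12 \<Longrightarrow> el12 s \<in> stab \<beta>1" "s \<in> T12 \<Longrightarrow> el12 s \<in> stab \<beta>3"
  "s \<in> T23 \<Longrightarrow> el23 s \<in> stab \<beta>1" "s \<in> T23 \<Longrightarrow> el23 s \<in> stab \<beta>2" "s \<in> T23 \<Longrightarrow> el23 s \<in> stab \<beta>4"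
  "s \<in> T34 \<Longrightarrow> el34 s \<in> stab \<beta>2" "s \<in> T34 \<Longrightarrow> el34 s \<in> stab \<beta>3"
  "s \<in> T13 \<Longrightarrow> el13 s \<in> stab \<beta>1" "s \<in> T13 \<Longrightarrow> el13 s \<in> stab \<beta>4"
  "s \<in> T24 \<Longrightarrow> el24 s \<in> stab \<beta>2" "s \<in> T24 \<Longrightarrow> el24 s \<in> stab \<beta>4"
  using rho by (auto simp: stab_def \<beta>_defs algebra_simps elim!: B_mono)

lemma \<phi>_swap:
  "s \<in> T12 \<Longrightarrow> \<phi> \<beta>1 (el12 s) = \<phi> \<beta>3 (el12 s)" "s \<in> T23 \<Longrightarrow> \<phi> \<beta>1 (el23 s) = \<phi> \<beta>2 (el23 s)"
  "s \<in> T34 \<Longrightarrow> \<phi> \<beta>2 (el34 s) = \<phi> \<beta>3 (el34 s)" "s \<in> T13 \<Longrightarrow> \<phi> \<beta>1 (el13 s) = \<phi> \<beta>4 (el13 s)"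
  "s \<in> T24 \<Longrightarrow> \<phi> \<beta>2 (el24 s) = \<phi> \<beta>4 (el24 s)"
  by (intro \<phi>_indep near_\<beta> stab_letters; assumption)+

lemma \<phi>_word2:
  assumes "near a b (2 * \<rho>)" "u \<in> stab b" "v \<in> stab b" "u' \<in> stab b" "v' \<in> stab b" "u + v = u' + v'"
  shows "\<phi> b u \<otimes>\<^bsub>H\<^esub> \<phi> b v = \<phi> b u' \<otimes>\<^bsub>H\<^esub> \<phi> b v'"
  using assms by (simp add: \<phi>_hom)

lemma stab_add: "u \<in> stab b \<Longrightarrow> v \<in> stab b \<Longrightarrow> u + v \<in> stab b"
  by (auto simp: stab_def grp_add)

lemma \<phi>_word3:
  assumes "near a b (2 * \<rho>)" "u \<in> stab b" "v \<in> stab b" "u' \<in> stab b" "v' \<in> stab b" "w' \<in> stab b"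
    "u + v = u' + v' + w'"
  shows "\<phi> b u \<otimes>\<^bsub>H\<^esub> \<phi> b v = \<phi> b u' \<otimes>\<^bsub>H\<^esub> \<phi> b v' \<otimes>\<^bsub>H\<^esub> \<phi> b w'"
  using assms by (simp add: \<phi>_hom stab_add)

text \<open>The relations hold because each takes place in the stabiliser of one of the four points, where \<open>\<phi>\<close> is a
homomorphism; the amalgam then yields a splitting of \<open>H\<close> over \<open>W\<close>.\<close>

lemma letter_hom_ex:
  obtains \<psi> where "\<And>u. u \<in> W \<Longrightarrow> \<psi> u \<in> carrier H"
    "\<And>u v. u \<in> W \<Longrightarrow> v \<in> W \<Longrightarrow> \<psi> (u + v) = \<psi> u \<otimes>\<^bsub>H\<^esub> \<psi> v"
    "\<And>s. s \<in> T12 \<Longrightarrow> \<psi> (el12 s) = \<phi> \<beta>1 (el12 s)" "\<And>s. s \<in> T23 \<Longrightarrow> \<psi> (el23 s) = \<phi> \<beta>1 (el23 s)"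
    "\<And>s. s \<in> T34 \<Longrightarrow> \<psi> (el34 s) = \<phi> \<beta>2 (el34 s)" "\<And>s. s \<in> T13 \<Longrightarrow> \<psi> (el13 s) = \<phi> \<beta>1 (el13 s)"
    "\<And>s. s \<in> T24 \<Longrightarrow> \<psi> (el24 s) = \<phi> \<beta>2 (el24 s)"
proof -
  obtain r r' where r: "r \<in> T23" "r' \<in> B (- (fst a - snd a + \<rho>))" "r * r' = 1" using B_unit by blast
  obtain t t' where t: "t \<in> T34" "t' \<in> B (- (snd a + \<rho>))" "t * t' = 1" using B_unit by blast
  note st = stab_letters near_\<beta>
  interpret am: tame_amalgam H T12 T23 T34 T13 T24 T14 "\<lambda>s. \<phi> \<beta>1 (el12 s)" "\<lambda>s. \<phi> \<beta>1 (el23 s)"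
    "\<lambda>s. \<phi> \<beta>2 (el34 s)" "\<lambda>s. \<phi> \<beta>1 (el13 s)" "\<lambda>s. \<phi> \<beta>2 (el24 s)" r r' t t'
  proof unfold_locales
    fix x y
    show "x \<in> T12 \<Longrightarrow> y \<in> T12 \<Longrightarrow> \<phi> \<beta>1 (el12 x) \<otimes>\<^bsub>H\<^esub> \<phi> \<beta>1 (el12 y) = \<phi> \<beta>1 (el12 (x + y))"
      using \<phi>_hom[OF st(12) st(1) st(1)] by (simp add: plus_uni_def)
    show "x \<in> T23 \<Longrightarrow> y \<in> T23 \<Longrightarrow> \<phi> \<beta>1 (el23 x) \<otimes>\<^bsub>H\<^esub> \<phi> \<beta>1 (el23 y) = \<phi> \<beta>1 (el23 (x + y))"
      using \<phi>_hom[OF st(12) st(3) st(3)] by (simp add: plus_uni_def)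
    show "x \<in> T34 \<Longrightarrow> y \<in> T34 \<Longrightarrow> \<phi> \<beta>2 (el34 x) \<otimes>\<^bsub>H\<^esub> \<phi> \<beta>2 (el34 y) = \<phi> \<beta>2 (el34 (x + y))"
      using \<phi>_hom[OF st(13) st(6) st(6)] by (simp add: plus_uni_def)
    show "x \<in> T13 \<Longrightarrow> y \<in> T13 \<Longrightarrow> \<phi> \<beta>1 (el13 x) \<otimes>\<^bsub>H\<^esub> \<phi> \<beta>1 (el13 y) = \<phi> \<beta>1 (el13 (x + y))"
      using \<phi>_hom[OF st(12) st(8) st(8)] by (simp add: plus_uni_def)
    show "x \<in> T24 \<Longrightarrow> y \<in> T24 \<Longrightarrow> \<phi> \<beta>2 (el24 x) \<otimes>\<^bsub>H\<^esub> \<phi> \<beta>2 (el24 y) = \<phi> \<beta>2 (el24 (x + y))"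
      using \<phi>_hom[OF st(13) st(10) st(10)] by (simp add: plus_uni_def)
    show "\<phi> \<beta>2 (el34 y) \<otimes>\<^bsub>H\<^esub> \<phi> \<beta>1 (el12 x) = \<phi> \<beta>1 (el12 x) \<otimes>\<^bsub>H\<^esub> \<phi> \<beta>2 (el34 y)"
      if "x \<in> T12" "y \<in> T34"
      unfolding \<phi>_swap(1)[OF that(1)] \<phi>_swap(3)[OF that(2)] using that
      by (intro \<phi>_word2[OF st(14)] st) (simp_all add: plus_uni_def)
    show "\<phi> \<beta>1 (el12 x) \<otimes>\<^bsub>H\<^esub> \<phi> \<beta>1 (el13 y) = \<phi> \<beta>1 (el13 y) \<otimes>\<^bsub>H\<^esub> \<phi> \<beta>1 (el12 x)"
      if "x \<in> T12" "y \<in> T13"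
      using that by (intro \<phi>_word2[OF st(12)] st) (simp_all add: plus_uni_def)
    show "\<phi> \<beta>1 (el23 x) \<otimes>\<^bsub>H\<^esub> \<phi> \<beta>1 (el13 y) = \<phi> \<beta>1 (el13 y) \<otimes>\<^bsub>H\<^esub> \<phi> \<beta>1 (el23 x)"
      if "x \<in> T23" "y \<in> T13"
      using that by (intro \<phi>_word2[OF st(12)] st) (simp_all add: plus_uni_def)
    show "\<phi> \<beta>2 (el24 y) \<otimes>\<^bsub>H\<^esub> \<phi> \<beta>1 (el23 x) = \<phi> \<beta>1 (el23 x) \<otimes>\<^bsub>H\<^esub> \<phi> \<beta>2 (el24 y)"
      if "x \<in> T23" "y \<in> T24"
      unfolding \<phi>_swap(2)[OF that(1)] using that
      by (intro \<phi>_word2[OF st(13)] st) (simp_all add: plus_uni_def)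
    show "\<phi> \<beta>2 (el34 x) \<otimes>\<^bsub>H\<^esub> \<phi> \<beta>2 (el24 y) = \<phi> \<beta>2 (el24 y) \<otimes>\<^bsub>H\<^esub> \<phi> \<beta>2 (el34 x)"
      if "x \<in> T34" "y \<in> T24"
      using that by (intro \<phi>_word2[OF st(13)] st) (simp_all add: plus_uni_def)
    show "\<phi> \<beta>2 (el24 y) \<otimes>\<^bsub>H\<^esub> \<phi> \<beta>1 (el13 x) = \<phi> \<beta>1 (el13 x) \<otimes>\<^bsub>H\<^esub> \<phi> \<beta>2 (el24 y)"
      if "x \<in> T13" "y \<in> T24"
      unfolding \<phi>_swap(4)[OF that(1)] \<phi>_swap(5)[OF that(2)] using that
      by (intro \<phi>_word2[OF st(15)] st) (simp_all add: plus_uni_def)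
    show "\<phi> \<beta>1 (el12 x) \<otimes>\<^bsub>H\<^esub> \<phi> \<beta>1 (el23 y)
        = \<phi> \<beta>1 (el13 (x * y)) \<otimes>\<^bsub>H\<^esub> \<phi> \<beta>1 (el23 y) \<otimes>\<^bsub>H\<^esub> \<phi> \<beta>1 (el12 x)"
      if "x \<in> T12" "y \<in> T23"
      using that B_mult'[OF that] by (intro \<phi>_word3[OF st(12)] st) (simp_all add: plus_uni_def)
    show "\<phi> \<beta>1 (el23 x) \<otimes>\<^bsub>H\<^esub> \<phi> \<beta>2 (el34 y)
        = \<phi> \<beta>2 (el24 (x * y)) \<otimes>\<^bsub>H\<^esub> \<phi> \<beta>2 (el34 y) \<otimes>\<^bsub>H\<^esub> \<phi> \<beta>1 (el23 x)"
      if "x \<in> T23" "y \<in> T34"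
      unfolding \<phi>_swap(2)[OF that(1)]
      using that B_mult'[OF that] by (intro \<phi>_word3[OF st(13)] st) (simp_all add: plus_uni_def)
    show "x \<in> T13 \<Longrightarrow> x * r' \<in> T12" "x \<in> T14 \<Longrightarrow> x * t' \<in> T13" "x \<in> T24 \<Longrightarrow> x * t' \<in> T23"
      using r t by (auto elim: B_mult')
  qed (use r t st \<phi>_carrier add_closed_B in \<open>auto elim: B_mult'\<close>)
  show ?thesis
  proof (rule am.amalgam_hom, goal_cases)
    case (1 \<psi>)
    show ?case by (rule that[of \<psi>, unfolded grp_def]) (fact 1)+
  qed
qed

end

section \<open>Flat paths\<close>

context cell_group
begin

text \<open>A bundle of the properties of the splitting, so that one splitting can be chosen once and for all.\<close>

definition extends_letters where
  "extends_letters \<psi> \<longleftrightarrow> (\<forall>u\<in>W. \<psi> u \<in> carrier H) \<and> (\<forall>u\<in>W. \<forall>v\<in>W. \<psi> (u + v) = \<psi> u \<otimes>\<^bsub>H\<^esub> \<psi> v) \<and>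
    (\<forall>s\<in>T12. \<psi> (el12 s) = \<phi> \<beta>1 (el12 s)) \<and> (\<forall>s\<in>T23. \<psi> (el23 s) = \<phi> \<beta>1 (el23 s)) \<and>
    (\<forall>s\<in>T34. \<psi> (el34 s) = \<phi> \<beta>2 (el34 s)) \<and> (\<forall>s\<in>T13. \<psi> (el13 s) = \<phi> \<beta>1 (el13 s)) \<and>
    (\<forall>s\<in>T24. \<psi> (el24 s) = \<phi> \<beta>2 (el24 s))"

definition \<psi> where "\<psi> = (SOME \<psi>. extends_letters \<psi>)"

lemma extends_letters_\<psi>: "extends_letters \<psi>"
proof -
  obtain f where "extends_letters f"
  proof (rule letter_hom_ex, goal_cases)
    case (1 f)
    from 1(2-) have "extends_letters f" unfolding extends_letters_def by blast
    then show ?case by (rule 1(1))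
  qed
  then show ?thesis unfolding \<psi>_def by (rule someI[of extends_letters])
qed

lemmas \<psi>_props = extends_letters_\<psi>[unfolded extends_letters_def]

lemma \<psi>_carrier: "u \<in> W \<Longrightarrow> \<psi> u \<in> carrier H" using \<psi>_props by blast
lemma \<psi>_add: "u \<in> W \<Longrightarrow> v \<in> W \<Longrightarrow> \<psi> (u + v) = \<psi> u \<otimes>\<^bsub>H\<^esub> \<psi> v" using \<psi>_props by blast

lemma \<psi>_zero: "\<psi> 0 = \<one>\<^bsub>H\<^esub>"
  using \<psi>_add[of 0 0] \<psi>_carrier[of 0] grp_0 by simp

text \<open>The splitting was prescribed only on root elements at two points of the plane. Any \<open>v\<close> that fixes \<open>b\<close> is a product of root
elements that fix \<open>b\<close>, on which the choice of the point does not matter.\<close>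

lemma \<psi>_stab:
  assumes b: "near a b (\<rho> / 2)" and v: "v \<in> grp b 0"
  shows "\<psi> v = \<phi> b v"
proof -
  have b2: "near a b (2 * \<rho>)" using b rho by (auto simp: near_def)
  have st: "w \<in> stab b" if "w \<in> grp b 0" for w
    using grp_near[OF that b] that by (simp add: stab_def)
  have W: "w \<in> W" if "w \<in> grp b 0" for w using st[OF that] by (simp add: stab_def)
  define P where "P w \<longleftrightarrow> w \<in> grp b 0 \<and> \<psi> w = \<phi> b w" for w
  have P_add: "P (u + w)" if "P u" "P w" for u w
    using that \<phi>_hom[OF b2 st st] by (simp add: P_def grp_add \<psi>_add W)
  have P12: "P (el12 s)" if "s \<in> B (- fst b)" for s
  proof -
    have 1: "el12 s \<in> grp b 0" "s \<in> T12" using that W[of "el12 s"] by auto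
    show ?thesis using \<psi>_props \<phi>_indep[OF near_\<beta>(1) b2 stab_letters(1)[OF 1(2)] st[OF 1(1)]] 1
      by (simp add: P_def)
  qed
  have P23: "P (el23 s)" if "s \<in> B (fst b - snd b)" for s
  proof -
    have 1: "el23 s \<in> grp b 0" "s \<in> T23" using that W[of "el23 s"] by auto
    show ?thesis using \<psi>_props \<phi>_indep[OF near_\<beta>(1) b2 stab_letters(3)[OF 1(2)] st[OF 1(1)]] 1
      by (simp add: P_def)
  qed
  have P34: "P (el34 s)" if "s \<in> B (snd b)" for s
  proof -
    have 1: "el34 s \<in> grp b 0" "s \<in> T34" using that W[of "el34 s"] by auto
    show ?thesis using \<psi>_props \<phi>_indep[OF near_\<beta>(2) b2 stab_letters(6)[OF 1(2)] st[OF 1(1)]] 1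
      by (simp add: P_def)
  qed
  have P13: "P (el13 s)" if "s \<in> B (- snd b)" for s
  proof -
    have 1: "el13 s \<in> grp b 0" "s \<in> T13" using that W[of "el13 s"] by auto
    show ?thesis using \<psi>_props \<phi>_indep[OF near_\<beta>(1) b2 stab_letters(8)[OF 1(2)] st[OF 1(1)]] 1
      by (simp add: P_def)
  qed
  have P24: "P (el24 s)" if "s \<in> B (fst b)" for s
  proof -
    have 1: "el24 s \<in> grp b 0" "s \<in> T24" using that W[of "el24 s"] by auto
    show ?thesis using \<psi>_props \<phi>_indep[OF near_\<beta>(2) b2 stab_letters(10)[OF 1(2)] st[OF 1(1)]] 1
      by (simp add: P_def)
  qed
  \<comment> \<open>A corner element of size \<open>0\<close> is the commutator of elements of the roots 13 and 34 that fix \<open>b\<close>.\<close>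
  have P14: "P (el14 z)" if z: "z \<in> B 0" for z
  proof -
    obtain t t' where t: "t \<in> B (snd b)" "t' \<in> B (- snd b)" "t * t' = 1" using B_unit by blast
    have s: "z * t' \<in> B (- snd b)" using B_mult[OF z t(2)] by simp
    have "el14 z = el14 (z * t' * t)" using t(3) by (metis mult.assoc mult.commute mult.right_neutral)
    also have "\<dots> = el13 (z * t') + el34 t + el13 (- (z * t')) + el34 (- t)"
      by (rule uni.expand) (simp add: algebra_simps)
    finally show ?thesis using P_add P13[OF s] P34[OF t(1)] P13[OF B_uminus[OF s]] P34[OF B_uminus[OF t(1)]]
      by simp
  qed
  have "P v"
    by (subst uni_decomp[of v], intro P_add P12 P23 P34 P13 P24 P14)
      (use letters_grp[OF v] in simp_all)
  then show ?thesis by (simp add: P_def)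
qed

end

context valued_ring
begin

text \<open>Paths that alternate between moving in a flat and passing to another flat at a common point, up to
homotopy in a cell. The second point records in which flat the path ends.\<close>

inductive flat_path :: "'r point \<Rightarrow> real \<Rightarrow> (real \<Rightarrow> 'r point \<Rightarrow> real) \<Rightarrow> 'r point \<Rightarrow> bool"
  for x :: "'r point" and r :: real where
  start: "flat_path x r (\<lambda>_. \<kappa> x) x"
| move: "flat_path x r g (u, b) \<Longrightarrow> near (snd x) b' r \<Longrightarrow> flat_path x r (g +++ seg u b b') (u, b')"
| switch: "flat_path x r g (u, b) \<Longrightarrow> v \<in> grp b 0 \<Longrightarrow> flat_path x r g (u + v, b)"
| homot: "flat_path x r g y \<Longrightarrow> homotopic_paths (cell x (2 * r)) g g' \<Longrightarrow> flat_path x r g' y"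

lemma path_image_seg_cell':
  assumes "- fst x + u \<in> grp (snd x) \<rho>" "near (snd x) b (2 * \<rho>)" "near (snd x) b' (2 * \<rho>)"
  shows "path_image (seg u b b') \<subseteq> cell x \<rho>"
  using path_image_seg_cell[OF assms] by (simp add: add.assoc[symmetric])

lemma near_mono: "near a b d \<Longrightarrow> d \<le> d' \<Longrightarrow> near a b d'" by (auto simp: near_def)

lemma self_in_cell: "0 \<le> \<rho> \<Longrightarrow> \<kappa> x \<in> cell x \<rho>"
  using cellI[of 0 x \<rho> "snd x"] by (simp add: grp_0 near_def)

lemma flat_path_facts:
  assumes "flat_path x r g y" "0 \<le> r"
  shows "near (snd x) (snd y) r \<and> - fst x + fst y \<in> grp (snd x) (2 * r) \<and> path g \<and>
    path_image g \<subseteq> cell x (2 * r) \<and> pathstart g = \<kappa> x \<and> pathfinish g = \<kappa> y"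
  using assms(1)
proof induction
  case start
  show ?case using assms(2) self_in_cell[of "2 * r" x]
    by (auto simp: near_def grp_0 path_def path_image_def pathstart_def pathfinish_def)
next
  case (move g u b b')
  then have *: "near (snd x) b (2 * (2 * r))" "near (snd x) b' (2 * (2 * r))" "- fst x + u \<in> grp (snd x) (2 * r)"
    using assms(2) by (auto elim!: near_mono)
  show ?case using move path_image_seg_cell'[OF *(3,1,2)] by (simp add: subset_path_image_join)
next
  case (switch g u b v)
  have "v \<in> grp (snd x) (2 * r)" using grp_near[OF switch(2), of "snd x" r] switch.IH by simp
  then show ?case using switch grp_add by (simp add: \<kappa>_switch add.assoc[symmetric])
next
  case (homot g y g')
  then show ?case
    using homotopic_paths_imp_path[OF homot(2)] homotopic_paths_imp_subset[OF homot(2)]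
      homotopic_paths_imp_pathstart[OF homot(2)] homotopic_paths_imp_pathfinish[OF homot(2)] by simp
qed

lemma tr_cell: 
  assumes "f \<in> cell (0, snd x) \<rho>"
  shows "tr (fst x) f \<in> cell x \<rho>"
proof -
  obtain w b where f: "f = \<kappa> (w, b)" and w: "w \<in> grp (snd x) \<rho>" and b: "near (snd x) b (2 * \<rho>)"
    using assms unfolding cell_def by auto
  show "tr (fst x) f \<in> cell x \<rho>" using cellI[OF w b] by (simp add: f tr_\<kappa> act_def)
qed

text \<open>A flat path is homotopic to the preferred path towards its last flat followed by a segment in this flat. The
preferred path depends on the end only, and this is why flat paths are determined by their
ends.\<close>

lemma flat_path_normal_form:
  assumes "flat_path x r g y" and r: "0 \<le> r"
  shows "\<exists>h \<in> cell_group.PG B (snd x) (2 * r) (- fst x + fst y).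
    cell_group.\<psi> B (snd x) (2 * r) (- fst x + fst y) = (- fst x + fst y, cell_group.cls B (snd x) (2 * r) h) \<and>
    homotopic_paths (cell x (2 * r)) g ((tr (fst x) \<circ> h) +++ seg (fst y) (snd x) (snd y))"
proof -
  interpret cell_group B "snd x" "2 * r" by unfold_locales (use r in simp)
  have trX: "homotopic_paths (cell x (2 * r)) (tr (fst x) \<circ> h) (tr (fst x) \<circ> h)" if "h \<in> PG w" for h w
    by (rule homotopic_paths_continuous_image[of X])
      (use PG_D[OF that] in \<open>auto intro: tr_cell continuous_on_tr\<close>)
  have trs: "pathstart (tr (fst x) \<circ> h) = \<kappa> x" "pathfinish (tr (fst x) \<circ> h) = \<kappa> (fst x + w, snd x)"
    if "h \<in> PG w" for h w
    using PG_D[OF that] by (simp_all add: pathstart_compose pathfinish_compose tr_\<kappa> act_def)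
  note nx = near_a
  from assms(1) show ?thesis
  proof induction
    case start
    have "(tr (fst x) \<circ> (\<lambda>_. \<kappa> (0, snd x))) +++ seg (fst x) (snd x) (snd x) = (\<lambda>_::real. \<kappa> x)"
      by (simp add: seg_const joinpaths_def o_def tr_\<kappa> act_def)
    then show ?case
      using \<psi>_zero one_H const_PG self_in_cell[of "2 * r" x] r
      by (intro bexI[of _ "\<lambda>_. \<kappa> (0, snd x)"]) (auto simp: path_def path_image_def)
  next
    case (move g u b b')
    from move.IH[unfolded fst_conv snd_conv] obtain h where h: "h \<in> PG (- fst x + u)" "\<psi> (- fst x + u) = (- fst x + u, cls h)"
      and hg: "homotopic_paths (cell x (2 * r)) g ((tr (fst x) \<circ> h) +++ seg u (snd x) b)"
      by blast
    from flat_path_facts[OF move(1) r] have f: "near (snd x) b r" "- fst x + u \<in> W" "pathfinish g = \<kappa> (u, b)" by auto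
    have nb: "near (snd x) b (2 * (2 * r))" "near (snd x) b' (2 * (2 * r))"
      using f(1) move(2) r by (auto elim!: near_mono)
    note im = path_image_seg_cell'[OF f(2)]
    have u: "fst x + (- fst x + u) = u" by (simp add: add.assoc[symmetric])
    have sj: "homotopic_paths (cell x (2 * r)) (seg u (snd x) b +++ seg u b b') (seg u (snd x) b')"
      using seg_join_cell[OF f(2) nx nb] by (simp only: u)
    have e: "pathfinish (tr (fst x) \<circ> h) = \<kappa> (u, snd x)" using trs[OF h(1)] u by simp
    have "homotopic_paths (cell x (2 * r)) (g +++ seg u b b')
        (((tr (fst x) \<circ> h) +++ seg u (snd x) b) +++ seg u b b')"
      using f(3) nb by (intro homotopic_paths_join hg) (simp_all add: im)
    also have "homotopic_paths (cell x (2 * r)) (((tr (fst x) \<circ> h) +++ seg u (snd x) b) +++ seg u b b')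
       ((tr (fst x) \<circ> h) +++ (seg u (snd x) b +++ seg u b b'))"
      using trX[OF h(1)] nb nx e
      by (intro homotopic_paths_sym[OF homotopic_paths_assoc]) (simp_all add: im)
    also have "homotopic_paths (cell x (2 * r)) ((tr (fst x) \<circ> h) +++ (seg u (snd x) b +++ seg u b b'))
       ((tr (fst x) \<circ> h) +++ seg u (snd x) b')"
      using e by (intro homotopic_paths_join trX[OF h(1)] sj) simp
    finally show ?case unfolding fst_conv snd_conv using h by blast
  next
    case (switch g u b v)
    from switch.IH[unfolded fst_conv snd_conv] obtain h where h: "h \<in> PG (- fst x + u)" "\<psi> (- fst x + u) = (- fst x + u, cls h)"
      and hg: "homotopic_paths (cell x (2 * r)) g ((tr (fst x) \<circ> h) +++ seg u (snd x) b)"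
      by blast
    from flat_path_facts[OF switch(1) r] have f: "near (snd x) b r" "- fst x + u \<in> W" by auto
    have nb: "near (snd x) b (2 * r / 2)" "near (snd x) b (2 * (2 * r))"
      using f(1) r by (auto elim!: near_mono)
    have v: "v \<in> W" using grp_near[OF switch(2) f(1)] by simp
    then have vs: "v \<in> stab b" using switch(2) by (simp add: stab_def)
    have uv: "- fst x + (u + v) = (- fst x + u) + v" by (simp add: add.assoc)
    let ?k = "seg 0 (snd x) b +++ seg v b (snd x)"
    have k: "?k \<in> PG v" by (rule \<phi>_PG[OF nb(2) vs])
    have "\<psi> ((- fst x + u) + v) = \<psi> (- fst x + u) \<otimes>\<^bsub>H\<^esub> \<phi> b v"
      using \<psi>_add[OF f(2) v] \<psi>_stab[OF nb(1) switch(2)] by simp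
    also have "\<dots> = ((- fst x + u) + v, cls (h +++ (tr (- fst x + u) \<circ> ?k)))"
      unfolding h(2) \<phi>_def by (rule mult_cls[OF f(2) h(1) k])
    finally have 1: "\<psi> (- fst x + (u + v)) = (- fst x + (u + v), cls (h +++ (tr (- fst x + u) \<circ> ?k)))"
      by (simp add: uv)
    have u: "fst x + (- fst x + u) = u" by (simp add: add.assoc[symmetric])
    have t: "tr (fst x) \<circ> (h +++ (tr (- fst x + u) \<circ> ?k)) =
       (tr (fst x) \<circ> h) +++ (seg u (snd x) b +++ seg (u + v) b (snd x))"
      by (simp add: path_compose_join tr_seg add.assoc[symmetric])
    have uvW: "- fst x + (u + v) \<in> W" unfolding uv by (rule grp_add[OF f(2) v])
    note im = path_image_seg_cell'[OF f(2)] path_image_seg_cell'[OF uvW]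
    have e: "pathfinish (tr (fst x) \<circ> h) = \<kappa> (u, snd x)" using trs[OF h(1)] u by simp
    have "homotopic_paths (cell x (2 * r)) 
        (((tr (fst x) \<circ> h) +++ (seg u (snd x) b +++ seg (u + v) b (snd x))) +++ reversepath (seg (u + v) b (snd x)))
        ((tr (fst x) \<circ> h) +++ seg u (snd x) b)"
      using trX[OF h(1)] nb nx e \<kappa>_switch[OF switch(2)]
      by (intro homotopic_paths_cancel_right) (simp_all add: im)
    then have "homotopic_paths (cell x (2 * r)) 
        ((tr (fst x) \<circ> (h +++ (tr (- fst x + u) \<circ> ?k))) +++ seg (u + v) (snd x) b)
        ((tr (fst x) \<circ> h) +++ seg u (snd x) b)"
      unfolding t reversepath_seg .
    moreover have "h +++ (tr (- fst x + u) \<circ> ?k) \<in> PG (- fst x + (u + v))"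
      using join_PG[OF f(2) h(1) k] by (simp only: uv)
    ultimately show ?case unfolding fst_conv snd_conv
      using 1 homotopic_paths_trans[OF hg homotopic_paths_sym] by blast
  next
    case (homot g y g')
    then show ?case using homotopic_paths_trans[OF homotopic_paths_sym[OF homot(2)]] by blast
  qed
qed

theorem flat_paths_homotopic:
  assumes g: "flat_path x r g y" and g': "flat_path x r g' y'" and r: "0 \<le> r" and y: "\<kappa> y = \<kappa> y'"
  shows "homotopic_paths (cell x (2 * r)) g g'"
proof -
  interpret cell_group B "snd x" "2 * r" by unfold_locales (use r in simp)
  have c: "clos 0 y y'" using y \<kappa>_eq_iff by blast
  then have sy: "snd y = snd y'" by (auto simp: clos_def near_def prod_eq_iff)
  have "- fst y + fst y' \<in> grp (snd y) 0"
    using c clos_0_iff[of "fst y" "snd y" "fst y'"] sy by (metis prod.collapse)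
  then have "flat_path x r g (fst y + (- fst y + fst y'), snd y)"
    using g by (intro flat_path.switch) simp_all
  then have "flat_path x r g y'" using sy by (simp add: add.assoc[symmetric])
  from flat_path_normal_form[OF this r] flat_path_normal_form[OF g' r]
  obtain h h' where h: "h \<in> PG (- fst x + fst y')" "h' \<in> PG (- fst x + fst y')" "cls h = cls h'"
    "homotopic_paths (cell x (2 * r)) g ((tr (fst x) \<circ> h) +++ seg (fst y') (snd x) (snd y'))"
    "homotopic_paths (cell x (2 * r)) g' ((tr (fst x) \<circ> h') +++ seg (fst y') (snd x) (snd y'))"
    by auto
  have "homotopic_paths X h h'" using h(3) cls_eq_iff PG_D[OF h(1)] by blast
  then have t: "homotopic_paths (cell x (2 * r)) (tr (fst x) \<circ> h) (tr (fst x) \<circ> h')"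
    by (rule homotopic_paths_continuous_image) (auto intro: tr_cell continuous_on_tr)
  have f: "near (snd x) (snd y') r" "- fst x + fst y' \<in> W" using flat_path_facts[OF g' r] by auto
  have nb: "near (snd x) (snd y') (2 * (2 * r))" using f(1) r by (auto elim!: near_mono)
  have e: "pathfinish (tr (fst x) \<circ> h) = \<kappa> (fst y', snd x)"
    using PG_D[OF h(1)] by (simp add: pathfinish_compose tr_\<kappa> act_def add.assoc[symmetric])
  have "homotopic_paths (cell x (2 * r)) ((tr (fst x) \<circ> h) +++ seg (fst y') (snd x) (snd y'))
     ((tr (fst x) \<circ> h') +++ seg (fst y') (snd x) (snd y'))"
    using e nb by (intro homotopic_paths_join t) (simp_all add: path_image_seg_cell'[OF f(2) near_a nb])
  then show ?thesis using h(4,5) homotopic_paths_sym homotopic_paths_trans by meson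
qed

lemma cell_mono:
  assumes d: "clos d x y" and "\<rho> + 2 * d \<le> \<sigma>" "2 * \<rho> + d \<le> 2 * \<sigma>" "2 * d \<le> \<sigma>"
  shows "cell y \<rho> \<subseteq> cell x \<sigma>"
proof
  fix f assume "f \<in> cell y \<rho>"
  then obtain w b where f: "f = \<kappa> (fst y + w, b)" and w: "w \<in> grp (snd y) \<rho>" and b: "near (snd y) b (2 * \<rho>)"
    unfolding cell_def by blast
  have n: "near (snd x) (snd y) d" using d by (simp add: clos_def)
  have mono: "u \<in> grp a q \<Longrightarrow> q \<le> q' \<Longrightarrow> u \<in> grp a q'" for u a q q'
    unfolding grp_def uni_in_def by (auto elim!: B_mono)
  have "- fst x + fst y \<in> grp (snd x) \<sigma>"
    using clos_imp_grp[of d "fst x" "snd x" "fst y" "snd y"] d assms(4) mono by (simp; blast)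
  moreover have "w \<in> grp (snd x) \<sigma>" using grp_near[OF w n] assms(2) mono by blast
  ultimately have "(- fst x + fst y) + w \<in> grp (snd x) \<sigma>" by (rule grp_add)
  moreover have "near (snd x) b (2 * \<sigma>)" using n b assms(3) by (auto simp: near_def)
  ultimately have "\<kappa> (fst x + ((- fst x + fst y) + w), b) \<in> cell x \<sigma>" by (rule cellI)
  then show "f \<in> cell x \<sigma>" by (simp add: f add.assoc[symmetric])
qed

lemma flat_path_mono:
  assumes "flat_path x r g y" "0 \<le> r" "r \<le> r'"
  shows "flat_path x r' g y"
  using assms(1)
proof induction
  case (homot g y g')
  have "cell x (2 * r) \<subseteq> cell x (2 * r')"
    using assms(2,3) by (intro cell_mono[where d = 0] clos_refl) auto
  then show ?case using homot flat_path.homot homotopic_paths_subset by blast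
qed (use assms(3) in \<open>auto intro: flat_path.intros elim: near_mono\<close>)

lemma flat_path_append:
  assumes g': "flat_path y r g' z" and g: "flat_path x R g y" and d: "clos d x y"
    and r: "0 \<le> r" "r + d \<le> R"
  shows "flat_path x R (g +++ g') z"
  using g'
proof induction
  have d0: "0 \<le> d" using d clos_nonneg by blast
  then have R: "0 \<le> R" using r by simp
  note G = flat_path_facts[OF g R]
  have sub: "cell y (2 * r) \<subseteq> cell x (2 * R)"
    using r d0 by (intro cell_mono[OF d]) auto
  have nr: "near (snd x) b R" if "near (snd y) b r" for b
    using that d r by (auto simp: clos_def near_def)
  {
    case start
    have "homotopic_paths (cell x (2 * R)) (g +++ (\<lambda>_. \<kappa> y)) g"
      using G by (intro homotopic_paths_right_unit) auto
    then show ?case using flat_path.homot[OF g] homotopic_paths_sym by blast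
  next
    case (move h u b b')
    note F = flat_path_facts[OF move(1) r(1)]
    have f: "- fst y + u \<in> grp (snd y) (2 * r)" "near (snd y) b (2 * (2 * r))" "near (snd y) b' (2 * (2 * r))"
      using F move(2) r(1) by (auto elim!: near_mono)
    have "homotopic_paths (cell x (2 * R)) ((g +++ h) +++ seg u b b') (g +++ (h +++ seg u b b'))"
      using F G sub path_image_seg_cell'[OF f]
      by (intro homotopic_paths_sym[OF homotopic_paths_assoc]) auto
    then show ?case using flat_path.move[OF move.IH nr[OF move(2)]] flat_path.homot by blast
  next
    case (switch h u b v)
    then show ?case by (intro flat_path.switch)
  next
    case (homot h w h')
    note F = flat_path_facts[OF homot(1) r(1)]
    have "homotopic_paths (cell x (2 * R)) (g +++ h) (g +++ h')"
      using homotopic_paths_subset[OF homot(2) sub] F G by (intro homotopic_paths_join) auto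
    then show ?case using flat_path.homot[OF homot.IH] by blast
  }
qed

lemma flat_path_letter:
  assumes "flat_path x r g (u, snd x)" "v \<in> grp b 0" "near (snd x) b r"
  shows "\<exists>g. flat_path x r g (u + v, snd x)"
proof -
  have "near (snd x) (snd x) r" using assms(3) near_nonneg by (simp add: near_def)
  then show ?thesis
    using flat_path.move[OF flat_path.switch[OF flat_path.move[OF assms(1,3)] assms(2)]] by blast
qed

text \<open>The displacement is a product of root elements. Each root element fixes one of the points \<open>\<beta>1\<close>, \<open>\<beta>2\<close>, where a path can
change flats.\<close>

lemma flat_path_exists:
  assumes d: "clos d x y"
  shows "\<exists>g. flat_path x (4 * d) g y"
proof -
  interpret cell_group B "snd x" "2 * d" by unfold_locales (use clos_nonneg[OF d] in simp)
  \<comment> \<open>Over the centre of the cell, every flat path can be continued into the flat displaced by \<open>v\<close>.\<close>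
  define R where "R v \<longleftrightarrow> (\<forall>g u. flat_path x (4 * d) g (u, snd x) \<longrightarrow> (\<exists>g. flat_path x (4 * d) g (u + v, snd x)))" for v
  have nb: "near (snd x) \<beta>1 (4 * d)" "near (snd x) \<beta>2 (4 * d)"
    using near_\<beta> by auto
  have R_add: "R (v + w)" if "R v" "R w" for v w
    using that unfolding R_def by (metis add.assoc)
  have RI: "R v" if "v \<in> stab \<beta>1 \<or> v \<in> stab \<beta>2" for v
    using that flat_path_letter[of x "4 * d" _ _ v] nb unfolding R_def stab_def by blast
  have w: "- fst x + fst y \<in> W"
    using clos_imp_grp[of d "fst x" "snd x" "fst y" "snd y"] d by simp
  have R14: "R (el14 z)" if z: "z \<in> T14" for z
  proof -
    obtain t t' where t: "t \<in> T34" "t' \<in> B (- (snd (snd x) + 2 * d))" "t * t' = 1" using B_unit by blast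
    have s: "z * t' \<in> T13" using z t by (auto elim: B_mult')
    have "el14 z = el14 (z * t' * t)" using t(3) by (metis mult.assoc mult.commute mult.right_neutral)
    also have "\<dots> = el13 (z * t') + el34 t + el13 (- (z * t')) + el34 (- t)"
      by (rule uni.expand) (simp add: algebra_simps)
    finally show ?thesis using R_add RI stab_letters s t(1) B_uminus by metis
  qed
  have L: "e12 (- fst x + fst y) \<in> T12" "e23 (- fst x + fst y) \<in> T23" "e34 (- fst x + fst y) \<in> T34"
    "e13 (- fst x + fst y) \<in> T13"
    "e24 (- fst x + fst y) - e23 (- fst x + fst y) * e34 (- fst x + fst y) \<in> T24"
    "e14 (- fst x + fst y) - e13 (- fst x + fst y) * e34 (- fst x + fst y) \<in> T14"
    using letters_grp[OF w] by (simp_all only: letter_iff)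
  have "R (- fst x + fst y)"
    by (subst uni_decomp[of "- fst x + fst y"], intro R_add R14 L RI)
      (use stab_letters L in blast)+
  moreover have "flat_path x (4 * d) (\<lambda>_. \<kappa> x) (fst x, snd x)" using flat_path.start[of x] by simp
  ultimately obtain g where "flat_path x (4 * d) g (fst x + (- fst x + fst y), snd x)"
    unfolding R_def by blast
  then have "flat_path x (4 * d) g (fst y, snd x)" by (simp add: add.assoc[symmetric])
  moreover have "near (snd x) (snd y) (4 * d)"
    using d clos_nonneg[OF d] by (auto simp: clos_def near_def)
  ultimately show ?thesis using flat_path.move by fastforce
qed

text \<open>One arc that serves for all bounds \<open>d\<close>; it exists because the least bound is attained.\<close>

definition flat_arc :: "'r point \<Rightarrow> 'r point \<Rightarrow> real \<Rightarrow> 'r point \<Rightarrow> real" where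
  "flat_arc x y = (SOME g. \<forall>d. clos d x y \<longrightarrow> flat_path x (4 * d) g y)"

lemma flat_path_flat_arc:
  assumes "clos d x y"
  shows "flat_path x (4 * d) (flat_arc x y) y"
proof -
  let ?D = "{d. clos d x y}"
  have b: "bdd_below ?D" using clos_nonneg by (intro bdd_belowI[of _ 0]) auto
  have c: "clos (Inf ?D) x y"
  proof (rule clos_closed)
    fix d' assume "Inf ?D < d'"
    then obtain d'' where "clos d'' x y" "d'' < d'" using assms cInf_lessD[of ?D d'] by blast
    then show "clos d' x y" by (auto intro: clos_mono)
  qed
  obtain g where g: "flat_path x (4 * Inf ?D) g y" using flat_path_exists[OF c] by blast
  have "\<forall>d. clos d x y \<longrightarrow> flat_path x (4 * d) g y"
    using flat_path_mono[OF g] clos_nonneg[OF c] cInf_lower[OF _ b] by simp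
  then have "\<forall>d. clos d x y \<longrightarrow> flat_path x (4 * d) (flat_arc x y) y"
    unfolding flat_arc_def by (rule someI[of "\<lambda>g. \<forall>d. clos d x y \<longrightarrow> flat_path x (4 * d) g y"])
  then show ?thesis using assms by blast
qed

lemma cell_subset: "0 \<le> \<rho> \<Longrightarrow> cell x \<rho> \<subseteq> \<kappa> ` {y. clos (5 * \<rho>) x y}"
proof
  fix f assume \<rho>: "0 \<le> \<rho>" and "f \<in> cell x \<rho>"
  then obtain w b where f: "f = \<kappa> (fst x + w, b)" and w: "w \<in> grp (snd x) \<rho>" and b: "near (snd x) b (2 * \<rho>)"
    unfolding cell_def by blast
  have "clos (3 * \<rho>) (fst x, snd x) (fst x + w, snd x)"
    by (rule grp_imp_clos) (use w \<rho> in \<open>simp_all add: add.assoc[symmetric]\<close>)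
  from clos_trans[OF this clos_flat[OF b]] have "clos (5 * \<rho>) x (fst x + w, b)" by simp
  then show "f \<in> \<kappa> ` {y. clos (5 * \<rho>) x y}" using f by blast
qed

text \<open>The homotopy has size proportional to the triangle. All later homotopies are assembled from this one.\<close>

theorem flat_arc_triangle:
  assumes xy: "clos d x y" and yz: "clos d y z" and xz: "clos d x z"
  shows "homotopic_paths (\<kappa> ` {w. clos (50 * d) x w}) (flat_arc x y +++ flat_arc y z) (flat_arc x z)"
proof -
  have d: "0 \<le> d" using clos_nonneg[OF xy] .
  \<comment> \<open>The second arc starts at distance \<open>d\<close> and adds \<open>4 * d\<close>; a cell of radius \<open>10 * d\<close> lies within distance \<open>50 * d\<close> of its centre.\<close>
  have "flat_path x (5 * d) (flat_arc x y) y" "flat_path x (5 * d) (flat_arc x z) z"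
    using flat_path_mono[OF flat_path_flat_arc[OF xy]] flat_path_mono[OF flat_path_flat_arc[OF xz]] d by auto
  then have "homotopic_paths (cell x (2 * (5 * d))) (flat_arc x y +++ flat_arc y z) (flat_arc x z)"
    using flat_path_append[OF flat_path_flat_arc[OF yz] _ xy, of "5 * d" "flat_arc x y"] d
    by (intro flat_paths_homotopic) auto
  then show ?thesis
    by (rule homotopic_paths_subset) (use cell_subset[of "10 * d" x] d in simp)
qed

end

section \<open>Every path is homotopic to a flat arc\<close>

lemma continuous_on_local:
  assumes "\<And>x. x \<in> S \<Longrightarrow> \<exists>U. open U \<and> x \<in> U \<and> continuous_on (S \<inter> U) f"
  shows "continuous_on S f"
  unfolding continuous_on_def
proof
  fix x assume x: "x \<in> S"
  then obtain U where U: "open U" "x \<in> U" "continuous_on (S \<inter> U) f" using assms by blast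
  have "at x within (S \<inter> U) = at x within S"
    using U by (intro at_within_nhd[of x U]) auto
  then show "(f \<longlongrightarrow> f x) (at x within S)"
    using U x unfolding continuous_on_def by (metis IntI)
qed

lemma tendsto_funI:
  fixes f :: "'a \<Rightarrow> 'b \<Rightarrow> 'c::topological_space"
  assumes "\<And>y. ((\<lambda>x. f x y) \<longlongrightarrow> l y) F"
  shows "(f \<longlongrightarrow> l) F"
proof -
  have "limitin (product_topology (\<lambda>_. euclidean) UNIV) f l F"
    using assms by (simp add: limitin_componentwise)
  then show ?thesis by (simp add: euclidean_product_topology)
qed

lemma homotopic_pathsE:
  assumes "homotopic_paths S p q"
  obtains h where "continuous_on ({0..1::real} \<times> {0..1::real}) h"
    "\<And>\<sigma> \<tau>. \<sigma> \<in> {0..1} \<Longrightarrow> \<tau> \<in> {0..1} \<Longrightarrow> h (\<sigma>, \<tau>) \<in> S"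
    "\<And>\<tau>. \<tau> \<in> {0..1} \<Longrightarrow> h (0, \<tau>) = p \<tau>" "\<And>\<tau>. \<tau> \<in> {0..1} \<Longrightarrow> h (1, \<tau>) = q \<tau>"
    "\<And>\<sigma>. \<sigma> \<in> {0..1} \<Longrightarrow> h (\<sigma>, 0) = pathstart p" "\<And>\<sigma>. \<sigma> \<in> {0..1} \<Longrightarrow> h (\<sigma>, 1) = pathfinish p"
proof -
  from assms obtain h where "continuous_on ({0..1::real} \<times> {0..1::real}) h" "h \<in> ({0..1} \<times> {0..1}) \<rightarrow> S"
    "\<forall>x\<in>{0..1}. h (0, x) = p x" "\<forall>x\<in>{0..1}. h (1, x) = q x"
    "\<forall>t\<in>{0..1}. pathstart (h \<circ> Pair t) = pathstart p \<and> pathfinish (h \<circ> Pair t) = pathfinish p"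
    unfolding homotopic_paths by blast
  then show ?thesis
    by (intro that[of h]) (auto simp: pathstart_def pathfinish_def o_def)
qed

text \<open>Homotopies on the unit square, placed side by side on the half strip.\<close>

definition stack :: "(nat \<Rightarrow> real \<times> real \<Rightarrow> 'a) \<Rightarrow> real \<times> real \<Rightarrow> 'a" where
  "stack h = (\<lambda>(x, \<tau>). h (nat \<lfloor>x\<rfloor>) (x - of_int \<lfloor>x\<rfloor>, \<tau>))"

lemma continuous_on_stack:
  fixes h :: "nat \<Rightarrow> real \<times> real \<Rightarrow> 'a::topological_space"
  assumes h: "\<And>k. continuous_on ({0..1} \<times> {0..1}) (h k)"
    and eq: "\<And>k \<tau>. \<tau> \<in> {0..1} \<Longrightarrow> h k (1, \<tau>) = h (Suc k) (0, \<tau>)"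
  shows "continuous_on ({0..} \<times> {0..1}) (stack h)"
proof -
  have piece: "stack h (x, \<tau>) = h n (x - n, \<tau>)" if "x \<in> {real n..real n + 1}" "\<tau> \<in> {0..1}" for n x \<tau>
  proof (cases "x = real n + 1")
    case True
    then have "\<lfloor>x\<rfloor> = int (Suc n)" by linarith
    then show ?thesis using eq[OF that(2), of n] True unfolding stack_def by (simp add: nat_add_distrib)
  next
    case False
    then have "\<lfloor>x\<rfloor> = int n" using that by (simp add: floor_eq_iff)
    then show ?thesis by (simp add: stack_def)
  qed
  have step: "continuous_on ({real n..real n + 1} \<times> {0..1}) (stack h)" for n
  proof -
    have "continuous_on ({real n..real n + 1} \<times> {0..1}) (\<lambda>p. h n (fst p - n, snd p))"
      by (rule continuous_on_compose2[OF h[of n]]) (auto intro!: continuous_intros)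
    then show ?thesis by (rule continuous_on_eq) (use piece in auto)
  qed
  have fin: "continuous_on ({0..real n} \<times> {0..1}) (stack h)" for n
  proof (induction n)
    case 0
    show ?case by (rule continuous_on_subset[OF step[of 0]]) auto
  next
    case (Suc n)
    have "{0..real (Suc n)} \<times> {0..1} = {0..real n} \<times> {0..1} \<union> {real n..real n + 1} \<times> {0..1::real}" by auto
    then show ?case using continuous_on_closed_Un[OF _ _ Suc step[of n]] by (simp add: closed_Times)
  qed
  show ?thesis
  proof (rule continuous_on_local)
    fix p :: "real \<times> real" assume "p \<in> {0..} \<times> {0..1}"
    obtain n where n: "fst p < real n" using reals_Archimedean2 by blast
    show "\<exists>U. open U \<and> p \<in> U \<and> continuous_on ({0..} \<times> {0..1} \<inter> U) (stack h)"
    proof (intro exI[of _ "{..<real n} \<times> UNIV"] conjI)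
      show "continuous_on ({0..} \<times> {0..1} \<inter> {..<real n} \<times> UNIV) (stack h)"
        by (rule continuous_on_subset[OF fin[of n]]) auto
    qed (use n in \<open>auto simp: open_Times mem_Times_iff\<close>)
  qed
qed

context valued_ring
begin

lemma tendsto_\<kappa>:
  assumes "\<And>e. 0 < e \<Longrightarrow> eventually (\<lambda>s. clos e x (f s)) F"
  shows "((\<lambda>s. \<kappa> (f s)) \<longlongrightarrow> \<kappa> x) F"
proof (rule tendsto_funI)
  fix y
  show "((\<lambda>s. \<kappa> (f s) y) \<longlongrightarrow> \<kappa> x y) F"
  proof (rule tendstoI)
    fix e :: real assume e: "0 < e"
    show "\<forall>\<^sub>F s' in F. dist (\<kappa> (f s') y) (\<kappa> x y) < e"
      using assms[OF half_gt_zero[OF e]]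
    proof eventually_elim
      case (elim s')
      have "\<bar>pd x y - pd (f s') y\<bar> \<le> e / 2" using pd_lipschitz pd_le[OF elim] order_trans by blast
      then show ?case using e by (simp add: \<kappa>_def dist_real_def abs_minus_commute)
    qed
  qed
qed

text \<open>Infinitely many homotopies are run on \<open>[0, 1)\<close> by the change of parameter \<open>\<sigma> / (1 - \<sigma>)\<close>. The bounds \<open>\<epsilon> k\<close> make the result
continuous at \<open>\<sigma> = 1\<close>, where the given path is inserted.\<close>

lemma homotopic_to_limit:
  fixes f :: "real \<Rightarrow> 'r point" and h :: "nat \<Rightarrow> real \<times> real \<Rightarrow> 'r point \<Rightarrow> real"
  assumes f: "continuous_on {0..1} (\<lambda>t. \<kappa> (f t))"
    and h: "\<And>k. continuous_on ({0..1} \<times> {0..1}) (h k)"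
    and eq: "\<And>k \<tau>. \<tau> \<in> {0..1} \<Longrightarrow> h k (1, \<tau>) = h (Suc k) (0, \<tau>)"
    and ends: "\<And>k \<sigma>. \<sigma> \<in> {0..1} \<Longrightarrow> h k (\<sigma>, 0) = \<kappa> (f 0)" "\<And>k \<sigma>. \<sigma> \<in> {0..1} \<Longrightarrow> h k (\<sigma>, 1) = \<kappa> (f 1)"
    and close: "\<And>k \<sigma> \<tau>. \<sigma> \<in> {0..1} \<Longrightarrow> \<tau> \<in> {0..1} \<Longrightarrow> h k (\<sigma>, \<tau>) \<in> \<kappa> ` {w. clos (\<epsilon> k) (f \<tau>) w}"
    and \<epsilon>: "\<epsilon> \<longlonglongrightarrow> 0"
    and S: "\<And>d t w. t \<in> {0..1} \<Longrightarrow> clos d (f t) w \<Longrightarrow> \<kappa> w \<in> S"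
  shows "homotopic_paths S (\<lambda>\<tau>. h 0 (0, \<tau>)) (\<lambda>\<tau>. \<kappa> (f \<tau>))"
proof -
  define G where "G p = (if fst p < 1 then stack h (fst p / (1 - fst p), snd p) else \<kappa> (f (snd p)))" for p
  have frac: "x - of_int \<lfloor>x\<rfloor> \<in> {0..1}" for x :: real
    by (simp add: floor_correct) linarith
  have Gk: "G (\<sigma>, \<tau>) = h (nat \<lfloor>\<sigma> / (1 - \<sigma>)\<rfloor>) (\<sigma> / (1 - \<sigma>) - of_int \<lfloor>\<sigma> / (1 - \<sigma>)\<rfloor>, \<tau>)"
    if "\<sigma> < 1" for \<sigma> \<tau> using that by (simp add: G_def stack_def)
  define kk where "kk \<sigma> = nat \<lfloor>\<sigma> / (1 - \<sigma>)\<rfloor>" for \<sigma> :: real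
  have Gclose: "\<exists>w. G (\<sigma>, \<tau>) = \<kappa> w \<and> (\<sigma> < 1 \<longrightarrow> clos (\<epsilon> (kk \<sigma>)) (f \<tau>) w) \<and> (\<sigma> \<ge> 1 \<longrightarrow> w = f \<tau>)"
    if \<tau>01: "\<tau> \<in> {0..1}" for \<sigma> \<tau>
  proof (cases "\<sigma> < 1")
    case True
    obtain w where "h (kk \<sigma>) (\<sigma> / (1 - \<sigma>) - of_int \<lfloor>\<sigma> / (1 - \<sigma>)\<rfloor>, \<tau>) = \<kappa> w" "clos (\<epsilon> (kk \<sigma>)) (f \<tau>) w"
      using close[OF frac \<tau>01, of "kk \<sigma>"] by blast
    then show ?thesis using True unfolding Gk[OF True] by (intro exI[of _ w]) (simp add: kk_def)
  next
    case False
    then show ?thesis by (intro exI[of _ "f \<tau>"]) (simp add: G_def)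
  qed
  \<comment> \<open>Witnesses of the bounds, for the estimate at \<open>\<sigma> = 1\<close>.\<close>
  define w where "w p = (SOME w. G p = \<kappa> w \<and> (fst p < 1 \<longrightarrow> clos (\<epsilon> (kk (fst p))) (f (snd p)) w) \<and> (fst p \<ge> 1 \<longrightarrow> w = f (snd p)))" for p
  have w: "G p = \<kappa> (w p)" "fst p < 1 \<Longrightarrow> clos (\<epsilon> (kk (fst p))) (f (snd p)) (w p)" "fst p \<ge> 1 \<Longrightarrow> w p = f (snd p)"
    if "snd p \<in> {0..1}" for p
    using someI_ex[OF Gclose[OF that, of "fst p"]] unfolding w_def by auto
  let ?Q = "{0..1::real} \<times> {0..1::real}"
  have "continuous_on ?Q G"
    unfolding continuous_on_def
  proof
    fix p :: "real \<times> real" assume p: "p \<in> ?Q"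
    show "(G \<longlongrightarrow> G p) (at p within ?Q)"
    proof (cases "fst p < 1")
      case True
      have "continuous_on ({0..<1} \<times> {0..1}) (\<lambda>p. stack h (fst p / (1 - fst p), snd p))"
        by (rule continuous_on_compose2[OF continuous_on_stack[of h]])
          (use h eq in \<open>auto intro!: continuous_intros\<close>)
      then have "continuous_on ({0..<1} \<times> {0..1}) G"
        by (rule continuous_on_eq) (auto simp: G_def)
      moreover have "p \<in> {0..<1} \<times> {0..1}" using p True by (auto simp: mem_Times_iff)
      ultimately have "(G \<longlongrightarrow> G p) (at p within {0..<1} \<times> {0..1})" unfolding continuous_on_def by blast
      moreover have "at p within {0..<1} \<times> {0..1} = at p within ?Q"
        using True by (intro at_within_nhd[of p "{..<1} \<times> UNIV"]) (auto simp: open_Times mem_Times_iff)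
      ultimately show ?thesis by simp
    next
      case False
      then have p1: "fst p = 1" and \<tau>0: "snd p \<in> {0..1}" using p by (auto simp: mem_Times_iff)
      have ev_sq: "\<forall>\<^sub>F q in at p within ?Q. q \<in> ?Q" by (simp add: eventually_at_filter)
      have "((\<lambda>q. \<kappa> (w q)) \<longlongrightarrow> \<kappa> (f (snd p))) (at p within ?Q)"
      proof (rule tendsto_\<kappa>)
        fix e :: real assume e: "0 < e"
        obtain K where K: "\<And>k. k \<ge> K \<Longrightarrow> \<epsilon> k < e / 2"
          using order_tendstoD(2)[OF \<epsilon> half_gt_zero[OF e]] by (auto simp: eventually_sequentially)
        have "\<forall>\<^sub>F s in at (snd p) within {0..1}. clos (e / 2) (f (snd p)) (f s)"
          using continuous_on_\<kappa>D[OF f \<tau>0] e by simp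
        then obtain \<eta> where \<eta>: "0 < \<eta>" "\<And>s. s \<in> {0..1} \<Longrightarrow> dist s (snd p) < \<eta> \<Longrightarrow> clos (e / 2) (f (snd p)) (f s)"
          using clos_refl[of "e / 2" "f (snd p)"] e unfolding eventually_at by (metis less_eq_real_def half_gt_zero)
        have lt: "real (K + 1) / (real (K + 1) + 1) < 1" by simp
        have "(snd \<longlongrightarrow> snd p) (at p within ?Q)" "(fst \<longlongrightarrow> 1) (at p within ?Q)"
          using p1 by (auto intro!: tendsto_eq_intros)
        then have "\<forall>\<^sub>F q in at p within ?Q. dist (snd q) (snd p) < \<eta>"
          "\<forall>\<^sub>F q in at p within ?Q. fst q > real (K + 1) / (real (K + 1) + 1)"
          using tendstoD[OF _ \<eta>(1)] order_tendstoD(1)[OF _ lt] by blast+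
        then show "\<forall>\<^sub>F q in at p within ?Q. clos e (f (snd p)) (w q)"
          using ev_sq
        proof eventually_elim
          case (elim q)
          then have q: "fst q \<le> 1" "snd q \<in> {0..1}" by (auto simp: mem_Times_iff)
          have c: "clos (e / 2) (f (snd p)) (f (snd q))" using \<eta>(2) elim q by blast
          have "clos (e / 2) (f (snd q)) (w q)"
          proof (cases "fst q < 1")
            case True
            have "real (K + 1) \<le> fst q / (1 - fst q)"
              using elim(2) True by (simp add: field_simps)
            then have "K \<le> kk (fst q)" unfolding kk_def by linarith
            then show ?thesis using w(2)[OF q(2) True] K clos_mono by (meson less_imp_le)
          next
            case False
            then show ?thesis using w(3)[OF q(2)] e clos_refl by simp
          qed
          from clos_trans[OF c this] show ?case by simp
        qed
      qed
      moreover have "\<forall>\<^sub>F q in at p within ?Q. \<kappa> (w q) = G q"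
        using ev_sq by eventually_elim (use w(1) in \<open>auto simp: mem_Times_iff\<close>)
      ultimately have "(G \<longlongrightarrow> \<kappa> (f (snd p))) (at p within ?Q)" by (rule Lim_transform_eventually)
      then show ?thesis using p1 by (simp add: G_def)
    qed
  qed
  moreover have "G \<in> ?Q \<rightarrow> S"
  proof (rule Pi_I)
    fix p assume p: "p \<in> ?Q"
    then have \<tau>: "snd p \<in> {0..1}" by auto
    show "G p \<in> S"
    proof (cases "fst p < 1")
      case True
      then show ?thesis using w(1,2)[OF \<tau>] S[OF \<tau>] by simp
    next
      case False
      then show ?thesis using w(1,3)[OF \<tau>] S[OF \<tau> clos_refl[of 0]] by simp
    qed
  qed
  moreover have "G (0, \<tau>) = h 0 (0, \<tau>)" "G (1, \<tau>) = \<kappa> (f \<tau>)" for \<tau> by (simp_all add: G_def stack_def)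
  moreover have "G (\<sigma>, 0) = h 0 (0, 0)" "G (\<sigma>, 1) = h 0 (0, 1)" if "\<sigma> \<in> {0..1}" for \<sigma>
    using ends[OF frac] ends(1)[of 0 0] ends(2)[of 0 0] by (cases "\<sigma> < 1"; simp add: Gk; simp add: G_def)+
  ultimately show ?thesis
    unfolding homotopic_paths by (intro exI[of _ G]) (auto simp: pathstart_def pathfinish_def)
qed

lemma uniform_clos:
  assumes f: "continuous_on {0..1} (\<lambda>t. \<kappa> (f t))" and e: "0 < e"
  obtains \<eta> where "0 < \<eta>" "\<And>s t. s \<in> {0..1} \<Longrightarrow> t \<in> {0..1::real} \<Longrightarrow> \<bar>s - t\<bar> < \<eta> \<Longrightarrow> clos e (f s) (f t)"
proof -
  have "\<exists>\<eta>>0. \<forall>t\<in>{0..1}. \<bar>s - t\<bar> < \<eta> \<longrightarrow> clos (e / 2) (f s) (f t)" if s: "s \<in> {0..1}" for s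
  proof -
    have "\<forall>\<^sub>F t in at s within {0..1}. clos (e / 2) (f s) (f t)"
      using continuous_on_\<kappa>D[OF f s] e by simp
    then show ?thesis
      using clos_refl[of "e / 2" "f s"] e unfolding eventually_at
      by (auto simp: dist_real_def abs_minus_commute)
  qed
  then obtain \<eta> where \<eta>: "\<And>s. s \<in> {0..1} \<Longrightarrow> 0 < \<eta> s"
    "\<And>s t. s \<in> {0..1} \<Longrightarrow> t \<in> {0..1} \<Longrightarrow> \<bar>s - t\<bar> < \<eta> s \<Longrightarrow> clos (e / 2) (f s) (f t)"
    by metis
  have "{0..1::real} \<subseteq> (\<Union>s\<in>{0..1}. ball s (\<eta> s))" using \<eta>(1) by force
  then obtain \<delta> where \<delta>: "0 < \<delta>" "\<And>s. s \<in> {0..1} \<Longrightarrow> \<exists>G\<in>(\<lambda>s. ball s (\<eta> s)) ` {0..1}. ball s \<delta> \<subseteq> G"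
    using Heine_Borel_lemma[of "{0..1::real}" "(\<lambda>s. ball s (\<eta> s)) ` {0..1}"]
    by (metis (no_types, lifting) compact_Icc imageE open_ball)
  show ?thesis
  proof
    fix s t :: real assume st: "s \<in> {0..1}" "t \<in> {0..1}" "\<bar>s - t\<bar> < \<delta>"
    obtain u where u: "u \<in> {0..1}" "ball s \<delta> \<subseteq> ball u (\<eta> u)" using \<delta>(2)[OF st(1)] by auto
    have "s \<in> ball s \<delta>" "t \<in> ball s \<delta>" using st \<delta>(1) by (auto simp: dist_real_def)
    then have "\<bar>u - s\<bar> < \<eta> u" "\<bar>u - t\<bar> < \<eta> u" using u(2) by (auto simp: dist_real_def subset_iff)
    then have "clos (e / 2) (f u) (f s)" "clos (e / 2) (f u) (f t)" using \<eta>(2) u(1) st by auto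
    then have "clos (e / 2) (f s) (f u)" "clos (e / 2) (f u) (f t)" using clos_sym by blast+
    from clos_trans[OF this] show "clos e (f s) (f t)" by simp
  qed (use \<delta> in auto)
qed

text \<open>A modulus of continuity that is defined at every dyadic scale; halving repeatedly bounds the coarse scales
by the fine ones, so all its values are finite.\<close>

lemma clos_modulus:
  assumes f: "continuous_on {0..1} (\<lambda>t. \<kappa> (f t))"
  obtains \<delta> where "\<delta> \<longlonglongrightarrow> 0"
    "\<And>k s t. s \<in> {0..1} \<Longrightarrow> t \<in> {0..1::real} \<Longrightarrow> \<bar>s - t\<bar> \<le> 1 / 2 ^ k \<Longrightarrow> clos (\<delta> k) (f s) (f t)"
proof -
  define Q where "Q k d \<longleftrightarrow> (\<forall>s\<in>{0..1}. \<forall>t\<in>{0..1}. \<bar>s - t\<bar> \<le> 1 / 2 ^ k \<longrightarrow> clos d (f s) (f t))" for k :: nat and d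
  have Qn: "0 \<le> d" if "Q k d" for k d
    using that clos_nonneg unfolding Q_def by (metis abs_zero atLeastAtMost_iff cancel_comm_monoid_add_class.diff_cancel order_refl zero_le_one zero_le_divide_1_iff zero_le_numeral zero_le_power)
  have Qmono: "Q k' d" if "Q k d" "k \<le> k'" for k k' d
    using that unfolding Q_def by (meson frac_le order_trans power_increasing one_le_numeral zero_less_numeral zero_less_power zero_le_one order_refl)
  have ex1: "\<exists>k. Q k e" if e: "0 < e" for e
  proof -
    obtain \<eta> where \<eta>: "0 < \<eta>" "\<And>s t. s \<in> {0..1} \<Longrightarrow> t \<in> {0..1} \<Longrightarrow> \<bar>s - t\<bar> < \<eta> \<Longrightarrow> clos e (f s) (f t)"
      using uniform_clos[OF f e] by blast
    obtain k where "(1 / 2) ^ k < \<eta>" using real_arch_pow_inv[of \<eta> "1 / 2"] \<eta>(1) by auto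
    then show ?thesis using \<eta>(2) unfolding Q_def by (intro exI[of _ k]) (auto simp: power_divide)
  qed
  have double: "Q k (2 * d)" if q: "Q (Suc k) d" for k d
    unfolding Q_def
  proof (intro ballI impI)
    fix s t :: real assume st: "s \<in> {0..1}" "t \<in> {0..1}" "\<bar>s - t\<bar> \<le> 1 / 2 ^ k"
    have "\<bar>s - (s + t) / 2\<bar> \<le> 1 / 2 ^ Suc k" "\<bar>(s + t) / 2 - t\<bar> \<le> 1 / 2 ^ Suc k" "(s + t) / 2 \<in> {0..1}"
      using st by (auto simp: field_simps)
    then have "clos d (f s) (f ((s + t) / 2))" "clos d (f ((s + t) / 2)) (f t)"
      using q st unfolding Q_def by blast+
    from clos_trans[OF this] show "clos (2 * d) (f s) (f t)" by simp
  qed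
  have ex2: "\<exists>d. Q k d" for k
  proof -
    obtain n where "Q n 1" using ex1[of 1] by auto
    then have "Q (n - j) (2 ^ j)" if "j \<le> n" for j
      using that
    proof (induction j)
      case (Suc j)
      then show ?case using double[of "n - Suc j" "2 ^ j"] by (simp add: Suc_diff_Suc)
    qed simp
    from this[of n] Qmono show ?thesis by (metis diff_self_eq_0 le0 order_refl)
  qed
  define \<delta> where "\<delta> k = Inf {d. Q k d}" for k
  have bdd: "bdd_below {d. Q k d}" for k using Qn by (intro bdd_belowI[of _ 0]) auto
  have Q\<delta>: "Q k (\<delta> k)" for k
    unfolding Q_def
  proof (intro ballI impI)
    fix s t :: real assume st: "s \<in> {0..1}" "t \<in> {0..1}" "\<bar>s - t\<bar> \<le> 1 / 2 ^ k"
    show "clos (\<delta> k) (f s) (f t)"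
    proof (rule clos_closed)
      fix d' assume "\<delta> k < d'"
      then obtain d where "Q k d" "d < d'" using ex2 cInf_lessD[of "{d. Q k d}" d'] unfolding \<delta>_def by blast
      then show "clos d' (f s) (f t)" using st unfolding Q_def by (meson clos_mono less_imp_le)
    qed
  qed
  have "\<delta> \<longlonglongrightarrow> 0"
  proof (rule LIMSEQ_I)
    fix e :: real assume "0 < e"
    then obtain K where K: "Q K (e / 2)" using ex1[of "e / 2"] by auto
    have "norm (\<delta> k - 0) < e" if "k \<ge> K" for k
    proof -
      have "\<delta> k \<le> e / 2" unfolding \<delta>_def by (rule cInf_lower[OF _ bdd]) (use Qmono[OF K that] in simp)
      then show ?thesis using Qn[OF Q\<delta>[of k]] \<open>0 < e\<close> by simp
    qed
    then show "\<exists>no. \<forall>n\<ge>no. norm (\<delta> n - 0) < e" by blast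
  qed
  then show ?thesis using that[of \<delta>] Q\<delta> unfolding Q_def by blast
qed

fun dyadic_arcs :: "(real \<Rightarrow> 'r point) \<Rightarrow> nat \<Rightarrow> real \<Rightarrow> real \<Rightarrow> real \<Rightarrow> 'r point \<Rightarrow> real" where
  "dyadic_arcs f 0 s t = flat_arc (f s) (f t)"
| "dyadic_arcs f (Suc k) s t = dyadic_arcs f k s ((s + t) / 2) +++ dyadic_arcs f k ((s + t) / 2) t"

text \<open>Passing from one dyadic subdivision to the next replaces each arc by two, and the triangle homotopies
are carried out side by side.\<close>

lemma dyadic_refine:
  assumes \<delta>: "\<And>k s t. s \<in> {0..1} \<Longrightarrow> t \<in> {0..1::real} \<Longrightarrow> \<bar>s - t\<bar> \<le> 1 / 2 ^ k \<Longrightarrow> clos (\<delta> k) (f s) (f t)"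
  assumes "0 \<le> s" "s \<le> t" "t \<le> 1" "t - s \<le> 1 / 2 ^ j"
  shows "\<exists>h. continuous_on ({0..1::real} \<times> {0..1}) h \<and>
     (\<forall>\<tau>\<in>{0..1}. h (0, \<tau>) = dyadic_arcs f k s t \<tau> \<and> h (1, \<tau>) = dyadic_arcs f (Suc k) s t \<tau>) \<and>
     (\<forall>\<sigma>\<in>{0..1}. h (\<sigma>, 0) = \<kappa> (f s) \<and> h (\<sigma>, 1) = \<kappa> (f t)) \<and>
     (\<forall>\<sigma>\<in>{0..1}. \<forall>\<tau>\<in>{0..1}. h (\<sigma>, \<tau>) \<in> \<kappa> ` {w. clos (51 * \<delta> (j + k)) (f (s + (t - s) * \<tau>)) w})"
  using assms(2-)
proof (induction k arbitrary: s t j)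
  case 0
  let ?m = "(s + t) / 2"
  have c: "clos (\<delta> j) (f s) (f ?m)" "clos (\<delta> j) (f ?m) (f t)" "clos (\<delta> j) (f s) (f t)"
    using 0 by (auto intro!: \<delta>)
  have h: "homotopic_paths (\<kappa> ` {w. clos (50 * \<delta> j) (f s) w}) (flat_arc (f s) (f t)) (flat_arc (f s) (f ?m) +++ flat_arc (f ?m) (f t))"
    by (rule homotopic_paths_sym[OF flat_arc_triangle[OF c]])
  note F = flat_path_facts[OF flat_path_flat_arc[OF c(3)]]
  have d: "0 \<le> \<delta> j" using clos_nonneg c by blast
  have E: "pathstart (flat_arc (f s) (f t)) = \<kappa> (f s)" "pathfinish (flat_arc (f s) (f t)) = \<kappa> (f t)"
    using F d by simp_all
  obtain h where h: "continuous_on ({0..1::real} \<times> {0..1::real}) h"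
    "\<And>\<sigma> \<tau>. \<sigma> \<in> {0..1} \<Longrightarrow> \<tau> \<in> {0..1} \<Longrightarrow> h (\<sigma>, \<tau>) \<in> \<kappa> ` {w. clos (50 * \<delta> j) (f s) w}"
    "\<And>\<tau>. \<tau> \<in> {0..1} \<Longrightarrow> h (0, \<tau>) = flat_arc (f s) (f t) \<tau>"
    "\<And>\<tau>. \<tau> \<in> {0..1} \<Longrightarrow> h (1, \<tau>) = (flat_arc (f s) (f ?m) +++ flat_arc (f ?m) (f t)) \<tau>"
    "\<And>\<sigma>. \<sigma> \<in> {0..1} \<Longrightarrow> h (\<sigma>, 0) = \<kappa> (f s)" "\<And>\<sigma>. \<sigma> \<in> {0..1} \<Longrightarrow> h (\<sigma>, 1) = \<kappa> (f t)"
    using homotopic_pathsE[OF h] E by metis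
  have "h (\<sigma>, \<tau>) \<in> \<kappa> ` {w. clos (51 * \<delta> j) (f (s + (t - s) * \<tau>)) w}"
    if st: "\<sigma> \<in> {0..1}" "\<tau> \<in> {0..1}" for \<sigma> \<tau>
  proof -
    obtain w where w: "h (\<sigma>, \<tau>) = \<kappa> w" "clos (50 * \<delta> j) (f s) w" using h(2)[OF st] by blast
    have b: "0 \<le> (t - s) * \<tau>" "(t - s) * \<tau> \<le> t - s"
      using st 0 by (auto simp: mult_left_le)
    have "clos (\<delta> j) (f (s + (t - s) * \<tau>)) (f s)"
      using b 0 by (intro \<delta>) auto
    from clos_trans[OF this w(2)] show ?thesis using w(1) by simp
  qed
  then show ?case using h by (intro exI[of _ h]) auto
next
  case (Suc k)
  let ?m = "(s + t) / 2"
  have m: "0 \<le> ?m" "s \<le> ?m" "?m \<le> t" "?m \<le> 1" "?m - s \<le> 1 / 2 ^ Suc j" "t - ?m \<le> 1 / 2 ^ Suc j"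
    using Suc.prems by (auto simp: field_simps)
  obtain h1 where h1: "continuous_on ({0..1::real} \<times> {0..1}) h1"
     "\<forall>\<tau>\<in>{0..1}. h1 (0, \<tau>) = dyadic_arcs f k s ?m \<tau> \<and> h1 (1, \<tau>) = dyadic_arcs f (Suc k) s ?m \<tau>"
     "\<forall>\<sigma>\<in>{0..1}. h1 (\<sigma>, 0) = \<kappa> (f s) \<and> h1 (\<sigma>, 1) = \<kappa> (f ?m)"
     "\<forall>\<sigma>\<in>{0..1}. \<forall>\<tau>\<in>{0..1}. h1 (\<sigma>, \<tau>) \<in> \<kappa> ` {w. clos (51 * \<delta> (Suc j + k)) (f (s + (?m - s) * \<tau>)) w}"
    using Suc.IH[OF Suc.prems(1) m(2,4,5)] by blast
  obtain h2 where h2: "continuous_on ({0..1::real} \<times> {0..1}) h2"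
     "\<forall>\<tau>\<in>{0..1}. h2 (0, \<tau>) = dyadic_arcs f k ?m t \<tau> \<and> h2 (1, \<tau>) = dyadic_arcs f (Suc k) ?m t \<tau>"
     "\<forall>\<sigma>\<in>{0..1}. h2 (\<sigma>, 0) = \<kappa> (f ?m) \<and> h2 (\<sigma>, 1) = \<kappa> (f t)"
     "\<forall>\<sigma>\<in>{0..1}. \<forall>\<tau>\<in>{0..1}. h2 (\<sigma>, \<tau>) \<in> \<kappa> ` {w. clos (51 * \<delta> (Suc j + k)) (f (?m + (t - ?m) * \<tau>)) w}"
    using Suc.IH[OF m(1,3) Suc.prems(3) m(6)] by blast
  define h where "h p = ((\<lambda>\<tau>. h1 (fst p, \<tau>)) +++ (\<lambda>\<tau>. h2 (fst p, \<tau>))) (snd p)" for p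
  have "continuous_on ({0..1::real} \<times> {0..1}) h"
    unfolding h_def using h1(1,3) h2(1,3)
    by (intro continuous_on_homotopic_join_lemma[of "\<lambda>\<sigma> \<tau>. h1 (\<sigma>, \<tau>)" "\<lambda>\<sigma> \<tau>. h2 (\<sigma>, \<tau>)"])
      (auto simp: pathstart_def pathfinish_def)
  moreover have "h (0, \<tau>) = dyadic_arcs f (Suc k) s t \<tau>" "h (1, \<tau>) = dyadic_arcs f (Suc (Suc k)) s t \<tau>"
    if "\<tau> \<in> {0..1}" for \<tau>
    using h1(2) h2(2) that by (auto simp: h_def joinpaths_def)
  moreover have "h (\<sigma>, 0) = \<kappa> (f s)" "h (\<sigma>, 1) = \<kappa> (f t)" if "\<sigma> \<in> {0..1}" for \<sigma>
    using h1(3) h2(3) that by (auto simp: h_def joinpaths_def)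
  moreover have "h (\<sigma>, \<tau>) \<in> \<kappa> ` {w. clos (51 * \<delta> (j + Suc k)) (f (s + (t - s) * \<tau>)) w}"
    if st: "\<sigma> \<in> {0..1}" "\<tau> \<in> {0..1}" for \<sigma> \<tau>
  proof (cases "\<tau> \<le> 1 / 2")
    case True
    then have 1: "h (\<sigma>, \<tau>) = h1 (\<sigma>, 2 * \<tau>)" "2 * \<tau> \<in> {0..1}" using st by (auto simp: h_def joinpaths_def)
    have 2: "s + (?m - s) * (2 * \<tau>) = s + (t - s) * \<tau>" by (simp add: field_simps)
    have "h1 (\<sigma>, 2 * \<tau>) \<in> \<kappa> ` {w. clos (51 * \<delta> (Suc j + k)) (f (s + (?m - s) * (2 * \<tau>))) w}"
      using h1(4) st(1) 1(2) by blast
    then show ?thesis unfolding 1(1) 2 by simp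
  next
    case False
    then have 1: "h (\<sigma>, \<tau>) = h2 (\<sigma>, 2 * \<tau> - 1)" "2 * \<tau> - 1 \<in> {0..1}" using st by (auto simp: h_def joinpaths_def)
    have 2: "?m + (t - ?m) * (2 * \<tau> - 1) = s + (t - s) * \<tau>" by (simp add: field_simps)
    have "h2 (\<sigma>, 2 * \<tau> - 1) \<in> \<kappa> ` {w. clos (51 * \<delta> (Suc j + k)) (f (?m + (t - ?m) * (2 * \<tau> - 1))) w}"
      using h2(4) st(1) 1(2) by blast
    then show ?thesis unfolding 1(1) 2 by simp
  qed
  ultimately show ?case by (intro exI[of _ h]) blast
qed

text \<open>The dyadic arcs converge to the path, and consecutive ones are homotopic within a distance that tends
to \<open>0\<close>.\<close>

theorem path_homotopic_flat_arc:
  assumes f: "continuous_on {0..1} (\<lambda>t. \<kappa> (f t))"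
    and S: "\<And>d t w. t \<in> {0..1} \<Longrightarrow> clos d (f t) w \<Longrightarrow> \<kappa> w \<in> S"
  shows "homotopic_paths S (flat_arc (f 0) (f 1)) (\<lambda>t. \<kappa> (f t))"
proof -
  obtain \<delta> where \<delta>: "\<delta> \<longlonglongrightarrow> 0"
    "\<And>k s t. s \<in> {0..1} \<Longrightarrow> t \<in> {0..1::real} \<Longrightarrow> \<bar>s - t\<bar> \<le> 1 / 2 ^ k \<Longrightarrow> clos (\<delta> k) (f s) (f t)"
    using clos_modulus[OF f] by blast
  have "\<exists>h. \<forall>k. continuous_on ({0..1::real} \<times> {0..1}) (h k) \<and>
     (\<forall>\<tau>\<in>{0..1}. h k (0, \<tau>) = dyadic_arcs f k 0 1 \<tau> \<and> h k (1, \<tau>) = dyadic_arcs f (Suc k) 0 1 \<tau>) \<and>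
     (\<forall>\<sigma>\<in>{0..1}. h k (\<sigma>, 0) = \<kappa> (f 0) \<and> h k (\<sigma>, 1) = \<kappa> (f 1)) \<and>
     (\<forall>\<sigma>\<in>{0..1}. \<forall>\<tau>\<in>{0..1}. h k (\<sigma>, \<tau>) \<in> \<kappa> ` {w. clos (51 * \<delta> k) (f \<tau>) w})"
    using dyadic_refine[of \<delta> f 0 1 0, OF \<delta>(2)] by (intro choice) simp
  then obtain h where h: "\<And>k. continuous_on ({0..1::real} \<times> {0..1}) (h k)"
     "\<And>k \<tau>. \<tau>\<in>{0..1} \<Longrightarrow> h k (0, \<tau>) = dyadic_arcs f k 0 1 \<tau> \<and> h k (1, \<tau>) = dyadic_arcs f (Suc k) 0 1 \<tau>"
     "\<And>k \<sigma>. \<sigma>\<in>{0..1} \<Longrightarrow> h k (\<sigma>, 0) = \<kappa> (f 0) \<and> h k (\<sigma>, 1) = \<kappa> (f 1)"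
     "\<And>k \<sigma> \<tau>. \<sigma>\<in>{0..1} \<Longrightarrow> \<tau>\<in>{0..1} \<Longrightarrow> h k (\<sigma>, \<tau>) \<in> \<kappa> ` {w. clos (51 * \<delta> k) (f \<tau>) w}"
    by metis
  have "homotopic_paths S (\<lambda>\<tau>. h 0 (0, \<tau>)) (\<lambda>t. \<kappa> (f t))"
    by (rule homotopic_to_limit[where \<epsilon> = "\<lambda>k. 51 * \<delta> k"])
      (use f h S \<delta>(1) in \<open>auto intro!: tendsto_mult_right_zero\<close>)
  moreover have "homotopic_paths S (\<lambda>\<tau>. h 0 (0, \<tau>)) (flat_arc (f 0) (f 1))"
    using h(2)[of _ 0] homotopic_paths_imp_path[OF calculation] homotopic_paths_imp_subset[OF calculation]
    by (intro homotopic_paths_eq) auto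
  ultimately show ?thesis using homotopic_paths_sym homotopic_paths_trans by blast
qed

end

section \<open>Lifting through the corner quotient\<close>

declare split_paired_Ex [simp del] split_paired_All [simp del]

lemma (in Metric_space) uniformly_continuous_on_compact:
  fixes K :: "'b::metric_space set"
  assumes K: "compact K" and H: "continuous_map (top_of_set K) mtopology H" and e: "0 < e"
  obtains \<eta> where "0 < \<eta>" "\<And>x y. x \<in> K \<Longrightarrow> y \<in> K \<Longrightarrow> dist x y < \<eta> \<Longrightarrow> d (H x) (H y) < e"
proof -
  have "\<exists>\<eta>>0. \<forall>y\<in>K. dist x y < \<eta> \<longrightarrow> H y \<in> mball (H x) (e / 2)" if x: "x \<in> K" for x
  proof -
    obtain U where U: "openin (top_of_set K) U" "x \<in> U" "\<forall>y\<in>U. H y \<in> mball (H x) (e / 2)"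
      using H x e unfolding continuous_map_to_metric by (metis half_gt_zero topspace_euclidean_subtopology)
    then obtain \<eta> where "0 < \<eta>" "\<And>y. y \<in> K \<Longrightarrow> dist y x < \<eta> \<Longrightarrow> y \<in> U"
      unfolding openin_euclidean_subtopology_iff by metis
    then show ?thesis using U(3) by (metis dist_commute)
  qed
  then obtain \<eta> where \<eta>: "\<And>x. x \<in> K \<Longrightarrow> 0 < \<eta> x"
    "\<And>x y. x \<in> K \<Longrightarrow> y \<in> K \<Longrightarrow> dist x y < \<eta> x \<Longrightarrow> H y \<in> mball (H x) (e / 2)"
    by metis
  have "K \<subseteq> \<Union>((\<lambda>x. ball x (\<eta> x)) ` K)" using \<eta>(1) by force
  then obtain \<delta> where \<delta>: "0 < \<delta>" "\<And>x. x \<in> K \<Longrightarrow> \<exists>G\<in>(\<lambda>x. ball x (\<eta> x)) ` K. ball x \<delta> \<subseteq> G"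
    using Heine_Borel_lemma[OF K, of "(\<lambda>x. ball x (\<eta> x)) ` K"] by (metis (no_types, lifting) imageE open_ball)
  show ?thesis
  proof
    fix x y assume xy: "x \<in> K" "y \<in> K" "dist x y < \<delta>"
    obtain u where u: "u \<in> K" "ball x \<delta> \<subseteq> ball u (\<eta> u)" using \<delta>(2)[OF xy(1)] by auto
    have "x \<in> ball x \<delta>" "y \<in> ball x \<delta>" using xy \<delta>(1) by auto
    then have "dist u x < \<eta> u" "dist u y < \<eta> u" using u(2) mem_ball by blast+
    then have "H x \<in> mball (H u) (e / 2)" "H y \<in> mball (H u) (e / 2)"
      using \<eta>(2)[OF u(1)] xy by blast+
    then show "d (H x) (H y) < e" using triangle''[of "H x" "H u" "H y"] by (auto simp: commute)
  qed (use \<delta> in auto)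
qed

context valued_ring
begin

lemma clos_symD: "clos d x y \<Longrightarrow> clos d y x"
  using clos_sym by blast

text \<open>The points of the model that correspond to points of the cone: the entries have finite size.\<close>

definition PFin :: "'r point set" where "PFin = {x. fst x \<in> UFin}"

lemma clos_PFin: assumes "clos d x y" "x \<in> PFin" shows "y \<in> PFin"
proof -
  have "- fst x + fst y \<in> UFin"
    using assms(1) Fin_I unfolding clos_def bnd_def UFin_def uni_in_def by auto
  then have "fst x + (- fst x + fst y) \<in> UFin" using assms(2) UFin_add unfolding PFin_def by blast
  then show ?thesis by (simp add: PFin_def add.assoc[symmetric])
qed

lemma zact_PFin: "z \<in> Fin \<Longrightarrow> x \<in> PFin \<Longrightarrow> zact z x \<in> PFin"
  using UFin_add[of "el14 z" "fst x"]
  by (simp add: PFin_def zact_def act_def) (simp add: UFin_def uni_in_def Fin_0)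

lemma flat_arc_image:
  assumes "clos d x y" "x \<in> PFin"
  shows "path_image (flat_arc x y) \<subseteq> \<kappa> ` PFin"
proof -
  have d: "0 \<le> 4 * d" using clos_nonneg[OF assms(1)] by simp
  have "path_image (flat_arc x y) \<subseteq> cell x (2 * (4 * d))"
    using flat_path_facts[OF flat_path_flat_arc[OF assms(1)] d] by blast
  also have "\<dots> \<subseteq> \<kappa> ` PFin" using cell_subset[of "2 * (4 * d)" x] d clos_PFin[OF _ assms(2)] by fastforce
  finally show ?thesis .
qed

lemma flat_arc_path:
  assumes "clos d x y"
  shows "path (flat_arc x y)" "pathstart (flat_arc x y) = \<kappa> x" "pathfinish (flat_arc x y) = \<kappa> y"
  using flat_path_facts[OF flat_path_flat_arc[OF assms]] clos_nonneg[OF assms] by auto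

text \<open>Any path is homotopic to the flat arc between its ends, so the model is simply connected.\<close>

theorem paths_homotopic:
  assumes f: "path f" "path_image f \<subseteq> \<kappa> ` PFin" and g: "path g" "path_image g \<subseteq> \<kappa> ` PFin"
    and ends: "pathstart f = pathstart g" "pathfinish f = pathfinish g"
  shows "homotopic_paths (\<kappa> ` PFin) f g"
proof -
  define x where "x = (SOME x. x \<in> PFin \<and> \<kappa> x = pathstart f)"
  define y where "y = (SOME x. x \<in> PFin \<and> \<kappa> x = pathfinish f)"
  have *: "homotopic_paths (\<kappa> ` PFin) (flat_arc x y) k"
    if k: "path k" "path_image k \<subseteq> \<kappa> ` PFin" "pathstart k = pathstart f" "pathfinish k = pathfinish f" for k
  proof -
    have "\<exists>w. w \<in> PFin \<and> \<kappa> w = k t" if "t \<in> {0..1}" for t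
      using k(2) that by (force simp: path_image_def)
    then obtain w where w: "\<And>t. t \<in> {0..1} \<Longrightarrow> w t \<in> PFin \<and> \<kappa> (w t) = k t" by metis
    define v where "v t = (if t = 0 then x else if t = 1 then y else w t)" for t
    have "x \<in> PFin \<and> \<kappa> x = pathstart f" unfolding x_def
      by (rule someI[of _ "w 0"]) (use w[of 0] k(3) in \<open>simp add: pathstart_def\<close>)
    moreover have "y \<in> PFin \<and> \<kappa> y = pathfinish f" unfolding y_def
      by (rule someI[of _ "w 1"]) (use w[of 1] k(4) in \<open>simp add: pathfinish_def\<close>)
    ultimately have v: "v t \<in> PFin" "\<kappa> (v t) = k t" if "t \<in> {0..1}" for t
      using w[OF that] k(3,4) by (auto simp: v_def pathstart_def pathfinish_def)
    have c: "continuous_on {0..1} (\<lambda>t. \<kappa> (v t))"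
      by (rule continuous_on_eq[OF k(1)[unfolded path_def]]) (use v in simp)
    have 1: "homotopic_paths (\<kappa> ` PFin) (flat_arc (v 0) (v 1)) (\<lambda>t. \<kappa> (v t))"
      by (rule path_homotopic_flat_arc[OF c]) (use v clos_PFin in blast)
    have 2: "homotopic_paths (\<kappa> ` PFin) k (\<lambda>t. \<kappa> (v t))"
      using k(1,2) v(2) by (intro homotopic_paths_eq) simp_all
    show ?thesis using homotopic_paths_trans[OF 1 homotopic_paths_sym[OF 2]] by (simp add: v_def)
  qed
  show ?thesis
    using homotopic_paths_trans[OF homotopic_paths_sym[OF *[OF f refl refl]] *[OF g ends[symmetric]]] .
qed

text \<open>Two chains that agree up to corner translations are compared step by step. The translation changes by at most
\<open>4 * \<rho>\<close> in each step, and since \<open>B (4 * \<rho>)\<close> is a group the changes do not accumulate.\<close>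

lemma chain_comparison:
  assumes x: "\<And>i. i < n \<Longrightarrow> clos \<rho> (x i) (x (Suc i))" and x': "\<And>i. i < n \<Longrightarrow> clos \<rho> (x' i) (x' (Suc i))"
    and ex: "\<And>i. i \<le> n \<Longrightarrow> \<exists>w. clos \<rho> (zact w (x i)) (x' i)" and start: "clos \<rho> (x 0) (x' 0)"
    and w: "clos \<rho> (zact w (x n)) (x' n)"
  shows "w \<in> B (4 * \<rho>)"
proof -
  have \<rho>: "0 \<le> \<rho>" using clos_nonneg[OF start] .
  \<comment> \<open>Four moves of length \<open>\<rho>\<close> lead from one translate of \<open>x i\<close> to another, through \<open>x'\<close> and back.\<close>
  have step: "w' - w \<in> B (4 * \<rho>)" if "clos (4 * \<rho>) (zact w y) (zact w' y)" for w w' y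
    using that clos_zact_iff[of "4 * \<rho>" "zact w y" "w' - w"] \<rho> by (simp add: zact_zact)
  have "clos \<rho> (zact w (x i)) (x' i) \<Longrightarrow> i \<le> n \<Longrightarrow> w \<in> B (4 * \<rho>)" for i w
  proof (induction i arbitrary: w)
    case 0
    have "clos (\<rho> + \<rho>) (zact w (x 0)) (x 0)" by (rule clos_trans[OF 0(1) clos_symD[OF start]])
    from clos_mono[OF clos_symD[OF this]] have "clos (4 * \<rho>) (x 0) (zact w (x 0))" using \<rho> by simp
    then show ?case using step[of 0 "x 0" w] by simp
  next
    case (Suc i)
    obtain z where z: "clos \<rho> (zact z (x i)) (x' i)" using ex[of i] Suc.prems by auto
    have zB: "z \<in> B (4 * \<rho>)" using Suc.IH[OF z] Suc.prems by simp
    have 1: "clos \<rho> (x' i) (x' (Suc i))" "clos \<rho> (x' (Suc i)) (zact w (x (Suc i)))"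
      "clos \<rho> (zact w (x (Suc i))) (zact w (x i))"
      using x'[of i] clos_symD[OF Suc.prems(1)] clos_symD[OF x[of i]] Suc.prems(2) by (simp_all add: clos_zact)
    from clos_trans[OF clos_trans[OF clos_trans[OF z 1(1)] 1(2)] 1(3)]
    have "clos (4 * \<rho>) (zact z (x i)) (zact w (x i))" by simp
    from B_add[OF step[OF this] zB] show ?case by simp
  qed
  then show ?thesis using w by blast
qed

end

text \<open>The abstract form of the quotient by the corner entries. In \<open>q_colipschitz\<close> one translation \<open>z\<close> has to serve for all
distances \<open>d\<close>; this identifies the fibres. The assumption \<open>spherical\<close> takes the place of completeness of the fibres.\<close>

locale cone_quotient = valued_ring B + Y: Metric_space M dY
  for B :: "real \<Rightarrow> 'r::comm_ring_1 set" and M :: "'y set" and dY +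
  fixes q :: "'r point \<Rightarrow> 'y" and C :: real
  assumes spherical: "(\<And>k. c (Suc k) - c k \<in> B (r k)) \<Longrightarrow> decseq r \<Longrightarrow> \<exists>z. \<forall>k. z - c k \<in> B (r k)"
    and C_pos: "0 < C"
    and q_lipschitz: "x \<in> PFin \<Longrightarrow> y \<in> PFin \<Longrightarrow> clos d x y \<Longrightarrow> dY (q x) (q y) \<le> C * d"
    and q_colipschitz: "x \<in> PFin \<Longrightarrow> y \<in> PFin \<Longrightarrow> \<exists>z\<in>Fin. \<forall>d. dY (q x) (q y) < d \<longrightarrow> clos (C * d) x (zact z y)"
    and q_surj: "q ` PFin = M"
    and q_zact: "z \<in> Fin \<Longrightarrow> x \<in> PFin \<Longrightarrow> q (zact z x) = q x"
begin

lemma lift_near: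
  assumes "x \<in> PFin" "y \<in> M" "dY (q x) y < d"
  shows "\<exists>x'\<in>PFin. q x' = y \<and> clos (C * d) x x'"
proof -
  obtain v where v: "v \<in> PFin" "q v = y" using assms(2) q_surj by blast
  then obtain z where "z \<in> Fin" "clos (C * d) x (zact z v)" using q_colipschitz[OF assms(1) v(1)] assms(3) by blast
  then show ?thesis using v q_zact zact_PFin by blast
qed

lemma same_fibre:
  assumes "x \<in> PFin" "y \<in> PFin" "q x = q y"
  shows "\<exists>z\<in>Fin. clos 0 (zact z x) y"
proof -
  obtain z where z: "z \<in> Fin" "\<And>d. dY (q y) (q x) < d \<Longrightarrow> clos (C * d) y (zact z x)"
    using q_colipschitz[OF assms(2,1)] by blast
  have "clos e y (zact z x)" if "0 < e" for e
  proof -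
    have "dY (q y) (q x) < e / C" using assms C_pos that q_surj Y.mdist_zero by auto
    from z(2)[OF this] show ?thesis using C_pos by simp
  qed
  then have "clos 0 y (zact z x)" by (rule clos_closed)
  from clos_symD[OF this] show ?thesis using z(1) by blast
qed

definition lift_of :: "(real \<Rightarrow> 'y) \<Rightarrow> (real \<Rightarrow> 'r point) \<Rightarrow> bool" where
  "lift_of \<gamma> f \<longleftrightarrow> (\<forall>t\<in>{0..1}. f t \<in> PFin \<and> q (f t) = \<gamma> t)"

text \<open>A lift that is continuous up to the error \<open>\<rho>\<close>: lift a fine subdivision point by point, and then each remaining point from
the preceding one.\<close>

lemma approximate_lift:
  assumes \<gamma>: "pathin Y.mtopology \<gamma>" and x0: "x0 \<in> PFin" "q x0 = \<gamma> 0" and \<rho>: "0 < \<rho>"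
  shows "\<exists>\<eta>>0. \<exists>f. lift_of \<gamma> f \<and> f 0 = x0 \<and> (\<forall>s\<in>{0..1}. \<forall>t\<in>{0..1}. \<bar>s - t\<bar> < \<eta> \<longrightarrow> clos \<rho> (f s) (f t))"
proof -
  \<comment> \<open>Two points of the lift are joined through their two subdivision points, in three steps of size \<open>C * e\<close>.\<close>
  define e where "e = \<rho> / (3 * C)"
  have e: "0 < e" "3 * (C * e) = \<rho>" using \<rho> C_pos by (auto simp: e_def)
  obtain \<eta> where \<eta>: "0 < \<eta>" "\<And>s t. s \<in> {0..1} \<Longrightarrow> t \<in> {0..1} \<Longrightarrow> dist s t < \<eta> \<Longrightarrow> dY (\<gamma> s) (\<gamma> t) < e"
    using Y.uniformly_continuous_on_compact[OF compact_Icc \<gamma>[unfolded pathin_def] e(1)] by blast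
  obtain N where N: "0 < N" "1 / real N < \<eta>" using \<eta>(1) by (metis nat_approx_posE of_nat_0_less_iff zero_less_Suc of_nat_Suc)
  have gM: "\<gamma> t \<in> M" if "t \<in> {0..1}" for t
    using \<gamma> that continuous_map_image_subset_topspace unfolding pathin_def by fastforce
  define g where "g i = min 1 (real i / real N)" for i
  have g01: "g i \<in> {0..1}" for i by (auto simp: g_def)
  have gs: "dist (g i) (g (Suc i)) \<le> 1 / real N" for i
    using N by (auto simp: g_def dist_real_def min_def field_simps)
  have "\<exists>L. \<forall>i. (L i \<in> PFin \<and> q (L i) = \<gamma> (g i) \<and> (i = 0 \<longrightarrow> L i = x0)) \<and> clos (C * e) (L i) (L (Suc i))"
  proof (rule dependent_nat_choice)
    show "\<exists>x. x \<in> PFin \<and> q x = \<gamma> (g 0) \<and> (0 = 0 \<longrightarrow> x = x0)" using x0 by (auto simp: g_def)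
    fix x n assume x: "x \<in> PFin \<and> q x = \<gamma> (g n) \<and> (n = 0 \<longrightarrow> x = x0)"
    have "dY (q x) (\<gamma> (g (Suc n))) < e" using x \<eta>(2)[OF g01 g01, of n "Suc n"] gs[of n] N by force
    then show "\<exists>y. (y \<in> PFin \<and> q y = \<gamma> (g (Suc n)) \<and> (Suc n = 0 \<longrightarrow> y = x0)) \<and> clos (C * e) x y"
      using lift_near x gM g01 by (metis nat.distinct(1))
  qed
  then obtain L where L: "\<And>i. L i \<in> PFin" "\<And>i. q (L i) = \<gamma> (g i)" "L 0 = x0" "\<And>i. clos (C * e) (L i) (L (Suc i))"
    by blast
  define fl where "fl t = nat \<lfloor>t * real N\<rfloor>" for t
  have fl: "g (fl t) \<le> t" "t < g (fl t) + 1 / real N" if "t \<in> {0..1}" for t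
  proof -
    have "real (fl t) \<le> t * N" "t * N < real (fl t) + 1" using that N unfolding fl_def by (auto simp: floor_correct intro: mult_nonneg_nonneg)
    moreover have "t * real N \<le> 1 * real N" using that by (intro mult_right_mono) auto
    ultimately have "real (fl t) \<le> real N" by linarith
    then have gN: "g (fl t) = real (fl t) / real N" using N(1) by (simp add: g_def min_def field_simps)
    show "g (fl t) \<le> t" "t < g (fl t) + 1 / real N"
      unfolding gN using N(1) \<open>real (fl t) \<le> t * N\<close> \<open>t * N < real (fl t) + 1\<close> by (simp_all add: field_simps)
  qed
  have "\<exists>y. y \<in> PFin \<and> q y = \<gamma> t \<and> clos (C * e) (L (fl t)) y \<and> (t = 0 \<longrightarrow> y = x0)" if t: "t \<in> {0..1}" for t
  proof (cases "t = 0")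
    case True
    then show ?thesis using x0 clos_refl[of "C * e" x0] e C_pos L(3) by (auto simp: fl_def)
  next
    case False
    have "dist (g (fl t)) t < \<eta>" using fl[OF t] N \<eta>(1) by (auto simp: dist_real_def)
    then have "dY (q (L (fl t))) (\<gamma> t) < e" using \<eta>(2)[OF g01 t] L(2) by simp
    then show ?thesis using lift_near[OF L(1) gM[OF t]] False by blast
  qed
  then obtain f where f: "\<And>t. t \<in> {0..1} \<Longrightarrow> f t \<in> PFin \<and> q (f t) = \<gamma> t \<and> clos (C * e) (L (fl t)) (f t) \<and> (t = 0 \<longrightarrow> f t = x0)"
    by metis
  have cc: "clos \<rho> (f s) (f t)" if st: "s \<in> {0..1}" "t \<in> {0..1}" "s \<le> t" "t - s < 1 / real N" for s t
  proof -
    have "t * real N < s * real N + 1" "s * real N \<le> t * real N" using st N by (auto simp: field_simps)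
    then have "\<lfloor>t * real N\<rfloor> = \<lfloor>s * real N\<rfloor> \<or> \<lfloor>t * real N\<rfloor> = \<lfloor>s * real N\<rfloor> + 1" by linarith
    moreover have "0 \<le> \<lfloor>s * real N\<rfloor>" using st by simp
    ultimately have "fl t = fl s \<or> fl t = Suc (fl s)" unfolding fl_def by (auto simp: nat_add_distrib)
    then have "clos (C * e) (L (fl s)) (L (fl t))" using L(4)[of "fl s"] clos_refl[of "C * e" "L (fl s)"] e C_pos by auto
    moreover have "clos (C * e) (f s) (L (fl s))" "clos (C * e) (L (fl t)) (f t)"
      using f[OF st(1)] f[OF st(2)] clos_symD by blast+
    ultimately have "clos (C * e + C * e + C * e) (f s) (f t)" using clos_trans by blast
    then show ?thesis using e(2) by simp
  qed
  have cl: "clos \<rho> (f s) (f t)" if "s \<in> {0..1}" "t \<in> {0..1}" "\<bar>s - t\<bar> < 1 / real N" for s t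
    using cc[of s t] clos_symD[OF cc[of t s]] that by (cases "s \<le> t") auto
  have f0: "f 0 = x0" using f[of 0] by simp
  show ?thesis
  proof (intro exI[of _ "1 / real N"] conjI exI[of _ f] ballI impI)
    show "lift_of \<gamma> f" using f by (simp add: lift_of_def)
  qed (use f0 cl N in simp_all)
qed

lemma lifts_comparison:
  assumes f: "\<forall>s\<in>{0..1}. \<forall>t\<in>{0..1}. \<bar>s - t\<bar> < \<eta> \<longrightarrow> clos \<rho> (f s) (f t)"
    and g: "\<forall>s\<in>{0..1}. \<forall>t\<in>{0..1}. \<bar>s - t\<bar> < \<eta> \<longrightarrow> clos \<rho> (g s) (g t)" and \<eta>: "0 < \<eta>"
    and ex: "\<And>t. t \<in> {0..1} \<Longrightarrow> \<exists>w. clos \<rho> (zact w (f t)) (g t)" and start: "clos \<rho> (f 0) (g 0)"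
    and t: "t \<in> {0..1::real}" and w: "clos \<rho> (zact w (f t)) (g t)"
  shows "w \<in> B (4 * \<rho>)"
proof -
  obtain n where n: "0 < n" "1 / real n < \<eta>" using \<eta> by (metis nat_approx_posE of_nat_0_less_iff zero_less_Suc of_nat_Suc)
  define h where "h i = t * (real i / real n)" for i
  have h01: "h i \<in> {0..1}" if "i \<le> n" for i
    using that t n mult_mono[of t 1 "real i / real n" 1] by (simp add: h_def)
  have hs: "\<bar>h i - h (Suc i)\<bar> < \<eta>" for i
  proof -
    have "\<bar>h i - h (Suc i)\<bar> = t / n" using t n by (simp add: h_def field_simps)
    also have "\<dots> \<le> 1 / n" using t n by (simp add: field_simps)
    finally show ?thesis using n by simp
  qed
  show ?thesis
  proof (rule chain_comparison[of n \<rho> "f \<circ> h" "g \<circ> h"])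
    show "clos \<rho> (zact w ((f \<circ> h) n)) ((g \<circ> h) n)" using w n by (simp add: h_def)
    show "clos \<rho> ((f \<circ> h) 0) ((g \<circ> h) 0)" using start by (simp add: h_def)
  qed (use f g h01 hs ex in \<open>auto simp: Suc_leI\<close>)
qed

text \<open>Approximate lifts at the scales \<open>\<rho> k\<close> differ by corner translations of size \<open>4 * \<rho> k\<close>, by comparison of chains. The
partial sums of these translations define nested balls, and a common point of the balls corrects the
first lift to a continuous one.\<close>

theorem path_lift:
  assumes \<gamma>: "pathin Y.mtopology \<gamma>" and x0: "x0 \<in> PFin" "q x0 = \<gamma> 0"
  shows "\<exists>f. lift_of \<gamma> f \<and> continuous_on {0..1} (\<lambda>t. \<kappa> (f t)) \<and> \<kappa> (f 0) = \<kappa> x0"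
proof -
  define \<rho> :: "nat \<Rightarrow> real" where "\<rho> k = (1 / 2) ^ k" for k
  have \<rho>: "0 < \<rho> k" "\<rho> (Suc k) \<le> \<rho> k" for k by (auto simp: \<rho>_def)
  have "\<forall>k. \<exists>\<eta> f. 0 < \<eta> \<and> lift_of \<gamma> f \<and> f 0 = x0 \<and> (\<forall>s\<in>{0..1}. \<forall>t\<in>{0..1}. \<bar>s - t\<bar> < \<eta> \<longrightarrow> clos (\<rho> k) (f s) (f t))"
    using approximate_lift[OF \<gamma> x0 \<rho>(1)] by blast
  then obtain \<eta> L where L: "\<And>k. 0 < \<eta> k" "\<And>k. lift_of \<gamma> (L k)" "\<And>k. L k 0 = x0"
    "\<And>k. \<forall>s\<in>{0..1}. \<forall>t\<in>{0..1}. \<bar>s - t\<bar> < \<eta> k \<longrightarrow> clos (\<rho> k) (L k s) (L k t)"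
    by metis
  have LP: "L k t \<in> PFin" "q (L k t) = \<gamma> t" if "t \<in> {0..1}" for k t
    using L(2) that by (auto simp: lift_of_def)
  have zex: "\<exists>z. clos 0 (zact z (L k t)) (L (Suc k) t) \<and> z \<in> B (4 * \<rho> k)" if t: "t \<in> {0..1}" for k t
  proof -
    have ex: "\<exists>w. clos 0 (zact w (L k t)) (L (Suc k) t)" if "t \<in> {0..1}" for t
      using same_fibre[OF LP(1)[OF that] LP(1)[OF that]] LP(2)[OF that] by metis
    then obtain w where w: "clos 0 (zact w (L k t)) (L (Suc k) t)" using t by blast
    have "w \<in> B (4 * \<rho> k)"
    proof (rule lifts_comparison[of "min (\<eta> k) (\<eta> (Suc k))" "\<rho> k" "L k" "L (Suc k)" t])
      show "\<forall>s\<in>{0..1}. \<forall>t\<in>{0..1}. \<bar>s - t\<bar> < min (\<eta> k) (\<eta> (Suc k)) \<longrightarrow> clos (\<rho> k) (L (Suc k) s) (L (Suc k) t)"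
        using L(4)[of "Suc k"] \<rho>(2)[of k] by (auto intro: clos_mono)
      show "clos (\<rho> k) (L k 0) (L (Suc k) 0)" using clos_refl[of "\<rho> k" x0] \<rho>(1)[of k] by (simp add: L(3))
      show "\<exists>w. clos (\<rho> k) (zact w (L k t)) (L (Suc k) t)" if "t \<in> {0..1}" for t
        using ex[OF that] clos_mono[OF _ less_imp_le[OF \<rho>(1)[of k]]] by blast
      show "clos (\<rho> k) (zact w (L k t)) (L (Suc k) t)" using w \<rho>(1)[of k] by (auto intro: clos_mono)
      show "\<forall>s\<in>{0..1}. \<forall>t\<in>{0..1}. \<bar>s - t\<bar> < min (\<eta> k) (\<eta> (Suc k)) \<longrightarrow> clos (\<rho> k) (L k s) (L k t)"
        using L(4)[of k] by auto
    qed (use L(1) t in simp_all)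
    then show ?thesis using w by blast
  qed
  then obtain z where z: "\<And>t k. t \<in> {0..1} \<Longrightarrow> clos 0 (zact (z t k) (L k t)) (L (Suc k) t) \<and> z t k \<in> B (4 * \<rho> k)"
    by metis
  \<comment> \<open>The translation that takes the first approximate lift to the one at scale \<open>k\<close>.\<close>
  define c where "c t k = (\<Sum>j<k. z t j)" for t k
  have c: "clos 0 (zact (c t k) (L 0 t)) (L k t)" if t: "t \<in> {0..1}" for t k
  proof (induction k)
    case 0
    then show ?case by (simp add: c_def clos_refl)
  next
    case (Suc k)
    have "clos 0 (zact (z t k) (zact (c t k) (L 0 t))) (zact (z t k) (L k t))" using Suc clos_zact by blast
    from clos_trans[OF this] have "clos (0 + 0) (zact (z t k) (zact (c t k) (L 0 t))) (L (Suc k) t)" using z[OF t] by blast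
    then show ?case by (simp add: zact_zact c_def add.commute)
  qed
  have "\<exists>\<zeta>. \<forall>k. \<zeta> - c t k \<in> B (4 * \<rho> k)" if "t \<in> {0..1}" for t
  proof (rule spherical)
    show "c t (Suc k) - c t k \<in> B (4 * \<rho> k)" for k using z[OF that] by (simp add: c_def)
    show "decseq (\<lambda>k. 4 * \<rho> k)" using \<rho>(2) by (intro decseq_SucI) simp
  qed
  then obtain \<zeta> where \<zeta>: "\<And>t k. t \<in> {0..1} \<Longrightarrow> \<zeta> t - c t k \<in> B (4 * \<rho> k)" by metis
  define f where "f t = zact (\<zeta> t) (L 0 t)" for t
  have fin: "\<zeta> t \<in> Fin" if "t \<in> {0..1}" for t using \<zeta>[OF that, of 0] Fin_I by (simp add: c_def)
  have fL: "clos (4 * \<rho> k) (f t) (L k t)" if t: "t \<in> {0..1}" for t k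
  proof -
    have "clos (4 * \<rho> k) (zact (c t k) (L 0 t)) (zact (\<zeta> t - c t k) (zact (c t k) (L 0 t)))"
      using clos_zact_iff \<zeta>[OF t] \<rho>(1) by (simp add: less_imp_le)
    from clos_symD[OF this] have "clos (4 * \<rho> k) (f t) (zact (c t k) (L 0 t))" by (simp add: zact_zact f_def)
    from clos_trans[OF this c[OF t]] show ?thesis by simp
  qed
  have small: "\<exists>k. 9 * \<rho> k < e" if e0: "0 < e" for e
  proof -
    obtain k where "(1 / 2) ^ k < e / 9" using real_arch_pow_inv[of "e / 9" "1 / 2"] e0 by auto
    then show ?thesis unfolding \<rho>_def by (intro exI[of _ k]) auto
  qed
  have "lift_of \<gamma> f" unfolding lift_of_def f_def using LP zact_PFin q_zact fin by auto
  moreover have "continuous_on {0..1} (\<lambda>t. \<kappa> (f t))"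
  proof (rule continuous_on_\<kappa>)
    fix s e :: real assume s: "s \<in> {0..1}" and e: "0 < e"
    obtain k where k: "9 * \<rho> k < e" using small[OF e] by blast
    have "clos e (f s) (f t)" if "t \<in> {0..1}" "dist t s < \<eta> k" for t
    proof -
      have "clos (\<rho> k) (L k s) (L k t)" using L(4) s that by (auto simp: dist_real_def abs_minus_commute)
      from clos_trans[OF clos_trans[OF fL[OF s] this] clos_symD[OF fL[OF that(1)]]]
      have "clos (4 * \<rho> k + \<rho> k + 4 * \<rho> k) (f s) (f t)" .
      then show ?thesis using k by (auto intro: clos_mono)
    qed
    then show "\<forall>\<^sub>F t in at s within {0..1}. clos e (f s) (f t)"
      using L(1)[of k] unfolding eventually_at by (intro exI[of _ "\<eta> k"]) auto
  qed
  moreover have "clos e (f 0) x0" if e: "0 < e" for e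
  proof -
    obtain k where "9 * \<rho> k < e" using small[OF e] by blast
    then have "4 * \<rho> k \<le> e" using \<rho>(1)[of k] by linarith
    then show ?thesis using fL[of 0 k] L(3)[of k] by (auto intro: clos_mono)
  qed
  then have "\<kappa> (f 0) = \<kappa> x0" using clos_closed[of 0] \<kappa>_eq_iff by blast
  ultimately show ?thesis by blast
qed

text \<open>Lifts of nearby paths in the homotopy have nearby ends. Their corner translations differ by an element of \<open>B r\<close>, for
every \<open>r > 0\<close>, and this survives a finite number of steps because \<open>B r\<close> is a group.\<close>

theorem lift_end_invariant:
  fixes K :: "real \<times> real \<Rightarrow> 'y"
  assumes K: "continuous_map (top_of_set ({0..1} \<times> {0..1})) Y.mtopology K"
    and K0: "\<And>s. s \<in> {0..1} \<Longrightarrow> K (s, 0) = q x0" and K1: "\<And>s. s \<in> {0..1} \<Longrightarrow> K (s, 1) = q x0"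
    and x0: "x0 \<in> PFin"
    and f: "lift_of (\<lambda>t. K (0, t)) f" "continuous_on {0..1} (\<lambda>t. \<kappa> (f t))" "\<kappa> (f 0) = \<kappa> x0" "\<kappa> (f 1) = \<kappa> (zact z x0)"
    and g: "lift_of (\<lambda>t. K (1, t)) g" "continuous_on {0..1} (\<lambda>t. \<kappa> (g t))" "\<kappa> (g 0) = \<kappa> x0" "\<kappa> (g 1) = \<kappa> (zact z' x0)"
  shows "z' - z \<in> B 0"
proof -
  have pin: "pathin Y.mtopology (\<lambda>t. K (s, t))" if "s \<in> {0..1}" for s
  proof -
    have "continuous_map (top_of_set {0..1}) (top_of_set ({0..1} \<times> {0..1})) (\<lambda>t. (s, t))"
      using that by (auto intro!: continuous_intros)
    from continuous_map_compose[OF this K] show ?thesis by (simp add: pathin_def o_def)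
  qed
  have "\<exists>F \<zeta>. lift_of (\<lambda>t. K (s, t)) F \<and> continuous_on {0..1} (\<lambda>t. \<kappa> (F t)) \<and> \<kappa> (F 0) = \<kappa> x0 \<and> \<kappa> (F 1) = \<kappa> (zact \<zeta> x0)
     \<and> (s = 0 \<longrightarrow> \<zeta> = z) \<and> (s = 1 \<longrightarrow> \<zeta> = z')" if s: "s \<in> {0..1}" for s
  proof -
    consider "s = 0" | "s = 1" | "s \<noteq> 0" "s \<noteq> 1" by blast
    then show ?thesis
    proof cases
      case 1
      then show ?thesis using f by (intro exI[of _ f] exI[of _ z]) simp
    next
      case 2
      then show ?thesis using g by (intro exI[of _ g] exI[of _ z']) simp
    next
      case 3
      obtain F where F: "lift_of (\<lambda>t. K (s, t)) F" "continuous_on {0..1} (\<lambda>t. \<kappa> (F t))" "\<kappa> (F 0) = \<kappa> x0"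
        using path_lift[OF pin[OF s] x0] K0[OF s] by auto
      then have "F 1 \<in> PFin" "q x0 = q (F 1)" using K1[OF s] unfolding lift_of_def by auto
      from same_fibre[OF x0 this] obtain \<zeta> where "clos 0 (zact \<zeta> x0) (F 1)" by blast
      then have "\<kappa> (F 1) = \<kappa> (zact \<zeta> x0)" using \<kappa>_eq_iff by metis
      then show ?thesis using F 3 by blast
    qed
  qed
  \<comment> \<open>The lifts are chosen separately for each \<open>s\<close>, without any continuity in \<open>s\<close>.\<close>
  then obtain F \<zeta> where F: "\<And>s. s \<in> {0..1} \<Longrightarrow> lift_of (\<lambda>t. K (s, t)) (F s) \<and> continuous_on {0..1} (\<lambda>t. \<kappa> (F s t)) \<and>
      \<kappa> (F s 0) = \<kappa> x0 \<and> \<kappa> (F s 1) = \<kappa> (zact (\<zeta> s) x0) \<and> (s = 0 \<longrightarrow> \<zeta> s = z) \<and> (s = 1 \<longrightarrow> \<zeta> s = z')"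
    by metis
  have "z' - z \<in> B r" if r: "0 < r" for r
  proof -
    define \<rho> where "\<rho> = r / 4"
    have \<rho>: "0 < \<rho>" "0 < \<rho> / C" using r C_pos by (auto simp: \<rho>_def)
    obtain \<eta> where \<eta>: "0 < \<eta>" "\<And>x y. x \<in> {0..1} \<times> {0..1} \<Longrightarrow> y \<in> {0..1} \<times> {0..1} \<Longrightarrow> dist x y < \<eta> \<Longrightarrow> dY (K x) (K y) < \<rho> / C"
      using Y.uniformly_continuous_on_compact[OF compact_Times[OF compact_Icc compact_Icc] K \<rho>(2)] by blast
    have close: "\<zeta> s' - \<zeta> s \<in> B r" if ss: "s \<in> {0..1}" "s' \<in> {0..1}" "\<bar>s - s'\<bar> < \<eta>" for s s'
    proof -
      obtain \<eta>1 where \<eta>1: "0 < \<eta>1" "\<And>a b. a \<in> {0..1} \<Longrightarrow> b \<in> {0..1} \<Longrightarrow> \<bar>a - b\<bar> < \<eta>1 \<Longrightarrow> clos \<rho> (F s a) (F s b)"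
        using uniform_clos[of "F s"] F[OF ss(1)] \<rho>(1) by metis
      obtain \<eta>2 where \<eta>2: "0 < \<eta>2" "\<And>a b. a \<in> {0..1} \<Longrightarrow> b \<in> {0..1} \<Longrightarrow> \<bar>a - b\<bar> < \<eta>2 \<Longrightarrow> clos \<rho> (F s' a) (F s' b)"
        using uniform_clos[of "F s'"] F[OF ss(2)] \<rho>(1) by metis
      have "\<zeta> s' - \<zeta> s \<in> B (4 * \<rho>)"
      proof (rule lifts_comparison[of "min \<eta>1 \<eta>2" \<rho> "F s" "F s'" 1])
        show "\<exists>w. clos \<rho> (zact w (F s t)) (F s' t)" if t: "t \<in> {0..1}" for t
        proof -
          have P: "F s t \<in> PFin" "F s' t \<in> PFin" "q (F s t) = K (s, t)" "q (F s' t) = K (s', t)"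
            using F[OF ss(1)] F[OF ss(2)] t by (auto simp: lift_of_def)
          have "dist (s', t) (s, t) < \<eta>" using ss(3) by (simp add: dist_Pair_Pair dist_real_def abs_minus_commute)
          then have "dY (q (F s' t)) (q (F s t)) < \<rho> / C" using \<eta>(2) ss t P by simp
          then obtain w where "clos (C * (\<rho> / C)) (F s' t) (zact w (F s t))"
            using q_colipschitz[OF P(2,1)] by blast
          from clos_symD[OF this] show ?thesis using C_pos by auto
        qed
        have "clos 0 (F s 0) (F s' 0)" using F ss(1,2) \<kappa>_eq_iff by metis
        then show "clos \<rho> (F s 0) (F s' 0)" using \<rho>(1) by (auto intro: clos_mono)
        have 1: "clos 0 (F s 1) (zact (\<zeta> s) x0)" "clos 0 (zact (\<zeta> s') x0) (F s' 1)"
          using F[OF ss(1)] F[OF ss(2)] \<kappa>_eq_iff by metis+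
        have "clos 0 (zact (\<zeta> s' - \<zeta> s) (F s 1)) (zact (\<zeta> s' - \<zeta> s) (zact (\<zeta> s) x0))"
          using 1(1) clos_zact by blast
        then have "clos 0 (zact (\<zeta> s' - \<zeta> s) (F s 1)) (zact (\<zeta> s') x0)" by (simp add: zact_zact)
        from clos_trans[OF this 1(2)] show "clos \<rho> (zact (\<zeta> s' - \<zeta> s) (F s 1)) (F s' 1)"
          using \<rho>(1) by (auto intro: clos_mono)
      qed (use \<eta>1 \<eta>2 in auto)
      then show ?thesis by (simp add: \<rho>_def)
    qed
    obtain n where n: "0 < n" "1 / real n < \<eta>" using \<eta>(1) by (metis nat_approx_posE of_nat_0_less_iff zero_less_Suc of_nat_Suc)
    have "\<zeta> (real i / n) - \<zeta> 0 \<in> B r" if "i \<le> n" for i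
      using that
    proof (induction i)
      case (Suc i)
      have "\<zeta> (real (Suc i) / n) - \<zeta> (real i / n) \<in> B r"
        using Suc.prems n by (intro close) (auto simp: field_simps)
      from B_add[OF this Suc.IH] show ?case using Suc.prems by simp
    qed (simp add: B_0)
    from this[of n] n F[of 0] F[of 1] show ?thesis by simp
  qed
  then show ?thesis by (rule B_closed)
qed

end

section \<open>The fundamental group of the quotient\<close>

lemma loop_homotopy_refl: "f \<in> based_loops T p \<Longrightarrow> (f, f) \<in> loop_homotopy T p"
  by (simp add: loop_homotopy_def based_loops_def pathin_def)

lemma loop_homotopy_sym: "(f, g) \<in> loop_homotopy T p \<Longrightarrow> (g, f) \<in> loop_homotopy T p"
  by (simp add: loop_homotopy_def homotopic_with_symD)

lemma loop_homotopy_trans: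
  "(f, g) \<in> loop_homotopy T p \<Longrightarrow> (g, h) \<in> loop_homotopy T p \<Longrightarrow> (f, h) \<in> loop_homotopy T p"
  unfolding loop_homotopy_def by (auto intro: homotopic_with_trans)

lemma loop_homotopy_I:
  assumes "homotopic_with (\<lambda>h. h 0 = p \<and> h 1 = p) (top_of_set {0..1}) T f g"
  shows "(f, g) \<in> loop_homotopy T p"
  using assms homotopic_with_imp_continuous_maps[OF assms] homotopic_with_imp_property[OF assms]
  by (simp add: loop_homotopy_def based_loops_def pathin_def)

lemma loop_homotopy_cong:
  assumes "f \<in> based_loops T p" "\<And>t. t \<in> {0..1} \<Longrightarrow> f t = g t"
  shows "(f, g) \<in> loop_homotopy T p"
proof (rule loop_homotopy_I, rule homotopic_with_equal)
  show "g 0 = p \<and> g 1 = p" using assms(1) assms(2)[of 0] assms(2)[of 1] by (simp add: based_loops_def)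
qed (use assms in \<open>auto simp: based_loops_def pathin_def\<close>)

lemma loop_class_eq_iff:
  "f \<in> based_loops T p \<Longrightarrow> loop_homotopy T p `` {f} = loop_homotopy T p `` {g} \<longleftrightarrow> (f, g) \<in> loop_homotopy T p"
  using loop_homotopy_refl loop_homotopy_sym loop_homotopy_trans by (metis (no_types, lifting) Image_singleton_iff subsetI subset_antisym)

lemma loop_class_eqI: "(f, g) \<in> loop_homotopy T p \<Longrightarrow> loop_homotopy T p `` {f} = loop_homotopy T p `` {g}"
  using loop_homotopy_sym loop_homotopy_trans by (metis (no_types, lifting) Image_singleton_iff subsetI subset_antisym)

lemma concat_homotopy:
  assumes "(f, f') \<in> loop_homotopy T p" "(g, g') \<in> loop_homotopy T p"
  shows "(concat_paths f g, concat_paths f' g') \<in> loop_homotopy T p"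
proof -
  let ?Q = "{0..1::real} \<times> {0..1::real}"
  obtain h where h: "continuous_map (top_of_set ?Q) T h" "\<And>x. h (0, x) = f x" "\<And>x. h (1, x) = f' x"
    "\<And>t. t \<in> {0..1} \<Longrightarrow> h (t, 0) = p \<and> h (t, 1) = p"
    using assms(1) unfolding loop_homotopy_def homotopic_with_def by auto
  obtain k where k: "continuous_map (top_of_set ?Q) T k" "\<And>x. k (0, x) = g x" "\<And>x. k (1, x) = g' x"
    "\<And>t. t \<in> {0..1} \<Longrightarrow> k (t, 0) = p \<and> k (t, 1) = p"
    using assms(2) unfolding loop_homotopy_def homotopic_with_def by auto
  define H where "H x = (if snd x \<le> 1 / 2 then h (fst x, 2 * snd x) else k (fst x, 2 * snd x - 1))" for x
  have sub: "subtopology (top_of_set ?Q) {x \<in> topspace (top_of_set ?Q). P x} = top_of_set (?Q \<inter> {x. P x})" for P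
    unfolding subtopology_subtopology by (rule arg_cong[where f = "subtopology euclidean"]) auto
  have "continuous_map (top_of_set ?Q) T H"
    unfolding H_def
  proof (rule continuous_map_cases_le)
    have "continuous_map (top_of_set (?Q \<inter> {x. snd x \<le> 1 / 2})) (top_of_set ?Q) (\<lambda>x. (fst x, 2 * snd x))"
      unfolding continuous_map_subtopology_eu by (intro conjI continuous_intros) auto
    from continuous_map_compose[OF this h(1)]
    show "continuous_map (subtopology (top_of_set ?Q) {x \<in> topspace (top_of_set ?Q). snd x \<le> 1 / 2}) T
        (\<lambda>x. h (fst x, 2 * snd x))"
      unfolding sub o_def .
    have "continuous_map (top_of_set (?Q \<inter> {x. 1 / 2 \<le> snd x})) (top_of_set ?Q) (\<lambda>x. (fst x, 2 * snd x - 1))"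
      unfolding continuous_map_subtopology_eu by (intro conjI continuous_intros) auto
    from continuous_map_compose[OF this k(1)]
    show "continuous_map (subtopology (top_of_set ?Q) {x \<in> topspace (top_of_set ?Q). 1 / 2 \<le> snd x}) T
        (\<lambda>x. k (fst x, 2 * snd x - 1))"
      unfolding sub o_def .
    show "h (fst x, 2 * snd x) = k (fst x, 2 * snd x - 1)" if "x \<in> topspace (top_of_set ?Q)" "snd x = 1 / 2" for x
    proof -
      have "2 * snd x = 1" "2 * snd x - 1 = 0" "fst x \<in> {0..1}" using that by auto
      then show ?thesis using h(4) k(4) by simp
    qed
  next
    have "continuous_on ?Q snd" by (intro continuous_intros)
    then show "continuous_map (top_of_set ?Q) euclideanreal snd" by simp
  qed simp
  then show ?thesis
    using h k by (intro loop_homotopy_I) (auto simp: homotopic_with_def H_def concat_paths_def fun_eq_iff intro!: exI[of _ H])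
qed

lemma concat_based_loops: "f \<in> based_loops T p \<Longrightarrow> g \<in> based_loops T p \<Longrightarrow> concat_paths f g \<in> based_loops T p"
  using concat_homotopy[OF loop_homotopy_refl loop_homotopy_refl, of f T p g] by (simp add: loop_homotopy_def)

lemma fundamental_group_mult:
  assumes f: "f \<in> based_loops T p" and g: "g \<in> based_loops T p"
  shows "loop_homotopy T p `` {f} \<otimes>\<^bsub>fundamental_group T p\<^esub> loop_homotopy T p `` {g} =
    loop_homotopy T p `` {concat_paths f g}"
proof -
  let ?L = "loop_homotopy T p"
  have "?L `` {concat_paths f' g'} = ?L `` {concat_paths f g}" if "f' \<in> ?L `` {f}" "g' \<in> ?L `` {g}" for f' g'
    using loop_class_eqI[OF concat_homotopy[of f f' T p g g']] that by simp
  moreover have "f \<in> ?L `` {f}" "g \<in> ?L `` {g}" using f g loop_homotopy_refl by auto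
  ultimately have "(\<Union>f'\<in>?L `` {f}. \<Union>g'\<in>?L `` {g}. ?L `` {concat_paths f' g'}) = ?L `` {concat_paths f g}"
    by blast
  then show ?thesis by (simp add: fundamental_group_def)
qed

text \<open>The operation on homotopy classes is not assumed to be a group beforehand; everything is transported from
the additive group.\<close>

lemma comm_group_image:
  fixes \<Phi> :: "'z::ab_group_add \<Rightarrow> 'g"
  assumes Z: "add_closed Z" and car: "\<Phi> ` Z = carrier G" and one: "\<Phi> 0 = \<one>\<^bsub>G\<^esub>"
    and mult: "\<And>z w. z \<in> Z \<Longrightarrow> w \<in> Z \<Longrightarrow> \<Phi> z \<otimes>\<^bsub>G\<^esub> \<Phi> w = \<Phi> (z + w)"
  shows "comm_group G"
proof (rule comm_groupI)
  note c = add_closedD[OF Z]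
  have E: "\<exists>z\<in>Z. x = \<Phi> z" if "x \<in> carrier G" for x using that car by blast
  have I: "\<Phi> z \<in> carrier G" if "z \<in> Z" for z using that car by blast
  fix x assume "x \<in> carrier G"
  then obtain u where u: "u \<in> Z" "x = \<Phi> u" using E by blast
  show "\<one>\<^bsub>G\<^esub> \<otimes>\<^bsub>G\<^esub> x = x" using mult[OF c(1) u(1)] u(2) one by simp
  show "\<exists>y\<in>carrier G. y \<otimes>\<^bsub>G\<^esub> x = \<one>\<^bsub>G\<^esub>"
    using mult[OF c(3)[OF u(1)] u(1)] u(2) one I[OF c(3)[OF u(1)]] by (intro bexI[of _ "\<Phi> (- u)"]) auto
  fix y assume "y \<in> carrier G"
  then obtain v where v: "v \<in> Z" "y = \<Phi> v" using E by blast
  show "x \<otimes>\<^bsub>G\<^esub> y \<in> carrier G" using mult[OF u(1) v(1)] I[OF c(2)[OF u(1) v(1)]] u v by simp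
  show "x \<otimes>\<^bsub>G\<^esub> y = y \<otimes>\<^bsub>G\<^esub> x" using mult[OF u(1) v(1)] mult[OF v(1) u(1)] u v by (simp add: add.commute)
  fix z assume "z \<in> carrier G"
  then obtain w where w: "w \<in> Z" "z = \<Phi> w" using E by blast
  show "x \<otimes>\<^bsub>G\<^esub> y \<otimes>\<^bsub>G\<^esub> z = x \<otimes>\<^bsub>G\<^esub> (y \<otimes>\<^bsub>G\<^esub> z)"
    using mult[OF u(1) v(1)] mult[OF v(1) w(1)] mult[OF c(2)[OF u(1) v(1)] w(1)] mult[OF u(1) c(2)[OF v(1) w(1)]] u v w
    by (simp add: add.assoc)
next
  show "\<one>\<^bsub>G\<^esub> \<in> carrier G" using add_closedD(1)[OF Z] one car by (metis imageI)
qed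

context cone_quotient
begin

text \<open>The quotient map on the image of \<open>\<kappa>\<close>.\<close>

definition qb :: "('r point \<Rightarrow> real) \<Rightarrow> 'y" where
  "qb \<phi> = q (SOME x. x \<in> PFin \<and> \<kappa> x = \<phi>)"

lemma q_cong: assumes "x \<in> PFin" "y \<in> PFin" "\<kappa> x = \<kappa> y" shows "q x = q y"
proof -
  have "dY (q x) (q y) \<le> C * 0" using assms \<kappa>_eq_iff by (intro q_lipschitz) auto
  then show ?thesis using assms q_surj Y.nonneg[of "q x" "q y"] Y.zero by auto
qed

lemma qb_\<kappa> [simp]: assumes "x \<in> PFin" shows "qb (\<kappa> x) = q x"
proof -
  have "(SOME y. y \<in> PFin \<and> \<kappa> y = \<kappa> x) \<in> PFin \<and> \<kappa> (SOME y. y \<in> PFin \<and> \<kappa> y = \<kappa> x) = \<kappa> x"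
    by (rule someI[of _ x]) (use assms in simp)
  then show ?thesis unfolding qb_def using q_cong assms by blast
qed

lemma continuous_map_qb: "continuous_map (top_of_set (\<kappa> ` PFin)) Y.mtopology qb"
  unfolding Y.continuous_map_to_metric
proof (intro ballI allI impI)
  fix \<phi> and e :: real assume "\<phi> \<in> topspace (top_of_set (\<kappa> ` PFin))" and e: "0 < e"
  then obtain x where x: "x \<in> PFin" "\<phi> = \<kappa> x" by auto
  define \<delta> where "\<delta> = min 1 (e / (2 * C))"
  have "C * \<delta> \<le> C * (e / (2 * C))" using C_pos by (intro mult_left_mono) (simp_all add: \<delta>_def)
  then have \<delta>: "0 < \<delta>" "\<delta> \<le> 1" "C * \<delta> < e" using e C_pos by (simp_all add: \<delta>_def)
  let ?V = "{f :: 'r point \<Rightarrow> real. f x < \<delta>}"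
  have "open ?V"
    by (rule open_Collect_less[OF continuous_on_product_then_coordinatewise[OF continuous_on_id] continuous_on_const])
  moreover have "\<phi> \<in> ?V" using \<delta>(1) clos_refl[of 0 x] by (simp add: x(2) \<kappa>_def pd_0_iff[THEN iffD2])
  moreover have "qb f \<in> Y.mball (qb \<phi>) e" if f: "f \<in> \<kappa> ` PFin \<inter> ?V" for f
  proof -
    obtain y where y: "y \<in> PFin" "f = \<kappa> y" "pd y x < \<delta>" using f by (auto simp: \<kappa>_def)
    have "clos \<delta> x y" using pd_less[OF y(3) \<delta>(2)] clos_symD by blast
    then have "dY (q x) (q y) \<le> C * \<delta>" using q_lipschitz x y by blast
    then show ?thesis using x y \<delta>(3) q_surj by auto
  qed
  ultimately show "\<exists>U. openin (top_of_set (\<kappa> ` PFin)) U \<and> \<phi> \<in> U \<and> (\<forall>y\<in>U. qb y \<in> Y.mball (qb \<phi>) e)"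
    using x by (intro exI[of _ "\<kappa> ` PFin \<inter> ?V"]) auto
qed

lemma push_homotopy:
  assumes "homotopic_paths (\<kappa> ` PFin) f g" "qb (pathstart f) = p" "qb (pathfinish f) = p"
  shows "(qb \<circ> f, qb \<circ> g) \<in> loop_homotopy Y.mtopology p"
proof (rule loop_homotopy_I)
  show "homotopic_with (\<lambda>h. h 0 = p \<and> h 1 = p) (top_of_set {0..1}) Y.mtopology (qb \<circ> f) (qb \<circ> g)"
    by (rule homotopic_with_compose_continuous_map_left[OF assms(1)[unfolded homotopic_paths_def] continuous_map_qb])
      (use assms(2,3) in \<open>simp add: pathstart_def pathfinish_def\<close>)
qed

text \<open>The class \<open>\<Phi> z\<close> is the image of any path from a fixed point \<open>x\<close> to its translate by \<open>z\<close>. It is well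
defined since the model is simply connected, onto since loops lift, and its kernel is \<open>B 0\<close> since
the end of a lift is an invariant.\<close>

theorem fundamental_group_cone:
  assumes p: "p \<in> M"
  defines "G \<equiv> fundamental_group Y.mtopology p"
  shows "comm_group G \<and> (\<exists>\<Phi>. \<Phi> ` Fin = carrier G \<and> (\<forall>z\<in>Fin. \<forall>w\<in>Fin. \<Phi> z = \<Phi> w \<longleftrightarrow> w - z \<in> B 0))"
proof -
  let ?L = "loop_homotopy Y.mtopology p" and ?X = "\<kappa> ` PFin"
  obtain x where x: "x \<in> PFin" "q x = p" using p q_surj by blast
  define a where "a z = flat_arc x (zact z x)" for z
  have a: "path (a z)" "path_image (a z) \<subseteq> ?X" "pathstart (a z) = \<kappa> x" "pathfinish (a z) = \<kappa> (zact z x)"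
    if z: "z \<in> Fin" for z
  proof -
    obtain r where "z \<in> B r" using z by (auto simp: Fin_def)
    then have "z \<in> B (max r 0)" using B_mono by auto
    then have "clos (max r 0) x (zact z x)" by (simp add: clos_zact_iff)
    then show "path (a z)" "path_image (a z) \<subseteq> ?X" "pathstart (a z) = \<kappa> x" "pathfinish (a z) = \<kappa> (zact z x)"
      using flat_arc_path flat_arc_image x(1) unfolding a_def by blast+
  qed
  have qe: "qb (\<kappa> x) = p" "z \<in> Fin \<Longrightarrow> qb (\<kappa> (zact z x)) = p" for z
    using x zact_PFin q_zact by auto
  define \<Phi> where "\<Phi> z = ?L `` {qb \<circ> a z}" for z
  have push: "(qb \<circ> f, qb \<circ> g) \<in> ?L" if "z \<in> Fin" "path f" "path_image f \<subseteq> ?X" "pathstart f = \<kappa> x" "pathfinish f = \<kappa> (zact z x)"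
    "path g" "path_image g \<subseteq> ?X" "pathstart g = \<kappa> x" "pathfinish g = \<kappa> (zact z x)" for f g z
    using that qe by (intro push_homotopy paths_homotopic) simp_all
  have aL: "qb \<circ> a z \<in> based_loops Y.mtopology p" if "z \<in> Fin" for z
    using push[OF that a[OF that] a[OF that]] by (simp add: loop_homotopy_def)
  have mult: "\<Phi> z \<otimes>\<^bsub>G\<^esub> \<Phi> w = \<Phi> (z + w)" if zw: "z \<in> Fin" "w \<in> Fin" for z w
  proof -
    \<comment> \<open>Translation by \<open>z\<close> does not change the image in the quotient, so the concatenated loops lift to this path.\<close>
    let ?k = "a z +++ (tr (el14 z) \<circ> a w)"
    have tim: "path_image (tr (el14 z) \<circ> a w) \<subseteq> ?X"
    proof -
      have "tr (el14 z) f \<in> ?X" if "f \<in> ?X" for f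
        using that zact_PFin[OF zw(1)] by (auto simp: tr_\<kappa> simp flip: zact_def)
      then show ?thesis using a(2)[OF zw(2)] by (auto simp: path_image_compose)
    qed
    have tp: "path (tr (el14 z) \<circ> a w)" using a(1)[OF zw(2)] continuous_on_tr by (intro path_continuous_image) auto
    have te: "pathstart (tr (el14 z) \<circ> a w) = \<kappa> (zact z x)" "pathfinish (tr (el14 z) \<circ> a w) = \<kappa> (zact (z + w) x)"
      using a[OF zw(2)] by (simp_all add: pathstart_compose pathfinish_compose tr_\<kappa> flip: zact_def zact_zact)
    have "(qb \<circ> ?k, qb \<circ> a (z + w)) \<in> ?L"
      using a[OF zw(1)] a[OF Fin_add[OF zw]] tim tp te Fin_add[OF zw]
      by (intro push[of "z + w"]) (simp_all add: subset_path_image_join)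
    moreover have "(concat_paths (qb \<circ> a z) (qb \<circ> a w), qb \<circ> ?k) \<in> ?L"
    proof (rule loop_homotopy_cong)
      fix t :: real assume t: "t \<in> {0..1}"
      have "qb (tr (el14 z) f) = qb f" if "f \<in> ?X" for f
        using that zact_PFin[OF zw(1)] q_zact[OF zw(1)] by (auto simp: tr_\<kappa> simp flip: zact_def)
      moreover have "a w (2 * t - 1) \<in> ?X" if "t > 1 / 2"
        using a(2)[OF zw(2)] t that by (auto simp: path_image_def image_subset_iff)
      ultimately show "concat_paths (qb \<circ> a z) (qb \<circ> a w) t = (qb \<circ> ?k) t"
        by (auto simp: concat_paths_def joinpaths_def)
    qed (intro concat_based_loops aL zw)
    ultimately show ?thesis unfolding G_def \<Phi>_def fundamental_group_mult[OF aL[OF zw(1)] aL[OF zw(2)]]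
      by (intro loop_class_eqI) (rule loop_homotopy_trans)
  qed
  have eq: "\<Phi> z = \<Phi> w \<longleftrightarrow> w - z \<in> B 0" if zw: "z \<in> Fin" "w \<in> Fin" for z w
  proof
    assume "w - z \<in> B 0"
    then have "clos 0 (zact z x) (zact (w - z) (zact z x))" by (simp add: clos_zact_iff)
    then have "\<kappa> (zact z x) = \<kappa> (zact w x)" unfolding \<kappa>_eq_iff by (simp add: zact_zact)
    then have "(qb \<circ> a z, qb \<circ> a w) \<in> ?L" using a[OF zw(1)] a[OF zw(2)] by (intro push[OF zw(1)]) simp_all
    then show "\<Phi> z = \<Phi> w" unfolding \<Phi>_def by (rule loop_class_eqI)
  next
    assume "\<Phi> z = \<Phi> w"
    then have "(qb \<circ> a z, qb \<circ> a w) \<in> ?L" unfolding \<Phi>_def loop_class_eq_iff[OF aL[OF zw(1)]] .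
    then obtain K where K: "continuous_map (top_of_set ({0..1::real} \<times> {0..1::real})) Y.mtopology K"
      "\<And>t. K (0, t) = qb (a z t)" "\<And>t. K (1, t) = qb (a w t)" "\<And>s. s \<in> {0..1} \<Longrightarrow> K (s, 0) = p \<and> K (s, 1) = p"
      unfolding loop_homotopy_def homotopic_with_def by auto
    have lift: "\<exists>f. lift_of (\<lambda>t. qb (a z t)) f \<and> continuous_on {0..1} (\<lambda>t. \<kappa> (f t)) \<and> \<kappa> (f 0) = \<kappa> x \<and> \<kappa> (f 1) = \<kappa> (zact z x)"
      if z: "z \<in> Fin" for z
    proof -
      have "\<exists>v. v \<in> PFin \<and> \<kappa> v = a z t" if "t \<in> {0..1}" for t
        using a(2)[OF z] that by (force simp: path_image_def)
      then obtain f where f: "\<And>t. t \<in> {0..1} \<Longrightarrow> f t \<in> PFin \<and> \<kappa> (f t) = a z t" by metis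
      have "continuous_on {0..1} (\<lambda>t. \<kappa> (f t))"
        by (rule continuous_on_eq[OF a(1)[OF z, unfolded path_def]]) (use f in simp)
      moreover have "lift_of (\<lambda>t. qb (a z t)) f" unfolding lift_of_def using f qb_\<kappa> by metis
      ultimately show ?thesis using f[of 0] f[of 1] a(3,4)[OF z] by (intro exI[of _ f]) (simp add: pathstart_def pathfinish_def)
    qed
    obtain f where f: "lift_of (\<lambda>t. qb (a z t)) f" "continuous_on {0..1} (\<lambda>t. \<kappa> (f t))" "\<kappa> (f 0) = \<kappa> x" "\<kappa> (f 1) = \<kappa> (zact z x)"
      using lift[OF zw(1)] by blast
    obtain g where g: "lift_of (\<lambda>t. qb (a w t)) g" "continuous_on {0..1} (\<lambda>t. \<kappa> (g t))" "\<kappa> (g 0) = \<kappa> x" "\<kappa> (g 1) = \<kappa> (zact w x)"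
      using lift[OF zw(2)] by blast
    show "w - z \<in> B 0"
      by (rule lift_end_invariant[OF K(1) _ _ x(1), of f z g w]) (use K f g x(2) in simp_all)
  qed
  have one: "\<Phi> 0 = \<one>\<^bsub>G\<^esub>"
  proof -
    have "(qb \<circ> a 0, qb \<circ> (\<lambda>_. \<kappa> x)) \<in> ?L"
      using a[OF Fin_0] x(1) by (intro push[OF Fin_0]) (auto simp: path_def path_image_def pathstart_def pathfinish_def)
    then show ?thesis unfolding \<Phi>_def G_def fundamental_group_def using qe(1) by (simp add: loop_class_eqI o_def)
  qed
  have car: "\<Phi> ` Fin = carrier G"
  proof -
    have "\<Phi> z \<in> carrier G" if "z \<in> Fin" for z
      using aL[OF that] by (simp add: \<Phi>_def G_def fundamental_group_def quotientI)
    moreover have "c \<in> \<Phi> ` Fin" if c: "c \<in> carrier G" for c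
    proof -
      obtain \<gamma> where \<gamma>: "c = ?L `` {\<gamma>}" "\<gamma> \<in> based_loops Y.mtopology p"
        using c unfolding G_def fundamental_group_def by (auto elim: quotientE)
      then have \<gamma>p: "pathin Y.mtopology \<gamma>" "\<gamma> 0 = p" "\<gamma> 1 = p" by (auto simp: based_loops_def)
      obtain f where f: "lift_of \<gamma> f" "continuous_on {0..1} (\<lambda>t. \<kappa> (f t))" "\<kappa> (f 0) = \<kappa> x"
        using path_lift[OF \<gamma>p(1) x(1)] x(2) \<gamma>p(2) by auto
      have f1: "f 1 \<in> PFin" "q x = q (f 1)" using f(1) x(2) \<gamma>p(3) by (auto simp: lift_of_def)
      obtain z where z: "z \<in> Fin" "clos 0 (zact z x) (f 1)" using same_fibre[OF x(1) f1] by blast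
      let ?k = "\<lambda>t. \<kappa> (f t)"
      have k: "path ?k" "path_image ?k \<subseteq> ?X" "pathstart ?k = \<kappa> x" "pathfinish ?k = \<kappa> (zact z x)"
        using f z(2) by (auto simp: path_def path_image_def pathstart_def pathfinish_def lift_of_def \<kappa>_eq_iff[symmetric])
      have "(qb \<circ> ?k, qb \<circ> a z) \<in> ?L" by (rule push[OF z(1) k a[OF z(1)]])
      moreover have "(\<gamma>, qb \<circ> ?k) \<in> ?L"
        by (rule loop_homotopy_cong[OF \<gamma>(2)]) (use f(1) in \<open>simp add: lift_of_def\<close>)
      ultimately have "c = \<Phi> z" unfolding \<gamma>(1) \<Phi>_def by (intro loop_class_eqI) (rule loop_homotopy_trans)
      then show ?thesis using z(1) by blast
    qed
    ultimately show ?thesis by blast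
  qed
  have "add_closed Fin" by (simp add: add_closed_def Fin_0 Fin_add Fin_uminus)
  from comm_group_image[OF this car one mult] car eq show ?thesis by blast
qed

end

section \<open>Sizes in a locally compact field\<close>

lemma tendsto_inverse_field [tendsto_intros]:
  fixes f :: "'b \<Rightarrow> 'a::topological_field"
  assumes "(f \<longlongrightarrow> a) F" "a \<noteq> 0"
  shows "((\<lambda>x. inverse (f x)) \<longlongrightarrow> inverse a) F"
  using filterlim_compose[OF tendsto_inverse_nhds[OF assms(2)] assms(1)] .

lemma continuous_on_inverse_field:
  fixes f :: "'b::topological_space \<Rightarrow> 'a::topological_field"
  assumes "continuous_on A f" "\<And>x. x \<in> A \<Longrightarrow> f x \<noteq> 0"
  shows "continuous_on A (\<lambda>x. inverse (f x))"
  using assms unfolding continuous_on_def by (auto intro: tendsto_inverse_field)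

text \<open>The tube lemma for the multiplication.\<close>

lemma compact_mult_nhd_0:
  fixes C N :: "'k::topological_field set"
  assumes C: "compact C" and N: "open N" "0 \<in> N"
  obtains W where "open W" "0 \<in> W" "\<And>w c. w \<in> W \<Longrightarrow> c \<in> C \<Longrightarrow> w * c \<in> N"
proof -
  let ?P = "{p :: 'k \<times> 'k. fst p * snd p \<in> N}"
  have "continuous_on UNIV (\<lambda>p :: 'k \<times> 'k. fst p * snd p)" by (intro continuous_intros)
  from open_vimage[OF N(1) this] have "open ?P" by (simp add: vimage_def)
  then have "\<exists>U V. openin euclidean U \<and> openin euclidean V \<and> (0::'k) \<in> U \<and> C \<subseteq> V \<and> U \<times> V \<subseteq> ?P"
    using C N by (intro tube_lemma_right) auto
  then show ?thesis using that by fastforce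
qed

text \<open>A compact neighbourhood \<open>V\<close> of \<open>0\<close> and a scalar \<open>l\<close> that contracts it to \<open>0\<close>. They replace an absolute value.\<close>

locale contracted_field =
  fixes V :: "'k::topological_field set" and V0 :: "'k set" and l :: 'k
  assumes V: "compact V" "open V0" "0 \<in> V0" "V0 \<subseteq> V"
    and l: "l \<noteq> 0" "\<And>x. x \<in> V \<Longrightarrow> l * x \<in> V"
    and absorb: "\<And>x. \<exists>n. l ^ n * x \<in> V0"
    and shrink: "\<And>N. open N \<Longrightarrow> 0 \<in> N \<Longrightarrow> \<exists>n. \<forall>x\<in>V. l ^ n * x \<in> N"

lemma nondiscrete_nhd_0:
  assumes "(euclidean :: 'k::topological_field topology) \<noteq> discrete_topology UNIV" "open U" "(0::'k) \<in> U"
  shows "\<exists>x\<in>U. x \<noteq> 0"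
proof (rule ccontr)
  assume "\<not> ?thesis"
  then have U: "U = {0}" using assms(3) by auto
  have "open {x}" for x :: 'k
  proof -
    have "open ((\<lambda>y. y - x) -` U)" by (intro open_vimage assms(2) continuous_intros)
    moreover have "(\<lambda>y. y - x) -` U = {x}" by (auto simp: U)
    ultimately show ?thesis by simp
  qed
  then have "discrete_topology UNIV = (euclidean :: 'k topology)" by (simp add: discrete_topology_unique)
  then show False using assms(1) by simp
qed

text \<open>Nondiscreteness supplies a scalar \<open>l\<close> that maps a compact neighbourhood \<open>C\<close> of \<open>0\<close> into itself and misses a point \<open>c0\<close> of it. Were
the powers of \<open>l\<close> to have a nonzero cluster point, some quotient of two powers would bring \<open>c0\<close> back close to
itself, although it stays in the closed set \<open>l C\<close>.\<close>

theorem contracted_field_exists: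
  assumes lc: "locally_compact_space (euclidean :: 'k::topological_field topology)"
    and nd: "(euclidean :: 'k topology) \<noteq> discrete_topology UNIV"
  shows "\<exists>V V0 (l::'k). contracted_field V V0 l"
proof -
  have "\<exists>U C. open U \<and> compact C \<and> (0::'k) \<in> U \<and> U \<subseteq> C"
    using lc unfolding locally_compact_space_def topspace_euclidean open_openin[symmetric]
      compactin_euclidean_iff by (metis UNIV_I)
  then obtain U C where U: "open U" "compact C" "(0::'k) \<in> U" "U \<subseteq> C" by metis
  obtain c0 where c0: "c0 \<in> U" "c0 \<noteq> 0" using nondiscrete_nhd_0[OF nd U(1,3)] by blast
  have "open (U - {c0})" "0 \<in> U - {c0}" using U c0 by auto
  then obtain W where W: "open W" "0 \<in> W" "\<And>w c. w \<in> W \<Longrightarrow> c \<in> C \<Longrightarrow> w * c \<in> U - {c0}"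
    using compact_mult_nhd_0[OF U(2)] by metis
  \<comment> \<open>This \<open>l\<close> maps \<open>C\<close> into itself and misses \<open>c0\<close>.\<close>
  obtain l where l: "l \<in> W" "l \<noteq> 0" using nondiscrete_nhd_0[OF nd W(1,2)] by blast
  have lC: "l * c \<in> C" "l * c \<noteq> c0" if "c \<in> C" for c using W(3)[OF l(1) that] U(4) by auto
  have lnC: "l ^ n * c \<in> C" if "c \<in> C" for n c
    by (induction n) (use that lC(1) in \<open>auto simp: mult.assoc\<close>)
  have c0C: "c0 \<in> C" using c0 U by auto
  \<comment> \<open>The powers of \<open>l\<close> stay in the compact set \<open>C / c0\<close>; outside \<open>N\<close> they would accumulate at some \<open>\<mu> \<noteq> 0\<close>.\<close>
  have conv: "\<exists>n0. \<forall>n\<ge>n0. l ^ n \<in> N" if N: "open N" "0 \<in> N" for N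
  proof (rule ccontr)
    assume contra: "\<not> ?thesis"
    define F where "F = inf sequentially (principal {n. l ^ n \<notin> N})"
    have F: "F \<noteq> bot"
    proof
      assume "F = bot"
      then have "eventually (\<lambda>n. l ^ n \<in> N) sequentially"
        using eventually_inf_principal[of "\<lambda>_. False" sequentially "{n. l ^ n \<notin> N}"] by (simp add: F_def)
      then show False using contra by (simp add: eventually_sequentially)
    qed
    let ?D = "(\<lambda>c. c * inverse c0) ` C - N"
    have "compact ((\<lambda>c. c * inverse c0) ` C)" by (intro compact_continuous_image U(2) continuous_intros)
    then have cD: "compact ?D" using N(1) by (rule compact_diff)
    have "l ^ n \<in> (\<lambda>c. c * inverse c0) ` C" for n
      using lnC[OF c0C, of n] c0(2) by (intro image_eqI[of _ _ "l ^ n * c0"]) (auto simp: mult.assoc)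
    then have "eventually (\<lambda>n. l ^ n \<in> ?D) F" by (auto simp: F_def eventually_inf_principal)
    then have "eventually (\<lambda>x. x \<in> ?D) (filtermap (\<lambda>n. l ^ n) F)" by (simp add: eventually_filtermap)
    moreover have "filtermap (\<lambda>n. l ^ n) F \<noteq> bot" using F by (simp add: filtermap_bot_iff)
    ultimately obtain \<mu> where \<mu>: "\<mu> \<in> ?D" "inf (nhds \<mu>) (filtermap (\<lambda>n. l ^ n) F) \<noteq> bot"
      using cD unfolding compact_filter by blast
    have \<mu>0: "\<mu> \<noteq> 0" using \<mu>(1) N(2) by auto
    let ?E = "(\<lambda>c. l * c) ` C"
    have "compact ?E" by (intro compact_continuous_image U(2) continuous_intros)
    then have "open (- ?E)" by (intro open_Compl compact_imp_closed)
    moreover have "c0 \<in> - ?E" using lC(2) by auto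
    ultimately have "eventually (\<lambda>x. x \<in> - ?E) (nhds c0)" by (simp add: eventually_nhds) blast
    moreover have "((\<lambda>p. fst p * inverse (snd p) * c0) \<longlongrightarrow> c0) (nhds (\<mu>, \<mu>))"
    proof -
      have "((\<lambda>p. fst p * inverse (snd p) * c0) \<longlongrightarrow> \<mu> * inverse \<mu> * c0) (nhds (\<mu>, \<mu>))"
        by (intro tendsto_mult tendsto_inverse_field tendsto_const)
          (use \<mu>0 in \<open>auto intro: tendsto_fst tendsto_snd filterlim_ident intro!: tendsto_eq_intros\<close>)
      then show ?thesis using \<mu>0 by simp
    qed
    ultimately have "eventually (\<lambda>p. fst p * inverse (snd p) * c0 \<in> - ?E) (nhds \<mu> \<times>\<^sub>F nhds \<mu>)"
      unfolding nhds_prod[symmetric] filterlim_iff by blast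
    then obtain P Q where PQ: "eventually P (nhds \<mu>)" "eventually Q (nhds \<mu>)"
      "\<And>x y. P x \<Longrightarrow> Q y \<Longrightarrow> x * inverse y * c0 \<in> - ?E"
      unfolding eventually_prod_filter by auto
    have freq: "\<exists>n\<ge>n0. P (l ^ n) \<and> Q (l ^ n)" for n0
    proof (rule ccontr)
      assume "\<not> ?thesis"
      then have "eventually (\<lambda>n. \<not> (P (l ^ n) \<and> Q (l ^ n))) F"
        unfolding F_def eventually_inf_principal by (auto simp: eventually_sequentially intro!: exI[of _ n0])
      then have "eventually (\<lambda>x. \<not> (P x \<and> Q x)) (filtermap (\<lambda>n. l ^ n) F)" by (simp add: eventually_filtermap)
      moreover have "eventually (\<lambda>x. P x \<and> Q x) (nhds \<mu>)" using PQ by (simp add: eventually_conj)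
      ultimately have "eventually (\<lambda>x. False) (inf (nhds \<mu>) (filtermap (\<lambda>n. l ^ n) F))"
        unfolding eventually_inf by blast
      then show False using \<mu>(2) by (simp add: trivial_limit_def)
    qed
    obtain n where n: "Q (l ^ n)" using freq by blast
    obtain m where m: "m \<ge> Suc n" "P (l ^ m)" using freq by blast
    have "l ^ m = l ^ n * (l * l ^ (m - Suc n))" using m(1) by (simp flip: power_Suc power_add)
    then have "l ^ m * inverse (l ^ n) * c0 = (l ^ n * inverse (l ^ n)) * (l * (l ^ (m - Suc n) * c0))"
      by (simp only: ac_simps)
    also have "\<dots> = l * (l ^ (m - Suc n) * c0)" using l(2) by simp
    finally have "l ^ m * inverse (l ^ n) * c0 = l * (l ^ (m - Suc n) * c0)" .
    moreover have "l * (l ^ (m - Suc n) * c0) \<in> ?E" using lnC[OF c0C] by blast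
    ultimately have "l ^ m * inverse (l ^ n) * c0 \<in> ?E" by (simp only:)
    then show False using PQ(3)[OF m(2) n] by blast
  qed
  have "contracted_field C U l"
  proof
    fix N :: "'k set" assume N: "open N" "0 \<in> N"
    obtain W' where W': "open W'" "0 \<in> W'" "\<And>w c. w \<in> W' \<Longrightarrow> c \<in> C \<Longrightarrow> w * c \<in> N"
      using compact_mult_nhd_0[OF U(2) N] by metis
    then show "\<exists>n. \<forall>x\<in>C. l ^ n * x \<in> N" using conv[OF W'(1,2)] by blast
  next
    fix x :: 'k
    have "open ((\<lambda>y. y * x) -` U)" by (intro open_vimage U(1) continuous_intros)
    moreover have "0 \<in> (\<lambda>y. y * x) -` U" using U(3) by simp
    ultimately show "\<exists>n. l ^ n * x \<in> U" using conv by blast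
  qed (use U l lC in auto)
  then show ?thesis by blast
qed

context contracted_field
begin

text \<open>The logarithmic size of \<open>x\<close>, to the base \<open>1 / l\<close>, is at most \<open>m\<close>.\<close>

definition vb :: "int \<Rightarrow> 'k \<Rightarrow> bool" where "vb m x \<longleftrightarrow> l powi m * x \<in> V"

lemma zero_V: "0 \<in> V" using V by auto

lemma l_pow_V: "x \<in> V \<Longrightarrow> l ^ n * x \<in> V"
  by (induction n) (auto simp: mult.assoc l(2))

lemma vb_0: "vb m 0" using zero_V by (simp add: vb_def)

lemma powi_add: "l powi (a + b) = l powi a * l powi b"
  using l(1) by (simp add: power_int_add)

lemma vb_shift: "vb m (l powi j * x) \<longleftrightarrow> vb (m + j) x"
  by (simp add: vb_def powi_add mult.assoc)

lemma vb_mono: "vb m x \<Longrightarrow> m \<le> m' \<Longrightarrow> vb m' x"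
proof -
  assume "vb m x" "m \<le> m'"
  then have "l powi m' * x = l ^ nat (m' - m) * (l powi m * x)"
    using powi_add[of "m' - m" m] by (simp add: power_int_def mult.assoc)
  then show ?thesis using \<open>vb m x\<close> l_pow_V unfolding vb_def by (simp only:)
qed

text \<open>The open sets \<open>{x. l ^ n * x \<in> V0}\<close> cover the field.\<close>

lemma compact_bounded:
  assumes "compact K"
  shows "\<exists>c\<ge>0. \<forall>x\<in>K. vb c x"
proof -
  have "\<exists>D\<subseteq>UNIV. finite D \<and> K \<subseteq> (\<Union>n\<in>D. (\<lambda>x. l ^ n * x) -` V0)"
  proof (rule compactE_image[OF assms])
    show "open ((\<lambda>x. l ^ n * x) -` V0)" for n by (intro open_vimage V(2) continuous_intros)
    show "K \<subseteq> (\<Union>n\<in>UNIV. (\<lambda>x. l ^ n * x) -` V0)" using absorb by auto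
  qed blast
  then obtain D :: "nat set" where D: "finite D" "K \<subseteq> (\<Union>n\<in>D. (\<lambda>x. l ^ n * x) -` V0)" by blast
  have "vb (int (Max (insert 0 D))) x" if x: "x \<in> K" for x
  proof -
    obtain n where n: "n \<in> D" "l ^ n * x \<in> V0" using D(2) x by auto
    then have "vb (int n) x" using V(4) by (auto simp: vb_def)
    then show ?thesis by (rule vb_mono) (use D(1) n(1) in auto)
  qed
  then show ?thesis by (intro exI[of _ "int (Max (insert 0 D))"]) auto
qed

lemma compact_vb: "compact {x. vb m x}"
proof -
  have "x \<in> (\<lambda>y. l powi (- m) * y) ` V" if "vb m x" for x
    using that powi_add[of "- m" m] unfolding vb_def
    by (intro image_eqI[of _ _ "l powi m * x"]) (simp_all flip: mult.assoc)
  moreover have "vb m (l powi (- m) * y)" if "y \<in> V" for y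
    using that powi_add[of m "- m"] unfolding vb_def by (simp flip: mult.assoc)
  ultimately have "{x. vb m x} = (\<lambda>y. l powi (- m) * y) ` V" by blast
  then show ?thesis by (simp add: compact_continuous_image V(1) continuous_intros)
qed

lemma vb_exists: "\<exists>m\<ge>0. vb m x"
  using compact_bounded[of "{x}"] by auto

text \<open>One constant for the errors of all algebraic operations: each is the bound of a compact set. The last
estimate says that an element of exact size \<open>m\<close> has an inverse of size about \<open>-m\<close>.\<close>

lemma vb_constants:
  obtains c :: int where "0 \<le> c" "\<And>m x y. vb m x \<Longrightarrow> vb m y \<Longrightarrow> vb (m + c) (x + y)"
    "\<And>m x. vb m x \<Longrightarrow> vb (m + c) (- x)"
    "\<And>m j x y. vb m x \<Longrightarrow> vb j y \<Longrightarrow> vb (m + j + c) (x * y)"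
    "vb c 1"
    "\<And>m x. x \<noteq> 0 \<Longrightarrow> \<not> vb (m - 1) x \<Longrightarrow> vb m x \<Longrightarrow> vb (c - m) (inverse x)"
proof -
  have add: "compact ((\<lambda>p. fst p + snd p) ` (V \<times> V))"
    by (intro compact_continuous_image compact_Times V(1) continuous_intros)
  have mult: "compact ((\<lambda>p. fst p * snd p) ` (V \<times> V))"
    by (intro compact_continuous_image compact_Times V(1) continuous_intros)
  have minus: "compact (uminus ` V)"
    by (intro compact_continuous_image V(1) continuous_intros)
  obtain c1 where c1: "0 \<le> c1" "\<forall>z\<in>(\<lambda>p. fst p + snd p) ` (V \<times> V). vb c1 z"
    using compact_bounded[OF add] by blast
  obtain c2 where c2: "0 \<le> c2" "\<forall>z\<in>(\<lambda>p. fst p * snd p) ` (V \<times> V). vb c2 z"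
    using compact_bounded[OF mult] by blast
  obtain c3 where c3: "0 \<le> c3" "\<forall>z\<in>uminus ` V. vb c3 z"
    using compact_bounded[OF minus] by blast
  obtain c4 where c4: "0 \<le> c4" "vb c4 1" using vb_exists by blast
  let ?A = "V \<inter> - ((\<lambda>y. l powi (- 1) * y) -` V0)"
  have "open ((\<lambda>y. l powi (- 1) * y) -` V0)" by (intro open_vimage V(2) continuous_intros)
  then have "compact ?A" by (intro compact_Int_closed V(1)) auto
  moreover have "x \<noteq> 0" if "x \<in> ?A" for x using that V(3) by auto
  ultimately have "compact (inverse ` ?A)"
    by (intro compact_continuous_image continuous_on_inverse_field continuous_on_id)
  from compact_bounded[OF this] obtain c5 where c5: "0 \<le> c5" "\<forall>z\<in>inverse ` ?A. vb c5 z"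
    by (elim exE conjE)
  define c where "c = Max {c1, c2, c3, c4, c5}"
  have c: "c1 \<le> c" "c2 \<le> c" "c3 \<le> c" "c4 \<le> c" "c5 \<le> c" unfolding c_def by simp_all
  show ?thesis
  proof
    show "0 \<le> c" using c1 c by simp
    show "vb c 1" using c4 c vb_mono by blast
    show "vb (m + c) (x + y)" if "vb m x" "vb m y" for m x y
    proof -
      have "l powi m * x + l powi m * y \<in> (\<lambda>p. fst p + snd p) ` (V \<times> V)"
        using that unfolding vb_def by (intro image_eqI[of _ _ "(l powi m * x, l powi m * y)"]) auto
      then have "vb c (l powi m * x + l powi m * y)" using c1(2) c(1) vb_mono by blast
      then show ?thesis using vb_shift[of c m "x + y"] by (simp add: distrib_left add.commute)
    qed
    show "vb (m + c) (- x)" if "vb m x" for m x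
    proof -
      have "vb c (- (l powi m * x))" using c3(2) that c(3) vb_mono unfolding vb_def[of m] by blast
      then show ?thesis using vb_shift[of c m "- x"] by (simp add: add.commute)
    qed
    show "vb (m + j + c) (x * y)" if "vb m x" "vb j y" for m j x y
    proof -
      have "(l powi m * x) * (l powi j * y) \<in> (\<lambda>p. fst p * snd p) ` (V \<times> V)"
        using that unfolding vb_def by (intro image_eqI[of _ _ "(l powi m * x, l powi j * y)"]) auto
      then have "vb c ((l powi m * x) * (l powi j * y))" using c2(2) c(2) vb_mono by blast
      then show ?thesis using vb_shift[of c "m + j" "x * y"] by (simp add: powi_add ac_simps)
    qed
    show "vb (c - m) (inverse x)" if x: "x \<noteq> 0" "\<not> vb (m - 1) x" "vb m x" for m x
    proof -
      have "l powi m * x \<in> ?A"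
        using x V(4) powi_add[of "- 1" m] by (auto simp: vb_def simp flip: mult.assoc)
      then have "vb c5 (inverse (l powi m * x))" using c5(2) by (metis imageI)
      then have "vb c (inverse (l powi m * x))" using c(5) vb_mono by blast
      then have "vb c (l powi (- m) * inverse x)" by (simp add: power_int_minus)
      then show ?thesis using vb_shift[of c "- m"] by simp
    qed
  qed
qed

lemma vb_unbounded_below:
  assumes "x \<noteq> 0" shows "\<exists>m. \<not> vb m x"
proof (rule ccontr)
  assume "\<not> ?thesis"
  then have a: "vb m x" for m by blast
  have "open (- {x})" "0 \<in> - {x}" using assms by auto
  then obtain n where n: "\<forall>v\<in>V. l ^ n * v \<in> - {x}" using shrink by blast
  have "l powi (- int n) * x \<in> V" using a[of "- int n"] by (simp add: vb_def)
  moreover have "l ^ n * (l powi (- int n) * x) = x" using l(1) by (simp add: power_int_minus field_simps)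
  ultimately show False using n by (metis ComplD insertI1)
qed

text \<open>The exact size; the value at \<open>0\<close> is a default.\<close>

definition \<nu> :: "'k \<Rightarrow> int" where "\<nu> x = (if x = 0 then 0 else (THE m. vb m x \<and> \<not> vb (m - 1) x))"

lemma \<nu>_props:
  assumes x: "x \<noteq> 0"
  shows "vb m x \<longleftrightarrow> \<nu> x \<le> m"
proof -
  obtain m0 where m0: "\<not> vb m0 x" using vb_unbounded_below[OF x] by blast
  obtain m1 where m1: "vb m1 x" using vb_exists by blast
  have less: "m0 < m" if "vb m x" for m using that m0 vb_mono by (meson not_le)
  have "\<exists>k. vb (m0 + int k) x" using m1 less[OF m1] by (intro exI[of _ "nat (m1 - m0)"]) simp
  then obtain k where k: "vb (m0 + int k) x" "\<And>j. j < k \<Longrightarrow> \<not> vb (m0 + int j) x"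
    using exists_least_iff[of "\<lambda>k. vb (m0 + int k) x"] by blast
  have "k \<noteq> 0" using k(1) m0 by (metis add_0_right of_nat_0)
  then have k1: "\<not> vb (m0 + int k - 1) x" using k(2)[of "k - 1"] by (simp add: of_nat_diff algebra_simps)
  have "\<nu> x = m0 + int k"
    unfolding \<nu>_def using x
  proof (simp, intro the_equality)
    show "vb (m0 + int k) x \<and> \<not> vb (m0 + int k - 1) x" using k(1) k1 by blast
    fix m assume m: "vb m x \<and> \<not> vb (m - 1) x"
    show "m = m0 + int k"
      using m k(1) k1 vb_mono[of m x "m0 + int k - 1"] vb_mono[of "m0 + int k" x "m - 1"] by linarith
  qed
  then show ?thesis using k(1) k1 vb_mono[of m x "m0 + int k - 1"] vb_mono[of "m0 + int k" x m] by linarith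
qed

text \<open>An element of \<open>V\<close> is determined by approximations from finite sets, one for each precision, and every element
is brought into \<open>V\<close> by a power of \<open>l\<close>.\<close>

lemma code_exists: "\<exists>code :: 'k \<Rightarrow> nat \<Rightarrow> nat. inj code"
proof -
  obtain c where c: "0 \<le> c" "\<And>m x y. vb m x \<Longrightarrow> vb m y \<Longrightarrow> vb (m + c) (x + y)"
    "\<And>m x. vb m x \<Longrightarrow> vb (m + c) (- x)"
    using vb_constants by metis
  have "\<exists>F. finite F \<and> V \<subseteq> (\<Union>f\<in>F. (\<lambda>x. l powi (- int n) * (x - f)) -` V0)" for n
  proof -
    have "\<exists>F\<subseteq>V. finite F \<and> V \<subseteq> (\<Union>f\<in>F. (\<lambda>x. l powi (- int n) * (x - f)) -` V0)"
    proof (rule compactE_image[OF V(1)])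
      show "open ((\<lambda>x. l powi (- int n) * (x - f)) -` V0)" for f by (intro open_vimage V(2) continuous_intros)
      show "V \<subseteq> (\<Union>f\<in>V. (\<lambda>x. l powi (- int n) * (x - f)) -` V0)" using V(3) by auto
    qed blast
    then show ?thesis by blast
  qed
  then obtain F where F: "\<And>n. finite (F n)" "\<And>n. V \<subseteq> (\<Union>f\<in>F n. (\<lambda>x. l powi (- int n) * (x - f)) -` V0)"
    by metis
  have "\<exists>f. x \<in> V \<longrightarrow> f \<in> F n \<and> vb (- int n) (x - f)" for x n
    using F(2)[of n] V(4) by (fastforce simp: vb_def)
  then obtain g where g: "\<And>x n. x \<in> V \<Longrightarrow> g x n \<in> F n \<and> vb (- int n) (x - g x n)" by metis
  have cF: "countable (\<Union>n. F n)" using F(1) by (simp add: countable_finite)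
  define k where "k x = (SOME n. l ^ n * x \<in> V)" for x
  have k: "l ^ k x * x \<in> V" for x
  proof -
    have "\<exists>n. l ^ n * x \<in> V" using absorb[of x] V(4) by blast
    from someI_ex[OF this] show ?thesis by (simp add: k_def)
  qed
  define code where "code x n = (case n of 0 \<Rightarrow> k x | Suc m \<Rightarrow> to_nat_on (\<Union>n. F n) (g (l ^ k x * x) m))" for x n
  have "inj code"
  proof (rule injI)
    fix x y assume eq: "code x = code y"
    have kk: "k x = k y" using fun_cong[OF eq, of 0] by (simp add: code_def)
    let ?x = "l ^ k x * x" and ?y = "l ^ k y * y"
    have gg: "g ?x m = g ?y m" for m
    proof -
      have "to_nat_on (\<Union>n. F n) (g ?x m) = to_nat_on (\<Union>n. F n) (g ?y m)"
        using fun_cong[OF eq, of "Suc m"] by (simp add: code_def)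
      moreover have "g ?x m \<in> (\<Union>n. F n)" "g ?y m \<in> (\<Union>n. F n)" using g k by blast+
      ultimately show ?thesis using cF by (simp add: inj_on_to_nat_on[THEN inj_on_eq_iff])
    qed
    have small: "vb (- int m + c + c) (?x - ?y)" for m
    proof -
      have "vb (- int m + c) (?x - g ?x m)" "vb (- int m + c) (- (?y - g ?y m))"
        using g[OF k, of x m] c(3)[OF conjunct2[OF g[OF k, of y m]]] c(1) vb_mono[of "- int m" _ "- int m + c"] by simp_all
      from c(2)[OF this] show ?thesis using gg[of m] by simp
    qed
    have "vb m (?x - ?y)" for m
      by (rule vb_mono[OF small[of "nat (c + c - m)"]]) simp
    then have "?x = ?y" using vb_unbounded_below[of "?x - ?y"] by auto
    then show "x = y" using kk l(1) by simp
  qed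
  then show ?thesis by blast
qed

lemma sequences_lepoll_reals: "(UNIV :: (nat \<Rightarrow> 'k) set) \<lesssim> (UNIV :: real set)"
proof -
  obtain code :: "'k \<Rightarrow> nat \<Rightarrow> nat" where code: "inj code" using code_exists by blast
  define f where "f X = {prod_encode (n, prod_encode (m, code (X n) m)) |n m. True}" for X
  have "inj f"
  proof (rule injI, rule ext, rule injD[OF code], rule ext)
    fix X Y n m assume "f X = f Y"
    moreover have "prod_encode (n, prod_encode (m, code (X n) m)) \<in> f X" unfolding f_def by blast
    ultimately show "code (X n) m = code (Y n) m" unfolding f_def by auto
  qed
  then have "(UNIV :: (nat \<Rightarrow> 'k) set) \<lesssim> (UNIV :: nat set set)" unfolding lepoll_def by blast
  then show ?thesis using nat_sets_eqpoll_reals lepoll_trans2 by blast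
qed

end

section \<open>Growth rates of sequences along an ultrafilter\<close>

locale growth = contracted_field V V0 l for V V0 :: "'k::topological_field set" and l :: 'k +
  fixes \<omega> :: "nat filter"
  assumes ultrafilter: "nonprincipal_ultrafilter_on {1..} \<omega>"
begin

lemma omega_nontrivial: "\<omega> \<noteq> bot"
  using ultrafilter by (simp add: nonprincipal_ultrafilter_on_def)

lemma omega_ultra: "eventually P \<omega> \<or> eventually (\<lambda>x. \<not> P x) \<omega>"
  using ultrafilter by (simp add: nonprincipal_ultrafilter_on_def)

lemma omega_large: "eventually (\<lambda>n. N \<le> n) \<omega>"
proof -
  have "eventually (\<lambda>n. n \<noteq> a) \<omega>" for a
  proof (rule ccontr)
    assume "\<not> eventually (\<lambda>n. n \<noteq> a) \<omega>"
    then have a: "eventually (\<lambda>n. n = a) \<omega>" using omega_ultra[of "\<lambda>n. n \<noteq> a"] by simp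
    have pos: "eventually (\<lambda>n. n \<in> {1..}) \<omega>"
      using ultrafilter by (auto simp: nonprincipal_ultrafilter_on_def le_principal)
    have "\<exists>n. n = a \<and> n \<in> {1..}"
      using eventually_happens'[OF omega_nontrivial eventually_conj[OF a pos]] .
    then have a1: "a \<in> {1..}" by blast
    have "\<omega> = principal {a}"
    proof (rule antisym)
      show "\<omega> \<le> principal {a}" using a by (simp add: le_principal)
      show "principal {a} \<le> \<omega>"
      proof (rule filter_leI)
        fix P assume "eventually P \<omega>"
        then have "eventually (\<lambda>n. P n \<and> n = a) \<omega>" using a by (rule eventually_conj)
        from eventually_happens'[OF omega_nontrivial this] show "eventually P (principal {a})"
          by (auto simp: eventually_principal)
      qed
    qed
    then show False using ultrafilter a1 unfolding nonprincipal_ultrafilter_on_def by blast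
  qed
  then have "eventually (\<lambda>n. \<forall>a\<in>{..<N}. n \<noteq> a) \<omega>" by (intro eventually_ball_finite) auto
  then show ?thesis by eventually_elim (metis lessThan_iff not_le)
qed

lemma omega_sequentially: "\<omega> \<le> sequentially"
  using omega_large unfolding le_filter_def eventually_sequentially
  by (metis (mono_tags, lifting) eventually_mono)

lemma omega_linear:
  assumes \<epsilon>: "0 < \<epsilon>"
  shows "eventually (\<lambda>n. c \<le> \<epsilon> * real n) \<omega>"
proof -
  obtain N where N: "c / \<epsilon> \<le> real N" using real_arch_simple by blast
  show ?thesis
    using omega_large[of N]
  proof eventually_elim
    case (elim n)
    then have "c / \<epsilon> \<le> real n" using N by linarith
    then show ?case using \<epsilon> by (simp add: pos_divide_le_eq mult.commute)
  qed
qed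

text \<open>Sequences of exponential growth rate at most \<open>r\<close> along the ultrafilter. Constant factors disappear in the
\<open>\<epsilon>\<close>, so that \<open>B\<close> satisfies the exact laws of \<^locale>\<open>valued_ring\<close>.\<close>

definition B :: "real \<Rightarrow> (nat \<Rightarrow> 'k) set" where
  "B r = {x. \<forall>\<epsilon>>0. eventually (\<lambda>n. vb \<lfloor>(r + \<epsilon>) * real n\<rfloor> (x n)) \<omega>}"

lemma B_I: "(\<And>\<epsilon>. 0 < \<epsilon> \<Longrightarrow> eventually (\<lambda>n. vb \<lfloor>(r + \<epsilon>) * real n\<rfloor> (x n)) \<omega>) \<Longrightarrow> x \<in> B r"
  by (simp add: B_def)
lemma B_D: "x \<in> B r \<Longrightarrow> 0 < \<epsilon> \<Longrightarrow> eventually (\<lambda>n. vb \<lfloor>(r + \<epsilon>) * real n\<rfloor> (x n)) \<omega>"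
  by (simp add: B_def)

lemma one_notin_B: "r < 0 \<Longrightarrow> 1 \<notin> B r"
proof
  assume r: "r < 0" and "1 \<in> B r"
  from B_D[OF this(2), of "- r / 2"] have ev: "eventually (\<lambda>n. vb \<lfloor>(r / 2) * real n\<rfloor> 1) \<omega>"
    using r by simp
  obtain m where m: "\<not> vb m (1::'k)" using vb_unbounded_below[of 1] by auto
  have "eventually (\<lambda>n. - of_int m \<le> (- r / 2) * real n) \<omega>" using r by (intro omega_linear) simp
  with ev have "eventually (\<lambda>n. False) \<omega>"
  proof eventually_elim
    case (elim n)
    then have "\<lfloor>(r / 2) * real n\<rfloor> \<le> m" by linarith
    then show ?case using elim(1) m vb_mono by blast
  qed
  then show False using omega_nontrivial by simp
qed

text \<open>A sequence of growth rate exactly \<open>a\<close>, with its inverse.\<close>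

definition scale :: "real \<Rightarrow> nat \<Rightarrow> 'k" where "scale a n = l powi (- \<lfloor>a * real n\<rfloor>)"

definition scale' :: "real \<Rightarrow> nat \<Rightarrow> 'k" where "scale' a n = l powi \<lfloor>a * real n\<rfloor>"

lemma scale_scale': "scale a * scale' a = 1"
  using l(1) by (auto simp: scale_def scale'_def fun_eq_iff simp flip: powi_add)

lemma scale_B: "scale r \<in> B r" "scale' r \<in> B (- r)"
proof -
  obtain c where c: "0 \<le> c" "vb c 1" using vb_constants by metis
  have lin: "eventually (\<lambda>n. real_of_int c + 3 \<le> \<epsilon> * real n) \<omega>" if "0 < \<epsilon>" for \<epsilon>
    by (rule omega_linear[OF that])
  show "scale r \<in> B r"
    proof (rule B_I)
      fix \<epsilon> :: real assume \<epsilon>: "0 < \<epsilon>"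
      show "eventually (\<lambda>n. vb \<lfloor>(r + \<epsilon>) * real n\<rfloor> (scale r n)) \<omega>"
        using lin[OF \<epsilon>]
      proof eventually_elim
        case (elim n)
        have "c \<le> \<lfloor>(r + \<epsilon>) * real n\<rfloor> + - \<lfloor>r * real n\<rfloor>" using elim by (simp add: distrib_right) linarith
        from vb_mono[OF c(2) this] show ?case
          using vb_shift[of "\<lfloor>(r + \<epsilon>) * real n\<rfloor>" "- \<lfloor>r * real n\<rfloor>" 1] by (simp add: scale_def)
      qed
    qed
  show "scale' r \<in> B (- r)"
    proof (rule B_I)
      fix \<epsilon> :: real assume \<epsilon>: "0 < \<epsilon>"
      show "eventually (\<lambda>n. vb \<lfloor>(- r + \<epsilon>) * real n\<rfloor> (scale' r n)) \<omega>"
        using lin[OF \<epsilon>]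
      proof eventually_elim
        case (elim n)
        have "(- r + \<epsilon>) * real n = \<epsilon> * real n - r * real n" by (simp add: algebra_simps)
        then have "c \<le> \<lfloor>(- r + \<epsilon>) * real n\<rfloor> + \<lfloor>r * real n\<rfloor>" using elim by linarith
        from vb_mono[OF c(2) this] show ?case
          using vb_shift[of "\<lfloor>(- r + \<epsilon>) * real n\<rfloor>" "\<lfloor>r * real n\<rfloor>" 1] by (simp add: scale'_def)
      qed
    qed
qed

sublocale valued_ring B
proof
  obtain c where c: "0 \<le> c" "\<And>m x y. vb m x \<Longrightarrow> vb m y \<Longrightarrow> vb (m + c) (x + y)"
    "\<And>m x. vb m x \<Longrightarrow> vb (m + c) (- x)"
    "\<And>m j x y. vb m x \<Longrightarrow> vb j y \<Longrightarrow> vb (m + j + c) (x * y)" "vb c 1"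
    using vb_constants by metis
  have lin: "eventually (\<lambda>n. real_of_int c + 3 \<le> \<epsilon> * real n) \<omega>" if "0 < \<epsilon>" for \<epsilon>
    by (rule omega_linear[OF that])
  fix r s :: real and x y :: "nat \<Rightarrow> 'k"
  show "0 \<in> B r" by (rule B_I) (simp add: vb_0)
  show "x + y \<in> B r" if xy: "x \<in> B r" "y \<in> B r"
  proof (rule B_I)
    fix \<epsilon> :: real assume \<epsilon>: "0 < \<epsilon>"
    show "eventually (\<lambda>n. vb \<lfloor>(r + \<epsilon>) * real n\<rfloor> ((x + y) n)) \<omega>"
      using B_D[OF xy(1) half_gt_zero[OF \<epsilon>]] B_D[OF xy(2) half_gt_zero[OF \<epsilon>]] lin[OF half_gt_zero[OF \<epsilon>]]
    proof eventually_elim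
      case (elim n)
      have "(r + \<epsilon>) * real n = (r + \<epsilon> / 2) * real n + \<epsilon> / 2 * real n" by (simp add: algebra_simps)
      then have "\<lfloor>(r + \<epsilon> / 2) * real n\<rfloor> + c \<le> \<lfloor>(r + \<epsilon>) * real n\<rfloor>" using elim(3) by linarith
      from vb_mono[OF c(2)[OF elim(1,2)] this] show ?case by simp
    qed
  qed
  show "- x \<in> B r" if x: "x \<in> B r"
  proof (rule B_I)
    fix \<epsilon> :: real assume \<epsilon>: "0 < \<epsilon>"
    show "eventually (\<lambda>n. vb \<lfloor>(r + \<epsilon>) * real n\<rfloor> ((- x) n)) \<omega>"
      using B_D[OF x half_gt_zero[OF \<epsilon>]] lin[OF half_gt_zero[OF \<epsilon>]]
    proof eventually_elim
      case (elim n)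
      have "(r + \<epsilon>) * real n = (r + \<epsilon> / 2) * real n + \<epsilon> / 2 * real n" by (simp add: algebra_simps)
      then have "\<lfloor>(r + \<epsilon> / 2) * real n\<rfloor> + c \<le> \<lfloor>(r + \<epsilon>) * real n\<rfloor>" using elim(2) by linarith
      from vb_mono[OF c(3)[OF elim(1)] this] show ?case by simp
    qed
  qed
  show "x * y \<in> B (r + s)" if xy: "x \<in> B r" "y \<in> B s"
  proof (rule B_I)
    fix \<epsilon> :: real assume "0 < \<epsilon>"
    then have \<epsilon>: "0 < \<epsilon> / 3" by simp
    show "eventually (\<lambda>n. vb \<lfloor>(r + s + \<epsilon>) * real n\<rfloor> ((x * y) n)) \<omega>"
      using B_D[OF xy(1) \<epsilon>] B_D[OF xy(2) \<epsilon>] lin[OF \<epsilon>]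
    proof eventually_elim
      case (elim n)
      have "(r + s + \<epsilon>) * real n = (r + \<epsilon> / 3) * real n + (s + \<epsilon> / 3) * real n + \<epsilon> / 3 * real n"
        by (simp add: algebra_simps)
      then have "\<lfloor>(r + \<epsilon> / 3) * real n\<rfloor> + \<lfloor>(s + \<epsilon> / 3) * real n\<rfloor> + c \<le> \<lfloor>(r + s + \<epsilon>) * real n\<rfloor>"
        using elim(3) by linarith
      from vb_mono[OF c(4)[OF elim(1,2)] this] show ?case by simp
    qed
  qed
  show "x \<in> B s" if "x \<in> B r" "r \<le> s"
  proof (rule B_I)
    fix \<epsilon> :: real assume \<epsilon>: "0 < \<epsilon>"
    show "eventually (\<lambda>n. vb \<lfloor>(s + \<epsilon>) * real n\<rfloor> (x n)) \<omega>"
      using B_D[OF that(1) \<epsilon>]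
    proof eventually_elim
      case (elim n)
      then show ?case by (rule vb_mono) (use that(2) in \<open>intro floor_mono mult_right_mono, auto\<close>)
    qed
  qed
  show "x \<in> B r" if "\<And>s. r < s \<Longrightarrow> x \<in> B s"
  proof (rule B_I)
    fix \<epsilon> :: real assume \<epsilon>: "0 < \<epsilon>"
    have "x \<in> B (r + \<epsilon> / 2)" using that \<epsilon> by simp
    from B_D[OF this half_gt_zero[OF \<epsilon>]] show "eventually (\<lambda>n. vb \<lfloor>(r + \<epsilon>) * real n\<rfloor> (x n)) \<omega>"
      by (simp add: add.commute)
  qed
  show "\<exists>t\<in>B r. \<exists>t'\<in>B (- r). t * t' = 1" using scale_B scale_scale' by blast
qed

text \<open>A diagonal sequence: at the place \<open>n\<close> use the last centre \<open>c k\<close> with \<open>k \<le> n\<close> that is consistent with all earlier balls up to the error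
\<open>1 / (k + 1)\<close>. Every \<open>k\<close> is admissible at \<open>\<omega>\<close>-almost all places.\<close>

lemma nested_balls:
  fixes c :: "nat \<Rightarrow> nat \<Rightarrow> 'k"
  assumes c: "\<And>k. c (Suc k) - c k \<in> B (r k)" and r: "decseq r"
  shows "\<exists>z. \<forall>k. z - c k \<in> B (r k)"
proof -
  have cc: "c j - c i \<in> B (r i)" if "i \<le> j" for i j
    using that
  proof (induction j rule: dec_induct)
    case base
    show ?case using B_0 by (metis diff_self)
  next
    case (step j)
    have "c (Suc j) - c j \<in> B (r i)" using c[of j] r step(1) B_mono unfolding decseq_def by blast
    from B_add[OF this step.IH] show ?case by (simp only: add_diff_eq diff_add_cancel)
  qed
  define A where "A k n \<longleftrightarrow> k \<le> n \<and> (\<forall>i\<le>k. vb \<lfloor>(r i + 1 / (real k + 1)) * real n\<rfloor> (c k n - c i n))" for k n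
  have evA: "eventually (A k) \<omega>" for k
  proof -
    have "eventually (\<lambda>n. \<forall>i\<in>{..k}. vb \<lfloor>(r i + 1 / (real k + 1)) * real n\<rfloor> (c k n - c i n)) \<omega>"
    proof (intro eventually_ball_finite ballI)
      fix i assume "i \<in> {..k}"
      then have "c k - c i \<in> B (r i)" using cc by simp
      from B_D[OF this, of "1 / (real k + 1)"]
      show "eventually (\<lambda>n. vb \<lfloor>(r i + 1 / (real k + 1)) * real n\<rfloor> (c k n - c i n)) \<omega>" by simp
    qed simp
    then show ?thesis using omega_large[of k] by eventually_elim (auto simp: A_def)
  qed
  \<comment> \<open>The default \<open>0\<close> matters only at places where no positive \<open>k\<close> is admissible.\<close>
  define K where "K n = Max (insert 0 {k. k \<le> n \<and> A k n})" for n
  define z where "z n = c (K n) n" for n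
  have "z - c i \<in> B (r i)" for i
  proof (rule B_I)
    fix \<epsilon> :: real assume \<epsilon>: "0 < \<epsilon>"
    obtain k0 where k0: "1 / (real k0 + 1) < \<epsilon>" using reals_Archimedean[OF \<epsilon>] by (auto simp: inverse_eq_divide add.commute)
    define k where "k = max i (Suc k0)"
    have k: "i \<le> k" "0 < k" "k0 \<le> k" by (auto simp: k_def)
    show "eventually (\<lambda>n. vb \<lfloor>(r i + \<epsilon>) * real n\<rfloor> ((z - c i) n)) \<omega>"
      using evA[of k]
    proof eventually_elim
      case (elim n)
      have fin: "finite {k. k \<le> n \<and> A k n}" by (rule finite_subset[of _ "{..n}"]) auto
      have kin: "k \<in> {k. k \<le> n \<and> A k n}" using elim by (auto simp: A_def)
      have kK: "k \<le> K n" unfolding K_def using fin kin by (intro Max_ge) auto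
      have "K n \<in> insert 0 {k. k \<le> n \<and> A k n}" unfolding K_def using fin by (intro Max_in) auto
      then have "A (K n) n" using kK k(2) by auto
      then have "vb \<lfloor>(r i + 1 / (real (K n) + 1)) * real n\<rfloor> (c (K n) n - c i n)"
        using k(1) kK by (auto simp: A_def)
      moreover have "1 / (real (K n) + 1) \<le> 1 / (real k0 + 1)"
        using kK k(3) by (intro divide_left_mono) auto
      then have "(r i + 1 / (real (K n) + 1)) * real n \<le> (r i + \<epsilon>) * real n"
        using k0 by (intro mult_right_mono) auto
      ultimately show ?case using vb_mono[OF _ floor_mono] by (simp add: z_def)
    qed
  qed
  then show ?thesis by blast
qed

text \<open>Units of exact sizes \<open>r\<close> with \<open>0 < r < 1\<close> have pairwise differences outside \<open>B 0\<close>, which gives the lower bound; the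
upper bound is the number of all sequences.\<close>

lemma quotient_eqpoll_reals:
  assumes car: "\<Phi> ` Fin = A" and \<Phi>: "\<forall>z\<in>Fin. \<forall>w\<in>Fin. \<Phi> z = \<Phi> w \<longleftrightarrow> w - z \<in> B 0"
  shows "A \<approx> (UNIV :: real set)"
proof (rule lepoll_antisym)
  have "A \<lesssim> Fin" using car image_lepoll by blast
  also have "Fin \<lesssim> (UNIV :: (nat \<Rightarrow> 'k) set)" by (simp add: subset_imp_lepoll)
  also note sequences_lepoll_reals
  finally show "A \<lesssim> (UNIV :: real set)" .
  obtain t t' where t: "\<And>r. t r \<in> B r \<and> t' r \<in> B (- r) \<and> t r * t' r = 1" using B_unit by metis
  have ne: "t r - t s \<notin> B 0" if rs: "0 < s" "s < r" for r s
  proof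
    assume "t r - t s \<in> B 0"
    then have "t r - t s \<in> B s" using B_mono rs by (meson less_imp_le)
    from B_add[OF this] have "t r \<in> B s" using t[of s] by force
    from B_mult[OF this] have "1 \<in> B (s - r)" using t[of r] by force
    then show False using one_notin_B rs by simp
  qed
  have "inj_on (\<lambda>r. \<Phi> (t r)) {0<..<1::real}"
  proof (rule inj_onI)
    fix r s :: real assume rs: "r \<in> {0<..<1}" "s \<in> {0<..<1}" "\<Phi> (t r) = \<Phi> (t s)"
    have tF: "t r \<in> Fin" for r using t Fin_I by blast
    have "t s - t r \<in> B 0" using \<Phi> tF rs(3) by blast
    moreover from B_uminus[OF this] have "t r - t s \<in> B 0" by simp
    ultimately show "r = s" using ne[of r s] ne[of s r] rs(1,2) by (cases r s rule: linorder_cases) auto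
  qed
  moreover have "(\<lambda>r. \<Phi> (t r)) ` {0<..<1::real} \<subseteq> A" using car t Fin_I by blast
  ultimately have "{0<..<1::real} \<lesssim> A" unfolding lepoll_def by blast
  moreover have "(UNIV :: real set) \<lesssim> {0<..<1::real}"
    using open_interval_eqpoll_reals[of 0 1] eqpoll_imp_lepoll eqpoll_sym by auto
  ultimately show "(UNIV :: real set) \<lesssim> A" using lepoll_trans by blast
qed

end

section \<open>Coordinates on the quotient group and word growth\<close>

text \<open>The entries of a matrix other than the corner, in the order 12, 23, 34, 13, 24, 22, 33. They can be
multiplied without knowledge of the corners, and they coordinatise the quotient by the corner subgroup.\<close>

type_synonym 'k tup = "'k \<times> 'k \<times> 'k \<times> 'k \<times> 'k \<times> 'k \<times> 'k"

abbreviation t12 :: "'k tup \<Rightarrow> 'k" where "t12 x \<equiv> fst x"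
abbreviation t23 :: "'k tup \<Rightarrow> 'k" where "t23 x \<equiv> fst (snd x)"
abbreviation t34 :: "'k tup \<Rightarrow> 'k" where "t34 x \<equiv> fst (snd (snd x))"
abbreviation t13 :: "'k tup \<Rightarrow> 'k" where "t13 x \<equiv> fst (snd (snd (snd x)))"
abbreviation t24 :: "'k tup \<Rightarrow> 'k" where "t24 x \<equiv> fst (snd (snd (snd (snd x))))"
abbreviation t22 :: "'k tup \<Rightarrow> 'k" where "t22 x \<equiv> fst (snd (snd (snd (snd (snd x)))))"
abbreviation t33 :: "'k tup \<Rightarrow> 'k" where "t33 x \<equiv> snd (snd (snd (snd (snd (snd x)))))"

definition tmul :: "'k::field tup \<Rightarrow> 'k tup \<Rightarrow> 'k tup" where
  "tmul x y = (t12 y + t12 x * t22 y, t22 x * t23 y + t23 x * t33 y, t33 x * t34 y + t34 x,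
     t13 y + t12 x * t23 y + t13 x * t33 y, t22 x * t24 y + t23 x * t34 y + t24 x,
     t22 x * t22 y, t33 x * t33 y)"

definition tone :: "'k::field tup" where "tone = (0, 0, 0, 0, 0, 1, 1)"

definition tinv :: "'k::field tup \<Rightarrow> 'k tup" where
  "tinv x = (- t12 x * inverse (t22 x), - t23 x * inverse (t22 x) * inverse (t33 x), - t34 x * inverse (t33 x),
     t12 x * t23 x * inverse (t22 x) * inverse (t33 x) - t13 x * inverse (t33 x),
     t23 x * t34 x * inverse (t33 x) * inverse (t22 x) - t24 x * inverse (t22 x),
     inverse (t22 x), inverse (t33 x))"

definition tval :: "'k::field tup set" where "tval = {x. t22 x \<noteq> 0 \<and> t33 x \<noteq> 0}"

lemma tmul_assoc: "tmul (tmul x y) z = tmul x (tmul y z)"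
  by (simp add: tmul_def algebra_simps)

lemma tmul_one [simp]: "tmul tone x = x" "tmul x tone = x"
  by (simp_all add: tmul_def tone_def)

lemma tval_mul: "x \<in> tval \<Longrightarrow> y \<in> tval \<Longrightarrow> tmul x y \<in> tval" by (simp add: tval_def tmul_def)
lemma tval_one: "tone \<in> tval" by (simp add: tval_def tone_def)
lemma tval_inv: "x \<in> tval \<Longrightarrow> tinv x \<in> tval" by (simp add: tval_def tinv_def)

lemma tmul_inv: assumes "x \<in> tval" shows "tmul x (tinv x) = tone" "tmul (tinv x) x = tone"
proof -
  have nz: "t22 x \<noteq> 0" "t33 x \<noteq> 0" using assms by (auto simp: tval_def)
  show "tmul x (tinv x) = tone" "tmul (tinv x) x = tone"
    using nz by (simp_all add: tmul_def tinv_def tone_def field_simps)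
qed

lemma continuous_on_tmul [continuous_intros]:
  fixes f g :: "'b::topological_space \<Rightarrow> 'k::topological_field tup"
  assumes "continuous_on A f" "continuous_on A g"
  shows "continuous_on A (\<lambda>x. tmul (f x) (g x))"
  unfolding tmul_def using assms by (intro continuous_intros)

lemma continuous_on_tinv: "continuous_on tval (tinv :: 'k::topological_field tup \<Rightarrow> _)"
  unfolding tinv_def by (intro continuous_intros continuous_on_inverse_field) (auto simp: tval_def)

lemma open_tval: "open (tval :: 'k::topological_field tup set)"
proof -
  have "open (- {0 :: 'k})" by (intro open_Compl closed_singleton)
  then have "open (((\<lambda>x :: 'k tup. t22 x) -` (- {0})) \<inter> ((\<lambda>x :: 'k tup. t33 x) -` (- {0})))"
    by (intro open_Int open_vimage continuous_intros)
  moreover have "((\<lambda>x :: 'k tup. t22 x) -` (- {0})) \<inter> ((\<lambda>x :: 'k tup. t33 x) -` (- {0})) = tval"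
    by (auto simp: tval_def)
  ultimately show ?thesis by simp
qed

lemma Hausdorff_euclidean_t2: "Hausdorff_space (euclidean :: 'b::t2_space topology)"
  unfolding Hausdorff_space_def disjnt_def open_openin[symmetric] using hausdorff by blast

context contracted_field
begin

lemma locally_compact_k: "locally_compact_space (euclidean :: 'k topology)"
  unfolding locally_compact_space_def
proof
  fix x :: 'k
  have "open ((\<lambda>y. y - x) -` V0)" by (intro open_vimage V(2) continuous_intros)
  moreover have "compact ((\<lambda>y. y + x) ` V)" by (intro compact_continuous_image V(1) continuous_intros)
  moreover have "(\<lambda>y. y - x) -` V0 \<subseteq> (\<lambda>y. y + x) ` V" using V(4) by (auto intro!: image_eqI[of _ _ "_ - x"])
  moreover have "x \<in> (\<lambda>y. y - x) -` V0" using V(3) by simp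
  ultimately show "\<exists>U K. openin euclidean U \<and> compactin euclidean K \<and> x \<in> U \<and> U \<subseteq> K"
    unfolding open_openin[symmetric] compactin_euclidean_iff by blast
qed

lemma locally_compact_tup: "locally_compact_space (euclidean :: 'k tup topology)"
proof -
  have prod: "locally_compact_space (euclidean :: ('k \<times> 'b) topology)"
    if "locally_compact_space (euclidean :: 'b::topological_space topology)"
    using locally_compact_space_prod_topology[of "euclidean :: 'k topology" "euclidean :: 'b topology"]
      locally_compact_k that by simp
  show ?thesis by (intro prod locally_compact_k)
qed

text \<open>The inverses of the diagonal entries are included so that boundedness is preserved under inversion, up to a
constant.\<close>

definition bd :: "int \<Rightarrow> 'k tup \<Rightarrow> bool" where
  "bd m x \<longleftrightarrow> vb m (t12 x) \<and> vb m (t23 x) \<and> vb m (t34 x) \<and> vb m (t13 x) \<and> vb m (t24 x) \<and>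
     vb m (t22 x) \<and> vb m (t33 x) \<and> vb m (inverse (t22 x)) \<and> vb m (inverse (t33 x))"

lemma bd_mono: "bd m x \<Longrightarrow> m \<le> m' \<Longrightarrow> bd m' x"
  unfolding bd_def using vb_mono by blast

lemma bd_constant:
  obtains c where "0 \<le> c" "\<And>m j x y. 0 \<le> m \<Longrightarrow> 0 \<le> j \<Longrightarrow> bd m x \<Longrightarrow> bd j y \<Longrightarrow> bd (m + j + c) (tmul x y)"
proof -
  obtain c where c: "0 \<le> c" "\<And>m x y. vb m x \<Longrightarrow> vb m y \<Longrightarrow> vb (m + c) (x + y)"
    "\<And>m j x y. vb m x \<Longrightarrow> vb j y \<Longrightarrow> vb (m + j + c) (x * y)"
    using vb_constants by metis
  show ?thesis
  proof
    show "0 \<le> 3 * c" using c by simp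
    fix m j x y assume mj: "0 \<le> m" "0 \<le> j" and xy: "bd m x" "bd j y"
    have A: "vb (m + j + 2 * c) (u + v)" if "vb (m + j + c) u" "vb (m + j + c) v" for u v
      using c(2)[OF that] by (simp add: add.assoc)
    have A': "vb (m + j + 3 * c) (u + v)" if "vb (m + j + 2 * c) u" "vb (m + j + c) v" for u v
      using c(2)[OF that(1) vb_mono[OF that(2)]] c(1) by (simp add: add.assoc)
    have M: "vb (m + j + c) (u * v)" if "vb m u" "vb j v" for u v
      using c(3)[OF that] .
    have X: "vb (m + j + c) u" if "vb m u" for u using vb_mono[OF that] mj c(1) by simp
    have Y: "vb (m + j + c) u" if "vb j u" for u using vb_mono[OF that] mj c(1) by simp
    have L: "vb (m + j + 3 * c) u" if "vb (m + j + c) u" for u using vb_mono[OF that] c(1) by simp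
    have L2: "vb (m + j + 3 * c) u" if "vb (m + j + 2 * c) u" for u using vb_mono[OF that] c(1) by simp
    show "bd (m + j + 3 * c) (tmul x y)"
      using xy unfolding bd_def tmul_def fst_conv snd_conv inverse_mult_distrib
      by (intro conjI) (blast intro: L L2 A A' M X Y)+
  qed
qed

lemma bd_exists:
  assumes T: "compact T" "T \<subseteq> tval"
  shows "\<exists>m\<ge>0. \<forall>x\<in>T. bd m x"
proof -
  have fin: "\<exists>m\<ge>0. \<forall>f\<in>F. \<forall>x\<in>T. vb m (f x)" if "finite F" "\<forall>f\<in>F. continuous_on T f"
    for F :: "('k tup \<Rightarrow> 'k) set"
    using that
  proof (induction F rule: finite_induct)
    case (insert f F)
    then obtain m where m: "0 \<le> m" "\<forall>f\<in>F. \<forall>x\<in>T. vb m (f x)" by auto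
    have "compact (f ` T)" using insert.prems T(1) by (intro compact_continuous_image) auto
    from compact_bounded[OF this] obtain m' where m': "0 \<le> m'" "\<forall>z\<in>f ` T. vb m' z" by (elim exE conjE)
    have "vb (max m m') (g x)" if "g \<in> insert f F" "x \<in> T" for g x
    proof (cases "g = f")
      case True
      then have "vb m' (g x)" using m'(2) that(2) by auto
      then show ?thesis by (rule vb_mono) simp
    next
      case False
      then have "vb m (g x)" using m(2) that by auto
      then show ?thesis by (rule vb_mono) simp
    qed
    then show ?case using m(1) by (intro exI[of _ "max m m'"]) auto
  qed auto
  have nz: "t22 x \<noteq> 0" "t33 x \<noteq> 0" if "x \<in> T" for x using that T(2) by (auto simp: tval_def)
  let ?F = "{t12, t23, t34, t13, t24, t22, t33, \<lambda>x. inverse (t22 x), \<lambda>x. inverse (t33 x)} :: ('k tup \<Rightarrow> 'k) set"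
  have "\<forall>f\<in>?F. continuous_on T f"
    using nz by (auto intro!: continuous_intros continuous_on_inverse_field)
  then obtain m where m: "0 \<le> m" "\<forall>f\<in>?F. \<forall>x\<in>T. vb m (f x)" using fin[of ?F] by auto
  then have "\<forall>x\<in>T. bd m x" unfolding bd_def by simp
  then show ?thesis using m(1) by blast
qed

text \<open>The elements of bounded size; the bounds on the inverses keep them away from the boundary of the group.\<close>

definition Q :: "int \<Rightarrow> 'k tup set" where "Q m = {x \<in> tval. bd m x}"

lemma Q_compact: "\<exists>K. compact K \<and> Q m \<subseteq> K \<and> K \<subseteq> tval"
proof -
  let ?V = "{x. vb m x}"
  \<comment> \<open>The pairs of mutually inverse bounded elements form a closed, hence compact, set.\<close>
  have "closed ((\<lambda>p :: 'k \<times> 'k. fst p * snd p) -` {1})" by (intro closed_vimage continuous_intros)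
  then have "compact ((?V \<times> ?V) \<inter> ((\<lambda>p :: 'k \<times> 'k. fst p * snd p) -` {1}))"
    by (intro compact_Int_closed compact_Times compact_vb)
  then have A: "compact (fst ` ((?V \<times> ?V) \<inter> ((\<lambda>p :: 'k \<times> 'k. fst p * snd p) -` {1})))" (is "compact ?A")
    by (intro compact_continuous_image continuous_intros)
  let ?K = "?V \<times> ?V \<times> ?V \<times> ?V \<times> ?V \<times> ?A \<times> ?A"
  have inA: "s \<in> ?A" if "s \<noteq> 0" "vb m s" "vb m (inverse s)" for s
    using that by (intro image_eqI[of _ _ "(s, inverse s)"]) auto
  have "compact ?K" by (intro compact_Times compact_vb A)
  moreover have "Q m \<subseteq> ?K" using inA unfolding Q_def tval_def bd_def by (auto simp: mem_Times_iff)
  moreover have "?K \<subseteq> tval" by (auto simp: tval_def)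
  ultimately show ?thesis by blast
qed

end

text \<open>A symmetric compact set with the identity; its \<open>n\<close>-fold products are the balls of a word metric.\<close>

locale compactly_generated = contracted_field V V0 l for V V0 :: "'k::topological_field set" and l +
  fixes T :: "'k tup set"
  assumes T: "compact T" "T \<subseteq> tval" "tone \<in> T"
    and T_inv: "x \<in> T \<Longrightarrow> tinv x \<in> T"
begin

fun ball_T :: "nat \<Rightarrow> 'k tup set" where
  "ball_T 0 = {tone}"
| "ball_T (Suc n) = {x. \<exists>s\<in>T. \<exists>y\<in>ball_T n. x = tmul s y}"

lemma ball_T_SucI: "s \<in> T \<Longrightarrow> y \<in> ball_T n \<Longrightarrow> tmul s y \<in> ball_T (Suc n)"
  unfolding ball_T.simps by blast

lemma ball_T_SucE:
  assumes "x \<in> ball_T (Suc n)"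
  obtains s y where "s \<in> T" "y \<in> ball_T n" "x = tmul s y"
  using assms unfolding ball_T.simps by blast

lemma ball_T_tval: "ball_T n \<subseteq> tval"
proof (induction n)
  case (Suc n)
  show ?case
  proof
    fix x assume "x \<in> ball_T (Suc n)"
    then obtain s y where "s \<in> T" "y \<in> ball_T n" "x = tmul s y" by (rule ball_T_SucE)
    then show "x \<in> tval" using Suc T(2) tval_mul by blast
  qed
qed (simp add: tval_one)

lemma ball_T_compact: "compact (ball_T n)"
proof (induction n)
  case (Suc n)
  have "compact ((\<lambda>p. tmul (fst p) (snd p)) ` (T \<times> ball_T n))"
    by (intro compact_continuous_image compact_Times T Suc continuous_intros)
  moreover have "ball_T (Suc n) = (\<lambda>p. tmul (fst p) (snd p)) ` (T \<times> ball_T n)"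
  proof (intro subset_antisym subsetI)
    fix x assume "x \<in> ball_T (Suc n)"
    then obtain s y where "s \<in> T" "y \<in> ball_T n" "x = tmul s y" by (rule ball_T_SucE)
    then show "x \<in> (\<lambda>p. tmul (fst p) (snd p)) ` (T \<times> ball_T n)"
      by (intro image_eqI[of _ _ "(s, y)"]) simp_all
  next
    fix x assume "x \<in> (\<lambda>p. tmul (fst p) (snd p)) ` (T \<times> ball_T n)"
    then obtain p where "p \<in> T \<times> ball_T n" "x = tmul (fst p) (snd p)" by blast
    then show "x \<in> ball_T (Suc n)" using ball_T_SucI[of "fst p" "snd p" n] by (simp only: mem_Times_iff)
  qed
  ultimately show ?case by simp
qed simp

lemma ball_T_add: "x \<in> ball_T m \<Longrightarrow> y \<in> ball_T n \<Longrightarrow> tmul x y \<in> ball_T (m + n)"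
proof (induction m arbitrary: x)
  case (Suc m)
  obtain s z where s: "s \<in> T" "z \<in> ball_T m" "x = tmul s z" using Suc.prems(1) by (rule ball_T_SucE)
  have "tmul z y \<in> ball_T (m + n)" using Suc.IH s Suc.prems by blast
  from ball_T_SucI[OF s(1) this] show ?case by (simp add: s(3) tmul_assoc del: ball_T.simps)
qed simp

lemma ball_T_mono: "x \<in> ball_T m \<Longrightarrow> m \<le> n \<Longrightarrow> x \<in> ball_T n"
proof -
  have 1: "tone \<in> ball_T k" for k
  proof (induction k)
    case (Suc k)
    from ball_T_SucI[OF T(3) this] show ?case by (simp del: ball_T.simps)
  qed simp
  show "x \<in> ball_T m \<Longrightarrow> m \<le> n \<Longrightarrow> x \<in> ball_T n"
    using ball_T_add[OF _ 1, of x m "n - m"] by simp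
qed

text \<open>Sizes are subadditive under products up to a constant, so they grow at most linearly in the word length.\<close>

lemma ball_T_bd: "\<exists>C\<ge>0. \<forall>n. \<forall>x\<in>ball_T n. bd (C * int (n + 1)) x"
proof -
  obtain c where c: "0 \<le> c" "\<And>m j x y. 0 \<le> m \<Longrightarrow> 0 \<le> j \<Longrightarrow> bd m x \<Longrightarrow> bd j y \<Longrightarrow> bd (m + j + c) (tmul x y)"
    using bd_constant by blast
  obtain m where m: "0 \<le> m" "\<forall>x\<in>T. bd m x" using bd_exists[OF T(1,2)] by blast
  have "\<forall>x\<in>ball_T n. bd ((m + c) * int (n + 1)) x" for n
  proof (induction n)
    case 0
    show ?case using m T(3) c(1) by (auto intro: bd_mono)
  next
    case (Suc n)
    show ?case
    proof
      fix x assume "x \<in> ball_T (Suc n)"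
      then obtain s y where "s \<in> T" "y \<in> ball_T n" "x = tmul s y" by (rule ball_T_SucE)
      then have "bd (m + (m + c) * int (n + 1) + c) x" using c m Suc by auto
      then show "bd ((m + c) * int (Suc n + 1)) x" by (simp add: algebra_simps)
    qed
  qed
  then show ?thesis using m(1) c(1) by (intro exI[of _ "m + c"]) auto
qed

end

locale compactly_generated_all = compactly_generated +
  assumes generates: "(\<Union>n. ball_T n) = tval"
begin

text \<open>Baire category: the group is locally compact and a countable union of the compact balls.\<close>

lemma ball_T_interior: "\<exists>n U. open U \<and> U \<noteq> {} \<and> U \<subseteq> ball_T n"
proof (rule ccontr)
  assume contra: "\<not> ?thesis"
  let ?X = "top_of_set (tval :: 'a tup set)"
  have H: "Hausdorff_space (euclidean :: 'a tup topology)" by (rule Hausdorff_euclidean_t2)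
  have "locally_compact_space ?X"
    by (rule locally_compact_space_open_subset[OF disjI1[OF H] locally_compact_tup])
      (use open_tval in \<open>simp only: open_openin\<close>)
  moreover have "Hausdorff_space ?X" using H by (rule Hausdorff_space_subtopology)
  ultimately have "completely_metrizable_space ?X \<or> locally_compact_space ?X \<and> regular_space ?X"
    using locally_compact_Hausdorff_imp_regular_space by blast
  then have "?X interior_of \<Union>(range ball_T) = {}"
  proof (rule Baire_category_alt)
    fix S assume "S \<in> range ball_T"
    then obtain n where S: "S = ball_T n" by blast
    have "closedin ?X S" unfolding S
      by (rule closed_subset[OF ball_T_tval compact_imp_closed[OF ball_T_compact]])
    moreover have "?X interior_of S = {}"
    proof (rule ccontr)
      assume ne: "?X interior_of S \<noteq> {}"
      have "openin ?X (?X interior_of S)" by simp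
      then have "open (?X interior_of S)" using open_tval by (rule openin_open_trans)
      moreover have "?X interior_of S \<subseteq> ball_T n" unfolding S by (rule interior_of_subset)
      ultimately show False using contra ne by blast
    qed
    ultimately show "closedin ?X S \<and> ?X interior_of S = {}" by blast
  qed simp
  moreover have "?X interior_of tval = tval" by (metis interior_of_topspace topspace_euclidean_subtopology)
  ultimately show False using generates tval_one by auto
qed

text \<open>Finitely many translates of a ball with interior cover the compact set.\<close>

lemma compact_in_ball_T:
  assumes K: "compact K" "K \<subseteq> tval"
  shows "\<exists>n. K \<subseteq> ball_T n"
proof -
  obtain n U where U: "open U" "U \<noteq> {}" "U \<subseteq> ball_T n" using ball_T_interior by blast
  obtain g where g: "g \<in> U" using U by blast
  have gv: "g \<in> tval" using g U ball_T_tval by blast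
  define N where "N q = (\<lambda>y. tmul (tmul g (tinv q)) y) -` U" for q
  have "\<exists>D\<subseteq>K. finite D \<and> K \<subseteq> (\<Union>q\<in>D. N q)"
  proof (rule compactE_image[OF K(1)])
    show "open (N q)" for q unfolding N_def by (intro open_vimage U(1) continuous_intros)
    show "K \<subseteq> (\<Union>q\<in>K. N q)"
    proof
      fix q assume q: "q \<in> K"
      then have "q \<in> N q" using K(2) g by (auto simp: N_def tmul_assoc tmul_inv)
      then show "q \<in> (\<Union>q\<in>K. N q)" using q by blast
    qed
  qed blast
  then obtain D where D: "D \<subseteq> K" "finite D" "K \<subseteq> (\<Union>q\<in>D. N q)" by blast
  have "\<exists>m. tmul q (tinv g) \<in> ball_T m" if "q \<in> D" for q
  proof -
    have "tmul q (tinv g) \<in> tval" using that D(1) K(2) gv by (auto intro: tval_mul tval_inv)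
    then show ?thesis using generates by blast
  qed
  then obtain m where m: "\<And>q. q \<in> D \<Longrightarrow> tmul q (tinv g) \<in> ball_T (m q)" by metis
  have "y \<in> ball_T (Max (insert 0 (m ` D)) + n)" if y: "y \<in> K" for y
  proof -
    obtain q where q: "q \<in> D" "y \<in> N q" using D(3) y by blast
    have qv: "q \<in> tval" using q(1) D(1) K(2) by blast
    have "tmul (tmul g (tinv q)) y \<in> ball_T n" using q(2) U(3) by (auto simp: N_def)
    from ball_T_add[OF m[OF q(1)] this]
    have "tmul (tmul q (tinv g)) (tmul (tmul g (tinv q)) y) \<in> ball_T (m q + n)" .
    moreover have "tmul (tmul q (tinv g)) (tmul (tmul g (tinv q)) y)
        = tmul q (tmul (tmul (tinv g) g) (tmul (tinv q) y))" by (simp only: tmul_assoc)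
    also have "\<dots> = tmul (tmul q (tinv q)) y" using gv by (simp add: tmul_inv tmul_assoc)
    also have "\<dots> = y" using qv by (simp add: tmul_inv)
    ultimately have "y \<in> ball_T (m q + n)" by simp
    then show ?thesis by (rule ball_T_mono) (use D(2) q(1) in auto)
  qed
  then show ?thesis by blast
qed

text \<open>Conjugation by a suitable power of a diagonal matrix with one entry \<open>l\<close> contracts a given root subgroup, so a root element of
size \<open>m\<close> is the conjugate of a bounded one by an element of length \<open>O(m)\<close>. A diagonal element of size \<open>m\<close> is a power of such a
matrix up to a bounded factor, and every element is a product of five root elements and two diagonal ones.\<close>

lemma bd_imp_ball_T: "\<exists>C. \<forall>m\<ge>0. \<forall>x\<in>tval. bd m x \<longrightarrow> x \<in> ball_T (C * nat (m + 1))"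
proof -
  obtain c where c: "0 \<le> c" "\<And>m x y. vb m x \<Longrightarrow> vb m y \<Longrightarrow> vb (m + c) (x + y)"
    "\<And>m x. vb m x \<Longrightarrow> vb (m + c) (- x)"
    "\<And>m j x y. vb m x \<Longrightarrow> vb j y \<Longrightarrow> vb (m + j + c) (x * y)" "vb c 1"
    "\<And>m x. x \<noteq> 0 \<Longrightarrow> \<not> vb (m - 1) x \<Longrightarrow> vb m x \<Longrightarrow> vb (c - m) (inverse x)"
    by (rule vb_constants) blast
  obtain e where e: "0 \<le> e" "vb e l" "vb e (inverse l)"
  proof -
    obtain e1 e2 where "0 \<le> e1" "vb e1 l" "0 \<le> e2" "vb e2 (inverse l)" using vb_exists by meson
    then show ?thesis using that[of "max e1 e2"] vb_mono by (metis max.cobounded1 max.cobounded2 max.coboundedI1)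
  qed
  define b where "b = c + e"
  obtain K where K: "compact K" "Q b \<subseteq> K" "K \<subseteq> tval" using Q_compact by blast
  obtain N where N: "K \<subseteq> ball_T N" using compact_in_ball_T[OF K(1,3)] by blast
  have QN: "x \<in> ball_T N" if "x \<in> tval" "bd b x" for x using that K(2) N by (auto simp: Q_def)
  have b: "c \<le> b" "e \<le> b" "0 \<le> b" using c(1) e(1) by (auto simp: b_def)
  have vb1: "vb b 1" using c(5) b vb_mono by blast
  have vbV: "vb b x" if "x \<in> V" for x using that vb_mono[of 0 x b] b by (simp add: vb_def)
  have pow: "x n \<in> ball_T (N * n)" if "x 0 = tone" "\<And>n. x (Suc n) = tmul y (x n)" "y \<in> ball_T N" for x y n
  proof (induction n)
    case (Suc n)
    have "tmul y (x n) \<in> ball_T (N + N * n)" by (rule ball_T_add[OF that(3) Suc])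
    then show ?case using that(2)[of n] by simp
  qed (use that in simp)
  \<comment> \<open>Powers of the diagonal matrices with one entry \<open>l\<close> or its inverse.\<close>
  define dg :: "'a \<Rightarrow> 'a \<Rightarrow> 'a tup" where "dg s t = (0, 0, 0, 0, 0, s, t)" for s t
  have dgm: "tmul (dg s t) (dg s' t') = dg (s * s') (t * t')" for s t s' t' by (simp add: tmul_def dg_def)
  have l1: "dg l 1 \<in> ball_T N" "dg (inverse l) 1 \<in> ball_T N" "dg 1 l \<in> ball_T N" "dg 1 (inverse l) \<in> ball_T N"
    using l(1) e vb1 b by (auto intro!: QN simp: dg_def tval_def bd_def vb_0 intro: vb_mono)
  have dp: "dg (l ^ n) 1 \<in> ball_T (N * n)" "dg (inverse l ^ n) 1 \<in> ball_T (N * n)"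
    "dg 1 (l ^ n) \<in> ball_T (N * n)" "dg 1 (inverse l ^ n) \<in> ball_T (N * n)" for n
    by (rule pow[OF _ _ l1(1)] pow[OF _ _ l1(2)] pow[OF _ _ l1(3)] pow[OF _ _ l1(4)];
        simp add: dgm; simp add: dg_def tone_def)+
  have conj: "w \<in> ball_T (N * (2 * n + 1))" if "w = tmul x (tmul y z)" "x \<in> ball_T (N * n)" "y \<in> ball_T N" "z \<in> ball_T (N * n)"
    for w x y z n
  proof -
    have "N * n + (N + N * n) = N * (2 * n + 1)" by (simp add: algebra_simps)
    then show ?thesis using ball_T_add[OF that(2) ball_T_add[OF that(3,4)]] that(1) by (simp only:)
  qed
  have nf: "\<exists>w\<in>V. y = inverse l ^ nat m * w" if "vb m y" "0 \<le> m" for m y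
    using that l(1) by (intro bexI[of _ "l ^ nat m * y"]) (auto simp: vb_def power_int_def field_simps)
  have el: "(y, 0, 0, 0, 0, 1, 1) \<in> ball_T (N * (2 * nat m + 1))" "(0, y, 0, 0, 0, 1, 1) \<in> ball_T (N * (2 * nat m + 1))"
    "(0, 0, y, 0, 0, 1, 1) \<in> ball_T (N * (2 * nat m + 1))" "(0, 0, 0, y, 0, 1, 1) \<in> ball_T (N * (2 * nat m + 1))"
    "(0, 0, 0, 0, y, 1, 1) \<in> ball_T (N * (2 * nat m + 1))" if y: "vb m y" "0 \<le> m" for m y
  proof -
    obtain w where w: "w \<in> V" "y = inverse l ^ nat m * w" using nf[OF y] by blast
    have q: "(w, 0, 0, 0, 0, 1, 1) \<in> ball_T N" "(0, w, 0, 0, 0, 1, 1) \<in> ball_T N" "(0, 0, w, 0, 0, 1, 1) \<in> ball_T N"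
       "(0, 0, 0, w, 0, 1, 1) \<in> ball_T N" "(0, 0, 0, 0, w, 1, 1) \<in> ball_T N"
      using vbV[OF w(1)] vb1 by (auto intro!: QN simp: tval_def bd_def vb_0)
    have i: "inverse l ^ nat m * l ^ nat m = 1" "l ^ nat m * inverse l ^ nat m = 1"
      using l(1) by (simp_all flip: power_mult_distrib)
    show "(y, 0, 0, 0, 0, 1, 1) \<in> ball_T (N * (2 * nat m + 1))"
      by (rule conj[OF _ dp(1)[of "nat m"] q(1) dp(2)[of "nat m"]]) (simp add: tmul_def dg_def w(2) i mult.commute)
    show "(0, y, 0, 0, 0, 1, 1) \<in> ball_T (N * (2 * nat m + 1))"
      by (rule conj[OF _ dp(2)[of "nat m"] q(2) dp(1)[of "nat m"]]) (simp add: tmul_def dg_def w(2) i mult.commute)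
    show "(0, 0, y, 0, 0, 1, 1) \<in> ball_T (N * (2 * nat m + 1))"
      by (rule conj[OF _ dp(4)[of "nat m"] q(3) dp(3)[of "nat m"]]) (simp add: tmul_def dg_def w(2) i mult.commute)
    show "(0, 0, 0, y, 0, 1, 1) \<in> ball_T (N * (2 * nat m + 1))"
      by (rule conj[OF _ dp(3)[of "nat m"] q(4) dp(4)[of "nat m"]]) (simp add: tmul_def dg_def w(2) i mult.commute)
    show "(0, 0, 0, 0, y, 1, 1) \<in> ball_T (N * (2 * nat m + 1))"
      by (rule conj[OF _ dp(2)[of "nat m"] q(5) dp(1)[of "nat m"]]) (simp add: tmul_def dg_def w(2) i mult.commute)
  qed
  \<comment> \<open>A bound on the inverse bounds the size from below; the offset \<open>f\<close> is the error of this estimate.\<close>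
  define f where "f = nat (c + \<bar>\<nu> 1\<bar>)"
  have dia: "dg s 1 \<in> ball_T (N * (nat m + f + 1))" "dg 1 s \<in> ball_T (N * (nat m + f + 1))"
    if s: "s \<noteq> 0" "vb m s" "vb m (inverse s)" "0 \<le> m" for m s
  proof -
    let ?k = "\<nu> s"
    have k: "vb ?k s" "\<not> vb (?k - 1) s" "?k \<le> m" using \<nu>_props[OF s(1)] s(2) by auto
    have "vb (?k + m + c) (s * inverse s)" by (rule c(4)[OF k(1) s(3)])
    then have "\<nu> 1 \<le> ?k + m + c" using s(1) \<nu>_props[of 1] by simp
    then have kn: "nat \<bar>?k\<bar> \<le> nat m + f" using k(3) s(4) c(1) unfolding f_def by linarith
    define s0 where "s0 = l powi ?k * s"
    have s0: "s0 \<noteq> 0" "vb 0 s0" using s(1) l(1) k(1) by (auto simp: s0_def vb_def)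
    have "vb (c - ?k) (inverse s)" by (rule c(6)[OF s(1) k(2,1)])
    then have "vb c (inverse s0)" using vb_shift[of c "- ?k" "inverse s"] by (simp add: s0_def power_int_minus)
    then have q: "dg s0 1 \<in> ball_T N" "dg 1 s0 \<in> ball_T N"
      using s0 vb1 b vb_mono[of 0 s0 b] vb_mono[of c _ b] by (auto intro!: QN simp: dg_def tval_def bd_def vb_0)
    have ss: "s = l powi (- ?k) * s0" using l(1) by (simp add: s0_def power_int_minus)
    have "\<exists>x. (x = l \<or> x = inverse l) \<and> l powi (- ?k) = x ^ nat \<bar>?k\<bar>"
      by (cases "0 \<le> ?k") (auto simp: power_int_def power_inverse)
    then have "dg (l powi (- ?k)) 1 \<in> ball_T (N * nat \<bar>?k\<bar>)" "dg 1 (l powi (- ?k)) \<in> ball_T (N * nat \<bar>?k\<bar>)"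
      using dp by auto
    from ball_T_add[OF this(1) q(1)] ball_T_add[OF this(2) q(2)]
    have "dg s 1 \<in> ball_T (N * nat \<bar>?k\<bar> + N)" "dg 1 s \<in> ball_T (N * nat \<bar>?k\<bar> + N)"
      unfolding dgm ss[symmetric] by simp_all
    moreover have "N * nat \<bar>?k\<bar> + N \<le> N * (nat m + f + 1)"
      using mult_le_mono2[OF kn, of N] by (simp add: algebra_simps)
    ultimately show "dg s 1 \<in> ball_T (N * (nat m + f + 1))" "dg 1 s \<in> ball_T (N * (nat m + f + 1))"
      using ball_T_mono by blast+
  qed
  define C where "C = N * (100 * (nat c + f + 1))"
  have "x \<in> ball_T (C * nat (m + 1))" if m: "0 \<le> m" and x: "x \<in> tval" "bd m x" for m x
  proof -
    obtain a bb cc p q s t where X: "x = (a, bb, cc, p, q, s, t)" by (cases x)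
    have st: "s \<noteq> 0" "t \<noteq> 0" using x(1) by (auto simp: X tval_def)
    have v: "vb m a" "vb m bb" "vb m cc" "vb m p" "vb m q" "vb m s" "vb m t" "vb m (inverse s)" "vb m (inverse t)"
      using x(2) by (auto simp: X bd_def)
    define M where "M = 3 * m + 4 * c"
    have M0: "0 \<le> M" using m c(1) by (simp add: M_def)
    have u: "vb (m + m + c) (a * inverse s)" "vb (m + m + c) (bb * inverse t)" "vb (m + m + c) (p * inverse t)"
      using c(4) v by blast+
    have "vb (m + m + c + m + c) (bb * inverse t * cc)" by (rule c(4)[OF u(2) v(3)])
    from c(3)[OF this] have "vb (3 * m + 3 * c) (- (bb * inverse t * cc))" by (simp add: algebra_simps)
    from c(2)[OF vb_mono[OF v(5)] this] have u24: "vb M (q - bb * inverse t * cc)" using m c(1) by (simp add: M_def algebra_simps)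
    have uu: "vb M (a * inverse s)" "vb M (bb * inverse t)" "vb M (p * inverse t)" "vb M cc"
      using u v(3) m c(1) by (auto simp: M_def elim!: vb_mono)
    \<comment> \<open>Divide by the diagonal on the right; the entry 24 is corrected for the product of the factors 23 and 34.\<close>
    have fac: "x = tmul (0, 0, 0, p * inverse t, 0, 1, 1) (tmul (0, bb * inverse t, 0, 0, 0, 1, 1)
        (tmul (0, 0, 0, 0, q - bb * inverse t * cc, 1, 1) (tmul (a * inverse s, 0, 0, 0, 0, 1, 1)
        (tmul (0, 0, cc, 0, 0, 1, 1) (tmul (dg s 1) (dg 1 t))))))"
      using st by (simp add: X tmul_def dg_def field_simps)
    let ?L = "N * (2 * nat M + 1)" and ?R = "N * (nat m + f + 1)"
    have "x \<in> ball_T (?L + (?L + (?L + (?L + (?L + (?R + ?R))))))"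
      unfolding fac by (intro ball_T_add el[OF _ M0] dia u24 uu st v m)
    then show ?thesis
    proof (rule ball_T_mono)
      have M': "nat M = 3 * nat m + 4 * nat c" using m c(1) by (simp add: M_def nat_add_distrib nat_mult_distrib)
      have "?L + (?L + (?L + (?L + (?L + (?R + ?R))))) = N * (5 * (2 * nat M + 1) + 2 * (nat m + f + 1))"
        by (simp add: algebra_simps)
      also have "5 * (2 * nat M + 1) + 2 * (nat m + f + 1) \<le> 100 * (nat c + f + 1) * nat (m + 1)"
      proof -
        have "nat (m + 1) = nat m + 1" using m by (simp add: nat_add_distrib)
        moreover have "nat c * 1 \<le> nat c * (nat m + 1)" "f * 1 \<le> f * (nat m + 1)" by (intro mult_left_mono; simp)+
        ultimately show ?thesis unfolding M' by (simp add: algebra_simps)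
      qed
      then have "N * (5 * (2 * nat M + 1) + 2 * (nat m + f + 1)) \<le> C * nat (m + 1)"
        unfolding C_def by (metis mult.assoc mult_le_mono2)
      finally show "?L + (?L + (?L + (?L + (?L + (?R + ?R))))) \<le> C * nat (m + 1)" by simp
    qed
  qed
  then show ?thesis by blast
qed

end

section \<open>Matrices, cosets and word length\<close>

lemma vector_4:
  "(vector [x, y, z, w] :: ('a::zero)^4) $ 1 = x" "(vector [x, y, z, w] :: ('a::zero)^4) $ 2 = y"
  "(vector [x, y, z, w] :: ('a::zero)^4) $ 3 = z" "(vector [x, y, z, w] :: ('a::zero)^4) $ 4 = w"
  unfolding vector_def by simp_all

definition matrix_of :: "'k::field tup \<Rightarrow> 'k \<Rightarrow> 'k ^ 4 ^ 4" where
  "matrix_of x w = vector [vector [1, t12 x, t13 x, w], vector [0, t22 x, t23 x, t24 x],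
     vector [0, 0, t33 x, t34 x], vector [0, 0, 0, 1]]"

lemma matrix_of_nth [simp]:
  "matrix_of x w $ 1 $ 1 = 1" "matrix_of x w $ 1 $ 2 = t12 x" "matrix_of x w $ 1 $ 3 = t13 x" "matrix_of x w $ 1 $ 4 = w"
  "matrix_of x w $ 2 $ 1 = 0" "matrix_of x w $ 2 $ 2 = t22 x" "matrix_of x w $ 2 $ 3 = t23 x" "matrix_of x w $ 2 $ 4 = t24 x"
  "matrix_of x w $ 3 $ 1 = 0" "matrix_of x w $ 3 $ 2 = 0" "matrix_of x w $ 3 $ 3 = t33 x" "matrix_of x w $ 3 $ 4 = t34 x"
  "matrix_of x w $ 4 $ 1 = 0" "matrix_of x w $ 4 $ 2 = 0" "matrix_of x w $ 4 $ 3 = 0" "matrix_of x w $ 4 $ 4 = 1"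
  by (simp_all add: matrix_of_def vector_4)

definition entries :: "'k::field ^ 4 ^ 4 \<Rightarrow> 'k tup" where
  "entries A = (A $ 1 $ 2, A $ 2 $ 3, A $ 3 $ 4, A $ 1 $ 3, A $ 2 $ 4, A $ 2 $ 2, A $ 3 $ 3)"

lemma entries_matrix_of [simp]: "entries (matrix_of x w) = x" by (simp add: entries_def)

lemma matrix_of_mult: "matrix_of x v ** matrix_of y w = matrix_of (tmul x y) (v + w + t12 x * t24 y + t13 x * t34 y)"
  by (simp add: vec_eq_iff forall_4 matrix_matrix_mult_def sum_4 tmul_def)

lemma entries_tval: "A \<in> abels4_carrier \<Longrightarrow> entries A \<in> tval"
  by (auto simp: abels4_carrier_def entries_def tval_def)

lemma abels4_carrier_matrix_of:
  assumes "A \<in> abels4_carrier" shows "A = matrix_of (entries A) (A $ 1 $ 4)"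
  using assms by (simp add: vec_eq_iff forall_4 abels4_carrier_def entries_def)

lemma matrix_of_abels4_carrier: "x \<in> tval \<Longrightarrow> matrix_of x w \<in> abels4_carrier"
  by (simp add: abels4_carrier_def tval_def dvd_field_iff)

lemma abels4_Z_eq: "abels4_Z = range (matrix_of (tone :: 'k::field tup))"
proof (intro subset_antisym subsetI)
  fix A :: "'k ^ 4 ^ 4" assume "A \<in> abels4_Z"
  then have "A = matrix_of tone (A $ 1 $ 4)"
    by (simp add: vec_eq_iff forall_4 abels4_Z_def mat_def tone_def)
  then show "A \<in> range (matrix_of tone)" by blast
next
  fix A :: "'k ^ 4 ^ 4" assume "A \<in> range (matrix_of tone)"
  then obtain w where "A = matrix_of tone w" by blast
  then show "A \<in> abels4_Z" by (simp add: forall_4 abels4_Z_def mat_def tone_def)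
qed

text \<open>The coset of the corner subgroup with given coordinates.\<close>

definition zcoset :: "'k::field tup \<Rightarrow> ('k ^ 4 ^ 4) set" where "zcoset x = range (matrix_of x)"

lemma zcoset_inj: "zcoset x = zcoset y \<longleftrightarrow> x = y"
  unfolding zcoset_def by (metis UNIV_I entries_matrix_of image_iff)

lemma coset_zcoset: "abels4_Z #>\<^bsub>abels4\<^esub> matrix_of x w = zcoset x"
proof -
  have "abels4_Z #>\<^bsub>abels4\<^esub> matrix_of x w = (\<lambda>v. matrix_of x (v + w)) ` UNIV"
    unfolding r_coset_def abels4_Z_eq by (auto simp: abels4_def matrix_of_mult tone_def tmul_def)
  also have "\<dots> = matrix_of x ` ((\<lambda>v. v + w) ` UNIV)" by (simp only: image_image)
  also have "(\<lambda>v. v + w) ` UNIV = UNIV" by (rule surj_plus_right)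
  finally show ?thesis by (simp add: zcoset_def)
qed

lemma zcoset_set_mult: "zcoset x <#>\<^bsub>abels4\<^esub> zcoset y = zcoset (tmul x y)"
proof (intro subset_antisym subsetI)
  fix A assume "A \<in> zcoset x <#>\<^bsub>abels4\<^esub> zcoset y"
  then obtain v w where "A = matrix_of x v ** matrix_of y w" by (auto simp: set_mult_def zcoset_def abels4_def)
  then show "A \<in> zcoset (tmul x y)" by (simp add: zcoset_def matrix_of_mult)
next
  fix A assume "A \<in> zcoset (tmul x y)"
  then obtain v where "A = matrix_of (tmul x y) v" by (auto simp: zcoset_def)
  then have "A = matrix_of x (v - t12 x * t24 y - t13 x * t34 y) ** matrix_of y 0" by (simp add: matrix_of_mult)
  then show "A \<in> zcoset x <#>\<^bsub>abels4\<^esub> zcoset y" by (auto simp: set_mult_def zcoset_def abels4_def)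
qed

lemma abels4_mod_Z_carrier: "carrier (abels4_mod_Z :: ('k::field ^ 4 ^ 4) set monoid) = zcoset ` tval"
proof -
  have "carrier (abels4_mod_Z :: ('k ^ 4 ^ 4) set monoid) = (\<lambda>A. abels4_Z #>\<^bsub>abels4\<^esub> A) ` abels4_carrier"
    by (simp add: abels4_mod_Z_def carrier_FactGroup) (simp add: abels4_def)
  also have "\<dots> = zcoset ` tval"
  proof (intro subset_antisym subsetI)
    fix g :: "('k ^ 4 ^ 4) set" assume "g \<in> (\<lambda>A. abels4_Z #>\<^bsub>abels4\<^esub> A) ` abels4_carrier"
    then obtain A :: "'k ^ 4 ^ 4" where A: "A \<in> abels4_carrier" "g = abels4_Z #>\<^bsub>abels4\<^esub> A" by blast
    have "g = zcoset (entries A)" unfolding A(2) by (subst abels4_carrier_matrix_of[OF A(1)]) (rule coset_zcoset)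
    then show "g \<in> zcoset ` tval" using entries_tval[OF A(1)] by blast
  next
    fix g :: "('k ^ 4 ^ 4) set" assume "g \<in> zcoset ` tval"
    then obtain x :: "'k tup" where x: "x \<in> tval" "g = zcoset x" by blast
    then have "g = abels4_Z #>\<^bsub>abels4\<^esub> matrix_of x 0" by (simp only: coset_zcoset)
    then show "g \<in> (\<lambda>A. abels4_Z #>\<^bsub>abels4\<^esub> A) ` abels4_carrier" using matrix_of_abels4_carrier[OF x(1)] by blast
  qed
  finally show ?thesis .
qed

lemma abels4_mod_Z_mult: "mult abels4_mod_Z (zcoset x) (zcoset y) = zcoset (tmul x y)"
  by (simp add: abels4_mod_Z_def FactGroup_def zcoset_set_mult)

lemma abels4_mod_Z_one: "one abels4_mod_Z = zcoset tone"
  by (simp add: abels4_mod_Z_def FactGroup_def abels4_Z_eq zcoset_def)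

lemma group_abels4_mod_Z: "group (abels4_mod_Z :: ('k::field ^ 4 ^ 4) set monoid)"
  by (rule groupI)
    (auto simp only: abels4_mod_Z_carrier abels4_mod_Z_one abels4_mod_Z_mult tmul_assoc tmul_one tmul_inv
      intro!: imageI tval_mul tval_one bexI[OF _ imageI[OF tval_inv]])

lemma abels4_mod_Z_inv: "x \<in> tval \<Longrightarrow> m_inv abels4_mod_Z (zcoset x) = zcoset (tinv x)"
  by (rule group.inv_equality[OF group_abels4_mod_Z])
    (simp_all add: abels4_mod_Z_carrier abels4_mod_Z_one abels4_mod_Z_mult tmul_inv tval_inv)

definition coords :: "('k::field ^ 4 ^ 4) set \<Rightarrow> 'k tup" where "coords g = (THE x. g = zcoset x)"

lemma coords_zcoset [simp]: "coords (zcoset x) = x" by (simp add: coords_def zcoset_inj)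

lemma zcoset_coords: "g \<in> carrier abels4_mod_Z \<Longrightarrow> zcoset (coords g) = g"
  by (auto simp: abels4_mod_Z_carrier)

lemma coords_tval: "g \<in> carrier abels4_mod_Z \<Longrightarrow> coords g \<in> tval"
  by (auto simp: abels4_mod_Z_carrier)

lemma openin_quotient_group_topology:
  "openin (quotient_group_topology X G H) U \<longleftrightarrow>
     U \<subseteq> carrier (G Mod H) \<and> openin X {x \<in> topspace X. H #>\<^bsub>G\<^esub> x \<in> U}"
proof -
  have "istopology (\<lambda>U. U \<subseteq> carrier (G Mod H) \<and> openin X {x \<in> topspace X. H #>\<^bsub>G\<^esub> x \<in> U})"
    unfolding istopology_def
  proof (intro conjI allI impI)
    fix U W assume U: "U \<subseteq> carrier (G Mod H) \<and> openin X {x \<in> topspace X. H #>\<^bsub>G\<^esub> x \<in> U}"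
      and W: "W \<subseteq> carrier (G Mod H) \<and> openin X {x \<in> topspace X. H #>\<^bsub>G\<^esub> x \<in> W}"
    show "U \<inter> W \<subseteq> carrier (G Mod H)" using U by blast
    have "{x \<in> topspace X. H #>\<^bsub>G\<^esub> x \<in> U \<inter> W}
        = {x \<in> topspace X. H #>\<^bsub>G\<^esub> x \<in> U} \<inter> {x \<in> topspace X. H #>\<^bsub>G\<^esub> x \<in> W}" by blast
    then show "openin X {x \<in> topspace X. H #>\<^bsub>G\<^esub> x \<in> U \<inter> W}" using U W by (simp only: openin_Int)
  next
    fix \<U> assume U: "\<forall>U\<in>\<U>. U \<subseteq> carrier (G Mod H) \<and> openin X {x \<in> topspace X. H #>\<^bsub>G\<^esub> x \<in> U}"
    show "\<Union>\<U> \<subseteq> carrier (G Mod H)" using U by blast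
    have "{x \<in> topspace X. H #>\<^bsub>G\<^esub> x \<in> \<Union>\<U>} = (\<Union>U\<in>\<U>. {x \<in> topspace X. H #>\<^bsub>G\<^esub> x \<in> U})" by blast
    then show "openin X {x \<in> topspace X. H #>\<^bsub>G\<^esub> x \<in> \<Union>\<U>}" using U by (simp only:) (intro openin_Union, blast)
  qed
  then show ?thesis unfolding quotient_group_topology_def by (simp only: topology_inverse')
qed

text \<open>The coordinates are continuous on matrices and constant on cosets.\<close>

lemma continuous_map_coords:
  "continuous_map (abels4_mod_Z_topology :: ('k::topological_field ^ 4 ^ 4) set topology) euclidean coords"
proof -
  let ?X = "top_of_set (abels4_carrier :: ('k ^ 4 ^ 4) set)"
  have X: "abels4_mod_Z_topology = quotient_group_topology ?X abels4 abels4_Z"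
    by (simp add: abels4_mod_Z_topology_def abels4_def)
  have car: "carrier (abels4 Mod abels4_Z) = (zcoset ` tval :: ('k ^ 4 ^ 4) set set)"
    using abels4_mod_Z_carrier unfolding abels4_mod_Z_def .
  have cosets: "abels4_Z #>\<^bsub>abels4\<^esub> A = zcoset (entries A)" if "A \<in> abels4_carrier" for A :: "'k ^ 4 ^ 4"
    by (subst abels4_carrier_matrix_of[OF that]) (rule coset_zcoset)
  have pre: "openin ?X {A \<in> topspace ?X. abels4_Z #>\<^bsub>abels4\<^esub> A \<in> {g \<in> zcoset ` tval. coords g \<in> W}}"
    if W: "open W" for W
  proof -
    have "continuous_on UNIV (entries :: 'k ^ 4 ^ 4 \<Rightarrow> _)" unfolding entries_def by (intro continuous_intros)
    from open_vimage[OF W this] have "openin ?X (abels4_carrier \<inter> entries -` W)" by (rule openin_open_Int)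
    moreover have "{A \<in> topspace ?X. abels4_Z #>\<^bsub>abels4\<^esub> A \<in> {g \<in> zcoset ` tval. coords g \<in> W}}
        = abels4_carrier \<inter> entries -` W"
      using cosets entries_tval by auto
    ultimately show ?thesis by simp
  qed
  have ts: "topspace abels4_mod_Z_topology = (zcoset ` tval :: ('k ^ 4 ^ 4) set set)"
  proof (rule subset_antisym)
    show "topspace abels4_mod_Z_topology \<subseteq> (zcoset ` tval :: ('k ^ 4 ^ 4) set set)"
      using openin_quotient_group_topology[of ?X abels4 abels4_Z] car unfolding X topspace_def by blast
    have "openin abels4_mod_Z_topology {g \<in> (zcoset ` tval :: ('k ^ 4 ^ 4) set set). coords g \<in> UNIV}"
      unfolding X openin_quotient_group_topology car using pre[OF open_UNIV] by blast
    then show "(zcoset ` tval :: ('k ^ 4 ^ 4) set set) \<subseteq> topspace abels4_mod_Z_topology"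
      using openin_subset by force
  qed
  show ?thesis
    unfolding continuous_map_def
  proof (intro conjI allI impI)
    fix W :: "'k tup set" assume "openin euclidean W"
    then have W: "open W" by (simp only: open_openin)
    show "openin abels4_mod_Z_topology {g \<in> topspace abels4_mod_Z_topology. coords g \<in> W}"
      unfolding ts unfolding X openin_quotient_group_topology car using pre[OF W] by blast
  qed simp
qed

lemma topspace_abels4_mod_Z: "topspace abels4_mod_Z_topology \<subseteq> carrier abels4_mod_Z"
  using openin_quotient_group_topology[of "top_of_set (carrier abels4)" abels4 abels4_Z]
  unfolding abels4_mod_Z_topology_def abels4_mod_Z_def topspace_def by blast

text \<open>A compact generating set of cosets becomes a compact generating set of coordinate tuples.\<close>

locale word_growth = contracted_field V V0 l for V V0 :: "'k::topological_field set" and l +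
  fixes S :: "('k ^ 4 ^ 4) set set"
  assumes S_compact: "compactin abels4_mod_Z_topology S"
    and S_generates: "generate abels4_mod_Z S = carrier abels4_mod_Z"
begin

lemma S_carrier: "S \<subseteq> carrier abels4_mod_Z"
  using compactin_subset_topspace[OF S_compact] topspace_abels4_mod_Z by blast

text \<open>The inverses are letters of the words in \<^const>\<open>word_length\<close> too. The identity is added so that the
balls are increasing.\<close>

definition T :: "'k tup set" where "T = insert tone (coords ` S \<union> tinv ` coords ` S)"

lemma tinv_tinv: "x \<in> tval \<Longrightarrow> tinv (tinv x) = x"
  by (simp add: tinv_def tval_def field_simps prod_eq_iff)

lemma coords_S: "coords ` S \<subseteq> tval" using S_carrier coords_tval by blast

sublocale compactly_generated V V0 l T
proof
  have K: "compact (coords ` S)"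
    using image_compactin[OF S_compact continuous_map_coords] by (simp only: compactin_euclidean_iff)
  have "compact (tinv ` coords ` S)"
    by (rule compact_continuous_image[OF continuous_on_subset[OF continuous_on_tinv coords_S] K])
  then show "compact T" unfolding T_def using K by (intro compact_insert compact_Un)
  show "T \<subseteq> tval" unfolding T_def using coords_S tval_one tval_inv by blast
  show "tone \<in> T" by (simp add: T_def)
  have "tinv tone = (tone :: 'k tup)" by (simp add: tinv_def tone_def)
  moreover have "tinv (tinv x) = x" if "x \<in> coords ` S" for x
    using tinv_tinv coords_S that by blast
  moreover have "insert tone (tinv ` coords ` S \<union> tinv ` tinv ` coords ` S) \<subseteq> T \<Longrightarrow> tinv ` T \<subseteq> T"
    if "tinv tone = (tone :: 'k tup)" using that by (simp only: T_def image_insert image_Un)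
  moreover have "tinv ` tinv ` coords ` S = coords ` S" using calculation(2) by (simp add: image_image cong: image_cong)
  ultimately have "tinv ` T \<subseteq> T" unfolding T_def by blast
  then show "tinv x \<in> T" if "x \<in> T" for x using that by blast
qed

abbreviation "letters \<equiv> S \<union> m_inv abels4_mod_Z ` S"

abbreviation "word ws \<equiv> foldr (mult abels4_mod_Z) ws (one abels4_mod_Z)"

lemma letters_T: "g \<in> letters \<Longrightarrow> \<exists>s\<in>T. g = zcoset s"
proof -
  assume "g \<in> letters"
  then obtain h where h: "h \<in> S" "g = h \<or> g = m_inv abels4_mod_Z h" by blast
  have hc: "h = zcoset (coords h)" "coords h \<in> tval" using zcoset_coords coords_tval h(1) S_carrier by auto
  have "m_inv abels4_mod_Z h = zcoset (tinv (coords h))" using abels4_mod_Z_inv[OF hc(2)] hc(1) by simp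
  then show ?thesis using h hc(1) by (auto simp: T_def)
qed

lemma T_letters: "s \<in> T \<Longrightarrow> s = tone \<or> zcoset s \<in> letters"
proof -
  have "zcoset (coords h) \<in> letters" "zcoset (tinv (coords h)) \<in> letters" if "h \<in> S" for h
  proof -
    have hc: "zcoset (coords h) = h" "coords h \<in> tval" using zcoset_coords coords_tval that S_carrier by auto
    show "zcoset (coords h) \<in> letters" using hc(1) that by simp
    show "zcoset (tinv (coords h)) \<in> letters" using abels4_mod_Z_inv[OF hc(2)] hc(1) that by auto
  qed
  then show "s \<in> T \<Longrightarrow> s = tone \<or> zcoset s \<in> letters" unfolding T_def by blast
qed

lemma word_ball_T: "set ws \<subseteq> letters \<Longrightarrow> \<exists>x\<in>ball_T (length ws). word ws = zcoset x"
proof (induction ws)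
  case (Cons g ws)
  have g: "g \<in> letters" and ws: "set ws \<subseteq> letters" using Cons.prems by simp_all
  obtain s where s: "s \<in> T" "g = zcoset s" using letters_T[OF g] by (rule bexE)
  obtain y where y: "y \<in> ball_T (length ws)" "word ws = zcoset y" using Cons.IH[OF ws] by (rule bexE)
  have "word (g # ws) = zcoset (tmul s y)" by (simp add: s(2) y(2) abels4_mod_Z_mult)
  then show ?case using ball_T_SucI[OF s(1) y(1)] by (metis length_Cons)
qed (simp add: abels4_mod_Z_one)

lemma ball_T_word: "x \<in> ball_T n \<Longrightarrow> \<exists>ws. length ws \<le> n \<and> set ws \<subseteq> letters \<and> word ws = zcoset x"
proof (induction n arbitrary: x)
  case 0
  then show ?case by (intro exI[of _ "[]"]) (simp add: abels4_mod_Z_one)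
next
  case (Suc n)
  obtain s y where s: "s \<in> T" "y \<in> ball_T n" "x = tmul s y" using Suc.prems by (rule ball_T_SucE)
  obtain ws where ws: "length ws \<le> n" "set ws \<subseteq> letters" "word ws = zcoset y" using Suc.IH[OF s(2)] by blast
  show ?case
  proof (cases "s = tone")
    case True
    then show ?thesis using ws s(3) by (intro exI[of _ ws]) simp
  next
    case False
    then have "zcoset s \<in> letters" using T_letters s(1) by blast
    moreover have "word (zcoset s # ws) = zcoset x" by (simp add: ws(3) s(3) abels4_mod_Z_mult)
    ultimately show ?thesis using ws by (intro exI[of _ "zcoset s # ws"]) simp
  qed
qed

lemma letters_ball_T: "g \<in> letters \<Longrightarrow> \<exists>x\<in>ball_T 1. g = zcoset x"
proof -
  assume "g \<in> letters"
  from letters_T[OF this] obtain s where s: "s \<in> T" "g = zcoset s" by (rule bexE)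
  have "s \<in> ball_T 1" using ball_T_SucI[OF s(1), of tone 0] by simp
  then show ?thesis using s(2) by (rule bexI[rotated])
qed

lemma generate_ball_T: "g \<in> generate abels4_mod_Z S \<Longrightarrow> \<exists>n. \<exists>x\<in>ball_T n. g = zcoset x"
proof (induction rule: generate.induct)
  case one
  show ?case by (intro exI[of _ 0]) (simp add: abels4_mod_Z_one)
next
  case (incl h)
  then show ?case by (intro exI[of _ 1] letters_ball_T) simp
next
  case (inv h)
  then show ?case by (intro exI[of _ 1] letters_ball_T) simp
next
  case (eng g h)
  obtain m x n y where "x \<in> ball_T m" "g = zcoset x" "y \<in> ball_T n" "h = zcoset y" using eng.IH by blast
  then show ?case using ball_T_add abels4_mod_Z_mult by blast
qed

sublocale compactly_generated_all V V0 l T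
proof
  show "(\<Union>n. ball_T n) = tval"
  proof (intro subset_antisym subsetI)
    fix x :: "'k tup" assume "x \<in> tval"
    then have "zcoset x \<in> generate abels4_mod_Z S" by (simp add: S_generates abels4_mod_Z_carrier)
    then show "x \<in> (\<Union>n. ball_T n)" using generate_ball_T by (metis UN_I UNIV_I zcoset_inj)
  qed (use ball_T_tval in blast)
qed

lemma word_length_le_iff:
  assumes x: "x \<in> tval"
  shows "word_length abels4_mod_Z S (zcoset x) \<le> n \<longleftrightarrow> x \<in> ball_T n"
proof -
  let ?P = "\<lambda>n. \<exists>ws. length ws = n \<and> set ws \<subseteq> letters \<and> word ws = zcoset x"
  obtain k where "x \<in> ball_T k" using x generates by blast
  then have ex: "\<exists>k. ?P k" using ball_T_word by blast
  show ?thesis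
  proof
    assume le: "word_length abels4_mod_Z S (zcoset x) \<le> n"
    have "?P (word_length abels4_mod_Z S (zcoset x))" unfolding word_length_def by (rule LeastI_ex[OF ex])
    then obtain ws where ws: "length ws = word_length abels4_mod_Z S (zcoset x)" "set ws \<subseteq> letters" "word ws = zcoset x"
      by blast
    obtain y where "y \<in> ball_T (length ws)" "word ws = zcoset y" using word_ball_T[OF ws(2)] by blast
    then show "x \<in> ball_T n" using ws le ball_T_mono zcoset_inj by metis
  next
    assume "x \<in> ball_T n"
    then obtain ws where ws: "length ws \<le> n" "set ws \<subseteq> letters" "word ws = zcoset x" using ball_T_word by blast
    have "word_length abels4_mod_Z S (zcoset x) \<le> length ws"
      unfolding word_length_def by (rule Least_le) (use ws in blast)
    then show "word_length abels4_mod_Z S (zcoset x) \<le> n" using ws(1) by simp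
  qed
qed

definition len :: "'k tup \<Rightarrow> nat" where "len x = word_length abels4_mod_Z S (zcoset x)"

lemma len_le_iff: "x \<in> tval \<Longrightarrow> len x \<le> n \<longleftrightarrow> x \<in> ball_T n"
  unfolding len_def by (rule word_length_le_iff)

lemma len_mul: "x \<in> tval \<Longrightarrow> y \<in> tval \<Longrightarrow> len (tmul x y) \<le> len x + len y"
  using ball_T_add len_le_iff tval_mul by blast

lemma len_one: "len tone = 0"
  using len_le_iff[OF tval_one, of 0] by simp

lemma tinv_mul: "x \<in> tval \<Longrightarrow> y \<in> tval \<Longrightarrow> tinv (tmul x y) = tmul (tinv y) (tinv x)"
proof -
  assume x: "x \<in> tval" and y: "y \<in> tval"
  have "tinv (tmul x y) = tmul (tinv (tmul x y)) (tmul x (tmul (tmul y (tinv y)) (tinv x)))"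
    using x y by (simp add: tmul_inv)
  also have "\<dots> = tmul (tmul (tinv (tmul x y)) (tmul x y)) (tmul (tinv y) (tinv x))" by (simp only: tmul_assoc)
  also have "\<dots> = tmul (tinv y) (tinv x)" using tmul_inv(2)[OF tval_mul[OF x y]] by simp
  finally show ?thesis .
qed

lemma ball_T_inv: "x \<in> ball_T n \<Longrightarrow> tinv x \<in> ball_T n"
proof (induction n arbitrary: x)
  case 0
  then show ?case by (simp add: tinv_def tone_def)
next
  case (Suc n)
  obtain s y where s: "s \<in> T" "y \<in> ball_T n" "x = tmul s y" using Suc.prems by (rule ball_T_SucE)
  have st: "s \<in> tval" using s(1) T(2) by blast
  have yt: "y \<in> tval" using s(2) ball_T_tval by blast
  have "tinv s \<in> ball_T 1" using ball_T_SucI[OF T_inv[OF s(1)], of tone 0] by simp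
  from ball_T_add[OF Suc.IH[OF s(2)] this] show ?case using tinv_mul[OF st yt] s(3) by (simp del: ball_T.simps)
qed

lemma len_inv: "x \<in> tval \<Longrightarrow> len (tinv x) = len x"
proof -
  have "len (tinv x) \<le> len x" if "x \<in> tval" for x
    using ball_T_inv len_le_iff that tval_inv by blast
  then show "x \<in> tval \<Longrightarrow> len (tinv x) = len x" by (metis antisym tinv_tinv tval_inv)
qed

lemma len_upper: "\<exists>C. \<forall>m\<ge>0. \<forall>x\<in>tval. bd m x \<longrightarrow> len x \<le> C * nat (m + 1)"
  using bd_imp_ball_T len_le_iff by metis

lemma len_lower: "\<exists>C\<ge>0. \<forall>x\<in>tval. bd (C * int (len x + 1)) x"
  using ball_T_bd len_le_iff by (metis order_refl)

lemma word_metric_len: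
  "x \<in> tval \<Longrightarrow> y \<in> tval \<Longrightarrow> word_metric abels4_mod_Z S (zcoset x) (zcoset y) = real (len (tmul (tinv x) y))"
  by (simp add: word_metric_def abels4_mod_Z_carrier len_def abels4_mod_Z_inv abels4_mod_Z_mult)

lemma word_metric_triangle:
  assumes "g \<in> carrier abels4_mod_Z" "h \<in> carrier abels4_mod_Z" "k \<in> carrier abels4_mod_Z"
  shows "word_metric abels4_mod_Z S g k \<le> word_metric abels4_mod_Z S g h + word_metric abels4_mod_Z S h k"
proof -
  obtain x y z where x: "x \<in> tval" "g = zcoset x" and y: "y \<in> tval" "h = zcoset y" and z: "z \<in> tval" "k = zcoset z"
    using assms unfolding abels4_mod_Z_carrier by blast
  have "tmul (tinv x) z = tmul (tinv x) (tmul (tmul y (tinv y)) z)" using y(1) by (simp add: tmul_inv)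
  also have "\<dots> = tmul (tmul (tinv x) y) (tmul (tinv y) z)" by (simp only: tmul_assoc)
  finally have "len (tmul (tinv x) z) \<le> len (tmul (tinv x) y) + len (tmul (tinv y) z)"
    using len_mul[of "tmul (tinv x) y" "tmul (tinv y) z"] x(1) y(1) z(1) by (simp add: tval_mul tval_inv)
  then show ?thesis by (simp add: x y z word_metric_len)
qed

lemma word_metric_self: "word_metric abels4_mod_Z S g g = 0"
proof (cases "g \<in> carrier abels4_mod_Z")
  case True
  then obtain x where "x \<in> tval" "g = zcoset x" unfolding abels4_mod_Z_carrier by blast
  then show ?thesis by (simp add: word_metric_len tmul_inv len_one)
qed (simp add: word_metric_def)

lemma word_metric_sym: "word_metric abels4_mod_Z S g h = word_metric abels4_mod_Z S h g"
proof (cases "g \<in> carrier abels4_mod_Z \<and> h \<in> carrier abels4_mod_Z")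
  case True
  then obtain x y where x: "x \<in> tval" "g = zcoset x" and y: "y \<in> tval" "h = zcoset y"
    unfolding abels4_mod_Z_carrier by blast
  have "tinv (tmul (tinv x) y) = tmul (tinv y) x" using tinv_mul x y tinv_tinv tval_inv by metis
  then show ?thesis using len_inv[of "tmul (tinv x) y"] x y by (simp add: word_metric_len tval_mul tval_inv)
qed (auto simp: word_metric_def)

end

section \<open>Points and distances of an asymptotic cone\<close>

text \<open>The general facts on cones hold for any pseudometric on \<open>X\<close>. Symmetry and nonnegativity are assumed on
the whole type, as the word metric satisfies them there.\<close>

locale word_cone =
  fixes \<omega> :: "nat filter" and X :: "'a set" and d :: "'a \<Rightarrow> 'a \<Rightarrow> real" and x0 :: 'a
  assumes w_nontrivial: "\<omega> \<noteq> bot" and w_ultra: "\<And>P. eventually P \<omega> \<or> eventually (\<lambda>x. \<not> P x) \<omega>"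
    and w_sequentially: "\<omega> \<le> sequentially"
    and d_nonneg: "\<And>x y. 0 \<le> d x y" and d_sym: "\<And>x y. d x y = d y x" and d_self: "\<And>x. d x x = 0"
    and d_triangle: "\<And>x y z. x \<in> X \<Longrightarrow> y \<in> X \<Longrightarrow> z \<in> X \<Longrightarrow> d x z \<le> d x y + d y z"
    and x0: "x0 \<in> X"
begin

abbreviation "P \<equiv> precone X d x0"
abbreviation "\<delta> \<equiv> precone_dist \<omega> d"

lemma w_pos: "eventually (\<lambda>n. 1 \<le> n) \<omega>"
  using w_sequentially eventually_ge_at_top[of 1] by (rule filter_leD)

text \<open>A cluster point along an ultrafilter is a limit.\<close>

lemma ultrafilter_bounded_convergent:
  fixes f :: "nat \<Rightarrow> real"
  assumes "eventually (\<lambda>n. f n \<in> {a..b}) \<omega>"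
  shows "\<exists>L\<in>{a..b}. (f \<longlongrightarrow> L) \<omega>"
proof -
  have "filtermap f \<omega> \<noteq> bot" using w_nontrivial by (simp add: filtermap_bot_iff)
  moreover have "eventually (\<lambda>y. y \<in> {a..b}) (filtermap f \<omega>)" using assms by (simp add: eventually_filtermap)
  ultimately obtain L where L: "L \<in> {a..b}" "inf (nhds L) (filtermap f \<omega>) \<noteq> bot"
    using compact_Icc[of a b] unfolding compact_filter by meson
  have "(f \<longlongrightarrow> L) \<omega>"
    unfolding filterlim_def le_filter_def
  proof (intro allI impI)
    fix Q assume Q: "eventually Q (nhds L)"
    show "eventually Q (filtermap f \<omega>)"
    proof (rule ccontr)
      assume "\<not> eventually Q (filtermap f \<omega>)"
      then have "eventually (\<lambda>y. \<not> Q y) (filtermap f \<omega>)"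
        using w_ultra[of "\<lambda>n. Q (f n)"] by (simp add: eventually_filtermap)
      with Q have "eventually (\<lambda>_. False) (inf (nhds L) (filtermap f \<omega>))"
        unfolding eventually_inf by blast
      then show False using L(2) by (simp add: eventually_False)
    qed
  qed
  then show ?thesis using L(1) by blast
qed

lemma precone_mem: "x \<in> P \<Longrightarrow> 1 \<le> n \<Longrightarrow> x n \<in> X"
  by (auto simp: precone_def)

lemma precone_bounded:
  assumes "x \<in> P" shows "\<exists>K. eventually (\<lambda>n. d (x n) x0 \<le> K * real n) \<omega>"
proof -
  have "limsup (\<lambda>n. ereal (d (x n) x0 / real n)) < \<infinity>" using assms by (simp add: precone_def)
  then obtain K :: real where K: "limsup (\<lambda>n. ereal (d (x n) x0 / real n)) < ereal K"
    by (metis less_PInf_Ex_of_nat order_le_less_trans ereal_dense2)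
  have "eventually (\<lambda>n. d (x n) x0 / real n < K) \<omega>"
    using filter_leD[OF w_sequentially Limsup_lessD[OF K]] by simp
  with w_pos have "eventually (\<lambda>n. d (x n) x0 \<le> K * real n) \<omega>"
    by eventually_elim (simp add: pos_divide_less_eq)
  then show ?thesis by blast
qed

lemma precone_limit:
  assumes "x \<in> P" "y \<in> P" shows "((\<lambda>n. d (x n) (y n) / real n) \<longlongrightarrow> \<delta> x y) \<omega>"
proof -
  obtain K L where K: "eventually (\<lambda>n. d (x n) x0 \<le> K * real n) \<omega>" and L: "eventually (\<lambda>n. d (y n) x0 \<le> L * real n) \<omega>"
    using precone_bounded assms by meson
  have "eventually (\<lambda>n. d (x n) (y n) / real n \<in> {0..K + L}) \<omega>"
    using K L w_pos
  proof eventually_elim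
    case (elim n)
    have "d (x n) (y n) \<le> d (x n) x0 + d x0 (y n)" using elim(3) assms by (intro d_triangle precone_mem x0)
    also have "\<dots> \<le> (K + L) * real n" using elim(1,2) by (simp add: d_sym[of x0] distrib_right)
    finally show ?case using elim(3) d_nonneg by (simp add: pos_divide_le_eq)
  qed
  from ultrafilter_bounded_convergent[OF this] obtain M where "((\<lambda>n. d (x n) (y n) / real n) \<longlongrightarrow> M) \<omega>" by (rule bexE)
  moreover from this have "\<delta> x y = M" unfolding precone_dist_def by (rule tendsto_Lim[OF w_nontrivial])
  ultimately show ?thesis by simp
qed

lemma precone_distI:
  assumes "((\<lambda>n. d (x n) (y n) / real n) \<longlongrightarrow> M) \<omega>" shows "\<delta> x y = M"
  unfolding precone_dist_def using assms by (rule tendsto_Lim[OF w_nontrivial])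

lemma precone_dist_nonneg: "x \<in> P \<Longrightarrow> y \<in> P \<Longrightarrow> 0 \<le> \<delta> x y"
  using tendsto_lowerbound[OF precone_limit _ w_nontrivial, of x y 0] d_nonneg by simp

lemma precone_dist_sym: "\<delta> x y = \<delta> y x"
  unfolding precone_dist_def by (subst d_sym) simp

lemma precone_dist_self: "\<delta> x x = 0"
  by (rule precone_distI) (simp add: d_self)

lemma precone_dist_triangle:
  assumes "x \<in> P" "y \<in> P" "z \<in> P" shows "\<delta> x z \<le> \<delta> x y + \<delta> y z"
proof (rule tendsto_le[OF w_nontrivial])
  show "((\<lambda>n. d (x n) (y n) / real n + d (y n) (z n) / real n) \<longlongrightarrow> \<delta> x y + \<delta> y z) \<omega>"
    by (intro tendsto_add precone_limit assms)
  show "((\<lambda>n. d (x n) (z n) / real n) \<longlongrightarrow> \<delta> x z) \<omega>" by (intro precone_limit assms)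
  show "eventually (\<lambda>n. d (x n) (z n) / real n \<le> d (x n) (y n) / real n + d (y n) (z n) / real n) \<omega>"
    using w_pos
  proof eventually_elim
    case (elim n)
    have "d (x n) (z n) \<le> d (x n) (y n) + d (y n) (z n)" using elim assms by (intro d_triangle precone_mem)
    then show ?case by (simp add: divide_right_mono flip: add_divide_distrib)
  qed
qed

lemma equiv_precone_rel: "equiv P (precone_rel \<omega> X d x0)"
proof (rule equivI)
  show "precone_rel \<omega> X d x0 \<subseteq> P \<times> P" by (auto simp: precone_rel_def)
  show "refl_on P (precone_rel \<omega> X d x0)" by (auto simp: refl_on_def precone_rel_def precone_dist_self)
  show "sym (precone_rel \<omega> X d x0)" by (auto simp: sym_def precone_rel_def precone_dist_sym)
  show "trans (precone_rel \<omega> X d x0)"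
  proof (rule transI)
    fix x y z assume "(x, y) \<in> precone_rel \<omega> X d x0" "(y, z) \<in> precone_rel \<omega> X d x0"
    then have m: "x \<in> P" "y \<in> P" "z \<in> P" and z: "\<delta> x y = 0" "\<delta> y z = 0" by (auto simp: precone_rel_def)
    show "(x, z) \<in> precone_rel \<omega> X d x0"
      using precone_dist_triangle[OF m] precone_dist_nonneg[OF m(1,3)] m z by (simp add: precone_rel_def)
  qed
qed

definition point :: "(nat \<Rightarrow> 'a) \<Rightarrow> (nat \<Rightarrow> 'a) set" where "point x = precone_rel \<omega> X d x0 `` {x}"

lemma cone_eq_point: "asymptotic_cone \<omega> X d x0 = point ` P"
  by (auto simp: asymptotic_cone_def quotient_def point_def)

lemma point_eq_iff: "x \<in> P \<Longrightarrow> y \<in> P \<Longrightarrow> point x = point y \<longleftrightarrow> \<delta> x y = 0"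
  unfolding point_def by (simp add: eq_equiv_class_iff[OF equiv_precone_rel]) (simp add: precone_rel_def)

lemma cone_dist_point:
  assumes x: "x \<in> P" and y: "y \<in> P"
  shows "cone_dist \<omega> X d x0 (point x) (point y) = \<delta> x y"
proof -
  have rep: "(SOME z. z \<in> point x) \<in> P \<and> \<delta> x (SOME z. z \<in> point x) = 0" if "x \<in> P" for x
  proof -
    have "x \<in> point x" using that by (simp add: point_def precone_rel_def precone_dist_self)
    then have "(SOME z. z \<in> point x) \<in> point x" by (rule someI[of "\<lambda>z. z \<in> point x"])
    moreover have "z \<in> point x \<Longrightarrow> z \<in> P \<and> \<delta> x z = 0" for z by (simp add: point_def precone_rel_def)
    ultimately show ?thesis by blast
  qed
  define a b where "a = (SOME z. z \<in> point x)" and "b = (SOME z. z \<in> point y)"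
  have a: "a \<in> P" "\<delta> x a = 0" "\<delta> a x = 0" and b: "b \<in> P" "\<delta> y b = 0" "\<delta> b y = 0"
    using rep[OF x] rep[OF y] precone_dist_sym by (simp_all add: a_def b_def)
  have "\<delta> a b = \<delta> x y"
    using precone_dist_triangle[of a x b] precone_dist_triangle[of x y b] precone_dist_triangle[of x a y]
      precone_dist_triangle[of a b y] x y a b by linarith
  then show ?thesis using x y by (simp add: cone_dist_def cone_eq_point a_def b_def)
qed

lemma Metric_space_cone: "Metric_space (asymptotic_cone \<omega> X d x0) (cone_dist \<omega> X d x0)"
proof
  let ?M = "asymptotic_cone \<omega> X d x0" and ?D = "cone_dist \<omega> X d x0"
  show "0 \<le> ?D a b" for a b
  proof (cases "a \<in> ?M \<and> b \<in> ?M")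
    case True
    then show ?thesis unfolding cone_eq_point by (auto simp: cone_dist_point precone_dist_nonneg)
  qed (auto simp: cone_dist_def)
  show "?D a b = ?D b a" for a b
  proof (cases "a \<in> ?M \<and> b \<in> ?M")
    case True
    then show ?thesis unfolding cone_eq_point by (auto simp: cone_dist_point intro: precone_dist_sym)
  qed (auto simp: cone_dist_def)
  show "?D a b = 0 \<longleftrightarrow> a = b" if "a \<in> ?M" "b \<in> ?M" for a b
  proof -
    obtain x y where "x \<in> P" "y \<in> P" "a = point x" "b = point y" using \<open>a \<in> ?M\<close> \<open>b \<in> ?M\<close> unfolding cone_eq_point by blast
    then show ?thesis by (simp only: cone_dist_point point_eq_iff)
  qed
  show "?D a c \<le> ?D a b + ?D b c" if "a \<in> ?M" "b \<in> ?M" "c \<in> ?M" for a b c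
    using that unfolding cone_eq_point by (auto simp: cone_dist_point precone_dist_triangle)
qed

text \<open>Membership in the precone is a bound along all integers, whereas the constructions below give bounds along the
ultrafilter only. Where the bound fails, the sequence is replaced by the base point, and this does
not change the point of the cone.\<close>

definition represent :: "(nat \<Rightarrow> 'a) \<Rightarrow> nat \<Rightarrow> 'a" where
  "represent y = (let K = (SOME K. eventually (\<lambda>n. y n \<in> X \<and> d (y n) x0 \<le> K * real n) \<omega>) in
     restrict (\<lambda>n. if y n \<in> X \<and> d (y n) x0 \<le> K * real n then y n else x0) {1..})"

lemma represent:
  assumes "eventually (\<lambda>n. y n \<in> X) \<omega>" "eventually (\<lambda>n. d (y n) x0 \<le> K * real n) \<omega>"
  shows "represent y \<in> P" "eventually (\<lambda>n. represent y n = y n) \<omega>"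
proof -
  define K' where "K' = (SOME K. eventually (\<lambda>n. y n \<in> X \<and> d (y n) x0 \<le> K * real n) \<omega>)"
  have rep: "represent y = restrict (\<lambda>n. if y n \<in> X \<and> d (y n) x0 \<le> K' * real n then y n else x0) {1..}"
    by (simp add: represent_def K'_def Let_def)
  have "eventually (\<lambda>n. y n \<in> X \<and> d (y n) x0 \<le> K * real n) \<omega>" using assms by (rule eventually_conj)
  then have "eventually (\<lambda>n. y n \<in> X \<and> d (y n) x0 \<le> K' * real n) \<omega>" unfolding K'_def
    by (rule someI[of "\<lambda>K. eventually (\<lambda>n. y n \<in> X \<and> d (y n) x0 \<le> K * real n) \<omega>"])
  with w_pos show "eventually (\<lambda>n. represent y n = y n) \<omega>" unfolding rep by eventually_elim simp
  have "eventually (\<lambda>n. ereal (d (represent y n) x0 / real n) \<le> ereal \<bar>K'\<bar>) sequentially"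
    using eventually_ge_at_top[of 1]
  proof eventually_elim
    case (elim n)
    have K': "K' * real n \<le> \<bar>K'\<bar> * real n" by (intro mult_right_mono) auto
    have "d (represent y n) x0 \<le> \<bar>K'\<bar> * real n"
      using elim by (auto simp: rep d_self intro: order_trans[OF _ K'])
    then show ?case using elim by (simp add: pos_divide_le_eq)
  qed
  from Limsup_bounded[OF this] have "limsup (\<lambda>n. ereal (d (represent y n) x0 / real n)) \<le> ereal \<bar>K'\<bar>" .
  then have "limsup (\<lambda>n. ereal (d (represent y n) x0 / real n)) < \<infinity>" by (rule order_le_less_trans) simp
  then show "represent y \<in> P" unfolding precone_def by (auto simp: rep x0)
qed

end

section \<open>The cone as a quotient of the model\<close>

text \<open>Finitely many entries of finite size have a common bound.\<close>

lemma (in valued_ring) exists_clos: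
  assumes "x \<in> PFin" shows "\<exists>d. clos d (0, 0, 0) x"
proof -
  obtain u a b where X: "x = (u, a, b)" by (cases x)
  have F: "e12 u \<in> Fin" "e23 u \<in> Fin" "e34 u \<in> Fin" "e13 u \<in> Fin" "e24 u \<in> Fin" "e14 u \<in> Fin"
    using assms by (simp_all add: PFin_def X UFin_def uni_in_def)
  define m where "m = - u"
  have G: "e13 m \<in> Fin" "e24 m \<in> Fin" "e14 m \<in> Fin"
    unfolding m_def uni_minus_sel by (intro Fin_add Fin_diff Fin_mult F)+
  obtain r where r: "\<And>i. i \<in> {e12 u, e23 u, e34 u, e13 u, e24 u, e14 u, e13 m, e24 m, e14 m} \<Longrightarrow> i \<in> B r"
  proof -
    have "\<exists>r. S \<subseteq> B r" if "finite S" "S \<subseteq> Fin" for S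
      using that
    proof (induction S)
      case (insert x S)
      obtain r s where "x \<in> B r" "S \<subseteq> B s" using insert by (auto simp: Fin_def)
      then show ?case using B_mono by (intro exI[of _ "max r s"]) (auto 4 4 intro: max.cobounded1 max.cobounded2)
    qed simp
    from this[of "{e12 u, e23 u, e34 u, e13 u, e24 u, e14 u, e13 m, e24 m, e14 m}"] show ?thesis
      using F G that by auto
  qed
  have r': "e12 m \<in> B r" "e23 m \<in> B r" "e34 m \<in> B r"
    unfolding m_def uni_minus_sel by (intro B_uminus r; simp)+
  let ?d = "\<bar>r\<bar> + \<bar>a\<bar> + \<bar>b\<bar>"
  have "clos ?d (0, 0, 0) x"
    unfolding clos_def near_def bnd_def X fst_conv snd_conv add_0_right minus_zero add_0_left m_def[symmetric]
    by (intro conjI B_mono[OF r] B_mono[OF r'(1)] B_mono[OF r'(2)] B_mono[OF r'(3)]) auto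
  then show ?thesis by blast
qed

context growth
begin

lemma mul_scale_B: "x * scale b \<in> B d \<longleftrightarrow> x \<in> B (d - b)"
proof
  assume "x * scale b \<in> B d"
  from B_mult[OF this scale_B(2)[of b]] show "x \<in> B (d - b)" by (simp add: mult.assoc scale_scale')
qed (use B_mult[OF _ scale_B(1)[of b], of x "d - b"] in simp)

lemma mul_scale'_B: "x * scale' a \<in> B d \<longleftrightarrow> x \<in> B (d + a)"
proof
  assume "x * scale' a \<in> B d"
  from B_mult[OF this scale_B(1)[of a]] show "x \<in> B (d + a)"
    by (simp add: mult.assoc mult.commute[of "scale' a"] scale_scale')
qed (use B_mult[OF _ scale_B(2)[of a], of x "d + a"] in simp)

lemma one_B: "1 \<in> B s \<longleftrightarrow> 0 \<le> s"
proof
  assume "0 \<le> s"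
  have "1 \<in> B (0 + - 0)" using B_mult[OF scale_B, of 0 0] scale_scale' by metis
  then show "1 \<in> B s" using B_mono \<open>0 \<le> s\<close> by force
qed (meson linorder_not_le one_notin_B)

lemma scale_scale'_B: "scale b * scale' a \<in> B d \<longleftrightarrow> b - a \<le> d"
  using mul_scale'_B[of "scale b" a d] mul_scale_B[of 1 b "d + a"] one_B[of "d + a - b"] by (simp add: diff_le_eq)

text \<open>The size is the infimum of all bounds. A bound that fails for \<open>s\<close> fails \<open>\<omega>\<close>-almost everywhere, because \<open>\<omega>\<close> is an ultrafilter, and
then gives a bound for the inverse.\<close>

lemma exact_size:
  assumes s: "s \<in> B r" "s' \<in> B r" "s * s' = 1"
  shows "\<exists>a. s \<in> B a \<and> s' \<in> B (- a)"
proof -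
  obtain c where c: "0 \<le> c" "\<And>m x. x \<noteq> 0 \<Longrightarrow> \<not> vb (m - 1) x \<Longrightarrow> vb m x \<Longrightarrow> vb (c - m) (inverse x)"
    using vb_constants by metis
  have inv: "vb (c - m) (inverse x)" if x: "x \<noteq> 0" "\<not> vb m x" for m x
  proof -
    have "vb (c - \<nu> x) (inverse x)" by (rule c(2)) (use x(1) \<nu>_props[OF x(1)] in auto)
    moreover have "m < \<nu> x" using x \<nu>_props by auto
    ultimately show ?thesis using vb_mono by force
  qed
  let ?A = "{a. s \<in> B a}"
  have low: "- r \<le> a" if "a \<in> ?A" for a
    using B_mult[of s a s' r] that s one_B[of "a + r"] by simp
  then have bdd: "bdd_below ?A" by (meson bdd_belowI)
  have ne: "?A \<noteq> {}" using s(1) by blast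
  let ?a = "Inf ?A"
  have "s \<in> B ?a"
  proof (rule B_closed)
    fix t assume "?a < t"
    then obtain a where "a \<in> ?A" "a < t" using cInf_lessD[OF ne] by blast
    then show "s \<in> B t" using B_mono by force
  qed
  moreover have "s' \<in> B (- ?a)"
  proof (rule B_closed)
    fix t assume "- ?a < t"
    then have "s \<notin> B (- t)" using cInf_lower[OF _ bdd, of "- t"] by force
    then obtain \<epsilon> where \<epsilon>: "0 < \<epsilon>" "\<not> eventually (\<lambda>n. vb \<lfloor>(- t + \<epsilon>) * real n\<rfloor> (s n)) \<omega>"
      unfolding B_def by blast
    then have ev: "eventually (\<lambda>n. \<not> vb \<lfloor>(- t + \<epsilon>) * real n\<rfloor> (s n)) \<omega>"
      using omega_ultra by blast
    show "s' \<in> B t"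
    proof (rule B_I)
      fix \<eta> :: real assume \<eta>: "0 < \<eta>"
      show "eventually (\<lambda>n. vb \<lfloor>(t + \<eta>) * real n\<rfloor> (s' n)) \<omega>"
        using ev omega_linear[OF \<eta>, of "real_of_int c + 1"]
      proof eventually_elim
        case (elim n)
        have "(s * s') n = 1 n" by (simp only: s(3))
        then have ss: "s n * s' n = 1" by simp
        then have "s n \<noteq> 0" by auto
        moreover have "s' n = inverse (s n)" using inverse_unique[OF ss] by simp
        ultimately have "vb (c - \<lfloor>(- t + \<epsilon>) * real n\<rfloor>) (s' n)" using inv elim(1) by simp
        moreover have "c - \<lfloor>(- t + \<epsilon>) * real n\<rfloor> \<le> \<lfloor>(t + \<eta>) * real n\<rfloor>"
        proof -
          have "(t + \<eta>) * real n = t * real n + \<eta> * real n" "(- t + \<epsilon>) * real n = - (t * real n) + \<epsilon> * real n"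
            "0 \<le> \<epsilon> * real n" using \<epsilon>(1) by (simp_all add: algebra_simps)
          then show ?thesis using elim(2) by linarith
        qed
        ultimately show ?case by (rule vb_mono)
      qed
    qed
  qed
  ultimately show ?thesis by blast
qed

text \<open>A bound for the growth rate of the size \<open>bd\<close> along a sequence of tuples.\<close>

definition tup_B :: "real \<Rightarrow> (nat \<Rightarrow> 'k tup) \<Rightarrow> bool" where
  "tup_B d D \<longleftrightarrow> (\<lambda>n. t12 (D n)) \<in> B d \<and> (\<lambda>n. t23 (D n)) \<in> B d \<and> (\<lambda>n. t34 (D n)) \<in> B d \<and>
     (\<lambda>n. t13 (D n)) \<in> B d \<and> (\<lambda>n. t24 (D n)) \<in> B d \<and> (\<lambda>n. t22 (D n)) \<in> B d \<and> (\<lambda>n. t33 (D n)) \<in> B d \<and>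
     (\<lambda>n. inverse (t22 (D n))) \<in> B d \<and> (\<lambda>n. inverse (t33 (D n))) \<in> B d"

lemma tup_B_D: "tup_B d D \<Longrightarrow> 0 < \<epsilon> \<Longrightarrow> eventually (\<lambda>n. bd \<lfloor>(d + \<epsilon>) * real n\<rfloor> (D n)) \<omega>"
  unfolding tup_B_def bd_def eventually_conj_iff by (blast dest: B_D)

lemma tup_B_I:
  assumes "\<And>\<epsilon>. 0 < \<epsilon> \<Longrightarrow> eventually (\<lambda>n. bd \<lfloor>(d + \<epsilon>) * real n\<rfloor> (D n)) \<omega>"
  shows "tup_B d D"
  using assms unfolding tup_B_def bd_def eventually_conj_iff by (intro conjI B_I) blast+

text \<open>The sequence of group elements that is represented by a point of the model.\<close>

definition tup :: "(nat \<Rightarrow> 'k) point \<Rightarrow> nat \<Rightarrow> 'k tup" where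
  "tup x n = (let u = fst x; s = scale (fst (snd x)) n; t = scale (snd (snd x)) n in
     (e12 u n * s, e23 u n * t, e34 u n, e13 u n * t, e24 u n, s, t))"

text \<open>The quotient of two such sequences, written out to avoid inverses of tuples.\<close>

definition dif :: "(nat \<Rightarrow> 'k) point \<Rightarrow> (nat \<Rightarrow> 'k) point \<Rightarrow> nat \<Rightarrow> 'k tup" where
  "dif x y n = (let w = - fst x + fst y; s = scale (fst (snd y)) n; t = scale (snd (snd y)) n;
       s' = scale' (fst (snd x)) n; t' = scale' (snd (snd x)) n in
     (e12 w n * s, e23 w n * t * s', e34 w n * t', e13 w n * t, e24 w n * s', s * s', t * t'))"

lemma scale_apply: "scale a n * scale' a n = 1" "scale' a n * scale a n = 1" "scale a n \<noteq> 0" "scale' a n \<noteq> 0"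
proof -
  have "(scale a * scale' a) n = 1 n" by (simp only: scale_scale')
  then show 1: "scale a n * scale' a n = 1" by simp
  then show "scale' a n * scale a n = 1" by (simp add: mult.commute)
  show "scale a n \<noteq> 0" "scale' a n \<noteq> 0" using 1 by auto
qed

lemma inverse_scale: "inverse (scale a n) = scale' a n" "inverse (scale' a n) = scale a n"
  using scale_apply[of a n] by (auto intro: inverse_unique)

lemma tup_tval: "tup x n \<in> tval" "dif x y n \<in> tval"
  by (simp_all add: tup_def dif_def Let_def tval_def scale_apply)

lemma tup_dif: "tmul (tup x n) (dif x y n) = tup y n"
proof -
  define w where "w = - fst x + fst y"
  have y: "fst y = fst x + w" by (simp add: w_def add.assoc[symmetric])
  have c: "scale a n * (b * scale' a n) = b" "scale a n * (b * (c * scale' a n)) = b * c" for a b c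
    using scale_apply(1)[of a n] by (simp_all add: mult.left_commute mult.assoc)
  show ?thesis
    unfolding tmul_def tup_def dif_def Let_def w_def[symmetric] fst_conv snd_conv
    unfolding y by (simp add: algebra_simps c scale_apply)
qed

lemma tinv_tup: "tmul (tinv (tup x n)) (tup y n) = dif x y n"
proof -
  have "tmul (tinv (tup x n)) (tup y n) = tmul (tmul (tinv (tup x n)) (tup x n)) (dif x y n)"
    by (simp only: tup_dif tmul_assoc)
  then show ?thesis using tmul_inv(2)[OF tup_tval(1)[of x n]] by simp
qed

text \<open>Up to the corner, the growth rate of the quotient is the distance in the model.\<close>

lemma tup_B_dif:
  "tup_B d (dif x y) \<longleftrightarrow> near (snd x) (snd y) d \<and>
     e12 (- fst x + fst y) \<in> B (d - fst (snd y)) \<and>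
     e23 (- fst x + fst y) \<in> B (fst (snd x) - snd (snd y) + d) \<and>
     e34 (- fst x + fst y) \<in> B (snd (snd x) + d) \<and>
     e13 (- fst x + fst y) \<in> B (d - snd (snd y)) \<and> e24 (- fst x + fst y) \<in> B (fst (snd x) + d)"
proof -
  define w where "w = - fst x + fst y"
  have eta: "(\<lambda>n. f n * g n) = f * g" for f g :: "nat \<Rightarrow> 'k" by (rule ext) simp
  have sw: "inverse (scale a n * scale' b n) = scale b n * scale' a n" for a b n
    by (simp add: inverse_mult_distrib inverse_scale mult.commute)
  have "tup_B d (dif x y) \<longleftrightarrow>
     e12 w * scale (fst (snd y)) \<in> B d \<and> e23 w * scale (snd (snd y)) * scale' (fst (snd x)) \<in> B d \<and>
     e34 w * scale' (snd (snd x)) \<in> B d \<and> e13 w * scale (snd (snd y)) \<in> B d \<and>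
     e24 w * scale' (fst (snd x)) \<in> B d \<and> scale (fst (snd y)) * scale' (fst (snd x)) \<in> B d \<and>
     scale (snd (snd y)) * scale' (snd (snd x)) \<in> B d \<and> scale (fst (snd x)) * scale' (fst (snd y)) \<in> B d \<and>
     scale (snd (snd x)) * scale' (snd (snd y)) \<in> B d"
    unfolding tup_B_def dif_def Let_def w_def[symmetric] fst_conv snd_conv sw eta by blast
  also have "\<dots> \<longleftrightarrow> near (snd x) (snd y) d \<and> e12 w \<in> B (d - fst (snd y)) \<and>
     e23 w \<in> B (fst (snd x) - snd (snd y) + d) \<and> e34 w \<in> B (snd (snd x) + d) \<and>
     e13 w \<in> B (d - snd (snd y)) \<and> e24 w \<in> B (fst (snd x) + d)"
    unfolding scale_scale'_B unfolding mul_scale_B mul_scale'_B near_def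
    by (auto simp: algebra_simps abs_le_iff)
  finally show ?thesis unfolding w_def .
qed

lemma clos_tup_B: "clos d x y \<Longrightarrow> tup_B d (dif x y)"
  unfolding tup_B_dif clos_def bnd_def by (elim conjE) (intro conjI; assumption)

text \<open>The tuples do not see the corner, and a corner translation makes it vanish. The corner of the inverse
is a polynomial in the other entries; the factor \<open>6\<close> accommodates its terms.\<close>

lemma tup_B_clos:
  assumes "tup_B d (dif x y)"
  shows "clos (6 * d) x (zact (- e14 (- fst x + fst y)) y)"
proof -
  define a b where "a = snd x" and "b = snd y"
  define w where "w = - fst x + fst y"
  define v where "v = - fst x + (el14 (- e14 w) + fst y)"
  have "v = el14 (- e14 w) + w" 
    unfolding v_def w_def add.assoc[symmetric] by (simp only: el14_central)
  then have v: "e12 v = e12 w" "e23 v = e23 w" "e34 v = e34 w" "e13 v = e13 w" "e24 v = e24 w" "e14 v = 0" by simp_all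
  have m: "- (el14 (- e14 w) + fst y) + fst x = - v" by (simp add: v_def minus_add add.assoc)
  have n: "near a b d" and e12: "e12 v \<in> B (d - fst b)" and e23: "e23 v \<in> B (fst a - snd b + d)"
    and e34: "e34 v \<in> B (snd a + d)" and e13: "e13 v \<in> B (d - snd b)" and e24: "e24 v \<in> B (fst a + d)"
    using assms unfolding tup_B_dif a_def b_def w_def[symmetric] v by simp_all
  have d: "0 \<le> d" using n by (rule near_nonneg)
  have n': "fst a - fst b \<le> d" "fst b - fst a \<le> d" "snd a - snd b \<le> d" "snd b - snd a \<le> d"
    using n by (auto simp: near_def)
  have forward: "bnd a b (6 * d) v"
    unfolding bnd_def v(6) using e12 e23 e34 e13 e24 d by (auto intro: B_0 elim!: B_mono)
  have backward: "bnd b a (6 * d) (- v)"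
    unfolding bnd_def uni_minus_sel v(6)
  proof (intro conjI)
    show "- e12 v \<in> B (6 * d - fst a)" by (rule B_mono[OF B_uminus[OF e12]]) (use n' d in linarith)
    show "- e23 v \<in> B (fst b - snd a + 6 * d)" by (rule B_mono[OF B_uminus[OF e23]]) (use n' d in linarith)
    show "- e34 v \<in> B (snd b + 6 * d)" by (rule B_mono[OF B_uminus[OF e34]]) (use n' d in linarith)
    show "e12 v * e23 v - e13 v \<in> B (6 * d - snd a)"
      by (intro B_diff B_mult'[OF e12 e23] B_mono[OF e13]) (use n' d in linarith)+
    show "e23 v * e34 v - e24 v \<in> B (fst b + 6 * d)"
      by (intro B_diff B_mult'[OF e23 e34] B_mono[OF e24]) (use n' d in linarith)+
    show "e12 v * e24 v + e13 v * e34 v - 0 - e12 v * e23 v * e34 v \<in> B (6 * d)"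
      by (intro B_add B_diff B_0 B_mult'[OF e12 e24] B_mult'[OF e13 e34] B_mult'[OF B_mult[OF e12 e23] e34])
        (use n' d in linarith)+
  qed
  have "near a b (6 * d)" using n d unfolding near_def by linarith
  moreover have "near b a (6 * d)" using calculation near_sym by blast
  ultimately show ?thesis
    using forward backward unfolding clos_def zact_def act_def fst_conv snd_conv w_def[symmetric] v_def[symmetric] m a_def b_def
    by blast
qed

end

locale abels_cone = growth V V0 l \<omega> + word_growth V V0 l S
  for V V0 :: "'k::topological_field set" and l :: 'k and \<omega> and S +
  fixes x0 :: "('k ^ 4 ^ 4) set"
  assumes base_point: "x0 \<in> carrier abels4_mod_Z"
begin

abbreviation "wd \<equiv> word_metric abels4_mod_Z S"

sublocale W: word_cone \<omega> "carrier abels4_mod_Z" wd x0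
  by unfold_locales
    (use omega_nontrivial omega_ultra omega_sequentially word_metric_sym word_metric_self word_metric_triangle base_point
      in \<open>auto simp: word_metric_def\<close>)

text \<open>The additive constant in the comparison of lengths with sizes is absorbed by \<open>\<epsilon>\<close>.\<close>

lemma len_limit_upper:
  "\<exists>C>0. \<forall>D d. 0 \<le> d \<longrightarrow> (\<forall>n. D n \<in> tval) \<longrightarrow> tup_B d D \<longrightarrow>
     (\<forall>\<epsilon>>0. eventually (\<lambda>n. real (len (D n)) \<le> (C * d + \<epsilon>) * real n) \<omega>)"
proof -
  obtain C where C: "\<And>m x. 0 \<le> m \<Longrightarrow> x \<in> tval \<Longrightarrow> bd m x \<Longrightarrow> len x \<le> C * nat (m + 1)" using len_upper by blast
  show ?thesis
  proof (intro exI[of _ "real C + 1"] conjI allI impI)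
    fix D d and \<epsilon> :: real
    assume d: "0 \<le> d" and D: "\<forall>n. D n \<in> tval" "tup_B d D" and \<epsilon>: "0 < \<epsilon>"
    define \<eta> where "\<eta> = \<epsilon> / (2 * (real C + 1))"
    have \<eta>: "0 < \<eta>" "real C * \<eta> \<le> \<epsilon> / 2" using \<epsilon> by (auto simp: \<eta>_def field_simps)
    have half: "0 < \<epsilon> / 2" using \<epsilon> by simp
    show "eventually (\<lambda>n. real (len (D n)) \<le> ((real C + 1) * d + \<epsilon>) * real n) \<omega>"
      using tup_B_D[OF D(2) \<eta>(1)] omega_linear[OF half, of "real C"]
    proof eventually_elim
      case (elim n)
      let ?m = "\<lfloor>(d + \<eta>) * real n\<rfloor>"
      have m: "0 \<le> ?m" using d \<eta>(1) by simp
      have "real (len (D n)) \<le> real (C * nat (?m + 1))" using C[OF m _ elim(1)] D(1) by (simp only: of_nat_le_iff)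
      also have "\<dots> = real C * (of_int ?m + 1)" using m by simp
      also have "\<dots> \<le> real C * ((d + \<eta>) * real n + 1)" by (intro mult_left_mono) auto
      also have "\<dots> = (real C * d + real C * \<eta>) * real n + real C" by (simp add: algebra_simps)
      also have "\<dots> \<le> (real C * d + \<epsilon> / 2) * real n + \<epsilon> / 2 * real n"
        using elim(2) mult_right_mono[OF \<eta>(2), of "real n"] by (simp add: algebra_simps)
      also have "\<dots> = (real C * d + \<epsilon>) * real n" by (simp add: algebra_simps)
      also have "\<dots> \<le> ((real C + 1) * d + \<epsilon>) * real n" using d by (intro mult_right_mono) (auto simp: algebra_simps)
      finally show ?case .
    qed
  qed simp
qed

text \<open>The additive constant disappears in the definition of the growth rate.\<close>

lemma len_limit_lower:
  "\<exists>C>0. \<forall>D d. 0 \<le> d \<longrightarrow> eventually (\<lambda>n. D n \<in> tval) \<omega> \<longrightarrow> eventually (\<lambda>n. real (len (D n)) \<le> d * real n) \<omega> \<longrightarrow>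
     tup_B (C * d) D"
proof -
  obtain C where C: "0 \<le> C" "\<And>x. x \<in> tval \<Longrightarrow> bd (C * int (len x + 1)) x" using len_lower by blast
  show ?thesis
  proof (intro exI[of _ "real_of_int C + 1"] conjI allI impI)
    fix D d assume d: "0 \<le> d" and D: "eventually (\<lambda>n. D n \<in> tval) \<omega>" "eventually (\<lambda>n. real (len (D n)) \<le> d * real n) \<omega>"
    show "tup_B ((real_of_int C + 1) * d) D"
    proof (rule tup_B_I)
      fix \<epsilon> :: real assume \<epsilon>: "0 < \<epsilon>"
      show "eventually (\<lambda>n. bd \<lfloor>((real_of_int C + 1) * d + \<epsilon>) * real n\<rfloor> (D n)) \<omega>"
        using D omega_linear[OF \<epsilon>, of "real_of_int C"]
      proof eventually_elim
        case (elim n)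
        have "real_of_int (C * int (len (D n) + 1)) = real_of_int C * real (len (D n)) + real_of_int C"
          by (simp add: algebra_simps)
        also have "\<dots> \<le> real_of_int C * (d * real n) + \<epsilon> * real n"
          using elim(2,3) C(1) by (intro add_mono mult_left_mono) auto
        also have "\<dots> \<le> ((real_of_int C + 1) * d + \<epsilon>) * real n" using d by (simp add: algebra_simps)
        finally have "C * int (len (D n) + 1) \<le> \<lfloor>((real_of_int C + 1) * d + \<epsilon>) * real n\<rfloor>" by (simp only: le_floor_iff)
        then show ?case using C(2)[OF elim(1)] bd_mono by blast
      qed
    qed
  qed (use C(1) in simp)
qed

definition rep :: "(nat \<Rightarrow> 'k) point \<Rightarrow> nat \<Rightarrow> ('k ^ 4 ^ 4) set" where
  "rep x = W.represent (\<lambda>n. zcoset (tup x n))"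

text \<open>The point of the cone below a point of the model.\<close>

definition q :: "(nat \<Rightarrow> 'k) point \<Rightarrow> (nat \<Rightarrow> ('k ^ 4 ^ 4) set) set" where "q x = W.point (rep x)"

abbreviation "ACone \<equiv> asymptotic_cone \<omega> (carrier abels4_mod_Z) wd x0"
abbreviation "cd \<equiv> cone_dist \<omega> (carrier abels4_mod_Z) wd x0"

lemma zcoset_carrier: "x \<in> tval \<Longrightarrow> zcoset x \<in> carrier abels4_mod_Z" by (simp add: abels4_mod_Z_carrier)

lemma wd_tup: "wd (zcoset (tup x n)) (zcoset (tup y n)) = real (len (dif x y n))"
  by (simp add: word_metric_len tup_tval tinv_tup)

lemma rep:
  assumes x: "x \<in> PFin"
  shows "rep x \<in> W.P" "eventually (\<lambda>n. rep x n = zcoset (tup x n)) \<omega>"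
proof -
  obtain d where d: "clos d (0, 0, 0) x" using exists_clos[OF x] by blast
  obtain C where "\<forall>D d. 0 \<le> d \<longrightarrow> (\<forall>n. D n \<in> tval) \<longrightarrow> tup_B d D \<longrightarrow>
     (\<forall>\<epsilon>>0. eventually (\<lambda>n. real (len (D n)) \<le> (C * d + \<epsilon>) * real n) \<omega>)" using len_limit_upper by blast
  then have C: "\<forall>\<epsilon>>0. eventually (\<lambda>n. real (len (dif (0, 0, 0) x n)) \<le> (C * d + \<epsilon>) * real n) \<omega>"
    using clos_tup_B[OF d] clos_nonneg[OF d] tup_tval(2) by simp
  define c where "c = wd (zcoset (tup (0, 0, 0) 0)) x0"
  have o: "tup (0, 0, 0) n = tup (0, 0, 0) 0" for n by (simp add: tup_def scale_def)
  have "eventually (\<lambda>n. wd (zcoset (tup x n)) x0 \<le> (C * d + 2) * real n) \<omega>"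
    using C[rule_format, OF zero_less_one] omega_linear[OF zero_less_one, of c]
  proof eventually_elim
    case (elim n)
    have "wd (zcoset (tup x n)) x0 \<le> wd (zcoset (tup x n)) (zcoset (tup (0, 0, 0) n)) + wd (zcoset (tup (0, 0, 0) n)) x0"
      by (intro word_metric_triangle zcoset_carrier tup_tval base_point)
    also have "wd (zcoset (tup x n)) (zcoset (tup (0, 0, 0) n)) = real (len (dif (0, 0, 0) x n))"
      by (subst word_metric_sym) (rule wd_tup)
    also have "wd (zcoset (tup (0, 0, 0) n)) x0 = c" unfolding c_def by (subst o) (rule refl)
    also have "real (len (dif (0, 0, 0) x n)) + c \<le> (C * d + 1) * real n + 1 * real n" using elim by (rule add_mono)
    finally show ?case by (simp add: algebra_simps)
  qed
  moreover have "eventually (\<lambda>n. zcoset (tup x n) \<in> carrier abels4_mod_Z) \<omega>" by (simp add: zcoset_carrier tup_tval)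
  ultimately show "rep x \<in> W.P" "eventually (\<lambda>n. rep x n = zcoset (tup x n)) \<omega>"
    unfolding rep_def by (blast intro: W.represent)+
qed

lemma q_dist:
  assumes "x \<in> PFin" "y \<in> PFin"
  shows "((\<lambda>n. real (len (dif x y n)) / real n) \<longlongrightarrow> cd (q x) (q y)) \<omega>"
proof -
  have "eventually (\<lambda>n. wd (rep x n) (rep y n) / real n = real (len (dif x y n)) / real n) \<omega>"
    using rep(2)[OF assms(1)] rep(2)[OF assms(2)] by eventually_elim (simp add: wd_tup)
  from Lim_transform_eventually[OF W.precone_limit[OF rep(1)[OF assms(1)] rep(1)[OF assms(2)]] this]
  show ?thesis unfolding q_def W.cone_dist_point[OF rep(1)[OF assms(1)] rep(1)[OF assms(2)]] .
qed

lemma limit_le: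
  assumes lim: "((\<lambda>n. f n / real n) \<longlongrightarrow> L) \<omega>" and f: "\<And>\<epsilon>. 0 < \<epsilon> \<Longrightarrow> eventually (\<lambda>n. f n \<le> (c + \<epsilon>) * real n) \<omega>"
  shows "L \<le> c"
proof (rule field_le_epsilon)
  fix \<epsilon> :: real assume \<epsilon>: "0 < \<epsilon>"
  show "L \<le> c + \<epsilon>"
  proof (rule tendsto_upperbound[OF lim _ omega_nontrivial])
    show "eventually (\<lambda>n. f n / real n \<le> c + \<epsilon>) \<omega>"
      using f[OF \<epsilon>] omega_large[of 1] by eventually_elim (simp add: pos_divide_le_eq)
  qed
qed

text \<open>The heights of the preimage are the exact sizes of the two diagonal sequences. After division by
\<^const>\<open>scale\<close> the diagonal has growth rate \<open>0\<close> and does not contribute to the distance.\<close>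

lemma q_surjective:
  assumes \<xi>: "\<xi> \<in> W.P"
  shows "\<exists>x\<in>PFin. q x = W.point \<xi>"
proof -
  define y where "y n = (if 1 \<le> n then coords (\<xi> n) else tone)" for n
  have y: "y n \<in> tval" for n using coords_tval[OF W.precone_mem[OF \<xi>]] tval_one by (simp only: y_def split: if_split) blast
  have \<xi>y: "\<xi> n = zcoset (y n)" if "1 \<le> n" for n using zcoset_coords[OF W.precone_mem[OF \<xi> that]] that by (simp add: y_def)
  obtain K where K: "eventually (\<lambda>n. wd (\<xi> n) x0 \<le> K * real n) \<omega>" using W.precone_bounded[OF \<xi>] by blast
  have "eventually (\<lambda>n. real (len (y n)) \<le> (\<bar>K\<bar> + 1) * real n) \<omega>"
    using K omega_linear[OF zero_less_one, of "wd (zcoset tone) x0"] omega_large[of 1]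
  proof eventually_elim
    case (elim n)
    have K': "K * real n \<le> \<bar>K\<bar> * real n" by (intro mult_right_mono) auto
    have ti: "tinv tone = (tone :: 'k tup)" by (simp add: tinv_def tone_def)
    have "real (len (y n)) = wd (zcoset tone) (zcoset (y n))" by (simp add: word_metric_len tval_one y ti)
    also have "\<dots> \<le> wd (zcoset tone) x0 + wd x0 (zcoset (y n))"
      by (intro word_metric_triangle zcoset_carrier tval_one y base_point)
    also have "\<dots> \<le> 1 * real n + \<bar>K\<bar> * real n"
    proof (rule add_mono[OF elim(2)])
      show "wd x0 (zcoset (y n)) \<le> \<bar>K\<bar> * real n"
        using elim(1) K' unfolding word_metric_sym[of x0] \<xi>y[OF elim(3)] by (rule order_trans)
    qed
    finally show ?case by (simp add: algebra_simps)
  qed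
  moreover obtain C where "\<forall>D d. 0 \<le> d \<longrightarrow> eventually (\<lambda>n. D n \<in> tval) \<omega> \<longrightarrow>
      eventually (\<lambda>n. real (len (D n)) \<le> d * real n) \<omega> \<longrightarrow> tup_B (C * d) D" using len_limit_lower by blast
  ultimately have yB: "tup_B (C * (\<bar>K\<bar> + 1)) y" using y by (simp add: always_eventually)
  define r where "r = C * (\<bar>K\<bar> + 1)"
  have nz: "t22 (y n) \<noteq> 0" "t33 (y n) \<noteq> 0" for n using y[of n] by (auto simp: tval_def)
  have one: "(\<lambda>n. t22 (y n)) * (\<lambda>n. inverse (t22 (y n))) = 1" "(\<lambda>n. t33 (y n)) * (\<lambda>n. inverse (t33 (y n))) = 1"
    using nz by (auto simp: fun_eq_iff)
  have s: "(\<lambda>n. t12 (y n)) \<in> B r" "(\<lambda>n. t23 (y n)) \<in> B r" "(\<lambda>n. t34 (y n)) \<in> B r" "(\<lambda>n. t13 (y n)) \<in> B r"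
    "(\<lambda>n. t24 (y n)) \<in> B r" "(\<lambda>n. t22 (y n)) \<in> B r" "(\<lambda>n. t33 (y n)) \<in> B r"
    "(\<lambda>n. inverse (t22 (y n))) \<in> B r" "(\<lambda>n. inverse (t33 (y n))) \<in> B r"
    using yB unfolding tup_B_def r_def by blast+
  obtain a where a: "(\<lambda>n. t22 (y n)) \<in> B a" "(\<lambda>n. inverse (t22 (y n))) \<in> B (- a)"
    using exact_size[OF s(6,8) one(1)] by blast
  obtain b where b: "(\<lambda>n. t33 (y n)) \<in> B b" "(\<lambda>n. inverse (t33 (y n))) \<in> B (- b)"
    using exact_size[OF s(7,9) one(2)] by blast
  \<comment> \<open>Dividing by the diagonal leaves the unitriangular part; the corner is arbitrary.\<close>
  define u where "u = Uni ((\<lambda>n. t12 (y n)) * (\<lambda>n. inverse (t22 (y n)))) ((\<lambda>n. t23 (y n)) * (\<lambda>n. inverse (t33 (y n))))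
    (\<lambda>n. t34 (y n)) ((\<lambda>n. t13 (y n)) * (\<lambda>n. inverse (t33 (y n)))) (\<lambda>n. t24 (y n)) 0"
  define x where "x = (u, a, b)"
  have x: "x \<in> PFin"
    unfolding PFin_def x_def UFin_def uni_in_def u_def by (auto intro!: Fin_mult s[THEN Fin_I] Fin_0)
  define D :: "nat \<Rightarrow> 'k tup" where "D n = (0, 0, 0, 0, 0, scale' a n * t22 (y n), scale' b n * t33 (y n))" for n
  have D: "D n \<in> tval" for n by (simp add: D_def tval_def scale_apply nz)
  have xD: "tmul (tup x n) (D n) = y n" for n
  proof -
    have c: "scale e n * (scale' e n * z) = z" for e z using scale_apply(1)[of e n] by (simp flip: mult.assoc)
    show ?thesis
      using nz[of n] by (auto simp: tmul_def tup_def D_def x_def u_def Let_def prod_eq_iff c mult.assoc)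
  qed
  have D0: "tup_B 0 D"
  proof -
    have eta: "(\<lambda>n. f n * g n) = f * g" for f g :: "nat \<Rightarrow> 'k" by (rule ext) simp
    have z: "(\<lambda>n. 0) = (0 :: nat \<Rightarrow> 'k)" by (simp add: fun_eq_iff)
    have "scale' a * (\<lambda>n. t22 (y n)) \<in> B 0" "scale' b * (\<lambda>n. t33 (y n)) \<in> B 0"
      using B_mult[OF scale_B(2)[of a] a(1)] B_mult[OF scale_B(2)[of b] b(1)] by simp_all
    moreover have "scale a * (\<lambda>n. inverse (t22 (y n))) \<in> B 0" "scale b * (\<lambda>n. inverse (t33 (y n))) \<in> B 0"
      using B_mult[OF scale_B(1)[of a] a(2)] B_mult[OF scale_B(1)[of b] b(2)] by simp_all
    ultimately show ?thesis
      unfolding tup_B_def D_def fst_conv snd_conv inverse_mult_distrib inverse_scale eta z by (simp add: B_0)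
  qed
  obtain C' where C': "\<forall>\<epsilon>>0. eventually (\<lambda>n. real (len (D n)) \<le> (C' * 0 + \<epsilon>) * real n) \<omega>"
  proof -
    obtain C' where "\<forall>D d. 0 \<le> d \<longrightarrow> (\<forall>n. D n \<in> tval) \<longrightarrow> tup_B d D \<longrightarrow>
       (\<forall>\<epsilon>>0. eventually (\<lambda>n. real (len (D n)) \<le> (C' * d + \<epsilon>) * real n) \<omega>)" using len_limit_upper by blast
    from this[rule_format, OF order_refl D D0] show ?thesis by (intro that) blast
  qed
  have wdD: "wd (zcoset (tup x n)) (zcoset (y n)) = real (len (D n))" for n
  proof -
    have "tmul (tinv (tup x n)) (y n) = tmul (tmul (tinv (tup x n)) (tup x n)) (D n)" by (simp only: xD tmul_assoc)
    then have "tmul (tinv (tup x n)) (y n) = D n" using tmul_inv(2)[OF tup_tval(1)[of x n]] by simp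
    then show ?thesis by (simp add: word_metric_len tup_tval y)
  qed
  have "eventually (\<lambda>n. wd (rep x n) (\<xi> n) / real n = real (len (D n)) / real n) \<omega>"
    using rep(2)[OF x] omega_large[of 1] by eventually_elim (simp add: \<xi>y wdD)
  from Lim_transform_eventually[OF W.precone_limit[OF rep(1)[OF x] \<xi>] this]
  have "W.\<delta> (rep x) \<xi> \<le> 0" by (rule limit_le) (use C' in simp)
  then have "W.\<delta> (rep x) \<xi> = 0" using W.precone_dist_nonneg[OF rep(1)[OF x] \<xi>] by simp
  then have "q x = W.point \<xi>" unfolding q_def using W.point_eq_iff[OF rep(1)[OF x] \<xi>] by simp
  then show ?thesis using x by blast
qed

text \<open>In the lower estimate the translation kills the corner of the quotient; it does not depend on the distance \<open>d\<close>.\<close>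

lemma cone_quotient_exists: "\<exists>C. cone_quotient B ACone cd q C"
proof -
  obtain C1 where C1: "0 < C1" "\<And>D d \<epsilon>. 0 \<le> d \<Longrightarrow> (\<And>n. D n \<in> tval) \<Longrightarrow> tup_B d D \<Longrightarrow> 0 < \<epsilon> \<Longrightarrow>
     eventually (\<lambda>n. real (len (D n)) \<le> (C1 * d + \<epsilon>) * real n) \<omega>"
    using len_limit_upper by blast
  obtain C2 where C2: "0 < C2" "\<And>D d. 0 \<le> d \<Longrightarrow> eventually (\<lambda>n. D n \<in> tval) \<omega> \<Longrightarrow>
     eventually (\<lambda>n. real (len (D n)) \<le> d * real n) \<omega> \<Longrightarrow> tup_B (C2 * d) D"
    using len_limit_lower by blast
  interpret Y: Metric_space ACone cd by (rule W.Metric_space_cone)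
  let ?C = "max C1 (6 * C2)"
  have "cone_quotient B ACone cd q ?C"
  proof
    show "\<exists>z. \<forall>k. z - c k \<in> B (r k)" if "\<And>k. c (Suc k) - c k \<in> B (r k)" "decseq r" for c r
      using nested_balls[of c r, OF that] .
    show "0 < ?C" using C1(1) by simp
    show "cd (q x) (q y) \<le> ?C * d" if x: "x \<in> PFin" and y: "y \<in> PFin" and d: "clos d x y" for x y d
    proof -
      have d0: "0 \<le> d" using d by (rule clos_nonneg)
      have "cd (q x) (q y) \<le> C1 * d"
        by (rule limit_le[OF q_dist[OF x y]]) (rule C1(2)[OF d0 tup_tval(2) clos_tup_B[OF d]])
      also have "\<dots> \<le> ?C * d" using d0 by (intro mult_right_mono) auto
      finally show ?thesis .
    qed
    show "\<exists>z\<in>Fin. \<forall>d. cd (q x) (q y) < d \<longrightarrow> clos (?C * d) x (zact z y)" if x: "x \<in> PFin" and y: "y \<in> PFin" for x y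
    proof (intro bexI[of _ "- e14 (- fst x + fst y)"] allI impI)
      have "- fst x + fst y \<in> UFin" using x y by (simp add: PFin_def UFin_add UFin_uminus)
      then show "- e14 (- fst x + fst y) \<in> Fin" unfolding UFin_def uni_in_def by (blast intro: Fin_uminus)
      fix d assume d: "cd (q x) (q y) < d"
      then have d0: "0 \<le> d" using Y.nonneg[of "q x" "q y"] by linarith
      have "eventually (\<lambda>n. real (len (dif x y n)) \<le> d * real n) \<omega>"
        using order_tendstoD(2)[OF q_dist[OF x y] d] omega_large[of 1]
        by eventually_elim (simp add: pos_divide_less_eq)
      then have "tup_B (C2 * d) (dif x y)" by (rule C2(2)[OF d0, rotated]) (simp add: tup_tval)
      from tup_B_clos[OF this] show "clos (?C * d) x (zact (- e14 (- fst x + fst y)) y)"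
      proof (rule clos_mono)
        have "6 * C2 * d \<le> ?C * d" using d0 by (intro mult_right_mono) auto
        then show "6 * (C2 * d) \<le> ?C * d" by simp
      qed
    qed
    show "q ` PFin = ACone"
    proof (rule subset_antisym)
      show "q ` PFin \<subseteq> ACone" unfolding W.cone_eq_point q_def using rep(1) by blast
      show "ACone \<subseteq> q ` PFin"
      proof
        fix p assume "p \<in> ACone"
        then obtain \<xi> where "\<xi> \<in> W.P" "p = W.point \<xi>" unfolding W.cone_eq_point by blast
        then show "p \<in> q ` PFin" using q_surjective[of \<xi>] by blast
      qed
    qed
    show "q (zact z x) = q x" if "z \<in> Fin" "x \<in> PFin" for z x
    proof -
      have "tup (zact z x) = tup x" by (rule ext) (simp add: tup_def zact_def act_def Let_def)
      then show ?thesis by (simp add: q_def rep_def)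
    qed
  qed
  then show ?thesis by blast
qed

end

theorem corollary1p4:
  fixes \<omega> :: "nat filter"
    and S :: "('k::topological_field ^ 4 ^ 4) set set"
  assumes locally_compact: "locally_compact_space (euclidean :: 'k topology)"
    and nondiscrete: "(euclidean :: 'k topology) \<noteq> discrete_topology UNIV"
    and ultrafilter: "nonprincipal_ultrafilter_on {1..} \<omega>"
    and S_compact: "compactin abels4_mod_Z_topology S"
    and S_generates: "generate abels4_mod_Z S = carrier abels4_mod_Z"
    and base_point: "x0 \<in> carrier abels4_mod_Z"
    and loop_base_point:
      "p \<in> asymptotic_cone \<omega> (carrier abels4_mod_Z) (word_metric abels4_mod_Z S) x0"
  shows "let G = fundamental_group
             (cone_topology \<omega> (carrier abels4_mod_Z) (word_metric abels4_mod_Z S) x0) p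
         in comm_group G \<and> carrier G \<approx> (UNIV :: real set)"
proof -
  obtain V V0 and l :: 'k where field: "contracted_field V V0 l"
    using contracted_field_exists[OF locally_compact nondiscrete] by blast
  interpret abels_cone V V0 l \<omega> S x0
    using field ultrafilter S_compact S_generates base_point
    by (simp add: abels_cone_def abels_cone_axioms_def growth_def growth_axioms_def word_growth_def word_growth_axioms_def)
  obtain C where C: "cone_quotient B ACone cd q C" using cone_quotient_exists by blast
  have top: "cone_topology \<omega> (carrier abels4_mod_Z) (word_metric abels4_mod_Z S) x0 = Metric_space.mtopology ACone cd"
    by (simp add: cone_topology_def)
  obtain \<Phi> where "comm_group (fundamental_group (Metric_space.mtopology ACone cd) p)"
    and \<Phi>: "\<Phi> ` Fin = carrier (fundamental_group (Metric_space.mtopology ACone cd) p)"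
      "\<forall>z\<in>Fin. \<forall>w\<in>Fin. \<Phi> z = \<Phi> w \<longleftrightarrow> w - z \<in> B 0"
    using cone_quotient.fundamental_group_cone[OF C loop_base_point] by blast
  then show ?thesis unfolding top Let_def using quotient_eqpoll_reals[OF \<Phi>] by blast
qed

end
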